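(* Let $\alpha>1/2$ and $f\in\mathcal{C}_\alpha$. Then there is a constant $C_f$, depending on $f$ and $\alpha$ but not on $N$, such that for every integer $N\ge 1$ there exists a Gaussian mixture with $N$ components $$\mathcal{T}_N f=\sum_{j=1}^N a_j G_j,\qquad a_j \text{ scalars},\ G_j\in\mathcal{D}\text{ for each } j,$$ such that $$\|\mathcal{T}_N f-f\|_{L_2(\mathbb{R}^2)}\le C_f\,N^{\frac12-\alpha}.$$
   Context: **Gaussian dictionary.** $\mathcal{D}$ is the set of all functions $x\mapsto e^{-|A(x-k)|^2}$ on $\mathbb{R}^2$ with $A$ an invertible real $2\times2$ matrix and $k\in\mathbb{R}^2$. **Curvelet system.** Scale indices $j$ range over $\mathbb{N}=\{0,1,2,\dots\}$. The Fourier transform on $\mathbb{R}^d$ is $\widehat f(\xi)=(2\pi)^{-d/2}\int f(x)e^{-ix\cdot\xi}\,dx$, with inverse $\mathcal{F}^{-1}$. Fix non-negative $C^\infty$ functions $w_0$ (on $[0,\infty)$, supported in $[0,\frac{8\pi}3]$) and $w$ (supported in $[\frac{2\pi}3,\frac{8\pi}3]$) with $w_0(r)^2+\sum_{j\ge1}w(2^{-j}r)^2=1$ for $r\ge 0$, and a non-negative $\nu\in C_c^\infty(\mathbb{R})$ supported in $[-\pi,\pi]$ with $\sum_{\ell\in\mathbb{Z}}\nu(\theta-\pi\ell)^2=1$. For $\xi=(r\cos\theta,r\sin\theta)$ put $\chi_0(\xi)=w_0(r)$, $\chi_1(\xi)=w(r/2)$ and, for $j\ge2$, $$\chi_j(\xi)=w(2^{-j}r)\bigl[\nu(2^{\lfloor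 j/2\rfloor}\theta)+\nu(2^{\lfloor j/2\rfloor}(\theta-\pi))\bigr],$$ where the angles $\theta$ and $\theta-\pi$ are each taken modulo $2\pi$ with representative in $[-\pi,\pi)$. Let $\Lambda_0=\lambda_0=\frac{16\pi}3$, $\Lambda_1=\lambda_1=\frac{32\pi}3$, and for $j\ge2$ let $\lambda_j=2^{j+1}\frac{8\pi}3\sin(2^{-\lfloor j/2\rfloor}\pi)$, $t_j=2^j\frac{2\pi}3\cos(2^{-\lfloor j/2\rfloor}\pi)$, $\Lambda_j=2(\frac{8\pi}3 2^j-t_j)$. Let $\mathbb{X}_j=\{(k_1/\Lambda_j,k_2/\lambda_j):(k_1,k_2)\in2\pi\mathbb{Z}^2\}$ and let $R_{j,\ell}$ be the counter-clockwise rotation by $\pi\ell2^{-\lfloor j/2\rfloor}$. The curvelets are $$\gamma_{j,\ell,k}(x)=\frac1{\sqrt{\Lambda_j\lambda_j}}(\mathcal{F}^{-1}\chi_j)(R_{j,\ell}^*x-k),\quad j\in\mathbb{N},\ 0\le\ell\le2^{\lfloor j/2\rfloor}-1,\ k\in\mathbb{X}_j,$$ and $\mathcal{D}_{curv}$ is the set of all of them. **Smoothness class.** $\mathcal{C}_\alpha$ is the set of $f\in L_2(\mathbb{R}^2)$, expanded as $f=\sum_{\gamma\in\mathcal{D}_{curv}}\omega(\gamma)\gamma$ in $L_2$ with $\omega(\gamma)=\langle f,\gamma\rangle$, whose coefficients satisfy the following: writing the expansion in decreasing rearrangement $f=\sum_{n\ge1}\omega_n\gamma_n$ (the $\gamma_n$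 distinct curvelets, including all those with non-zero coefficient, $\omega_n=\omega(\gamma_n)$, $|\omega_n|\ge|\omega_{n+1}|$), one has $|\omega_n|=\mathcal{O}(n^{-\alpha})$. *)

theory Defs
  imports
    "HOL-Analysis.Analysis"
    "HOL-Library.Landau_Symbols"
    "HOL-Library.Real_Mod"
begin

section \<open>The space $L_2$\<close>

text \<open>Functions rather than classes modulo null sets. The integral of a non-integrable
  function is \<open>0\<close>, so \<open>norm_L2\<close> and \<open>inner_L2\<close> are meaningful only for members of \<open>L2\<close>.\<close>

definition L2 :: "(real^2 \<Rightarrow> complex) set" where
  "L2 = {f \<in> borel_measurable lebesgue. integrable lebesgue (\<lambda>x. (cmod (f x))\<^sup>2)}"

definition norm_L2 :: "(real^2 \<Rightarrow> complex) \<Rightarrow> real" where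
  "norm_L2 f = sqrt (\<integral>x. (cmod (f x))\<^sup>2 \<partial>lebesgue)"

definition inner_L2 :: "(real^2 \<Rightarrow> complex) \<Rightarrow> (real^2 \<Rightarrow> complex) \<Rightarrow> complex" where
  "inner_L2 f g = (\<integral>x. f x * cnj (g x) \<partial>lebesgue)"

definition inverse_fourier :: "('a::euclidean_space \<Rightarrow> complex) \<Rightarrow> 'a \<Rightarrow> complex" where
  "inverse_fourier g x =
     complex_of_real ((2 * pi) powr (- real DIM('a) / 2)) *
     (\<integral>\<xi>. g \<xi> * exp (\<i> * complex_of_real (x \<bullet> \<xi>)) \<partial>lebesgue)"


section \<open>Gaussians\<close>

definition gaussian_dict :: "(real^2 \<Rightarrow> complex) set" where
  "gaussian_dict =
     {(\<lambda>x. complex_of_real (exp (- (norm (A *v (x - k)))\<^sup>2))) | (A :: real^2^2) k. invertible A}"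


section \<open>Window functions\<close>

text \<open>\<open>C\<^sup>\<infinity>\<close> on \<open>S\<close>, with one-sided derivatives at boundary points of an interval.\<close>

definition smooth_real_on :: "real set \<Rightarrow> (real \<Rightarrow> real) \<Rightarrow> bool" where
  "smooth_real_on S f \<longleftrightarrow>
     (\<exists>D :: nat \<Rightarrow> real \<Rightarrow> real.
        (\<forall>x\<in>S. D 0 x = f x) \<and>
        (\<forall>n. \<forall>x\<in>S. (D n has_real_derivative D (Suc n) x) (at x within S)))"

definition curvelet_windows ::
    "(real \<Rightarrow> real) \<Rightarrow> (real \<Rightarrow> real) \<Rightarrow> (real \<Rightarrow> real) \<Rightarrow> bool" where
  "curvelet_windows w0 w \<nu> \<longleftrightarrow>
     smooth_real_on {0..} w0 \<and> (\<forall>r\<ge>0. 0 \<le> w0 r) \<and> (\<forall>r. r > 8 * pi / 3 \<longrightarrow> w0 r = 0) \<and>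
     smooth_real_on UNIV w \<and> (\<forall>r. 0 \<le> w r) \<and>
     (\<forall>r. r \<notin> {2 * pi / 3 .. 8 * pi / 3} \<longrightarrow> w r = 0) \<and>
     (\<forall>r\<ge>0. ((\<lambda>j::nat. (w (r / 2 ^ j))\<^sup>2) has_sum (1 - (w0 r)\<^sup>2)) {1..}) \<and>
     smooth_real_on UNIV \<nu> \<and> (\<forall>\<theta>. 0 \<le> \<nu> \<theta>) \<and>
     (\<forall>\<theta>. \<theta> \<notin> {- pi .. pi} \<longrightarrow> \<nu> \<theta> = 0) \<and>
     (\<forall>\<theta>. ((\<lambda>l::int. (\<nu> (\<theta> - pi * of_int l))\<^sup>2) has_sum 1) UNIV)"


section \<open>Curvelets\<close>

text \<open>Representative modulo \<open>2\<pi>\<close> in \<open>[-\<pi>, \<pi>)\<close>.\<close>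

definition wrap_angle :: "real \<Rightarrow> real" where
  "wrap_angle \<theta> = (\<theta> + pi) rmod (2 * pi) - pi"

text \<open>The value \<open>Arg 0 = 0\<close> is immaterial below: \<open>w\<close> vanishes at \<open>0\<close>.\<close>

definition polar_angle :: "real^2 \<Rightarrow> real" where
  "polar_angle \<xi> = Arg (Complex (\<xi> $ 1) (\<xi> $ 2))"

definition curvelet_chi ::
    "(real \<Rightarrow> real) \<Rightarrow> (real \<Rightarrow> real) \<Rightarrow> (real \<Rightarrow> real) \<Rightarrow> nat \<Rightarrow> real^2 \<Rightarrow> real" where
  "curvelet_chi w0 w \<nu> j \<xi> =
     (if j = 0 then w0 (norm \<xi>)
      else if j = 1 then w (norm \<xi> / 2)
      else w (norm \<xi> / 2 ^ j) *
           (\<nu> (2 ^ (j div 2) * wrap_angle (polar_angle \<xi>)) +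
            \<nu> (2 ^ (j div 2) * wrap_angle (polar_angle \<xi> - pi))))"

definition small_lambda :: "nat \<Rightarrow> real" where
  "small_lambda j =
     (if j = 0 then 16 * pi / 3
      else if j = 1 then 32 * pi / 3
      else 2 ^ (j + 1) * (8 * pi / 3) * sin (pi / 2 ^ (j div 2)))"

definition curvelet_t :: "nat \<Rightarrow> real" where
  "curvelet_t j = 2 ^ j * (2 * pi / 3) * cos (pi / 2 ^ (j div 2))"

definition big_lambda :: "nat \<Rightarrow> real" where
  "big_lambda j =
     (if j = 0 then 16 * pi / 3
      else if j = 1 then 32 * pi / 3
      else 2 * (8 * pi / 3 * 2 ^ j - curvelet_t j))"

definition curvelet_grid :: "nat \<Rightarrow> (real^2) set" where
  "curvelet_grid j =
     {vector [2 * pi * of_int m1 / big_lambda j, 2 * pi * of_int m2 / small_lambda j]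
       | m1 m2 :: int. True}"

definition rotation2 :: "real \<Rightarrow> real^2^2" where
  "rotation2 a = vector [vector [cos a, - sin a], vector [sin a, cos a]]"

definition curvelet ::
    "(real \<Rightarrow> real) \<Rightarrow> (real \<Rightarrow> real) \<Rightarrow> (real \<Rightarrow> real) \<Rightarrow>
     nat \<Rightarrow> nat \<Rightarrow> real^2 \<Rightarrow> real^2 \<Rightarrow> complex" where
  "curvelet w0 w \<nu> j l k x =
     complex_of_real (1 / sqrt (big_lambda j * small_lambda j)) *
     inverse_fourier (\<lambda>\<xi>. complex_of_real (curvelet_chi w0 w \<nu> j \<xi>))
       (transpose (rotation2 (pi * real l / 2 ^ (j div 2))) *v x - k)"

definition curvelet_dict ::
    "(real \<Rightarrow> real) \<Rightarrow> (real \<Rightarrow> real) \<Rightarrow> (real \<Rightarrow> real) \<Rightarrow> (real^2 \<Rightarrow> complex) set" where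
  "curvelet_dict w0 w \<nu> =
     {curvelet w0 w \<nu> j l k | j l k. l < 2 ^ (j div 2) \<and> k \<in> curvelet_grid j}"


section \<open>The smoothness class\<close>

text \<open>\<open>f = (\<Sum>\<gamma>\<in>D. \<langle>f, \<gamma>\<rangle> \<gamma>)\<close> in $L_2$, as the limit of the net of finite partial sums
  (unconditional convergence, as \<open>D\<close> carries no order). For the curvelets this is a genuine
  condition on \<open>f\<close>: the two opposite wedges of \<open>curvelet_chi\<close> can overlap modulo \<open>big_lambda\<close>.\<close>

definition L2_expansion :: "(real^2 \<Rightarrow> complex) set \<Rightarrow> (real^2 \<Rightarrow> complex) \<Rightarrow> bool" where
  "L2_expansion D f \<longleftrightarrow>
     ((\<lambda>F. norm_L2 (\<lambda>x. f x - (\<Sum>\<gamma>\<in>F. inner_L2 f \<gamma> * \<gamma> x))) \<longlongrightarrow> 0)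
       (finite_subsets_at_top D)"

text \<open>An enumeration \<open>g 1, g 2, \<dots>\<close> of distinct members of \<open>D\<close>, exhausting those with
  non-zero coefficient. Under \<open>L2_expansion D f\<close> it satisfies
  \<open>f = (\<Sum>n\<ge>1. \<langle>f, g n\<rangle> g n)\<close> in $L_2$, since the omitted terms are zero.\<close>

definition decreasing_rearrangement ::
    "(real^2 \<Rightarrow> complex) set \<Rightarrow> (real^2 \<Rightarrow> complex) \<Rightarrow> (nat \<Rightarrow> real^2 \<Rightarrow> complex) \<Rightarrow> bool" where
  "decreasing_rearrangement D f g \<longleftrightarrow>
     inj_on g {1..} \<and> g ` {1..} \<subseteq> D \<and>
     (\<forall>\<gamma>\<in>D. inner_L2 f \<gamma> \<noteq> 0 \<longrightarrow> \<gamma> \<in> g ` {1..}) \<and>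
     (\<forall>n\<ge>1. cmod (inner_L2 f (g (Suc n))) \<le> cmod (inner_L2 f (g n)))"

definition curvelet_class ::
    "(real \<Rightarrow> real) \<Rightarrow> (real \<Rightarrow> real) \<Rightarrow> (real \<Rightarrow> real) \<Rightarrow> real \<Rightarrow> (real^2 \<Rightarrow> complex) set" where
  "curvelet_class w0 w \<nu> \<alpha> =
     {f \<in> L2. L2_expansion (curvelet_dict w0 w \<nu>) f \<and>
        (\<exists>g. decreasing_rearrangement (curvelet_dict w0 w \<nu>) f g \<and>
             (\<lambda>n. cmod (inner_L2 f (g n))) \<in> O(\<lambda>n. real n powr (- \<alpha>)))}"

end

theory Submission
  imports Defs "HOL-Probability.Probability"
begin

text \<open>
Three facts give the rate.

Curvelets satisfy a Bessel inequality (\<open>curvelet_bessel\<close>): at each frequency at most \<open>56\<close> wedges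
overlap, and within one wedge the curvelets are orthogonal exponentials on a rectangle, cut off by
a bounded window. Since the coefficients are \<open>O(n powr (- \<alpha>))\<close>, dropping all but the first \<open>N\<close> terms of
the expansion costs a squared norm of order \<open>N powr (1 - 2 * \<alpha>)\<close>, which is the square of the
desired rate.

All curvelets are approximated by Gaussian mixtures equally well (\<open>curvelet_approximation\<close>): for
each \<open>P\<close> there is one constant \<open>C\<close> such that \<open>2 ^ L\<close> Gaussians reach the squared error
\<open>C * (1/4) ^ (L * P)\<close> for every curvelet and every \<open>L\<close>. The dictionary is invariant under
invertible affine maps, so a curvelet may be dilated anisotropically until its wedge has unit
size. The resulting frequency profiles have derivatives along the coordinate lines that are bounded
uniformly in the scale (\<open>profiles_line_smooth\<close>). Divide such a profile by a fixed Gaussian and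
approximate the quotient by convolution with a trigonometric Jackson kernel (\<open>jackson2_error\<close>). The
convolution is an exponential sum; multiplied by the Gaussian again and transformed back, it
becomes a mixture of translated Gaussians. Plancherel's inequality carries the error over.

The remaining question is how to distribute \<open>N\<close> Gaussians over \<open>N\<close> terms
(\<open>gaussian_block_approximation\<close>). Giving \<open>(N / n) powr (1/2)\<close> Gaussians to term \<open>n\<close> uses \<open>O(N)\<close> in
total and makes every squared error \<open>O(N powr (- 2 * \<alpha>))\<close>. But nothing is known about the inner
products of the errors, and their sum might be as large as \<open>O(N powr (1 - \<alpha>))\<close> in norm. Therefore
each approximation is supplemented by a random correction whose mean is exactly the error, up to a
negligible part. The sum of the errors is then replaced by a sum of independent centred functions,
whose squared norms add up in expectation to \<open>O(N powr (1 - 2 * \<alpha>))\<close>. Large corrections are rare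
enough for the expected number of Gaussians to stay \<open>O(N)\<close>, and some outcome is at most twice
the average in both respects (\<open>derandomised_selection\<close>).\<close>

section \<open>Square-integrable functions\<close>

text \<open>Squared norms are additive under the expectations and Parseval identities used throughout, so
the argument runs on them and takes one square root at the very end.\<close>

definition norm_sq :: "(real^2 \<Rightarrow> complex) \<Rightarrow> real" where
  "norm_sq f = (\<integral>x. (cmod (f x))\<^sup>2 \<partial>lebesgue)"

lemma norm_sq_nonneg: "0 \<le> norm_sq f"
  by (simp add: norm_sq_def)

lemma norm_L2_eq_sqrt: "norm_L2 f = sqrt (norm_sq f)"
  by (simp add: norm_L2_def norm_sq_def)

lemma cmod_add_sq_le: "(cmod (a + b))\<^sup>2 \<le> 2 * (cmod a)\<^sup>2 + 2 * (cmod b)\<^sup>2"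
proof -
  have "(cmod (a + b))\<^sup>2 \<le> (cmod a + cmod b)\<^sup>2"
    by (intro power_mono norm_triangle_ineq norm_ge_zero)
  also have "\<dots> \<le> 2 * (cmod a)\<^sup>2 + 2 * (cmod b)\<^sup>2"
    using sum_squares_bound[of "cmod a" "cmod b"] by (simp add: power2_sum)
  finally show ?thesis .
qed

lemma L2_measurable: "f \<in> L2 \<Longrightarrow> f \<in> borel_measurable lebesgue"
  and L2_integrable: "f \<in> L2 \<Longrightarrow> integrable lebesgue (\<lambda>x. (cmod (f x))\<^sup>2)"
  by (auto simp: L2_def)

lemma L2_zero: "(\<lambda>x. 0) \<in> L2"
  by (simp add: L2_def)

lemma L2_add:
  assumes "f \<in> L2" "g \<in> L2"
  shows "(\<lambda>x. f x + g x) \<in> L2"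
proof -
  note [measurable] = assms[THEN L2_measurable]
  have "integrable lebesgue (\<lambda>x. 2 * (cmod (f x))\<^sup>2 + 2 * (cmod (g x))\<^sup>2)"
    using assms by (intro Bochner_Integration.integrable_add integrable_mult_right L2_integrable)
  then have "integrable lebesgue (\<lambda>x. (cmod (f x + g x))\<^sup>2)"
    by (rule Bochner_Integration.integrable_bound) (auto intro!: AE_I2 cmod_add_sq_le)
  then show ?thesis
    by (simp add: L2_def)
qed

lemma L2_cmult:
  assumes "f \<in> L2"
  shows "(\<lambda>x. c * f x) \<in> L2"
proof -
  note [measurable] = L2_measurable[OF assms]
  have "(\<lambda>x. c * f x) \<in> borel_measurable lebesgue" by measurable
  with assms show ?thesis by (simp add: L2_def norm_mult power_mult_distrib)
qed

lemma L2_diff: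
  assumes "f \<in> L2" "g \<in> L2"
  shows "(\<lambda>x. f x - g x) \<in> L2"
  using L2_add[OF assms(1) L2_cmult[OF assms(2), of "-1"]] by simp

lemma L2_sum:
  assumes "\<And>i. i \<in> I \<Longrightarrow> f i \<in> L2"
  shows "(\<lambda>x. \<Sum>i\<in>I. f i x) \<in> L2"
  using assms
  by (induction I rule: infinite_finite_induct) (auto intro: L2_zero L2_add)

lemma norm_sq_add_le:
  assumes "f \<in> L2" "g \<in> L2"
  shows "norm_sq (\<lambda>x. f x + g x) \<le> 2 * norm_sq f + 2 * norm_sq g"
proof -
  have "norm_sq (\<lambda>x. f x + g x) \<le> (\<integral>x. 2 * (cmod (f x))\<^sup>2 + 2 * (cmod (g x))\<^sup>2 \<partial>lebesgue)"
    unfolding norm_sq_def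
    using assms by (intro integral_mono L2_integrable L2_add Bochner_Integration.integrable_add
        integrable_mult_right cmod_add_sq_le)
  also have "\<dots> = 2 * norm_sq f + 2 * norm_sq g"
    unfolding norm_sq_def
    using assms by (subst Bochner_Integration.integral_add) (auto intro!: L2_integrable)
  finally show ?thesis .
qed

lemma norm_sq_cmult: "norm_sq (\<lambda>x. c * f x) = (cmod c)\<^sup>2 * norm_sq f"
  by (simp add: norm_sq_def norm_mult power_mult_distrib)

lemma norm_sq_minus: "norm_sq (\<lambda>x. - f x) = norm_sq f"
  by (simp add: norm_sq_def)

lemma norm_sq_diff_commute: "norm_sq (\<lambda>x. f x - g x) = norm_sq (\<lambda>x. g x - f x)"
  by (simp add: norm_sq_def norm_minus_commute)

lemma norm_sq_diff_le:
  assumes "f \<in> L2" "g \<in> L2"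
  shows "norm_sq (\<lambda>x. f x - g x) \<le> 2 * norm_sq f + 2 * norm_sq g"
  using norm_sq_add_le[OF assms(1) L2_cmult[OF assms(2), of "-1"]]
  by (simp add: norm_sq_minus)

lemma cmod_sum_sq_le:
  assumes "finite I"
  shows "(cmod (\<Sum>i\<in>I. z i))\<^sup>2 \<le> real (card I) * (\<Sum>i\<in>I. (cmod (z i))\<^sup>2)"
proof -
  have "(cmod (\<Sum>i\<in>I. z i))\<^sup>2 \<le> (\<Sum>i\<in>I. cmod (z i))\<^sup>2"
    by (intro power_mono norm_sum norm_ge_zero)
  also have "\<dots> = (\<Sum>i\<in>I. 1 * cmod (z i))\<^sup>2" by simp
  also have "\<dots> \<le> (\<Sum>i\<in>I. 1\<^sup>2) * (\<Sum>i\<in>I. (cmod (z i))\<^sup>2)"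
    by (rule Cauchy_Schwarz_ineq_sum)
  finally show ?thesis by simp
qed

lemma norm_sq_sum_le:
  assumes "finite I" "\<And>i. i \<in> I \<Longrightarrow> f i \<in> L2"
  shows "norm_sq (\<lambda>x. \<Sum>i\<in>I. f i x) \<le> real (card I) * (\<Sum>i\<in>I. norm_sq (f i))"
proof -
  have "norm_sq (\<lambda>x. \<Sum>i\<in>I. f i x)
      \<le> (\<integral>x. real (card I) * (\<Sum>i\<in>I. (cmod (f i x))\<^sup>2) \<partial>lebesgue)"
    unfolding norm_sq_def using assms
    by (intro integral_mono L2_integrable L2_sum integrable_mult_right
        Bochner_Integration.integrable_sum cmod_sum_sq_le) auto
  also have "\<dots> = real (card I) * (\<Sum>i\<in>I. norm_sq (f i))"
    using assms by (simp add: norm_sq_def L2_integrable Bochner_Integration.integral_sum)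
  finally show ?thesis .
qed

section \<open>Gaussian mixtures\<close>

text \<open>Indexing by \<open>j < m\<close> makes mixtures concatenate without shifting ranges away from \<open>1\<close>.\<close>

definition gauss_mix :: "nat \<Rightarrow> (real^2 \<Rightarrow> complex) \<Rightarrow> bool" where
  "gauss_mix m S \<longleftrightarrow>
     (\<exists>a G. (\<forall>j<m. G j \<in> gaussian_dict) \<and> S = (\<lambda>x. \<Sum>j<m. a j * G j x))"

lemma gaussian_dict_nonempty: "\<exists>G. G \<in> gaussian_dict"
  proof -
  have "invertible (mat 1 :: real^2^2)"
    by (simp add: invertible_det_nz)
  then show ?thesis
    unfolding gaussian_dict_def by blast
qed

lemma gauss_mix_zero: "gauss_mix m (\<lambda>x. 0)"
proof -
  obtain G where "G \<in> gaussian_dict" using gaussian_dict_nonempty by blast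
  then show ?thesis
    unfolding gauss_mix_def by (intro exI[of _ "\<lambda>_. 0"] exI[of _ "\<lambda>_. G"]) auto
qed

lemma gauss_mix_add:
  assumes "gauss_mix m S" "gauss_mix n T"
  shows "gauss_mix (m + n) (\<lambda>x. S x + T x)"
proof -
  obtain a G where S: "\<forall>j<m. G j \<in> gaussian_dict" "S = (\<lambda>x. \<Sum>j<m. a j * G j x)"
    using assms(1) by (auto simp: gauss_mix_def)
  obtain b F where T: "\<forall>j<n. F j \<in> gaussian_dict" "T = (\<lambda>x. \<Sum>j<n. b j * F j x)"
    using assms(2) by (auto simp: gauss_mix_def)
  let ?c = "\<lambda>j. if j < m then a j else b (j - m)"
  let ?H = "\<lambda>j. if j < m then G j else F (j - m)"
  have "(\<Sum>j<m + n. ?c j * ?H j x) = S x + T x" for x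
  proof -
    have "(\<Sum>j<m + n. ?c j * ?H j x) = (\<Sum>j<m. ?c j * ?H j x) + (\<Sum>j=m..<m + n. ?c j * ?H j x)"
      by (metis (no_types, lifting) atLeast0LessThan le_add1 sum.atLeastLessThan_concat zero_le)
    also have "(\<Sum>j=m..<m + n. ?c j * ?H j x) = (\<Sum>j<n. b j * F j x)"
      by (rule sum.reindex_bij_witness[of _ "\<lambda>j. j + m" "\<lambda>j. j - m"]) auto
    finally show ?thesis by (simp add: S(2) T(2))
  qed
  moreover have "\<forall>j<m+n. ?H j \<in> gaussian_dict"
    using S(1) T(1) by auto
  ultimately show ?thesis
    unfolding gauss_mix_def by (intro exI[of _ ?c] exI[of _ ?H]) auto
qed

text \<open>Unused components get the coefficient \<open>0\<close>.\<close>

lemma gauss_mix_mono: "gauss_mix m S \<Longrightarrow> m \<le> n \<Longrightarrow> gauss_mix n S"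
  using gauss_mix_add[OF _ gauss_mix_zero, of m S "n - m"] by simp

lemma gauss_mix_cmult:
  assumes "gauss_mix m S"
  shows "gauss_mix m (\<lambda>x. c * S x)"
proof -
  obtain a G where "\<forall>j<m. G j \<in> gaussian_dict" "S = (\<lambda>x. \<Sum>j<m. a j * G j x)"
    using assms by (auto simp: gauss_mix_def)
  then show ?thesis
    unfolding gauss_mix_def
    by (intro exI[of _ "\<lambda>j. c * a j"] exI[of _ G]) (auto simp: sum_distrib_left mult.assoc)
qed

lemma gauss_mix_diff:
  assumes "gauss_mix m S" "gauss_mix n T"
  shows "gauss_mix (m + n) (\<lambda>x. S x - T x)"
  using gauss_mix_add[OF assms(1) gauss_mix_cmult[OF assms(2), of "-1"]] by simp

lemma gauss_mix_sum:
  assumes "finite I" "\<And>i. i \<in> I \<Longrightarrow> gauss_mix (m i) (S i)"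
  shows "gauss_mix (\<Sum>i\<in>I. m i) (\<lambda>x. \<Sum>i\<in>I. S i x)"
  using assms by (induction I) (auto intro: gauss_mix_zero gauss_mix_add)

section \<open>Random selection with the right mean\<close>

text \<open>If \<open>x\<close> takes the value \<open>x k\<close> with probability \<open>p k\<close>, the centred variable \<open>x - \<mu>\<close> is orthogonal
to the constant \<open>s\<close> on average, and its variance is at most its second moment.\<close>

lemma variance_le_second_moment:
  fixes x :: "'k \<Rightarrow> complex"
  assumes "finite J" "\<And>k. k \<in> J \<Longrightarrow> 0 \<le> p k" "sum p J = 1"
  defines "\<mu> \<equiv> \<Sum>k\<in>J. p k *\<^sub>R x k"
  shows "(\<Sum>k\<in>J. p k * (cmod (s + x k - \<mu>))\<^sup>2) \<le> (cmod s)\<^sup>2 + (\<Sum>k\<in>J. p k * (cmod (x k))\<^sup>2)"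
proof -
  have m: "(\<Sum>k\<in>J. p k * (x k \<bullet> v)) = \<mu> \<bullet> v" for v
    by (simp add: \<mu>_def inner_sum_left)
  have "(cmod (s + x k - \<mu>))\<^sup>2
      = (cmod (s - \<mu>))\<^sup>2 + 2 * (x k \<bullet> (s - \<mu>)) + (cmod (x k))\<^sup>2" for k
    by (simp only: power2_norm_eq_inner) (simp add: algebra_simps inner_commute)
  then have "(\<Sum>k\<in>J. p k * (cmod (s + x k - \<mu>))\<^sup>2)
      = (\<Sum>k\<in>J. p k * (cmod (s - \<mu>))\<^sup>2 + 2 * (p k * (x k \<bullet> (s - \<mu>))) + p k * (cmod (x k))\<^sup>2)"
    by (simp only: distrib_left mult.assoc mult.left_commute[of _ 2])
  also have "\<dots> = (cmod (s - \<mu>))\<^sup>2 + 2 * (\<mu> \<bullet> (s - \<mu>)) + (\<Sum>k\<in>J. p k * (cmod (x k))\<^sup>2)"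
    using assms(3) by (simp add: sum.distrib flip: sum_distrib_right sum_distrib_left m)
  also have "(cmod (s - \<mu>))\<^sup>2 + 2 * (\<mu> \<bullet> (s - \<mu>)) = (cmod s)\<^sup>2 - (cmod \<mu>)\<^sup>2"
    by (simp only: power2_norm_eq_inner) (simp add: algebra_simps inner_commute)
  finally show ?thesis by simp
qed

lemma weighted_average_le:
  fixes v :: "'k \<Rightarrow> real"
  assumes "finite J" "\<And>k. k \<in> J \<Longrightarrow> 0 \<le> p k" "sum p J = 1"
    and "(\<Sum>k\<in>J. p k * v k) \<le> c"
  shows "\<exists>k\<in>J. v k \<le> c"
proof (rule ccontr)
  assume "\<not> ?thesis"
  then have *: "c < v k" if "k \<in> J" for k using that by force
  have "\<exists>k\<in>J. p k \<noteq> 0" using assms(3) by (metis sum.neutral zero_neq_one)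
  then obtain k0 where "k0 \<in> J" "0 < p k0" using assms(2) by (metis less_eq_real_def)
  then have "(\<Sum>k\<in>J. p k * c) < (\<Sum>k\<in>J. p k * v k)"
    using assms(1,2) *
    by (intro sum_strict_mono_ex1) (auto intro!: mult_left_mono bexI[of _ k0] simp: less_imp_le)
  then show False
    using assms(3,4) by (simp flip: sum_distrib_right)
qed

text \<open>Draw \<open>\<kappa> n\<close> independently with law \<open>p n\<close>. The deviations of \<open>X n (\<kappa> n)\<close> from their means are
independent and centred, so their squared norms add up in expectation although the functions
\<open>X n k\<close> need not be orthogonal; the expected cost is a plain sum as well. Some outcome does not
exceed the expectation of the combined quantity \<open>A * error + B * cost\<close>; the proof finds it by
fixing the choices one index at a time, each no worse than its conditional expectation.\<close>

lemma derandomised_selection: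
  fixes X :: "'n \<Rightarrow> 'k \<Rightarrow> real^2 \<Rightarrow> complex" and p cost :: "'n \<Rightarrow> 'k \<Rightarrow> real"
  assumes "finite I"
    and fin: "\<And>n. n \<in> I \<Longrightarrow> finite (J n)"
    and p: "\<And>n k. n \<in> I \<Longrightarrow> k \<in> J n \<Longrightarrow> 0 \<le> p n k" "\<And>n. n \<in> I \<Longrightarrow> sum (p n) (J n) = 1"
    and X: "\<And>n k. n \<in> I \<Longrightarrow> k \<in> J n \<Longrightarrow> X n k \<in> L2"
    and A: "0 \<le> A" and B: "0 \<le> B"
  shows "\<exists>\<kappa>. (\<forall>n\<in>I. \<kappa> n \<in> J n) \<and>
      A * norm_sq (\<lambda>x. \<Sum>n\<in>I. X n (\<kappa> n) x - (\<Sum>k\<in>J n. p n k *\<^sub>R X n k x)) + B * (\<Sum>n\<in>I. cost n (\<kappa> n))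
      \<le> A * (\<Sum>n\<in>I. \<Sum>k\<in>J n. p n k * norm_sq (X n k)) + B * (\<Sum>n\<in>I. \<Sum>k\<in>J n. p n k * cost n k)"
  using assms(1-5)
proof (induction I)
  case empty
  then show ?case by (simp add: norm_sq_def)
next
  case (insert m I)
  define \<mu> where "\<mu> n x = (\<Sum>k\<in>J n. p n k *\<^sub>R X n k x)" for n x
  obtain \<kappa> where \<kappa>: "\<forall>n\<in>I. \<kappa> n \<in> J n"
    and le: "A * norm_sq (\<lambda>x. \<Sum>n\<in>I. X n (\<kappa> n) x - \<mu> n x) + B * (\<Sum>n\<in>I. cost n (\<kappa> n))
      \<le> A * (\<Sum>n\<in>I. \<Sum>k\<in>J n. p n k * norm_sq (X n k)) + B * (\<Sum>n\<in>I. \<Sum>k\<in>J n. p n k * cost n k)"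
    using insert.IH[OF insert.prems(1-4)] unfolding \<mu>_def by auto
  have XL: "X n k \<in> L2" if "n \<in> insert m I" "k \<in> J n" for n k
    using that insert.prems(4) by auto
  have \<mu>L: "\<mu> n \<in> L2" if "n \<in> insert m I" for n
  proof -
    have "(\<lambda>x. \<Sum>k\<in>J n. complex_of_real (p n k) * X n k x) \<in> L2"
      using that XL by (intro L2_sum L2_cmult) auto
    then show ?thesis by (simp add: \<mu>_def[abs_def] scaleR_conv_of_real)
  qed
  (* s is the deviation accumulated by the indices already decided. *)
  define s where "s x = (\<Sum>n\<in>I. X n (\<kappa> n) x - \<mu> n x)" for x
  have sL: "s \<in> L2"
    unfolding s_def[abs_def] using \<kappa> XL \<mu>L by (intro L2_sum L2_diff) auto
  have pm: "finite (J m)" "\<And>k. k \<in> J m \<Longrightarrow> 0 \<le> p m k" "sum (p m) (J m) = 1"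
    using insert.prems by auto
  let ?v = "\<lambda>k. A * norm_sq (\<lambda>x. s x + X m k x - \<mu> m x) + B * cost m k"
  have tL: "(\<lambda>x. s x + X m k x - \<mu> m x) \<in> L2" if "k \<in> J m" for k
    using that by (intro L2_diff L2_add sL XL \<mu>L) auto
  have int: "(\<Sum>k\<in>J m. p m k * norm_sq (\<lambda>x. s x + X m k x - \<mu> m x))
      = (\<integral>x. (\<Sum>k\<in>J m. p m k * (cmod (s x + X m k x - \<mu> m x))\<^sup>2) \<partial>lebesgue)"
    unfolding norm_sq_def
    by (subst Bochner_Integration.integral_sum) (auto intro!: L2_integrable tL)
  also have "\<dots> \<le> (\<integral>x. (cmod (s x))\<^sup>2 + (\<Sum>k\<in>J m. p m k * (cmod (X m k x))\<^sup>2) \<partial>lebesgue)"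
  proof (intro integral_mono)
    fix x
    show "(\<Sum>k\<in>J m. p m k * (cmod (s x + X m k x - \<mu> m x))\<^sup>2)
        \<le> (cmod (s x))\<^sup>2 + (\<Sum>k\<in>J m. p m k * (cmod (X m k x))\<^sup>2)"
      unfolding \<mu>_def using pm by (intro variance_le_second_moment) auto
  qed (auto intro!: L2_integrable tL sL XL Bochner_Integration.integrable_sum Bochner_Integration.integrable_add integrable_mult_right)
  also have "\<dots> = norm_sq s + (\<Sum>k\<in>J m. p m k * norm_sq (X m k))"
    unfolding norm_sq_def
    by (subst Bochner_Integration.integral_add; (subst Bochner_Integration.integral_sum)?)
      (auto intro!: L2_integrable sL XL)
  finally have 1: "(\<Sum>k\<in>J m. p m k * norm_sq (\<lambda>x. s x + X m k x - \<mu> m x))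
      \<le> norm_sq s + (\<Sum>k\<in>J m. p m k * norm_sq (X m k))" .
  have "(\<Sum>k\<in>J m. p m k * ?v k)
      = A * (\<Sum>k\<in>J m. p m k * norm_sq (\<lambda>x. s x + X m k x - \<mu> m x)) + B * (\<Sum>k\<in>J m. p m k * cost m k)"
    by (simp add: sum_distrib_left sum.distrib algebra_simps)
  also have "\<dots> \<le> A * (norm_sq s + (\<Sum>k\<in>J m. p m k * norm_sq (X m k))) + B * (\<Sum>k\<in>J m. p m k * cost m k)"
    using mult_left_mono[OF 1 A] by simp
  finally obtain k where k: "k \<in> J m"
    and kle: "?v k \<le> A * (norm_sq s + (\<Sum>k\<in>J m. p m k * norm_sq (X m k))) + B * (\<Sum>k\<in>J m. p m k * cost m k)"
    using weighted_average_le[OF pm, of ?v] by blast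
  let ?\<kappa> = "\<kappa>(m := k)"
  have eq: "(\<Sum>n\<in>I. g n (?\<kappa> n)) = (\<Sum>n\<in>I. g n (\<kappa> n))" for g :: "'n \<Rightarrow> 'k \<Rightarrow> 'z::comm_monoid_add"
    using insert.hyps by (intro sum.cong) auto
  have "(\<lambda>x. \<Sum>n\<in>insert m I. X n (?\<kappa> n) x - \<mu> n x) = (\<lambda>x. s x + X m k x - \<mu> m x)"
    using insert.hyps eq[of "\<lambda>n k. X n k _ - \<mu> n _"] by (auto simp: s_def fun_eq_iff)
  moreover have "(\<Sum>n\<in>insert m I. cost n (?\<kappa> n)) = (\<Sum>n\<in>I. cost n (\<kappa> n)) + cost m k"
    using insert.hyps eq[of cost] by simp
  ultimately have "A * norm_sq (\<lambda>x. \<Sum>n\<in>insert m I. X n (?\<kappa> n) x - \<mu> n x)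
        + B * (\<Sum>n\<in>insert m I. cost n (?\<kappa> n))
      = ?v k + B * (\<Sum>n\<in>I. cost n (\<kappa> n))"
    by (simp add: algebra_simps)
  also have "\<dots> \<le> A * norm_sq s + B * (\<Sum>n\<in>I. cost n (\<kappa> n))
      + A * (\<Sum>k\<in>J m. p m k * norm_sq (X m k)) + B * (\<Sum>k\<in>J m. p m k * cost m k)"
    using kle by (simp add: algebra_simps)
  also have "\<dots> \<le> A * (\<Sum>n\<in>insert m I. \<Sum>k\<in>J n. p n k * norm_sq (X n k))
      + B * (\<Sum>n\<in>insert m I. \<Sum>k\<in>J n. p n k * cost n k)"
    using le insert.hyps unfolding s_def[symmetric] by (simp add: algebra_simps)
  finally show ?case
    using k \<kappa> insert.hyps unfolding \<mu>_def by (intro exI[of _ ?\<kappa>]) auto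
qed

section \<open>Affine changes of variables and Gaussian integrals\<close>

text \<open>The change of variables formula for invertible affine maps, read as an identity of measures, so
that it serves Lebesgue and Bochner integrals alike.\<close>

lemma lborel_affine_image:
  fixes A :: "real^2^2"
  assumes "invertible A"
  shows "(lborel :: (real^2) measure) =
    density (distr lborel borel (\<lambda>x. A *v x + b)) (\<lambda>_. ennreal \<bar>det A\<bar>)"
proof (rule lborel_eqI)
  have [measurable]: "(\<lambda>x. A *v x + b) \<in> borel_measurable borel"
    by (intro borel_measurable_continuous_onI continuous_intros)
  let ?h = "\<lambda>x. A *v x + b"
  fix l u :: "real^2"
  assume lu: "\<And>b. b \<in> Basis \<Longrightarrow> l \<bullet> b \<le> u \<bullet> b"
  obtain A' where A': "A ** A' = mat 1" "A' ** A = mat 1"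
    using assms by (auto simp: invertible_def)
  have inv: "A' *v (A *v x) = x" "A *v (A' *v x) = x" for x
    by (simp_all add: matrix_vector_mul_assoc A')
  have dA: "det A \<noteq> 0" using assms by (simp add: invertible_det_nz)
  have dA': "det A' * det A = 1" by (metis A'(2) det_I det_mul)
  have vim: "?h -` box l u = (*v) A' ` box (l - b) (u - b)"
  proof (intro equalityI subsetI)
    fix x assume "x \<in> ?h -` box l u"
    then have "A *v x \<in> box (l - b) (u - b)" by (auto simp: mem_box algebra_simps)
    then show "x \<in> (*v) A' ` box (l - b) (u - b)" by (metis imageI inv(1))
  qed (auto simp: inv mem_box algebra_simps)
  have lm: "(*v) A' ` box (l - b) (u - b) \<in> lmeasurable"
    by (intro measurable_linear_image) auto
  have bs: "(*v) A' ` box (l - b) (u - b) \<in> sets borel"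
    unfolding vim[symmetric] by (metis borel_measurable_continuous_onI \<open>?h \<in> borel_measurable borel\<close> borel_open measurable_sets_borel open_box)
  have "emeasure (distr lborel borel ?h) (box l u) = emeasure lborel ((*v) A' ` box (l - b) (u - b))"
    by (subst emeasure_distr) (auto simp: vim)
  also have "\<dots> = emeasure lebesgue ((*v) A' ` box (l - b) (u - b))"
    using bs by simp
  also have "\<dots> = ennreal (\<bar>det A'\<bar> * measure lebesgue (box (l - b) (u - b)))"
    using lm measure_linear_image[OF matrix_vector_mul_linear[of A'] lmeasurable_box, of "l - b" "u - b"]
    by (simp add: emeasure_eq_measure2)
  also have "measure lebesgue (box (l - b) (u - b)) = (\<Prod>b\<in>Basis. (u - l) \<bullet> b)"
    using lu by (simp add: measure_lborel_box_eq inner_diff_left)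
  finally have "emeasure (distr lborel borel ?h) (box l u) = ennreal (\<bar>det A'\<bar> * (\<Prod>b\<in>Basis. (u - l) \<bullet> b))" .
  moreover have "\<bar>det A\<bar> * \<bar>det A'\<bar> = 1"
    using dA' by (metis abs_mult abs_one mult.commute)
  ultimately show "emeasure (density (distr lborel borel ?h) (\<lambda>_. ennreal \<bar>det A\<bar>)) (box l u)
      = ennreal (\<Prod>b\<in>Basis. (u - l) \<bullet> b)"
    by (simp add: emeasure_density nn_integral_cmult_indicator flip: ennreal_mult' mult.assoc)
qed simp

lemma measurable_affine [measurable]:
  "(\<lambda>x::real^2. (A::real^2^2) *v x + b) \<in> borel_measurable borel"
  by (intro borel_measurable_continuous_onI continuous_intros)

lemma integrable_affine_iff:
  fixes A :: "real^2^2" and f :: "real^2 \<Rightarrow> 'b::{banach, second_countable_topology}"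
  assumes "invertible A" and [measurable]: "f \<in> borel_measurable borel"
  shows "integrable lborel (\<lambda>x. f (A *v x + b)) \<longleftrightarrow> integrable lborel f"
proof -
  have scale: "integrable M (\<lambda>x. c *\<^sub>R g x) \<longleftrightarrow> integrable M g"
    if "c \<noteq> 0" for c :: real and M and g :: "real^2 \<Rightarrow> 'b"
    using integrable_scaleR_right[of c M g] integrable_scaleR_right[of "1 / c" M "\<lambda>x. c *\<^sub>R g x"] that
    by auto
  have "integrable lborel f \<longleftrightarrow> integrable (distr lborel borel (\<lambda>x. A *v x + b)) (\<lambda>x. \<bar>det A\<bar> *\<^sub>R f x)"
    by (subst lborel_affine_image[OF assms(1), of b], subst integrable_density) auto
  also have "\<dots> \<longleftrightarrow> integrable lborel (\<lambda>x. f (A *v x + b))"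
    using assms(1) by (subst integrable_distr_eq) (auto simp: invertible_det_nz scale)
  finally show ?thesis by simp
qed

lemma integral_affine:
  fixes A :: "real^2^2" and f :: "real^2 \<Rightarrow> 'b::{banach, second_countable_topology}"
  assumes "invertible A" and [measurable]: "f \<in> borel_measurable borel"
  shows "(\<integral>x. f x \<partial>lborel) = \<bar>det A\<bar> *\<^sub>R (\<integral>x. f (A *v x + b) \<partial>lborel)"
proof -
  have "(\<integral>x. f x \<partial>lborel) = (\<integral>x. \<bar>det A\<bar> *\<^sub>R f x \<partial>distr lborel borel (\<lambda>x. A *v x + b))"
    by (subst lborel_affine_image[OF assms(1), of b], subst integral_density) auto
  also have "\<dots> = \<bar>det A\<bar> *\<^sub>R (\<integral>x. f (A *v x + b) \<partial>lborel)"
    by (subst integral_distr) auto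
  finally show ?thesis .
qed

lemma integrable_pair_mult:
  fixes f :: "'a::euclidean_space \<Rightarrow> 'c::{real_normed_field, banach, second_countable_topology}"
    and g :: "'b::euclidean_space \<Rightarrow> 'c"
  assumes "integrable lborel f" "integrable lborel g"
  shows "integrable (lborel \<Otimes>\<^sub>M lborel) (\<lambda>(x, y). f x * g y)"
proof (rule lborel_pair.Fubini_integrable)
  have [measurable]: "f \<in> borel_measurable borel" "g \<in> borel_measurable borel"
    using assms[THEN borel_measurable_integrable] by simp_all
  show "(\<lambda>(x, y). f x * g y) \<in> borel_measurable (lborel \<Otimes>\<^sub>M lborel)" by measurable
qed (use assms in \<open>auto simp: norm_mult\<close>)

lemma vector2_eq_iff: "x = y \<longleftrightarrow> x $ 1 = y $ 1 \<and> x $ 2 = y $ 2" for x y :: "'a^2"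
  by (simp add: vec_eq_iff forall_2)

lemma inner_real2: "x \<bullet> y = x $ 1 * y $ 1 + x $ 2 * y $ 2" for x y :: "real^2"
  by (simp add: inner_vec_def sum_2)

lemma norm_real2_sq: "(norm x)\<^sup>2 = (x $ 1)\<^sup>2 + (x $ 2)\<^sup>2" for x :: "real^2"
  unfolding power2_norm_eq_inner inner_real2 by (simp add: power2_eq_square)

lemma Basis_real2: "(Basis :: (real^2) set) = {axis 1 1, axis 2 1}"
  by (auto simp: Basis_vec_def exhaust_2) (metis exhaust_2)

lemma measurable_vector2 [measurable]:
  "(\<lambda>z. vector [fst z, snd z] :: real^2) \<in> borel_measurable (borel :: (real \<times> real) measure)"
proof -
  have "(\<lambda>z. vector [fst z, snd z] :: real^2) = (\<lambda>z. fst z *\<^sub>R axis 1 1 + snd z *\<^sub>R axis 2 1)"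
    by (auto simp: vector2_eq_iff axis_def)
  then show ?thesis by (simp add: borel_prod[symmetric])
qed

text \<open>Transports Fubini's theorem for pairs to \<open>real^2\<close>.\<close>

lemma lborel_real2: "(lborel :: (real^2) measure) = distr lborel borel (\<lambda>z::real\<times>real. vector [fst z, snd z])"
proof (rule lborel_eqI)
  fix l u :: "real^2"
  assume lu: "\<And>b. b \<in> Basis \<Longrightarrow> l \<bullet> b \<le> u \<bullet> b"
  then have le: "l $ 1 \<le> u $ 1" "l $ 2 \<le> u $ 2"
    using lu[of "axis 1 1"] lu[of "axis 2 1"] by (auto simp: Basis_real2 inner_axis)
  have "(\<lambda>z::real\<times>real. vector [fst z, snd z]) -` box l u = box (l $ 1, l $ 2) (u $ 1, u $ 2)"
    by (auto simp: mem_box Basis_real2 inner_axis Basis_prod_def)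
  then have "emeasure (distr lborel borel (\<lambda>z::real\<times>real. vector [fst z, snd z] :: real^2)) (box l u)
      = emeasure lborel (box (l $ 1, l $ 2) (u $ 1, u $ 2))"
    by (subst emeasure_distr) auto
  also have "\<dots> = ennreal ((u $ 1 - l $ 1) * (u $ 2 - l $ 2))"
    using le by (subst emeasure_lborel_box) (auto simp: Basis_prod_def)
  also have "(u $ 1 - l $ 1) * (u $ 2 - l $ 2) = (\<Prod>b\<in>Basis. (u - l) \<bullet> b)"
    by (simp add: Basis_real2 inner_axis axis_eq_axis)
  finally show "emeasure (distr lborel borel (\<lambda>z::real\<times>real. vector [fst z, snd z] :: real^2)) (box l u)
      = ennreal (\<Prod>b\<in>Basis. (u - l) \<bullet> b)" .
qed simp

lemma measurable_vec_nth [measurable]: "(\<lambda>x::real^2. x $ i) \<in> borel_measurable borel"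
  by (intro borel_measurable_continuous_onI continuous_intros)

lemma
  fixes f g :: "real \<Rightarrow> 'c::{real_normed_field, banach, second_countable_topology}"
  assumes f: "integrable lborel f" and g: "integrable lborel g"
  shows integrable_real2_product: "integrable lborel (\<lambda>x::real^2. f (x $ 1) * g (x $ 2))"
    and integral_real2_product:
      "(\<integral>x. f ((x::real^2) $ 1) * g (x $ 2) \<partial>lborel) = (\<integral>x. f x \<partial>lborel) * (\<integral>x. g x \<partial>lborel)"
proof -
  have [measurable]: "f \<in> borel_measurable borel" "g \<in> borel_measurable borel"
    using assms[THEN borel_measurable_integrable] by simp_all
  have pair: "integrable (lborel \<Otimes>\<^sub>M lborel) (\<lambda>(x, y). f x * g y)"
    by (intro integrable_pair_mult f g)
  then show "integrable lborel (\<lambda>x::real^2. f (x $ 1) * g (x $ 2))"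
    by (subst lborel_real2, subst integrable_distr_eq) (auto simp: lborel_prod case_prod_unfold)
  have "(\<integral>x. f ((x::real^2) $ 1) * g (x $ 2) \<partial>lborel) = (\<integral>z. f (fst z) * g (snd z) \<partial>(lborel \<Otimes>\<^sub>M lborel))"
    by (subst lborel_real2, subst integral_distr) (auto simp: lborel_prod)
  also have "\<dots> = (\<integral>x. \<integral>y. f x * g y \<partial>lborel \<partial>lborel)"
    using lborel_pair.integral_fst'[of "\<lambda>(x, y). f x * g y"] pair by (simp add: case_prod_unfold)
  finally show "(\<integral>x. f ((x::real^2) $ 1) * g (x $ 2) \<partial>lborel) = (\<integral>x. f x \<partial>lborel) * (\<integral>x. g x \<partial>lborel)"
    using f g by simp
qed

text \<open>The standard Gaussian is a fixed point of the Fourier transform; on the line this is the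
characteristic function of the normal distribution, and in the plane it follows by Fubini.\<close>

lemma
  shows integrable_gaussian_exp: "integrable lborel (\<lambda>x. complex_of_real (exp (- x\<^sup>2 / 2)) * exp (\<i> * complex_of_real (x * t)))"
    and fourier_gaussian_real: "(\<integral>x. complex_of_real (exp (- x\<^sup>2 / 2)) * exp (\<i> * complex_of_real (x * t)) \<partial>lborel)
      = complex_of_real (sqrt (2 * pi) * exp (- t\<^sup>2 / 2))"
proof -
  have "integrable lborel (\<lambda>x. complex_of_real (sqrt (2*pi) * normal_density 0 1 x))"
    by (intro integrable_of_real integrable_mult_right) (rule integrable_normal_density, simp)
  then have "integrable lborel (\<lambda>x. complex_of_real (exp (- x\<^sup>2 / 2)))"
    by (simp add: normal_density_def)
  then show "integrable lborel (\<lambda>x. complex_of_real (exp (- x\<^sup>2 / 2)) * exp (\<i> * complex_of_real (x * t)))"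
    by (rule Bochner_Integration.integrable_bound) (auto simp: norm_mult)
  have "complex_of_real (exp (- t\<^sup>2 / 2)) = (\<integral>x. exp (\<i> * complex_of_real (t * x)) \<partial>std_normal_distribution)"
    using char_std_normal_distribution unfolding char_def fun_eq_iff by simp
  also have "\<dots> = (\<integral>x. std_normal_density x *\<^sub>R exp (\<i> * complex_of_real (t * x)) \<partial>lborel)"
    by (subst integral_density) auto
  also have "\<dots> = (\<integral>x. (1 / sqrt (2 * pi)) *\<^sub>R (complex_of_real (exp (- x\<^sup>2 / 2)) * exp (\<i> * complex_of_real (x * t))) \<partial>lborel)"
    by (simp add: std_normal_density_def scaleR_conv_of_real mult.commute)
  also have "\<dots> = (1 / sqrt (2 * pi)) *\<^sub>R (\<integral>x. complex_of_real (exp (- x\<^sup>2 / 2)) * exp (\<i> * complex_of_real (x * t)) \<partial>lborel)"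
    by (rule integral_scaleR_right)
  finally show "(\<integral>x. complex_of_real (exp (- x\<^sup>2 / 2)) * exp (\<i> * complex_of_real (x * t)) \<partial>lborel)
      = complex_of_real (sqrt (2 * pi) * exp (- t\<^sup>2 / 2))"
    by (simp add: scaleR_conv_of_real field_simps)
qed

lemma
  fixes t :: "real^2"
  shows integrable_gaussian_exp2: "integrable lborel (\<lambda>x. complex_of_real (exp (- (norm x)\<^sup>2 / 2)) * exp (\<i> * complex_of_real (x \<bullet> t)))"
    and fourier_gaussian: "(\<integral>x. complex_of_real (exp (- (norm x)\<^sup>2 / 2)) * exp (\<i> * complex_of_real (x \<bullet> t)) \<partial>lborel)
      = complex_of_real (2 * pi * exp (- (norm t)\<^sup>2 / 2))"
proof -
  have eq: "complex_of_real (exp (- (norm x)\<^sup>2 / 2)) * exp (\<i> * complex_of_real (x \<bullet> t))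
     = (complex_of_real (exp (- (x $ 1)\<^sup>2 / 2)) * exp (\<i> * complex_of_real (x $ 1 * t $ 1)))
       * (complex_of_real (exp (- (x $ 2)\<^sup>2 / 2)) * exp (\<i> * complex_of_real (x $ 2 * t $ 2)))" for x :: "real^2"
  proof -
    have "exp (- (norm x)\<^sup>2 / 2) = exp (- (x $ 1)\<^sup>2 / 2) * exp (- (x $ 2)\<^sup>2 / 2)"
      by (simp add: norm_real2_sq diff_divide_distrib flip: exp_add)
    moreover have "exp (\<i> * complex_of_real (x \<bullet> t)) = exp (\<i> * complex_of_real (x $ 1 * t $ 1)) * exp (\<i> * complex_of_real (x $ 2 * t $ 2))"
      by (simp add: inner_real2 distrib_left flip: exp_add)
    ultimately show ?thesis by simp
  qed
  show "integrable lborel (\<lambda>x. complex_of_real (exp (- (norm x)\<^sup>2 / 2)) * exp (\<i> * complex_of_real (x \<bullet> t)))"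
    unfolding eq by (intro integrable_real2_product integrable_gaussian_exp)
  have s: "sqrt (2*pi) * sqrt (2*pi) = 2 * pi" by simp
  have "(\<integral>x. complex_of_real (exp (- (norm x)\<^sup>2 / 2)) * exp (\<i> * complex_of_real (x \<bullet> t)) \<partial>lborel)
      = complex_of_real (sqrt (2 * pi) * exp (- (t $ 1)\<^sup>2 / 2)) * complex_of_real (sqrt (2 * pi) * exp (- (t $ 2)\<^sup>2 / 2))"
    unfolding eq
    by (subst integral_real2_product[OF integrable_gaussian_exp integrable_gaussian_exp])
      (simp only: fourier_gaussian_real)
  also have "\<dots> = complex_of_real ((sqrt (2*pi) * sqrt (2*pi)) * (exp (- (t $ 1)\<^sup>2 / 2) * exp (- (t $ 2)\<^sup>2 / 2)))"
    by (simp only: of_real_mult mult_ac)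
  also have "exp (- (t $ 1)\<^sup>2 / 2) * exp (- (t $ 2)\<^sup>2 / 2) = exp (- (norm t)\<^sup>2 / 2)"
    by (simp add: norm_real2_sq diff_divide_distrib flip: exp_add)
  finally show "(\<integral>x. complex_of_real (exp (- (norm x)\<^sup>2 / 2)) * exp (\<i> * complex_of_real (x \<bullet> t)) \<partial>lborel)
      = complex_of_real (2 * pi * exp (- (norm t)\<^sup>2 / 2))"
    by (simp only: s)
qed

lemma L2_borelI:
  assumes "f \<in> borel_measurable borel" "integrable lborel (\<lambda>x. (cmod (f x))\<^sup>2)"
  shows "f \<in> L2"
  using assms by (auto simp: L2_def measurable_completion integrable_completion)

lemma norm_sq_borel:
  assumes "f \<in> borel_measurable borel"
  shows "norm_sq f = (\<integral>x. (cmod (f x))\<^sup>2 \<partial>lborel)"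
  using assms by (simp add: norm_sq_def integral_completion)

lemma L2_borel_integrable:
  assumes "f \<in> borel_measurable borel" "f \<in> L2"
  shows "integrable lborel (\<lambda>x. (cmod (f x))\<^sup>2)"
  using assms by (auto simp: L2_def integrable_completion)

lemma L2_affine:
  fixes A :: "real^2^2"
  assumes "invertible A" "f \<in> borel_measurable borel" "f \<in> L2"
  shows "(\<lambda>x. f (A *v x + b)) \<in> L2"
proof (rule L2_borelI)
  note [measurable] = assms(2)
  show "(\<lambda>x. f (A *v x + b)) \<in> borel_measurable borel" by measurable
  show "integrable lborel (\<lambda>x. (cmod (f (A *v x + b)))\<^sup>2)"
    using integrable_affine_iff[OF assms(1), of "\<lambda>x. (cmod (f x))\<^sup>2" b] L2_borel_integrable[OF assms(2,3)]
    by simp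
qed

lemma norm_sq_affine:
  fixes A :: "real^2^2"
  assumes "invertible A" "f \<in> borel_measurable borel"
  shows "norm_sq f = \<bar>det A\<bar> * norm_sq (\<lambda>x. f (A *v x + b))"
proof -
  note [measurable] = assms(2)
  have "(\<lambda>x. f (A *v x + b)) \<in> borel_measurable borel" by measurable
  then show ?thesis
    using integral_affine[OF assms(1), of "\<lambda>x. (cmod (f x))\<^sup>2" b] assms(2) by (simp add: norm_sq_borel)
qed

lemma gaussian_dict_borel: "G \<in> gaussian_dict \<Longrightarrow> G \<in> borel_measurable borel"
  by (auto simp: gaussian_dict_def matrix_vector_mult_diff_distrib intro!: borel_measurable_continuous_onI continuous_intros)

text \<open>\<open>A (B x + b - k) = (A B) (x - B\<inverse> (k - b))\<close>: the dictionary is closed under invertible affine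
changes of variables. This is where arbitrary covariance matrices are used, and it makes long
thin curvelets as cheap as round ones.\<close>

lemma gaussian_dict_affine:
  assumes "G \<in> gaussian_dict" "invertible A"
  shows "(\<lambda>x. G (A *v x + b)) \<in> gaussian_dict"
proof -
  obtain B :: "real^2^2" and k where G: "G = (\<lambda>x. complex_of_real (exp (- (norm (B *v (x - k)))\<^sup>2)))" and B: "invertible B"
    using assms(1) unfolding gaussian_dict_def by blast
  obtain A' where A': "A ** A' = mat 1" using assms(2) by (auto simp: invertible_def)
  have "B *v (A *v x + b - k) = (B ** A) *v (x - A' *v (k - b))" for x
  proof -
    have "A *v (x - A' *v (k - b)) = A *v x + b - k"
      by (simp add: matrix_vector_mult_diff_distrib[of A] matrix_vector_mul_assoc A')
    then show ?thesis
      by (simp only: matrix_vector_mul_assoc[symmetric])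
  qed
  then have "(\<lambda>x. G (A *v x + b))
      = (\<lambda>x. complex_of_real (exp (- (norm ((B ** A) *v (x - A' *v (k - b))))\<^sup>2)))"
    by (simp add: G)
  moreover have "invertible (B ** A)" using B assms(2) by (rule invertible_mult)
  ultimately show ?thesis
    unfolding gaussian_dict_def by blast
qed

lemma unit_gaussian_L2: "(\<lambda>x::real^2. complex_of_real (exp (- (norm x)\<^sup>2))) \<in> L2"
proof (rule L2_borelI)
  have "integrable lborel (\<lambda>x::real^2. complex_of_real (exp (- (norm x)\<^sup>2 / 2)))"
    using integrable_gaussian_exp2[of 0] by simp
  then show "integrable lborel (\<lambda>x::real^2. (cmod (complex_of_real (exp (- (norm x)\<^sup>2))))\<^sup>2)"
    by (rule Bochner_Integration.integrable_bound) (auto simp: power2_eq_square simp flip: exp_add)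
qed (intro borel_measurable_continuous_onI continuous_intros)

lemma gaussian_dict_L2: "G \<in> gaussian_dict \<Longrightarrow> G \<in> L2"
proof -
  assume "G \<in> gaussian_dict"
  then obtain B :: "real^2^2" and k where G: "G = (\<lambda>x. complex_of_real (exp (- (norm (B *v (x - k)))\<^sup>2)))" and B: "invertible B"
    unfolding gaussian_dict_def by blast
  have "(\<lambda>x. complex_of_real (exp (- (norm (B *v x + (- (B *v k))))\<^sup>2))) \<in> L2"
    using B by (intro L2_affine[OF _ _ unit_gaussian_L2]) (auto intro!: borel_measurable_continuous_onI continuous_intros)
  then show ?thesis by (simp add: G matrix_vector_mult_diff_distrib)
qed

lemma gauss_mix_L2: "gauss_mix m S \<Longrightarrow> S \<in> L2"
proof -
  assume "gauss_mix m S"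
  then obtain a G where S: "\<forall>j<m. G j \<in> gaussian_dict" "S = (\<lambda>x. \<Sum>j<m. a j * G j x)"
    by (auto simp: gauss_mix_def)
  have "(\<lambda>x. a j * G j x) \<in> L2" if "j < m" for j
    by (rule L2_cmult, rule gaussian_dict_L2) (use S(1) that in blast)
  then show ?thesis unfolding S(2) by (intro L2_sum) simp
qed

lemma gauss_mix_borel: "gauss_mix m S \<Longrightarrow> S \<in> borel_measurable borel"
proof -
  assume "gauss_mix m S"
  then obtain a G where S: "\<forall>j<m. G j \<in> gaussian_dict" "S = (\<lambda>x. \<Sum>j<m. a j * G j x)"
    by (auto simp: gauss_mix_def)
  have "(\<lambda>x. a j * G j x) \<in> borel_measurable borel" if "j < m" for j
    using S(1) that by (intro borel_measurable_times borel_measurable_const gaussian_dict_borel) auto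
  then show ?thesis unfolding S(2) by (intro borel_measurable_sum) auto
qed

lemma gauss_mix_affine:
  assumes "gauss_mix m S" "invertible A"
  shows "gauss_mix m (\<lambda>x. S (A *v x + b))"
proof -
  obtain a G where S: "\<forall>j<m. G j \<in> gaussian_dict" "S = (\<lambda>x. \<Sum>j<m. a j * G j x)"
    using assms(1) by (auto simp: gauss_mix_def)
  then show ?thesis
    unfolding gauss_mix_def using assms(2)
    by (intro exI[of _ a] exI[of _ "\<lambda>j x. G j (A *v x + b)"]) (simp add: gaussian_dict_affine)
qed

section \<open>The inequality in Plancherel's theorem\<close>

lemma inverse_fourier_eq_lborel:
  fixes g :: "real^2 \<Rightarrow> complex"
  assumes [measurable]: "g \<in> borel_measurable borel"
  shows "inverse_fourier g x =
    (1 / (2 * pi)) *\<^sub>R (\<integral>\<xi>. g \<xi> * exp (\<i> * complex_of_real (x \<bullet> \<xi>)) \<partial>lborel)"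
proof -
  have "(2 * pi) powr (- real DIM(real^2) / 2) = 1 / (2 * pi)"
    by (simp add: powr_minus_divide)
  then show ?thesis
    unfolding inverse_fourier_def by (subst integral_completion) (simp_all add: scaleR_conv_of_real)
qed

lemma measurable_cnj [measurable]: "cnj \<in> borel_measurable borel"
  by (intro borel_measurable_continuous_onI continuous_intros)

text \<open>For a function that is not integrable the left-hand side is \<open>0\<close>.\<close>

lemma ennreal_norm_integral_le:
  fixes f :: "'a \<Rightarrow> 'b::{banach, second_countable_topology}"
  shows "ennreal (norm (integral\<^sup>L M f)) \<le> (\<integral>\<^sup>+x. ennreal (norm (f x)) \<partial>M)"
  by (cases "integrable M f") (auto intro: integral_norm_bound_ennreal simp: not_integrable_integral_eq)

lemma integrable_mult_iexp:
  fixes g :: "real^2 \<Rightarrow> complex"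
  assumes "integrable lborel g"
  shows "integrable lborel (\<lambda>\<xi>. g \<xi> * exp (\<i> * complex_of_real (x \<bullet> \<xi>)))"
proof -
  have [measurable]: "g \<in> borel_measurable borel" using assms by auto
  show ?thesis
    by (rule Bochner_Integration.integrable_bound[OF assms]) (auto simp: norm_mult)
qed

lemma inverse_fourier_borel:
  fixes g :: "real^2 \<Rightarrow> complex"
  assumes [measurable]: "g \<in> borel_measurable borel"
  shows "(\<lambda>x. inverse_fourier g x) \<in> borel_measurable borel"
proof -
  have "(\<lambda>(x, \<xi>). g \<xi> * exp (\<i> * complex_of_real (x \<bullet> \<xi>)))
      \<in> borel_measurable ((borel :: (real^2) measure) \<Otimes>\<^sub>M lborel)"
  proof -
    have "(\<lambda>z. g (snd z) * exp (\<i> * complex_of_real (fst z \<bullet> snd z)))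
        \<in> borel_measurable ((borel :: (real^2) measure) \<Otimes>\<^sub>M borel)"
      by measurable
    then show ?thesis by (simp add: case_prod_unfold)
  qed
  then have "(\<lambda>x. \<integral>\<xi>. g \<xi> * exp (\<i> * complex_of_real (x \<bullet> \<xi>)) \<partial>lborel) \<in> borel_measurable borel"
    by (rule lborel.borel_measurable_lebesgue_integral)
  then show ?thesis
    by (simp add: inverse_fourier_eq_lborel)
qed

lemma norm_inverse_fourier_le:
  fixes g :: "real^2 \<Rightarrow> complex"
  assumes "g \<in> borel_measurable borel"
  shows "cmod (inverse_fourier g x) \<le> (\<integral>\<xi>. cmod (g \<xi>) \<partial>lborel)"
proof -
  have "cmod (inverse_fourier g x) \<le> (1 / (2 * pi)) * (\<integral>\<xi>. cmod (g \<xi> * exp (\<i> * complex_of_real (x \<bullet> \<xi>))) \<partial>lborel)"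
    unfolding inverse_fourier_eq_lborel[OF assms]
    by (simp add: integral_norm_bound divide_right_mono)
  also have "\<dots> = (1 / (2 * pi)) * (\<integral>\<xi>. cmod (g \<xi>) \<partial>lborel)" by (simp add: norm_mult)
  also have "\<dots> \<le> 1 * (\<integral>\<xi>. cmod (g \<xi>) \<partial>lborel)"
    using pi_gt3 by (intro mult_right_mono integral_nonneg) auto
  finally show ?thesis by simp
qed

text \<open>The Fourier transform of the wide Gaussian \<open>exp (- |x|\<^sup>2 / (2 n\<^sup>2))\<close> is an approximate identity
as \<open>n\<close> grows; its total mass, computed next, does not depend on \<open>n\<close>.\<close>

lemma
  fixes t :: "real^2" and n :: real
  assumes n: "n > 0"
  shows integrable_wide_gaussian: "integrable lborel (\<lambda>x. complex_of_real (exp (- (norm x / n)\<^sup>2 / 2)) * exp (\<i> * complex_of_real (x \<bullet> t)))"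
    and fourier_wide_gaussian: "(\<integral>x. complex_of_real (exp (- (norm x / n)\<^sup>2 / 2)) * exp (\<i> * complex_of_real (x \<bullet> t)) \<partial>lborel)
      = complex_of_real (n\<^sup>2 * (2 * pi * exp (- (n * norm t)\<^sup>2 / 2)))"
proof -
  let ?A = "mat (1 / n) :: real^2^2"
  let ?f = "\<lambda>x. complex_of_real (exp (- (norm x)\<^sup>2 / 2)) * exp (\<i> * complex_of_real (x \<bullet> (n *\<^sub>R t)))"
  have A: "?A *v x = (1 / n) *\<^sub>R x" for x
    by (simp add: vector2_eq_iff matrix_vector_mult_def mat_def sum_2)
  have d: "det ?A = 1 / n\<^sup>2"
    by (simp add: det_2 mat_def power2_eq_square)
  have inv: "invertible ?A" using n by (simp add: invertible_det_nz d)
  have f: "?f (?A *v x + 0) = complex_of_real (exp (- (norm x / n)\<^sup>2 / 2)) * exp (\<i> * complex_of_real (x \<bullet> t))" for x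
    using n by (simp add: A)
  have m: "?f \<in> borel_measurable borel"
    using integrable_gaussian_exp2[of "n *\<^sub>R t"] by auto
  show "integrable lborel (\<lambda>x. complex_of_real (exp (- (norm x / n)\<^sup>2 / 2)) * exp (\<i> * complex_of_real (x \<bullet> t)))"
    using integrable_affine_iff[OF inv m, of 0] integrable_gaussian_exp2[of "n *\<^sub>R t"] unfolding f by simp
  show "(\<integral>x. complex_of_real (exp (- (norm x / n)\<^sup>2 / 2)) * exp (\<i> * complex_of_real (x \<bullet> t)) \<partial>lborel)
      = complex_of_real (n\<^sup>2 * (2 * pi * exp (- (n * norm t)\<^sup>2 / 2)))"
    (is "?I = _")
  proof -
    have 1: "integral\<^sup>L lborel ?f = complex_of_real (2 * pi * exp (- (n * norm t)\<^sup>2 / 2))"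
      using fourier_gaussian[of "n *\<^sub>R t"] n by simp
    have "?I = n\<^sup>2 *\<^sub>R ((1 / n\<^sup>2) *\<^sub>R ?I)" using n by simp
    also have "(1 / n\<^sup>2) *\<^sub>R ?I = integral\<^sup>L lborel ?f"
      using integral_affine[OF inv m, of 0] unfolding f d by simp
    finally show ?thesis unfolding 1 by (simp add: scaleR_conv_of_real)
  qed
qed

lemma nn_integral_gaussian_kernel:
  fixes \<xi> :: "real^2" and n :: real
  assumes n: "n > 0"
  shows "(\<integral>\<^sup>+\<eta>. ennreal (n\<^sup>2 * (2 * pi * exp (- (n * norm (\<xi> - \<eta>))\<^sup>2 / 2))) \<partial>lborel) = ennreal ((2 * pi)\<^sup>2)"
proof -
  have i: "integrable lborel (\<lambda>x::real^2. exp (- (norm x / (1/n))\<^sup>2 / 2))"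
    using integrable_Re[OF integrable_wide_gaussian[of "1/n" 0]] n by simp
  have "(\<integral>x. exp (- (norm (x::real^2) / (1/n))\<^sup>2 / 2) \<partial>lborel) = (1/n)\<^sup>2 * (2 * pi)"
    using fourier_wide_gaussian[of "1/n" 0] n
    by (simp flip: of_real_mult of_real_power of_real_divide add: integral_complex_of_real)
  then have "(\<integral>\<^sup>+x. ennreal (exp (- (norm (x::real^2) / (1/n))\<^sup>2 / 2)) \<partial>lborel) = ennreal ((1/n)\<^sup>2 * (2 * pi))"
    using i by (subst nn_integral_eq_integral) auto
  then have *: "(\<integral>\<^sup>+x. ennreal (exp (- (n * norm (x::real^2))\<^sup>2 / 2)) \<partial>lborel) = ennreal ((1/n)\<^sup>2 * (2 * pi))"
    by (simp add: mult.commute)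
  have "(\<integral>\<^sup>+\<eta>. ennreal (n\<^sup>2 * (2 * pi * exp (- (n * norm (\<xi> - \<eta>))\<^sup>2 / 2))) \<partial>lborel)
      = (\<integral>\<^sup>+x. ennreal (n\<^sup>2 * (2 * pi * exp (- (n * norm (\<xi> - x))\<^sup>2 / 2)))
          \<partial>distr lborel borel (\<lambda>x. \<xi> + (-1) *\<^sub>R x))"
  proof -
    have "lborel = density (distr lborel borel (\<lambda>x::real^2. \<xi> + (-1) *\<^sub>R x)) (\<lambda>_. ennreal (\<bar>-1\<bar> ^ DIM(real^2)))"
      by (rule lborel_affine) simp
    then show ?thesis by (simp add: density_1)
  qed
  also have "\<dots> = (\<integral>\<^sup>+x. ennreal (n\<^sup>2 * (2 * pi)) * ennreal (exp (- (n * norm (x::real^2))\<^sup>2 / 2)) \<partial>lborel)"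
    by (subst nn_integral_distr) (auto simp: ennreal_mult'[symmetric] mult.assoc)
  also have "\<dots> = ennreal (n\<^sup>2 * (2 * pi)) * ennreal ((1/n)\<^sup>2 * (2 * pi))"
    unfolding *[symmetric] by (rule nn_integral_cmult) measurable
  also have "\<dots> = ennreal ((2 * pi)\<^sup>2)"
    using n by (simp add: ennreal_mult'[symmetric] power2_eq_square)
  finally show ?thesis .
qed

text \<open>Against a Gaussian weight all integrals converge absolutely, so Fubini turns the energy of an
inverse Fourier transform into a double integral of \<open>\<Phi> \<xi> * cnj (\<Phi> \<eta>)\<close> against the approximate
identity \<open>k\<close>.\<close>

lemma gaussian_weighted_energy:
  fixes \<Phi> :: "real^2 \<Rightarrow> complex" and n :: real
  assumes i1: "integrable lborel \<Phi>" and n: "n > 0"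
  defines "k \<equiv> \<lambda>\<zeta>::real^2. n\<^sup>2 * (2 * pi * exp (- (n * norm \<zeta>)\<^sup>2 / 2))"
  defines "F \<equiv> inverse_fourier \<Phi>"
  shows "(\<integral>x. complex_of_real ((cmod (F x))\<^sup>2 * exp (- (norm x / n)\<^sup>2 / 2)) \<partial>lborel)
    = (1 / (2 * pi)\<^sup>2) *\<^sub>R (\<integral>\<xi>. (\<integral>\<eta>. \<Phi> \<xi> * cnj (\<Phi> \<eta>) * complex_of_real (k (\<xi> - \<eta>)) \<partial>lborel) \<partial>lborel)"
proof -
  have m [measurable]: "\<Phi> \<in> borel_measurable borel" using i1 by auto
  have [measurable]: "F \<in> borel_measurable borel" unfolding F_def by (rule inverse_fourier_borel) simp
  define w where "w x = complex_of_real (exp (- (norm x / n)\<^sup>2 / 2))" for x :: "real^2"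
  have w_int: "integrable lborel (\<lambda>x. w x * exp (\<i> * complex_of_real (x \<bullet> t)))" for t
    unfolding w_def by (rule integrable_wide_gaussian[OF n])
  have w: "integrable lborel w" using w_int[of 0] by simp
  then have [measurable]: "w \<in> borel_measurable borel" by auto
  let ?e = "\<lambda>x \<xi>. exp (\<i> * complex_of_real (x \<bullet> (\<xi>::real^2)))"
  have inner: "(\<integral>x. w x * cnj (F x) * ?e x \<xi> \<partial>lborel)
      = (1 / (2 * pi)) *\<^sub>R (\<integral>\<eta>. cnj (\<Phi> \<eta>) * complex_of_real (k (\<xi> - \<eta>)) \<partial>lborel)" for \<xi>
  proof -
    have int: "integrable (lborel \<Otimes>\<^sub>M lborel) (\<lambda>(x, \<eta>). w x * cnj (\<Phi> \<eta>) * ?e x (\<xi> - \<eta>))"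
    proof (rule Bochner_Integration.integrable_bound)
      show "integrable (lborel \<Otimes>\<^sub>M lborel) (\<lambda>(x, \<eta>). w x * cnj (\<Phi> \<eta>))"
        using i1 by (intro integrable_pair_mult w) auto
      have [measurable]: "(\<lambda>z. ?e (fst z) (\<xi> - snd z)) \<in> borel_measurable (lborel \<Otimes>\<^sub>M lborel)"
      proof -
        have "(\<lambda>z. ?e (fst z) (\<xi> - snd z)) \<in> borel_measurable borel"
          by (intro borel_measurable_continuous_onI continuous_intros)
        then show ?thesis by (simp add: lborel_prod)
      qed
      show "(\<lambda>(x, \<eta>). w x * cnj (\<Phi> \<eta>) * ?e x (\<xi> - \<eta>)) \<in> borel_measurable (lborel \<Otimes>\<^sub>M lborel)"
        unfolding case_prod_unfold by measurable
    qed (auto simp: norm_mult)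
    have "w x * cnj (F x) * ?e x \<xi> = (1 / (2 * pi)) *\<^sub>R (\<integral>\<eta>. w x * cnj (\<Phi> \<eta>) * ?e x (\<xi> - \<eta>) \<partial>lborel)" for x
    proof -
      have "cnj (F x) = (1 / (2 * pi)) *\<^sub>R (\<integral>\<eta>. cnj (\<Phi> \<eta>) * cnj (?e x \<eta>) \<partial>lborel)"
        unfolding F_def inverse_fourier_eq_lborel[OF m] complex_cnj_scaleR
        by (simp only: complex_cnj_mult[symmetric] Bochner_Integration.integral_cnj)
      then have "w x * cnj (F x) * ?e x \<xi> = (1 / (2 * pi)) *\<^sub>R ((w x * ?e x \<xi>) * (\<integral>\<eta>. cnj (\<Phi> \<eta>) * cnj (?e x \<eta>) \<partial>lborel))"
        by simp
      also have "(w x * ?e x \<xi>) * (\<integral>\<eta>. cnj (\<Phi> \<eta>) * cnj (?e x \<eta>) \<partial>lborel)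
          = (\<integral>\<eta>. (w x * ?e x \<xi>) * (cnj (\<Phi> \<eta>) * cnj (?e x \<eta>)) \<partial>lborel)"
        by simp
      also have "(\<lambda>\<eta>. (w x * ?e x \<xi>) * (cnj (\<Phi> \<eta>) * cnj (?e x \<eta>))) = (\<lambda>\<eta>. w x * cnj (\<Phi> \<eta>) * ?e x (\<xi> - \<eta>))"
        by (simp add: fun_eq_iff exp_cnj inner_diff_right algebra_simps exp_diff exp_minus divide_inverse)
      finally show ?thesis .
    qed
    then have "(\<integral>x. w x * cnj (F x) * ?e x \<xi> \<partial>lborel)
        = (1 / (2 * pi)) *\<^sub>R (\<integral>x. (\<integral>\<eta>. w x * cnj (\<Phi> \<eta>) * ?e x (\<xi> - \<eta>) \<partial>lborel) \<partial>lborel)"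
      by simp
    also have "(\<integral>x. (\<integral>\<eta>. w x * cnj (\<Phi> \<eta>) * ?e x (\<xi> - \<eta>) \<partial>lborel) \<partial>lborel)
        = (\<integral>\<eta>. (\<integral>x. w x * cnj (\<Phi> \<eta>) * ?e x (\<xi> - \<eta>) \<partial>lborel) \<partial>lborel)"
      using lborel_pair.Fubini_integral[OF int] by simp
    also have "\<dots> = (\<integral>\<eta>. cnj (\<Phi> \<eta>) * complex_of_real (k (\<xi> - \<eta>)) \<partial>lborel)"
    proof (rule Bochner_Integration.integral_cong[OF refl])
      fix \<eta>
      have "(\<integral>x. w x * cnj (\<Phi> \<eta>) * ?e x (\<xi> - \<eta>) \<partial>lborel) = (\<integral>x. cnj (\<Phi> \<eta>) * (w x * ?e x (\<xi> - \<eta>)) \<partial>lborel)"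
        by (simp only: mult_ac)
      also have "\<dots> = cnj (\<Phi> \<eta>) * (\<integral>x. w x * ?e x (\<xi> - \<eta>) \<partial>lborel)"
        by simp
      also have "(\<integral>x. w x * ?e x (\<xi> - \<eta>) \<partial>lborel) = complex_of_real (k (\<xi> - \<eta>))"
        unfolding w_def k_def by (rule fourier_wide_gaussian[OF n])
      finally show "(\<integral>x. w x * cnj (\<Phi> \<eta>) * ?e x (\<xi> - \<eta>) \<partial>lborel) = cnj (\<Phi> \<eta>) * complex_of_real (k (\<xi> - \<eta>))" .
    qed
    finally show ?thesis .
  qed
  define B where "B = (\<integral>\<xi>. cmod (\<Phi> \<xi>) \<partial>lborel)"
  have F_le: "cmod (F x) \<le> B" for x
    unfolding F_def B_def by (rule norm_inverse_fourier_le) simp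
  have int2: "integrable (lborel \<Otimes>\<^sub>M lborel) (\<lambda>(x, \<xi>). w x * cnj (F x) * (\<Phi> \<xi> * ?e x \<xi>))"
  proof (rule Bochner_Integration.integrable_bound)
    show "integrable (lborel \<Otimes>\<^sub>M lborel) (\<lambda>(x, \<xi>). (complex_of_real B * w x) * \<Phi> \<xi>)"
      using i1 w by (intro integrable_pair_mult integrable_mult_right)
    have [measurable]: "(\<lambda>z. ?e (fst z) (snd z)) \<in> borel_measurable (lborel \<Otimes>\<^sub>M lborel)"
    proof -
      have "(\<lambda>z. ?e (fst z) (snd z)) \<in> borel_measurable borel"
        by (intro borel_measurable_continuous_onI continuous_intros)
      then show ?thesis by (simp add: lborel_prod)
    qed
    show "(\<lambda>(x, \<xi>). w x * cnj (F x) * (\<Phi> \<xi> * ?e x \<xi>)) \<in> borel_measurable (lborel \<Otimes>\<^sub>M lborel)"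
      unfolding case_prod_unfold by measurable
    show "AE z in lborel \<Otimes>\<^sub>M lborel. cmod (case z of (x, \<xi>) \<Rightarrow> w x * cnj (F x) * (\<Phi> \<xi> * ?e x \<xi>))
        \<le> cmod (case z of (x, \<xi>) \<Rightarrow> (complex_of_real B * w x) * \<Phi> \<xi>)"
    proof (rule AE_I2, clarify)
      fix x \<xi>
      have "cmod (F x) * (cmod (w x) * cmod (\<Phi> \<xi>)) \<le> \<bar>B\<bar> * (cmod (w x) * cmod (\<Phi> \<xi>))"
        using F_le[of x] by (intro mult_right_mono) auto
      then show "cmod (w x * cnj (F x) * (\<Phi> \<xi> * ?e x \<xi>)) \<le> cmod ((complex_of_real B * w x) * \<Phi> \<xi>)"
        by (simp add: norm_mult mult_ac)
    qed
  qed
  have "complex_of_real ((cmod (F x))\<^sup>2 * exp (- (norm x / n)\<^sup>2 / 2))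
      = (1 / (2 * pi)) *\<^sub>R (\<integral>\<xi>. w x * cnj (F x) * (\<Phi> \<xi> * ?e x \<xi>) \<partial>lborel)" for x
  proof -
    have "complex_of_real ((cmod (F x))\<^sup>2 * exp (- (norm x / n)\<^sup>2 / 2)) = w x * cnj (F x) * F x"
      by (simp only: w_def of_real_mult complex_norm_square mult_ac)
    also have "\<dots> = w x * cnj (F x) * ((1 / (2 * pi)) *\<^sub>R (\<integral>\<xi>. \<Phi> \<xi> * ?e x \<xi> \<partial>lborel))"
      unfolding F_def by (simp add: inverse_fourier_eq_lborel)
    also have "\<dots> = (1 / (2 * pi)) *\<^sub>R (w x * cnj (F x) * (\<integral>\<xi>. \<Phi> \<xi> * ?e x \<xi> \<partial>lborel))"
      by (simp only: mult_scaleR_right)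
    also have "w x * cnj (F x) * (\<integral>\<xi>. \<Phi> \<xi> * ?e x \<xi> \<partial>lborel) = (\<integral>\<xi>. w x * cnj (F x) * (\<Phi> \<xi> * ?e x \<xi>) \<partial>lborel)"
      by simp
    finally show ?thesis .
  qed
  then have "(\<integral>x. complex_of_real ((cmod (F x))\<^sup>2 * exp (- (norm x / n)\<^sup>2 / 2)) \<partial>lborel)
      = (1 / (2 * pi)) *\<^sub>R (\<integral>x. (\<integral>\<xi>. w x * cnj (F x) * (\<Phi> \<xi> * ?e x \<xi>) \<partial>lborel) \<partial>lborel)"
    by (simp only: integral_scaleR_right)
  also have "(\<integral>x. (\<integral>\<xi>. w x * cnj (F x) * (\<Phi> \<xi> * ?e x \<xi>) \<partial>lborel) \<partial>lborel)
      = (\<integral>\<xi>. (\<integral>x. w x * cnj (F x) * (\<Phi> \<xi> * ?e x \<xi>) \<partial>lborel) \<partial>lborel)"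
    using lborel_pair.Fubini_integral[OF int2] by simp
  also have "\<dots> = (\<integral>\<xi>. (1 / (2 * pi)) *\<^sub>R (\<integral>\<eta>. \<Phi> \<xi> * cnj (\<Phi> \<eta>) * complex_of_real (k (\<xi> - \<eta>)) \<partial>lborel) \<partial>lborel)"
  proof (rule Bochner_Integration.integral_cong[OF refl])
    fix \<xi>
    have "(\<integral>x. w x * cnj (F x) * (\<Phi> \<xi> * ?e x \<xi>) \<partial>lborel) = (\<integral>x. \<Phi> \<xi> * (w x * cnj (F x) * ?e x \<xi>) \<partial>lborel)"
      by (simp only: mult_ac)
    also have "\<dots> = \<Phi> \<xi> * (\<integral>x. w x * cnj (F x) * ?e x \<xi> \<partial>lborel)"
      by simp
    also have "\<dots> = (1 / (2 * pi)) *\<^sub>R (\<Phi> \<xi> * (\<integral>\<eta>. cnj (\<Phi> \<eta>) * complex_of_real (k (\<xi> - \<eta>)) \<partial>lborel))"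
      unfolding inner by (simp only: mult_scaleR_right)
    also have "\<Phi> \<xi> * (\<integral>\<eta>. cnj (\<Phi> \<eta>) * complex_of_real (k (\<xi> - \<eta>)) \<partial>lborel)
        = (\<integral>\<eta>. \<Phi> \<xi> * cnj (\<Phi> \<eta>) * complex_of_real (k (\<xi> - \<eta>)) \<partial>lborel)"
      by (simp add: mult.assoc)
    finally show "(\<integral>x. w x * cnj (F x) * (\<Phi> \<xi> * ?e x \<xi>) \<partial>lborel)
        = (1 / (2 * pi)) *\<^sub>R (\<integral>\<eta>. \<Phi> \<xi> * cnj (\<Phi> \<eta>) * complex_of_real (k (\<xi> - \<eta>)) \<partial>lborel)" .
  qed
  finally show ?thesis
    by (simp add: power2_eq_square)
qed

text \<open>Bound the double integral of the preceding lemma by \<open>|\<Phi> \<xi>| |\<Phi> \<eta>| \<le> (|\<Phi> \<xi>|\<^sup>2 + |\<Phi> \<eta>|\<^sup>2) / 2\<close> and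
integrate out the kernel, uniformly in the width of the weight; then let the weight tend to \<open>1\<close>
with Fatou's lemma.\<close>

lemma
  fixes \<Phi> :: "real^2 \<Rightarrow> complex"
  assumes i1: "integrable lborel \<Phi>" and i2: "integrable lborel (\<lambda>\<xi>. (cmod (\<Phi> \<xi>))\<^sup>2)"
  shows inverse_fourier_L2: "inverse_fourier \<Phi> \<in> L2"
    and plancherel_inequality: "norm_sq (inverse_fourier \<Phi>) \<le> (\<integral>\<xi>. (cmod (\<Phi> \<xi>))\<^sup>2 \<partial>lborel)"
proof -
  have m [measurable]: "\<Phi> \<in> borel_measurable borel" using i1 by auto
  define F where "F = inverse_fourier \<Phi>"
  have Fm [measurable]: "F \<in> borel_measurable borel" unfolding F_def by (rule inverse_fourier_borel[OF m])
  define E where "E = (\<integral>\<xi>. (cmod (\<Phi> \<xi>))\<^sup>2 \<partial>lborel)"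
  have E: "E \<ge> 0" "(\<integral>\<^sup>+\<xi>. ennreal ((cmod (\<Phi> \<xi>))\<^sup>2) \<partial>lborel) = ennreal E"
    unfolding E_def using i2 by (auto intro: nn_integral_eq_integral)
  have weighted: "(\<integral>\<^sup>+x. ennreal ((cmod (F x))\<^sup>2 * exp (- (norm x / n)\<^sup>2 / 2)) \<partial>lborel) \<le> ennreal E"
    if n: "n > 0" for n :: real
  proof -
    define k where "k \<zeta> = n\<^sup>2 * (2 * pi * exp (- (n * norm \<zeta>)\<^sup>2 / 2))" for \<zeta> :: "real^2"
    have k0: "k \<zeta> \<ge> 0" for \<zeta> by (simp add: k_def)
    have km [measurable]: "k \<in> borel_measurable borel"
      unfolding k_def by measurable
    have kint: "(\<integral>\<^sup>+\<eta>. ennreal (k (\<xi> - \<eta>)) \<partial>lborel) = ennreal ((2 * pi)\<^sup>2)" for \<xi>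
      unfolding k_def by (rule nn_integral_gaussian_kernel[OF n])
    have ksym: "k (\<xi> - \<eta>) = k (\<eta> - \<xi>)" for \<xi> \<eta>
      by (simp add: k_def norm_minus_commute)
    define B where "B = (\<integral>\<xi>. cmod (\<Phi> \<xi>) \<partial>lborel)"
    have F_le: "cmod (F x) \<le> B" for x
      unfolding F_def B_def by (rule norm_inverse_fourier_le) simp
    have int: "integrable lborel (\<lambda>x::real^2. (cmod (F x))\<^sup>2 * exp (- (norm x / n)\<^sup>2 / 2))"
    proof (rule Bochner_Integration.integrable_bound)
      show "integrable lborel (\<lambda>x::real^2. B\<^sup>2 * exp (- (norm x / n)\<^sup>2 / 2))"
        using integrable_Re[OF integrable_wide_gaussian[OF n, of 0]] by simp
      show "AE x::real^2 in lborel. norm ((cmod (F x))\<^sup>2 * exp (- (norm x / n)\<^sup>2 / 2)) \<le> norm (B\<^sup>2 * exp (- (norm x / n)\<^sup>2 / 2))"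
        using F_le by (intro AE_I2) (auto simp: abs_mult intro!: power_mono)
    qed simp
    let ?I = "\<integral>x. (cmod (F x))\<^sup>2 * exp (- (norm x / n)\<^sup>2 / 2) \<partial>lborel"
    have "?I \<ge> 0" by (intro integral_nonneg_AE) auto
    have "complex_of_real ?I = (1 / (2 * pi)\<^sup>2) *\<^sub>R (\<integral>\<xi>. (\<integral>\<eta>. \<Phi> \<xi> * cnj (\<Phi> \<eta>) * complex_of_real (k (\<xi> - \<eta>)) \<partial>lborel) \<partial>lborel)"
      using gaussian_weighted_energy[OF i1 n] unfolding F_def k_def
      by (simp only: integral_complex_of_real)
    then have "cmod (complex_of_real ?I) = (1 / (2 * pi)\<^sup>2) * cmod (\<integral>\<xi>. (\<integral>\<eta>. \<Phi> \<xi> * cnj (\<Phi> \<eta>) * complex_of_real (k (\<xi> - \<eta>)) \<partial>lborel) \<partial>lborel)"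
      by simp
    then have I_eq: "ennreal ?I = ennreal (1 / (2 * pi)\<^sup>2) * ennreal (cmod (\<integral>\<xi>. (\<integral>\<eta>. \<Phi> \<xi> * cnj (\<Phi> \<eta>) * complex_of_real (k (\<xi> - \<eta>)) \<partial>lborel) \<partial>lborel))"
      using \<open>?I \<ge> 0\<close> by (simp only: norm_of_real abs_of_nonneg) (rule ennreal_mult', simp)
    have "ennreal (cmod (\<integral>\<xi>. (\<integral>\<eta>. \<Phi> \<xi> * cnj (\<Phi> \<eta>) * complex_of_real (k (\<xi> - \<eta>)) \<partial>lborel) \<partial>lborel))
        \<le> (\<integral>\<^sup>+\<xi>. ennreal (cmod (\<integral>\<eta>. \<Phi> \<xi> * cnj (\<Phi> \<eta>) * complex_of_real (k (\<xi> - \<eta>)) \<partial>lborel)) \<partial>lborel)"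
      by (rule ennreal_norm_integral_le)
    also have "\<dots> \<le> (\<integral>\<^sup>+\<xi>. (\<integral>\<^sup>+\<eta>. ennreal (cmod (\<Phi> \<xi> * cnj (\<Phi> \<eta>) * complex_of_real (k (\<xi> - \<eta>)))) \<partial>lborel) \<partial>lborel)"
      by (intro nn_integral_mono ennreal_norm_integral_le)
    also have "\<dots> \<le> (\<integral>\<^sup>+\<xi>. (\<integral>\<^sup>+\<eta>. ennreal ((cmod (\<Phi> \<xi>))\<^sup>2 / 2) * ennreal (k (\<xi> - \<eta>))
            + ennreal ((cmod (\<Phi> \<eta>))\<^sup>2 / 2) * ennreal (k (\<xi> - \<eta>)) \<partial>lborel) \<partial>lborel)"
    proof (intro nn_integral_mono)
      fix \<xi> \<eta>
      have "cmod (\<Phi> \<xi>) * cmod (\<Phi> \<eta>) \<le> (cmod (\<Phi> \<xi>))\<^sup>2 / 2 + (cmod (\<Phi> \<eta>))\<^sup>2 / 2"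
        using sum_squares_bound[of "cmod (\<Phi> \<xi>)" "cmod (\<Phi> \<eta>)"] by simp
      then have "cmod (\<Phi> \<xi>) * cmod (\<Phi> \<eta>) * k (\<xi> - \<eta>) \<le> ((cmod (\<Phi> \<xi>))\<^sup>2 / 2 + (cmod (\<Phi> \<eta>))\<^sup>2 / 2) * k (\<xi> - \<eta>)"
        by (intro mult_right_mono k0)
      then show "ennreal (cmod (\<Phi> \<xi> * cnj (\<Phi> \<eta>) * complex_of_real (k (\<xi> - \<eta>))))
          \<le> ennreal ((cmod (\<Phi> \<xi>))\<^sup>2 / 2) * ennreal (k (\<xi> - \<eta>)) + ennreal ((cmod (\<Phi> \<eta>))\<^sup>2 / 2) * ennreal (k (\<xi> - \<eta>))"
        using k0 by (simp add: norm_mult distrib_right ennreal_leI flip: ennreal_mult' ennreal_plus)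
    qed
    also have "\<dots> = (\<integral>\<^sup>+\<xi>. (\<integral>\<^sup>+\<eta>. ennreal ((cmod (\<Phi> \<xi>))\<^sup>2 / 2) * ennreal (k (\<xi> - \<eta>)) \<partial>lborel) \<partial>lborel)
        + (\<integral>\<^sup>+\<xi>. (\<integral>\<^sup>+\<eta>. ennreal ((cmod (\<Phi> \<eta>))\<^sup>2 / 2) * ennreal (k (\<xi> - \<eta>)) \<partial>lborel) \<partial>lborel)"
      by (subst nn_integral_add[symmetric], measurable)
        (intro nn_integral_cong nn_integral_add; measurable)
    also have "(\<integral>\<^sup>+\<xi>. (\<integral>\<^sup>+\<eta>. ennreal ((cmod (\<Phi> \<eta>))\<^sup>2 / 2) * ennreal (k (\<xi> - \<eta>)) \<partial>lborel) \<partial>lborel)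
        = (\<integral>\<^sup>+\<eta>. (\<integral>\<^sup>+\<xi>. ennreal ((cmod (\<Phi> \<eta>))\<^sup>2 / 2) * ennreal (k (\<xi> - \<eta>)) \<partial>lborel) \<partial>lborel)"
      by (rule lborel_pair.Fubini') measurable
    also have "(\<integral>\<^sup>+\<eta>. (\<integral>\<^sup>+\<xi>. ennreal ((cmod (\<Phi> \<eta>))\<^sup>2 / 2) * ennreal (k (\<xi> - \<eta>)) \<partial>lborel) \<partial>lborel)
        = (\<integral>\<^sup>+\<eta>. ennreal ((cmod (\<Phi> \<eta>))\<^sup>2 / 2) * ennreal ((2*pi)\<^sup>2) \<partial>lborel)"
      by (simp only: ksym[of _ "_ :: real^2"]) (subst nn_integral_cmult, measurable, simp only: ksym kint)
    also have "(\<integral>\<^sup>+\<xi>. (\<integral>\<^sup>+\<eta>. ennreal ((cmod (\<Phi> \<xi>))\<^sup>2 / 2) * ennreal (k (\<xi> - \<eta>)) \<partial>lborel) \<partial>lborel)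
        = (\<integral>\<^sup>+\<eta>. ennreal ((cmod (\<Phi> \<eta>))\<^sup>2 / 2) * ennreal ((2*pi)\<^sup>2) \<partial>lborel)"
      by (subst nn_integral_cmult, measurable, simp only: kint)
    also have "(\<integral>\<^sup>+\<eta>. ennreal ((cmod (\<Phi> \<eta>))\<^sup>2 / 2) * ennreal ((2*pi)\<^sup>2) \<partial>lborel)
          + (\<integral>\<^sup>+\<eta>. ennreal ((cmod (\<Phi> \<eta>))\<^sup>2 / 2) * ennreal ((2*pi)\<^sup>2) \<partial>lborel)
        = (\<integral>\<^sup>+\<eta>. ennreal ((2*pi)\<^sup>2) * ennreal ((cmod (\<Phi> \<eta>))\<^sup>2) \<partial>lborel)"
      by (subst nn_integral_add[symmetric], measurable, intro nn_integral_cong)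
        (simp flip: ennreal_mult' ennreal_plus)
    also have "\<dots> = ennreal ((2*pi)\<^sup>2) * ennreal E"
      by (subst nn_integral_cmult) (auto simp: E)
    finally have "ennreal ?I \<le> ennreal (1 / (2 * pi)\<^sup>2) * (ennreal ((2*pi)\<^sup>2) * ennreal E)"
      unfolding I_eq by (intro mult_left_mono) auto
    also have "\<dots> = ennreal E"
      by (simp add: ennreal_mult'[symmetric] flip: mult.assoc)
    finally show ?thesis
      using int by (subst nn_integral_eq_integral) auto
  qed
  have "(\<integral>\<^sup>+x. ennreal ((cmod (F x))\<^sup>2) \<partial>lborel)
      \<le> (\<integral>\<^sup>+x. liminf (\<lambda>n. ennreal ((cmod (F x))\<^sup>2 * exp (- (norm x / real (Suc n))\<^sup>2 / 2))) \<partial>lborel)"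
  proof (intro nn_integral_mono)
    fix x :: "real^2"
    have "(\<lambda>n. norm x / real (Suc n)) \<longlonglongrightarrow> 0"
      by (rule LIMSEQ_Suc[OF lim_const_over_n])
    then have "(\<lambda>n. (cmod (F x))\<^sup>2 * exp (- (norm x / real (Suc n))\<^sup>2 / 2)) \<longlonglongrightarrow> (cmod (F x))\<^sup>2 * exp (- 0\<^sup>2 / 2)"
      by (intro tendsto_intros) auto
    then have "(\<lambda>n. ennreal ((cmod (F x))\<^sup>2 * exp (- (norm x / real (Suc n))\<^sup>2 / 2))) \<longlonglongrightarrow> ennreal ((cmod (F x))\<^sup>2)"
      by (intro tendsto_ennrealI) simp
    then show "ennreal ((cmod (F x))\<^sup>2) \<le> liminf (\<lambda>n. ennreal ((cmod (F x))\<^sup>2 * exp (- (norm x / real (Suc n))\<^sup>2 / 2)))"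
      by (subst lim_imp_Liminf) auto
  qed
  also have "\<dots> \<le> liminf (\<lambda>n. \<integral>\<^sup>+x. ennreal ((cmod (F x))\<^sup>2 * exp (- (norm x / real (Suc n))\<^sup>2 / 2)) \<partial>lborel)"
    by (rule nn_integral_liminf) measurable
  also have "\<dots> \<le> liminf (\<lambda>n::nat. ennreal E)"
    by (intro Liminf_mono always_eventually allI weighted) simp
  also have "\<dots> = ennreal E" by (simp add: Liminf_const)
  finally have le: "(\<integral>\<^sup>+x. ennreal ((cmod (F x))\<^sup>2) \<partial>lborel) \<le> ennreal E" .
  then have int: "integrable lborel (\<lambda>x. (cmod (F x))\<^sup>2)"
    by (intro integrableI_bounded) (auto intro: le_less_trans)
  then show "inverse_fourier \<Phi> \<in> L2"
    using Fm unfolding F_def by (intro L2_borelI)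
  have "ennreal (\<integral>x. (cmod (F x))\<^sup>2 \<partial>lborel) \<le> ennreal E"
    using le int by (subst (asm) nn_integral_eq_integral) auto
  then show "norm_sq (inverse_fourier \<Phi>) \<le> (\<integral>\<xi>. (cmod (\<Phi> \<xi>))\<^sup>2 \<partial>lborel)"
    using E(1) Fm by (simp add: norm_sq_borel F_def[symmetric] E_def[symmetric])
qed

section \<open>Parseval's identity on a rectangle\<close>

lemma integral_exp_symmetric_interval:
  fixes c :: complex and L :: real
  assumes "L > 0" "c \<noteq> 0"
  shows "(\<integral>x. indicator {-L..L} x *\<^sub>R exp (c * complex_of_real x) \<partial>lborel)
    = exp (c * complex_of_real L) / c - exp (c * complex_of_real (-L)) / c"
proof (rule integral_FTC_Icc)
  show "-L \<le> L" using assms by simp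
  fix x
  have "((\<lambda>z. exp (c * z) / c) has_field_derivative exp (c * complex_of_real x)) (at (complex_of_real x))"
    using assms(2) by (auto intro!: derivative_eq_intros)
  then show "((\<lambda>x. exp (c * complex_of_real x) / c) has_vector_derivative exp (c * complex_of_real x)) (at x within {-L..L})"
    by (rule has_vector_derivative_real_field)
qed (intro continuous_intros)

lemma lattice_exponential_mean_zero:
  fixes n :: int and L :: real
  assumes "L > 0" "n \<noteq> 0"
  shows "(\<integral>x. indicator {-L..L} x *\<^sub>R exp (\<i> * complex_of_real (2 * pi * of_int n / L * x)) \<partial>lborel) = 0"
proof -
  define c where "c = \<i> * complex_of_real (2 * pi * of_int n / L)"
  have c: "c \<noteq> 0" using assms by (simp add: c_def)
  have r: "\<i> * complex_of_real (2 * pi * of_int n / L * x) = c * complex_of_real x" for x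
    by (simp only: c_def of_real_mult mult.assoc)
  have "c * complex_of_real L = \<i> * complex_of_real (2 * pi * of_int n / L * L)"
    by (rule r[symmetric])
  also have "2 * pi * of_int n / L * L = 2 * pi * of_int n" using assms by simp
  finally have e: "exp (c * complex_of_real L) = 1"
    by (simp only:) (simp add: exp_eq_1)
  have "c * complex_of_real (-L) = - (c * complex_of_real L)" by simp
  then have "exp (c * complex_of_real (-L)) = 1"
    by (simp only: exp_minus e inverse_1)
  with e show ?thesis
    unfolding r integral_exp_symmetric_interval[OF assms(1) c] by (simp only: diff_self)
qed

text \<open>The frequencies are spaced for the period \<open>L\<close>, while the interval has length \<open>2 * L\<close>: two full
periods. The rectangle thus covers the frequency support of a curvelet, at the price of a factor
in the Bessel constant.\<close>

lemma lattice_exponential_orthogonality: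
  fixes n :: int and L :: real
  assumes "L > 0"
  shows "integrable lborel (\<lambda>x. indicator {-L..L} x *\<^sub>R exp (\<i> * complex_of_real (2 * pi * of_int n / L * x)))"
    and "(\<integral>x. indicator {-L..L} x *\<^sub>R exp (\<i> * complex_of_real (2 * pi * of_int n / L * x)) \<partial>lborel)
      = (if n = 0 then complex_of_real (2 * L) else 0)"
proof -
  have "integrable lborel (indicat_real {-L..L})"
    by (rule integrable_real_indicator) (auto simp: emeasure_lborel_Icc_eq)
  then show "integrable lborel (\<lambda>x. indicator {-L..L} x *\<^sub>R exp (\<i> * complex_of_real (2 * pi * of_int n / L * x)))"
    by (rule Bochner_Integration.integrable_bound) (auto simp: indicator_def)
  show "(\<integral>x. indicator {-L..L} x *\<^sub>R exp (\<i> * complex_of_real (2 * pi * of_int n / L * x)) \<partial>lborel)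
      = (if n = 0 then complex_of_real (2 * L) else 0)"
  proof (cases "n = 0")
    case True
    have "(\<integral>x. indicator {-L..L} x *\<^sub>R (1::complex) \<partial>lborel) = complex_of_real (2 * L)"
      using assms by (simp add: scaleR_conv_of_real)
    with True show ?thesis by simp
  next
    case False
    then show ?thesis using lattice_exponential_mean_zero[OF assms] by simp
  qed
qed

definition box2 :: "real \<Rightarrow> real \<Rightarrow> (real^2) set" where
  "box2 a b = {\<xi>. \<bar>\<xi> $ 1\<bar> \<le> a \<and> \<bar>\<xi> $ 2\<bar> \<le> b}"

text \<open>The modulation by which a translation along the grid of a scale appears on the Fourier side.\<close>

definition lattice_exp :: "real \<Rightarrow> real \<Rightarrow> int \<times> int \<Rightarrow> real^2 \<Rightarrow> complex" where
  "lattice_exp a b m \<xi> = exp (- (\<i> * complex_of_real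
     (vector [2 * pi * of_int (fst m) / a, 2 * pi * of_int (snd m) / b] \<bullet> \<xi>)))"

lemma cmod_lattice_exp [simp]: "cmod (lattice_exp a b m \<xi>) = 1"
  by (simp add: lattice_exp_def)

lemma lattice_exp_borel [measurable]: "lattice_exp a b m \<in> borel_measurable borel"
  unfolding lattice_exp_def[abs_def] by (intro borel_measurable_continuous_onI continuous_intros)

lemma
  assumes a: "a > 0" and b: "b > 0"
  shows integrable_lattice_exp: "integrable lborel (\<lambda>\<xi>. indicator (box2 a b) \<xi> *\<^sub>R (lattice_exp a b m \<xi> * cnj (lattice_exp a b m' \<xi>)))"
    and integral_lattice_exp: "(\<integral>\<xi>. indicator (box2 a b) \<xi> *\<^sub>R (lattice_exp a b m \<xi> * cnj (lattice_exp a b m' \<xi>)) \<partial>lborel)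
      = (if m = m' then complex_of_real (4 * a * b) else 0)"
proof -
  let ?f = "\<lambda>L n x. indicator {-L..L} x *\<^sub>R exp (\<i> * complex_of_real (2 * pi * of_int n / L * x))"
  let ?n1 = "fst m' - fst m" and ?n2 = "snd m' - snd m"
  have eq: "indicator (box2 a b) \<xi> *\<^sub>R (lattice_exp a b m \<xi> * cnj (lattice_exp a b m' \<xi>))
      = ?f a ?n1 (\<xi> $ 1) * ?f b ?n2 (\<xi> $ 2)" for \<xi> :: "real^2"
  proof -
    have "lattice_exp a b m \<xi> * cnj (lattice_exp a b m' \<xi>)
        = exp (\<i> * complex_of_real (2 * pi * of_int ?n1 / a * \<xi> $ 1)) * exp (\<i> * complex_of_real (2 * pi * of_int ?n2 / b * \<xi> $ 2))"
    proof -
      have "(- (\<i> * complex_of_real (vector [2 * pi * of_int (fst m) / a, 2 * pi * of_int (snd m) / b] \<bullet> \<xi>)))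
          + cnj (- (\<i> * complex_of_real (vector [2 * pi * of_int (fst m') / a, 2 * pi * of_int (snd m') / b] \<bullet> \<xi>)))
          = \<i> * complex_of_real (2 * pi * of_int ?n1 / a * \<xi> $ 1) + \<i> * complex_of_real (2 * pi * of_int ?n2 / b * \<xi> $ 2)"
        by (simp add: inner_real2 complex_eq_iff diff_divide_distrib algebra_simps)
      then show ?thesis
        unfolding lattice_exp_def exp_cnj mult_exp_exp by (simp only: exp_add)
    qed
    moreover have "indicator (box2 a b) \<xi> = (indicator {-a..a} (\<xi> $ 1) * indicator {-b..b} (\<xi> $ 2) :: real)"
      by (auto simp: indicator_def box2_def abs_le_iff)
    ultimately show ?thesis by simp
  qed
  show "integrable lborel (\<lambda>\<xi>. indicator (box2 a b) \<xi> *\<^sub>R (lattice_exp a b m \<xi> * cnj (lattice_exp a b m' \<xi>)))"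
    unfolding eq by (intro integrable_real2_product lattice_exponential_orthogonality a b)
  have "(\<integral>\<xi>. indicator (box2 a b) \<xi> *\<^sub>R (lattice_exp a b m \<xi> * cnj (lattice_exp a b m' \<xi>)) \<partial>lborel)
      = (if ?n1 = 0 then complex_of_real (2 * a) else 0) * (if ?n2 = 0 then complex_of_real (2 * b) else 0)"
    unfolding eq
    by (subst integral_real2_product) (simp_all only: lattice_exponential_orthogonality a b)
  then show "(\<integral>\<xi>. indicator (box2 a b) \<xi> *\<^sub>R (lattice_exp a b m \<xi> * cnj (lattice_exp a b m' \<xi>)) \<partial>lborel)
      = (if m = m' then complex_of_real (4 * a * b) else 0)"
    by (auto simp: prod_eq_iff)
qed

lemma
  fixes c :: "int \<times> int \<Rightarrow> complex"
  assumes a: "a > 0" and b: "b > 0" and "finite M"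
  shows integrable_trig_sum_sq: "integrable lborel (\<lambda>\<xi>. indicator (box2 a b) \<xi> * (cmod (\<Sum>m\<in>M. c m * lattice_exp a b m \<xi>))\<^sup>2)"
    and parseval_trig_sum: "(\<integral>\<xi>. indicator (box2 a b) \<xi> * (cmod (\<Sum>m\<in>M. c m * lattice_exp a b m \<xi>))\<^sup>2 \<partial>lborel)
      = 4 * a * b * (\<Sum>m\<in>M. (cmod (c m))\<^sup>2)"
proof -
  let ?g = "\<lambda>m m' \<xi>. (c m * cnj (c m')) * (indicator (box2 a b) \<xi> *\<^sub>R (lattice_exp a b m \<xi> * cnj (lattice_exp a b m' \<xi>)))"
  have eq: "complex_of_real (indicator (box2 a b) \<xi> * (cmod (\<Sum>m\<in>M. c m * lattice_exp a b m \<xi>))\<^sup>2)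
      = (\<Sum>m\<in>M. \<Sum>m'\<in>M. ?g m m' \<xi>)" for \<xi>
  proof -
    have "complex_of_real ((cmod (\<Sum>m\<in>M. c m * lattice_exp a b m \<xi>))\<^sup>2)
        = (\<Sum>m\<in>M. \<Sum>m'\<in>M. (c m * lattice_exp a b m \<xi>) * cnj (c m' * lattice_exp a b m' \<xi>))"
      by (simp only: complex_norm_square cnj_sum sum_product)
    then have "complex_of_real (indicator (box2 a b) \<xi> * (cmod (\<Sum>m\<in>M. c m * lattice_exp a b m \<xi>))\<^sup>2)
        = (\<Sum>m\<in>M. \<Sum>m'\<in>M. complex_of_real (indicator (box2 a b) \<xi>)
            * ((c m * lattice_exp a b m \<xi>) * cnj (c m' * lattice_exp a b m' \<xi>)))"
      by (simp only: of_real_mult sum_distrib_left)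
    also have "\<dots> = (\<Sum>m\<in>M. \<Sum>m'\<in>M. ?g m m' \<xi>)"
      by (intro sum.cong refl) (simp add: scaleR_conv_of_real)
    finally show ?thesis .
  qed
  have int: "integrable lborel (\<lambda>\<xi>. ?g m m' \<xi>)" for m m'
    by (intro integrable_mult_right integrable_lattice_exp a b)
  have i: "integrable lborel (\<lambda>\<xi>. \<Sum>m\<in>M. \<Sum>m'\<in>M. ?g m m' \<xi>)"
    by (intro Bochner_Integration.integrable_sum int)
  then show "integrable lborel (\<lambda>\<xi>. indicator (box2 a b) \<xi> * (cmod (\<Sum>m\<in>M. c m * lattice_exp a b m \<xi>))\<^sup>2)"
    unfolding eq[symmetric] by (simp only: complex_of_real_integrable_eq)
  have "complex_of_real (\<integral>\<xi>. indicator (box2 a b) \<xi> * (cmod (\<Sum>m\<in>M. c m * lattice_exp a b m \<xi>))\<^sup>2 \<partial>lborel)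
      = (\<integral>\<xi>. (\<Sum>m\<in>M. \<Sum>m'\<in>M. ?g m m' \<xi>) \<partial>lborel)"
    unfolding eq[symmetric] by (rule integral_complex_of_real[symmetric])
  also have "\<dots> = (\<Sum>m\<in>M. \<Sum>m'\<in>M. (\<integral>\<xi>. ?g m m' \<xi> \<partial>lborel))"
    by (subst Bochner_Integration.integral_sum, intro Bochner_Integration.integrable_sum int)
      (intro sum.cong refl Bochner_Integration.integral_sum int)
  also have "\<dots> = (\<Sum>m\<in>M. \<Sum>m'\<in>M. (c m * cnj (c m')) * (if m = m' then complex_of_real (4 * a * b) else 0))"
    by (simp only: Bochner_Integration.integral_mult_right_zero integral_lattice_exp[OF a b])
  also have "\<dots> = (\<Sum>m\<in>M. (c m * cnj (c m)) * complex_of_real (4 * a * b))"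
  proof (intro sum.cong refl)
    fix m assume "m \<in> M"
    then show "(\<Sum>m'\<in>M. (c m * cnj (c m')) * (if m = m' then complex_of_real (4 * a * b) else 0))
        = (c m * cnj (c m)) * complex_of_real (4 * a * b)"
      using assms(3) by (simp add: mult_delta_right)
  qed
  also have "\<dots> = complex_of_real (4 * a * b * (\<Sum>m\<in>M. (cmod (c m))\<^sup>2))"
    unfolding of_real_mult[of "4 * a * b"] of_real_sum sum_distrib_left
    by (intro sum.cong refl) (simp only: complex_norm_square mult.commute)
  finally show "(\<integral>\<xi>. indicator (box2 a b) \<xi> * (cmod (\<Sum>m\<in>M. c m * lattice_exp a b m \<xi>))\<^sup>2 \<partial>lborel)
      = 4 * a * b * (\<Sum>m\<in>M. (cmod (c m))\<^sup>2)"
    by (simp only: of_real_eq_iff)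
qed

section \<open>Polar angles, dyadic scales and rotations\<close>

lemma
  shows polar_1: "\<xi> $ 1 = norm \<xi> * cos (polar_angle \<xi>)"
    and polar_2: "\<xi> $ 2 = norm \<xi> * sin (polar_angle \<xi>)"
proof -
  let ?z = "Complex (\<xi> $ 1) (\<xi> $ 2)"
  have n: "cmod ?z = norm \<xi>"
    by (simp add: cmod_def norm_eq_sqrt_inner inner_real2 power2_eq_square)
  have "rcis (norm \<xi>) (polar_angle \<xi>) = ?z"
    using rcis_cmod_Arg[of ?z] by (simp add: n polar_angle_def)
  then show "\<xi> $ 1 = norm \<xi> * cos (polar_angle \<xi>)" "\<xi> $ 2 = norm \<xi> * sin (polar_angle \<xi>)"
    by (metis Re_rcis complex.sel(1), metis Im_rcis complex.sel(2))
qed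

lemma polar_angle_bounds: "- pi < polar_angle \<xi>" "polar_angle \<xi> \<le> pi"
  using Arg_bounded[of "Complex (\<xi> $ 1) (\<xi> $ 2)"] by (auto simp: polar_angle_def)

lemma wrap_angle_conv: "\<exists>n::int. wrap_angle \<theta> = \<theta> + 2 * pi * of_int n"
proof -
  have "wrap_angle \<theta> = frac ((\<theta> + pi) / (2 * pi)) * (2 * pi) - pi"
    by (simp add: wrap_angle_def rmod_conv_frac)
  also have "\<dots> = \<theta> + 2 * pi * of_int (- \<lfloor>(\<theta> + pi) / (2 * pi)\<rfloor>)"
    by (simp add: frac_def field_simps)
  finally show ?thesis by blast
qed

lemma sin_wrap_angle: "sin (wrap_angle \<theta>) = sin \<theta>"
proof -
  obtain n :: int where "wrap_angle \<theta> = \<theta> + 2 * pi * of_int n" using wrap_angle_conv by blast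
  then show ?thesis by (simp add: sin_add sin_int_2pin cos_int_2pin)
qed

lemma abs_sin_le_sin:
  assumes "\<bar>a\<bar> \<le> d" "d \<le> pi / 2"
  shows "\<bar>sin a\<bar> \<le> sin d"
proof -
  have "- d \<le> a" "a \<le> d" "- (pi/2) \<le> - d" using assms by auto
  then have "sin a \<le> sin d" "sin (- d) \<le> sin a"
    using assms by (intro sin_monotone_2pi_le; simp)+
  then show ?thesis by (simp add: abs_le_iff)
qed

text \<open>A wedge and its reflection in the origin are described together by a bound on \<open>\<bar>sin\<bar>\<close> of the angle.\<close>

lemma near_multiple_of_pi:
  assumes "\<bar>sin x\<bar> \<le> sin d" "0 \<le> d" "d \<le> pi / 2"
  shows "\<exists>z::int. \<bar>x - pi * of_int z\<bar> \<le> d"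
proof -
  define z where "z = \<lfloor>x / pi + 1/2\<rfloor>"
  define y where "y = x - pi * of_int z"
  have "of_int z \<le> x / pi + 1/2" "x / pi + 1/2 < of_int z + 1" unfolding z_def by linarith+
  then have "pi * of_int z \<le> x + pi/2" "x + pi/2 < pi * of_int z + pi"
    by (simp_all add: field_simps)
  then have y: "\<bar>y\<bar> \<le> pi/2" unfolding y_def abs_le_iff by (intro conjI; linarith)
  have "\<bar>sin y\<bar> = \<bar>sin x\<bar>"
  proof -
    have "sin y = sin x * cos (pi * of_int z)"
      unfolding y_def by (simp add: sin_diff sin_npi_int)
    moreover have "\<bar>cos (pi * of_int z)\<bar> = 1"
      by (simp add: cos_npi_int)
    ultimately show ?thesis by (simp add: abs_mult)
  qed
  have "\<bar>y\<bar> \<le> d"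
  proof (rule ccontr)
    assume "\<not> \<bar>y\<bar> \<le> d"
    then have "sin d < sin \<bar>y\<bar>"
      using y assms by (intro sin_monotone_2pi) auto
    also have "\<dots> = \<bar>sin y\<bar>"
      using sin_ge_zero[of "\<bar>y\<bar>"] y by (cases "y \<ge> 0") (auto simp: abs_if)
    finally show False using assms \<open>\<bar>sin y\<bar> = \<bar>sin x\<bar>\<close> by simp
  qed
  then show ?thesis unfolding y_def by blast
qed

text \<open>\<open>Arg\<close> is continuous off the non-positive real axis, and on it equals \<open>pi\<close> except at the origin.\<close>

lemma polar_angle_borel [measurable]: "polar_angle \<in> borel_measurable borel"
proof -
  define f where "f z = indicator (- \<real>\<^sub>\<le>\<^sub>0) z *\<^sub>R Arg z + indicator (\<real>\<^sub>\<le>\<^sub>0 - {0}) z *\<^sub>R pi" for z :: complex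
  have "Arg z = f z" for z
  proof (cases "z \<in> \<real>\<^sub>\<le>\<^sub>0")
    case True
    then have z: "Re z \<le> 0" "Im z = 0" by (auto simp: complex_nonpos_Reals_iff)
    show ?thesis
    proof (cases "z = 0")
      case False
      with z have "Re z < 0" by (auto simp: complex_eq_iff)
      with z have "Arg z = pi" by (simp add: Arg_eq_pi)
      with True False show ?thesis by (simp add: f_def)
    qed (simp add: f_def Arg_zero)
  qed (simp add: f_def)
  then have "Arg = f" by blast
  have cl: "closed (\<real>\<^sub>\<le>\<^sub>0 :: complex set)" by (rule closed_nonpos_Reals_complex)
  have "(\<lambda>z. indicator (- \<real>\<^sub>\<le>\<^sub>0) z *\<^sub>R Arg z) \<in> borel_measurable borel"
    using cl by (intro borel_measurable_continuous_on_indicator continuous_on_Arg) auto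
  moreover have "(\<lambda>z. indicator (\<real>\<^sub>\<le>\<^sub>0 - {0}) z *\<^sub>R pi) \<in> borel_measurable (borel :: complex measure)"
    using cl by (intro borel_measurable_scaleR borel_measurable_indicator borel_measurable_const) auto
  ultimately have "f \<in> borel_measurable borel"
    unfolding f_def[abs_def] by (rule borel_measurable_add)
  then have [measurable]: "Arg \<in> borel_measurable borel"
    by (simp only: \<open>Arg = f\<close>)
  have "(\<lambda>\<xi>::real^2. Complex (\<xi> $ 1) (\<xi> $ 2)) \<in> borel_measurable borel"
    unfolding complex_eq by (intro borel_measurable_continuous_onI continuous_intros)
  then show ?thesis
    unfolding polar_angle_def[abs_def] by measurable
qed

lemma wrap_angle_borel [measurable]: "wrap_angle \<in> borel_measurable borel"
proof -
  have eq: "wrap_angle = (\<lambda>\<theta>. ((\<theta> + pi) / (2 * pi) - of_int \<lfloor>(\<theta> + pi) / (2 * pi)\<rfloor>) * (2 * pi) - pi)"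
    by (simp add: fun_eq_iff wrap_angle_def rmod_conv_frac frac_def)
  show ?thesis unfolding eq by measurable
qed

lemma smooth_real_on_continuous: "smooth_real_on S f \<Longrightarrow> continuous_on S f"
proof -
  assume "smooth_real_on S f"
  then obtain D where D: "\<forall>x\<in>S. D 0 x = f x" "\<forall>n. \<forall>x\<in>S. (D n has_real_derivative D (Suc n) x) (at x within S)"
    unfolding smooth_real_on_def by blast
  then have "continuous_on S (D 0)"
    by (meson DERIV_continuous_on)
  then show ?thesis
    using D(1) by (simp cong: continuous_on_cong)
qed

text \<open>Up to \<open>pi / 3\<close> the derivative of \<open>sin x - x / 2\<close> is non-negative; from there on
\<open>sin x \<ge> sqrt 3 / 2 > pi / 4\<close>.\<close>

lemma half_le_sin:
  assumes "0 \<le> x" "x \<le> pi / 2"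
  shows "x / 2 \<le> sin x"
proof (cases "x \<le> pi / 3")
  case True
  have mono: "(\<lambda>y. sin y - y / 2) 0 \<le> (\<lambda>y. sin y - y / 2) x"
  proof (rule DERIV_nonneg_imp_nondecreasing[OF assms(1)])
    fix y assume y: "0 \<le> y" "y \<le> x"
    have "cos (pi/3) \<le> cos y" using y True by (intro cos_monotone_0_pi_le) auto
    then have "0 \<le> cos y - 1/2" by (simp add: cos_60)
    moreover have "((\<lambda>y. sin y - y / 2) has_real_derivative (cos y - 1/2)) (at y)"
      by (intro DERIV_diff DERIV_sin DERIV_cdivide DERIV_ident)
    ultimately show "\<exists>D. ((\<lambda>y. sin y - y / 2) has_real_derivative D) (at y) \<and> 0 \<le> D"
      by (intro exI[of _ "cos y - 1/2"] conjI)
  qed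
  then show ?thesis by simp
next
  case False
  have "x / 2 \<le> pi / 4" using assms by simp
  also have "\<dots> \<le> 33/40"
  proof -
    have "(31415926535899::real) / 10 ^ 13 \<le> 33 / 10" by simp
    with pi_approx(2) have "pi \<le> 33 / 10" by (rule order_trans)
    then show ?thesis by simp
  qed
  also have "\<dots> \<le> sqrt 3 / 2"
  proof -
    have "33/20 \<le> sqrt 3" by (rule real_le_rsqrt) (simp add: power2_eq_square)
    then show ?thesis by simp
  qed
  also have "\<dots> = sin (pi / 3)" by (simp add: sin_60)
  also have "\<dots> \<le> sin x" using False assms by (intro sin_monotone_2pi_le) auto
  finally show ?thesis .
qed

lemma card_nats_near: "card {l::nat. \<bar>y - real l\<bar> \<le> 1} \<le> 3" and finite_nats_near: "finite {l::nat. \<bar>y - real l\<bar> \<le> 1}"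
proof -
  have sub: "{l::nat. \<bar>y - real l\<bar> \<le> 1} \<subseteq> nat ` {\<lceil>y\<rceil> - 1..\<lceil>y\<rceil> + 1}"
  proof
    fix l :: nat assume "l \<in> {l. \<bar>y - real l\<bar> \<le> 1}"
    then have "y - 1 \<le> real l" "real l \<le> y + 1" by auto
    then have "\<lceil>y\<rceil> - 1 \<le> int l" "int l \<le> \<lceil>y\<rceil> + 1" by linarith+
    then show "l \<in> nat ` {\<lceil>y\<rceil> - 1..\<lceil>y\<rceil> + 1}"
      by (intro image_eqI[of _ _ "int l"]) auto
  qed
  then show "finite {l::nat. \<bar>y - real l\<bar> \<le> 1}" by (rule finite_subset) simp
  have "card {l::nat. \<bar>y - real l\<bar> \<le> 1} \<le> card (nat ` {\<lceil>y\<rceil> - 1..\<lceil>y\<rceil> + 1})"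
    using sub by (intro card_mono) auto
  also have "\<dots> \<le> card {\<lceil>y\<rceil> - 1..\<lceil>y\<rceil> + 1}" by (intro card_image_le) auto
  finally show "card {l::nat. \<bar>y - real l\<bar> \<le> 1} \<le> 3" by simp
qed

text \<open>A radial window of scale \<open>j\<close> lives on \<open>a * 2 ^ j \<le> r \<le> 4 * a * 2 ^ j\<close>.\<close>

lemma card_dyadic_scales:
  "card {j::nat. a * 2 ^ j \<le> r \<and> r \<le> 4 * a * 2 ^ j} \<le> 3"
  and finite_dyadic_scales: "finite {j::nat. a * 2 ^ j \<le> r \<and> r \<le> 4 * a * 2 ^ j}"
  if a: "a > 0" for a r :: real
proof -
  let ?J = "{j::nat. a * 2 ^ j \<le> r \<and> r \<le> 4 * a * 2 ^ j}"
  have "\<exists>j0. ?J \<subseteq> {j0..<j0 + 3}"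
  proof (cases "?J = {}")
    case False
    define j0 where "j0 = (LEAST j. j \<in> ?J)"
    have j0: "j0 \<in> ?J" 
    proof -
      obtain j1 where "j1 \<in> ?J" using False by blast
      then show ?thesis unfolding j0_def by (rule LeastI[of "\<lambda>j. j \<in> ?J"])
    qed
    have "j < j0 + 3" if "j \<in> ?J" for j
    proof (rule ccontr)
      assume "\<not> j < j0 + 3"
      then have "(2::real) ^ (j0 + 3) \<le> 2 ^ j" by (intro power_increasing) auto
      then have "a * 2 ^ (j0 + 3) \<le> a * 2 ^ j" using a by simp
      moreover have "4 * a * 2 ^ j0 < a * 2 ^ (j0 + 3)" using a by (simp add: power_add)
      moreover have "a * 2 ^ j \<le> r" "r \<le> 4 * a * 2 ^ j0" using that j0 by blast+
      ultimately show False by linarith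
    qed
    moreover have "j0 \<le> j" if "j \<in> ?J" for j unfolding j0_def using that by (rule Least_le[of "\<lambda>j. j \<in> ?J"])
    ultimately have "?J \<subseteq> {j0..<j0 + 3}" by (simp add: subset_eq)
    then show ?thesis by blast
  qed blast
  then obtain j0 where sub: "?J \<subseteq> {j0..<j0 + 3}" by blast
  then show "finite ?J" by (rule finite_subset) simp
  show "card ?J \<le> 3" using card_mono[OF _ sub] by simp
qed

lemma transpose_rotation_mult:
  "transpose (rotation2 a) *v x = vector [cos a * x $ 1 + sin a * x $ 2, - sin a * x $ 1 + cos a * x $ 2]"
  by (simp add: vector2_eq_iff rotation2_def transpose_def matrix_vector_mult_def sum_2)

lemma norm_transpose_rotation [simp]: "norm (transpose (rotation2 a) *v x) = norm x"
proof -
  have "(c * p + s * q)\<^sup>2 + (- s * p + c * q)\<^sup>2 = (s\<^sup>2 + c\<^sup>2) * (p\<^sup>2 + q\<^sup>2)" for c s p q :: real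
    by (simp add: power2_eq_square algebra_simps)
  from this[of "cos a" "x $ 1" "sin a" "x $ 2"]
  have "(norm (transpose (rotation2 a) *v x))\<^sup>2 = (norm x)\<^sup>2"
    unfolding norm_real2_sq transpose_rotation_mult by simp
  then show ?thesis by simp
qed

lemma det_transpose_rotation [simp]: "det (transpose (rotation2 a)) = 1"
  by (simp add: det_2 transpose_def rotation2_def flip: power2_eq_square)

lemma invertible_transpose_rotation: "invertible (transpose (rotation2 a))"
  unfolding invertible_det_nz det_transpose_rotation by simp

lemma transpose_rotation_inner: "(transpose (rotation2 a) *v x) \<bullet> (transpose (rotation2 a) *v y) = x \<bullet> y"
proof -
  have "(c * p + s * q) * (c * p' + s * q') + (- s * p + c * q) * (- s * p' + c * q')
      = (s\<^sup>2 + c\<^sup>2) * (p * p' + q * q')" for c s p q p' q' :: real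
    by (simp add: power2_eq_square algebra_simps)
  from this[of "cos a" "x $ 1" "sin a" "x $ 2" "y $ 1" "y $ 2"] show ?thesis
    unfolding inner_real2 transpose_rotation_mult by simp
qed

lemma transpose_rotation_polar_2:
  "(transpose (rotation2 a) *v x) $ 2 = norm x * sin (polar_angle x - a)"
  unfolding transpose_rotation_mult by (simp add: polar_1[of x] polar_2[of x] sin_diff algebra_simps)

section \<open>The Bessel bound for curvelets\<close>

text \<open>Up to constants the periods of the grid are \<open>2 ^ j\<close> in the radial and \<open>2 ^ j / 2 ^ (j div 2)\<close> in the
angular direction, the side lengths of a wedge of scale \<open>j\<close>.\<close>

lemma big_lambda_pos: "big_lambda j > 0" and small_lambda_pos: "small_lambda j > 0"
  and big_lambda_ge: "j \<ge> 2 \<Longrightarrow> 4 * pi * 2 ^ j \<le> big_lambda j"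
  and small_lambda_ge: "j \<ge> 2 \<Longrightarrow> 8 * pi / 3 * pi * (2 ^ j / 2 ^ (j div 2)) \<le> small_lambda j"
proof -
  show big: "4 * pi * 2 ^ j \<le> big_lambda j" if "j \<ge> 2" for j
  proof -
    have "curvelet_t j \<le> 2 ^ j * (2 * pi / 3) * 1"
      unfolding curvelet_t_def by (intro mult_left_mono) auto
    then have "curvelet_t j \<le> (2/3) * (pi * 2 ^ j)" by (simp add: mult_ac)
    moreover have "big_lambda j = (16/3) * (pi * 2 ^ j) - 2 * curvelet_t j"
      using that by (simp add: big_lambda_def)
    ultimately show ?thesis by linarith
  qed
  have small: "8 * pi / 3 * pi * (2 ^ j / 2 ^ (j div 2)) \<le> small_lambda j" if "j \<ge> 2" for j
  proof -
    define d where "d = pi / 2 ^ (j div 2)"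
    have "(2::real) ^ 1 \<le> 2 ^ (j div 2)" using that by (intro power_increasing) auto
    then have "d \<le> pi / 2" unfolding d_def by (intro divide_left_mono) auto
    moreover have "0 \<le> d" by (simp add: d_def)
    ultimately have "d / 2 \<le> sin d" by (intro half_le_sin)
    then have "2 ^ (j + 1) * (8 * pi / 3) * (d / 2) \<le> 2 ^ (j + 1) * (8 * pi / 3) * sin d"
      by (intro mult_left_mono) auto
    then show ?thesis using that by (simp add: small_lambda_def d_def)
  qed
  then show "8 * pi / 3 * pi * (2 ^ j / 2 ^ (j div 2)) \<le> small_lambda j" if "j \<ge> 2" for j
    using that by blast
  show "big_lambda j > 0"
  proof (cases "j \<ge> 2")
    case True
    have "0 < 4 * pi * 2 ^ j" by simp
    with big[OF True] show ?thesis by linarith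
  qed (auto simp: big_lambda_def)
  show "small_lambda j > 0"
  proof (cases "j \<ge> 2")
    case True
    have "0 < 8 * pi / 3 * pi * (2 ^ j / 2 ^ (j div 2))" by simp
    with small[OF True] show ?thesis by linarith
  qed (auto simp: small_lambda_def)
qed

locale curvelet_system =
  fixes w0 w \<nu> :: "real \<Rightarrow> real"
  assumes windows: "curvelet_windows w0 w \<nu>"
begin

abbreviation "chi \<equiv> curvelet_chi w0 w \<nu>"

lemma smooth_w0: "smooth_real_on {0..} w0"
  and smooth_w: "smooth_real_on UNIV w"
  and smooth_\<nu>: "smooth_real_on UNIV \<nu>"
  and w_nonneg: "0 \<le> w r"
  and \<nu>_nonneg: "0 \<le> \<nu> \<theta>"
  and w_support: "w r \<noteq> 0 \<Longrightarrow> 2 * pi / 3 \<le> r \<and> r \<le> 8 * pi / 3"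
  and w0_support: "w0 r \<noteq> 0 \<Longrightarrow> r \<le> 8 * pi / 3"
  and \<nu>_support: "\<nu> \<theta> \<noteq> 0 \<Longrightarrow> \<bar>\<theta>\<bar> \<le> pi"
  and w_sum: "0 \<le> r \<Longrightarrow> ((\<lambda>j::nat. (w (r / 2 ^ j))\<^sup>2) has_sum (1 - (w0 r)\<^sup>2)) {1..}"
  and \<nu>_sum: "((\<lambda>l::int. (\<nu> (\<theta> - pi * of_int l))\<^sup>2) has_sum 1) UNIV"
proof -
  note W = windows[unfolded curvelet_windows_def]
  show "smooth_real_on {0..} w0" "smooth_real_on UNIV w" "smooth_real_on UNIV \<nu>" "0 \<le> w r" "0 \<le> \<nu> \<theta>"
    using W by blast+
  show "w r \<noteq> 0 \<Longrightarrow> 2 * pi / 3 \<le> r \<and> r \<le> 8 * pi / 3" using W by (meson atLeastAtMost_iff)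
  show "w0 r \<noteq> 0 \<Longrightarrow> r \<le> 8 * pi / 3" using W by (meson not_less)
  show "\<nu> \<theta> \<noteq> 0 \<Longrightarrow> \<bar>\<theta>\<bar> \<le> pi" using W by (meson atLeastAtMost_iff abs_le_iff minus_le_iff)
  show "0 \<le> r \<Longrightarrow> ((\<lambda>j::nat. (w (r / 2 ^ j))\<^sup>2) has_sum (1 - (w0 r)\<^sup>2)) {1..}" using W by blast
  show "((\<lambda>l::int. (\<nu> (\<theta> - pi * of_int l))\<^sup>2) has_sum 1) UNIV" using W by blast
qed

lemma w_le_1: "w r \<le> 1"
proof (cases "r \<ge> 0")
  case True
  have s: "((\<lambda>j::nat. (w (2 * r / 2 ^ j))\<^sup>2) has_sum (1 - (w0 (2 * r))\<^sup>2)) {1..}"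
    using True by (intro w_sum) simp
  have "((\<lambda>j::nat. (w (2 * r / 2 ^ j))\<^sup>2) has_sum (w r)\<^sup>2) {1::nat}"
    using has_sum_finite[of "{1::nat}" "\<lambda>j. (w (2 * r / 2 ^ j))\<^sup>2"] by simp
  from has_sum_mono2[OF this s] have "(w r)\<^sup>2 \<le> 1 - (w0 (2 * r))\<^sup>2" by auto
  also have "\<dots> \<le> 1\<^sup>2" by simp
  finally show ?thesis by (rule power2_le_imp_le) simp
next
  case False
  then have "w r = 0" using w_support[of r] pi_gt_zero by fastforce
  then show ?thesis by simp
qed

lemma \<nu>_le_1: "\<nu> \<theta> \<le> 1"
proof -
  have "((\<lambda>l::int. (\<nu> (\<theta> - pi * of_int l))\<^sup>2) has_sum (\<nu> \<theta>)\<^sup>2) {0}"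
    using has_sum_finite[of "{0::int}" "\<lambda>l. (\<nu> (\<theta> - pi * of_int l))\<^sup>2"] by simp
  from has_sum_mono2[OF this \<nu>_sum] have "(\<nu> \<theta>)\<^sup>2 \<le> 1\<^sup>2" by simp
  then show ?thesis by (rule power2_le_imp_le) simp
qed

lemma abs_w0_le_1: "0 \<le> r \<Longrightarrow> \<bar>w0 r\<bar> \<le> 1"
proof -
  assume "0 \<le> r"
  then have "0 \<le> 1 - (w0 r)\<^sup>2"
    by (intro has_sum_nonneg[OF w_sum]) auto
  then show ?thesis by (simp add: abs_square_le_1)
qed

text \<open>On this disc all windows \<open>w (r / 2 ^ j)\<close> vanish, so the partition of unity leaves \<open>w0\<close> alone.
Smoothness of \<open>w0\<close> on a half line does not make \<open>w0 (norm \<xi>)\<close> smooth at the origin; being constant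
there does.\<close>

lemma w0_near_0: "0 \<le> r \<Longrightarrow> r < 4 * pi / 3 \<Longrightarrow> w0 r = 1"
proof -
  assume r: "0 \<le> r" "r < 4 * pi / 3"
  have "w (r / 2 ^ j) = 0" if "j \<in> {1..}" for j :: nat
  proof (rule ccontr)
    assume "w (r / 2 ^ j) \<noteq> 0"
    then have "2 * pi / 3 \<le> r / 2 ^ j" using w_support by blast
    also have "\<dots> \<le> r / 2 ^ 1"
      using that r(1) by (intro divide_left_mono power_increasing) auto
    finally show False using r(2) by simp
  qed
  then have "((\<lambda>j::nat. (w (r / 2 ^ j))\<^sup>2) has_sum 0) {1..}"
    by (intro has_sum_0) auto
  then have "1 - (w0 r)\<^sup>2 = 0"
    using w_sum[OF r(1)] has_sum_unique by blast
  then have "(w0 r)\<^sup>2 = 1" by simp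
  moreover have "0 \<le> w0 r" using windows r(1) by (simp add: curvelet_windows_def)
  ultimately show ?thesis by (metis abs_of_nonneg abs_square_eq_1)
qed

lemma abs_chi_le_2: "\<bar>chi j \<xi>\<bar> \<le> 2"
proof -
  have ws: "\<bar>w r\<bar> \<le> 1" for r using w_nonneg w_le_1 by (simp add: abs_le_iff order_trans[of _ 0])
  have ns: "\<bar>\<nu> a + \<nu> b\<bar> \<le> 2" for a b
    using \<nu>_nonneg[of a] \<nu>_nonneg[of b] \<nu>_le_1[of a] \<nu>_le_1[of b] by linarith
  have "\<bar>w0 (norm \<xi>)\<bar> \<le> 2" using abs_w0_le_1[of "norm \<xi>"] by simp
  moreover have "\<bar>w (norm \<xi> / 2)\<bar> \<le> 2" using ws[of "norm \<xi> / 2"] by simp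
  moreover have "\<bar>w r * (\<nu> a + \<nu> b)\<bar> \<le> 1 * 2" for r a b
    unfolding abs_mult by (intro mult_mono ws ns) auto
  ultimately show ?thesis by (simp add: curvelet_chi_def)
qed

lemma w_borel [measurable]: "w \<in> borel_measurable borel"
  and \<nu>_borel [measurable]: "\<nu> \<in> borel_measurable borel"
  by (intro borel_measurable_continuous_onI smooth_real_on_continuous smooth_w smooth_\<nu>)+

lemma w0_norm_borel [measurable]: "(\<lambda>\<xi>::real^2. w0 (norm \<xi>)) \<in> borel_measurable borel"
  by (intro borel_measurable_continuous_onI continuous_on_compose2[OF smooth_real_on_continuous[OF smooth_w0]] continuous_intros) auto

lemma chi_borel [measurable]: "chi j \<in> borel_measurable borel"
  unfolding curvelet_chi_def[abs_def] by measurable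

lemma wedge_sin_bound:
  assumes "\<nu> (2 ^ m * wrap_angle a) \<noteq> 0" "m \<ge> 1"
  shows "\<bar>sin a\<bar> \<le> sin (pi / 2 ^ m)"
proof -
  have "2 ^ m * \<bar>wrap_angle a\<bar> \<le> pi"
    using \<nu>_support[OF assms(1)] by (simp add: abs_mult)
  then have "\<bar>wrap_angle a\<bar> \<le> pi / 2 ^ m" by (simp add: field_simps)
  moreover have "pi / 2 ^ m \<le> pi / 2"
  proof -
    have "(2::real) ^ 1 \<le> 2 ^ m" using assms(2) by (intro power_increasing) auto
    then show ?thesis by (intro divide_left_mono) auto
  qed
  ultimately show ?thesis
    using abs_sin_le_sin[of "wrap_angle a"] by (simp add: sin_wrap_angle)
qed

lemma chi_support:
  assumes j: "j \<ge> 2" and nz: "chi j \<xi> \<noteq> 0"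
  shows "2 * pi / 3 * 2 ^ j \<le> norm \<xi>" "norm \<xi> \<le> 8 * pi / 3 * 2 ^ j"
    and "\<bar>sin (polar_angle \<xi>)\<bar> \<le> sin (pi / 2 ^ (j div 2))"
proof -
  have eq: "chi j \<xi> = w (norm \<xi> / 2 ^ j) *
           (\<nu> (2 ^ (j div 2) * wrap_angle (polar_angle \<xi>)) +
            \<nu> (2 ^ (j div 2) * wrap_angle (polar_angle \<xi> - pi)))"
    using j by (simp add: curvelet_chi_def)
  have "w (norm \<xi> / 2 ^ j) \<noteq> 0" using nz unfolding eq by auto
  from w_support[OF this] show "2 * pi / 3 * 2 ^ j \<le> norm \<xi>" "norm \<xi> \<le> 8 * pi / 3 * 2 ^ j"
    by (simp_all add: field_simps)
  have m: "j div 2 \<ge> 1" using j by simp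
  have "\<nu> (2 ^ (j div 2) * wrap_angle (polar_angle \<xi>)) \<noteq> 0 \<or> \<nu> (2 ^ (j div 2) * wrap_angle (polar_angle \<xi> - pi)) \<noteq> 0"
    using nz unfolding eq by auto
  then show "\<bar>sin (polar_angle \<xi>)\<bar> \<le> sin (pi / 2 ^ (j div 2))"
    using wedge_sin_bound[OF _ m, of "polar_angle \<xi>"] wedge_sin_bound[OF _ m, of "polar_angle \<xi> - pi"]
    by auto
qed

text \<open>The rectangle has twice the side lengths of the period, and contains the support.\<close>

lemma chi_support_box: "chi j \<xi> \<noteq> 0 \<Longrightarrow> \<xi> \<in> box2 (big_lambda j) (small_lambda j)"
proof -
  assume nz: "chi j \<xi> \<noteq> 0"
  have c: "\<bar>\<xi> $ i\<bar> \<le> norm \<xi>" for i by (rule component_le_norm_cart)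
  consider "j = 0" | "j = 1" | "j \<ge> 2" by linarith
  then show ?thesis
  proof cases
    case 1
    then have "norm \<xi> \<le> 8 * pi / 3" using nz w0_support by (simp add: curvelet_chi_def)
    then have "\<bar>\<xi> $ 1\<bar> \<le> 16 * pi / 3" "\<bar>\<xi> $ 2\<bar> \<le> 16 * pi / 3"
      using c[of 1] c[of 2] pi_gt_zero by linarith+
    then show ?thesis using 1 by (simp add: box2_def big_lambda_def small_lambda_def)
  next
    case 2
    then have "norm \<xi> / 2 \<le> 8 * pi / 3" using nz w_support[of "norm \<xi> / 2"] by (simp add: curvelet_chi_def)
    then have "\<bar>\<xi> $ 1\<bar> \<le> 32 * pi / 3" "\<bar>\<xi> $ 2\<bar> \<le> 32 * pi / 3"
      using c[of 1] c[of 2] pi_gt_zero by linarith+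
    then show ?thesis using 2 by (simp add: box2_def big_lambda_def small_lambda_def)
  next
    case 3
    note s = chi_support[OF 3 nz]
    have "8 * pi / 3 * 2 ^ j \<le> 4 * pi * 2 ^ j" by simp
    then have "\<bar>\<xi> $ 1\<bar> \<le> big_lambda j"
      using c[of 1] s(2) big_lambda_ge[OF 3] by linarith
    moreover have "\<bar>\<xi> $ 2\<bar> \<le> small_lambda j"
    proof -
      have "\<bar>\<xi> $ 2\<bar> = norm \<xi> * \<bar>sin (polar_angle \<xi>)\<bar>"
        by (subst polar_2) (simp add: abs_mult)
      also have "\<dots> \<le> (8 * pi / 3 * 2 ^ j) * sin (pi / 2 ^ (j div 2))"
        using s by (intro mult_mono) auto
      also have "\<dots> = small_lambda j / 2" using 3 by (simp add: small_lambda_def)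
      also have "\<dots> \<le> small_lambda j" using small_lambda_pos[of j] by simp
      finally show ?thesis .
    qed
    ultimately show ?thesis by (simp add: box2_def)
  qed
qed

text \<open>The rotation that turns the \<open>l\<close>-th wedge of scale \<open>j\<close> onto the axis.\<close>

definition rot :: "nat \<Rightarrow> nat \<Rightarrow> real^2 \<Rightarrow> real^2" where
  "rot j l \<eta> = transpose (rotation2 (pi * real l / 2 ^ (j div 2))) *v \<eta>"

lemma norm_rot: "norm (rot j l \<eta>) = norm \<eta>"
  by (simp only: rot_def norm_transpose_rotation)

lemma rot_borel [measurable]: "rot j l \<in> borel_measurable borel"
  unfolding rot_def[abs_def] by (intro borel_measurable_continuous_onI continuous_intros)

text \<open>The wedges that see the frequency \<open>\<eta>\<close>.\<close>

definition active :: "real^2 \<Rightarrow> (nat \<times> nat) set" where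
  "active \<eta> = {(j, l). l < 2 ^ (j div 2) \<and> chi j (rot j l \<eta>) \<noteq> 0}"

text \<open>A wedge of scale \<open>j\<close> is active only if the angle of \<open>\<eta>\<close>, in units of \<open>pi / 2 ^ (j div 2)\<close>, is within
\<open>1\<close> of \<open>l\<close> up to a half turn. At most six half turns \<open>z\<close> are possible, and each admits at most
three values of \<open>l\<close>.\<close>

lemma active_angles:
  assumes j: "j \<ge> 2"
  shows "finite {l. (j, l) \<in> active \<eta>}" "card {l. (j, l) \<in> active \<eta>} \<le> 18"
proof -
  define s where "s = (2::real) ^ (j div 2)"
  define \<theta> where "\<theta> = polar_angle \<eta>"
  define y where "y z = s * \<theta> / pi - s * of_int z" for z :: int
  have s2: "s \<ge> 2"
  proof -
    have "(2::real) ^ 1 \<le> 2 ^ (j div 2)" using j by (intro power_increasing) auto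
    then show ?thesis by (simp add: s_def)
  qed
  have sub: "{l. (j, l) \<in> active \<eta>} \<subseteq> (\<Union>z\<in>{-3..2}. {l. \<bar>y z - real l\<bar> \<le> 1})"
  proof
    fix l assume "l \<in> {l. (j, l) \<in> active \<eta>}"
    then have l: "l < 2 ^ (j div 2)" and nz: "chi j (rot j l \<eta>) \<noteq> 0" by (auto simp: active_def)
    have ls: "real l < s" using l unfolding s_def by (metis of_nat_less_iff of_nat_numeral of_nat_power)
    note norm_rot[of j l \<eta>]
    moreover have "0 < 2 * pi / 3 * 2 ^ j" by simp
    ultimately have pos: "norm \<eta> > 0" using chi_support(1)[OF j nz] by linarith
    have "norm \<eta> * \<bar>sin (polar_angle (rot j l \<eta>))\<bar> = \<bar>rot j l \<eta> $ 2\<bar>"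
      by (subst polar_2) (simp add: abs_mult norm_rot)
    also have "\<dots> = norm \<eta> * \<bar>sin (\<theta> - pi * real l / s)\<bar>"
      unfolding rot_def transpose_rotation_polar_2 by (simp add: abs_mult \<theta>_def s_def)
    finally have "\<bar>sin (\<theta> - pi * real l / s)\<bar> = \<bar>sin (polar_angle (rot j l \<eta>))\<bar>"
      using pos by simp
    then have "\<bar>sin (\<theta> - pi * real l / s)\<bar> \<le> sin (pi / s)"
      using chi_support(3)[OF j nz] by (simp add: s_def)
    moreover have "pi / s \<le> pi / 2" using s2 by (intro divide_left_mono) auto
    moreover have "0 \<le> pi / s" using s2 by simp
    ultimately obtain z :: int where z: "\<bar>\<theta> - pi * real l / s - pi * of_int z\<bar> \<le> pi / s"
      using near_multiple_of_pi by blast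
    have "\<bar>y z - real l\<bar> = (s / pi) * \<bar>\<theta> - pi * real l / s - pi * of_int z\<bar>"
    proof -
      have "y z - real l = (s / pi) * (\<theta> - pi * real l / s - pi * of_int z)"
        using s2 by (simp add: y_def field_simps)
      then show ?thesis using s2 by (simp add: abs_mult)
    qed
    also have "\<dots> \<le> (s / pi) * (pi / s)" using z s2 by (intro mult_left_mono) auto
    finally have yl: "\<bar>y z - real l\<bar> \<le> 1" using s2 by simp
    have t: "- s \<le> s * \<theta> / pi" "s * \<theta> / pi \<le> s"
    proof -
      have "s * (- pi) \<le> s * \<theta>" "s * \<theta> \<le> s * pi"
        using polar_angle_bounds[of \<eta>] s2 unfolding \<theta>_def by (intro mult_left_mono; simp)+
      then show "- s \<le> s * \<theta> / pi" "s * \<theta> / pi \<le> s" by (simp_all add: field_simps)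
    qed
    have "s * of_int z \<le> 2 * s" "- (3 * s) \<le> s * of_int z"
      using yl t ls s2 unfolding y_def by linarith+
    then have "s * of_int z \<le> s * 2" "s * (-3) \<le> s * of_int z" by (simp_all add: mult.commute)
    then have "of_int z \<le> (2::real)" "(-3::real) \<le> of_int z"
      using s2 by (simp_all only: mult_le_cancel_left_pos)
    then have "z \<in> {-3..2}" by simp
    then show "l \<in> (\<Union>z\<in>{-3..2}. {l. \<bar>y z - real l\<bar> \<le> 1})" using yl by blast
  qed
  have fin: "finite (\<Union>z\<in>{-3..2::int}. {l. \<bar>y z - real l\<bar> \<le> 1})"
    by (intro finite_UN_I finite_nats_near) auto
  show "finite {l. (j, l) \<in> active \<eta>}" using sub fin by (rule finite_subset)
  have "card {l. (j, l) \<in> active \<eta>} \<le> card (\<Union>z\<in>{-3..2::int}. {l. \<bar>y z - real l\<bar> \<le> 1})"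
    using sub fin by (intro card_mono)
  also have "\<dots> \<le> (\<Sum>z\<in>{-3..2::int}. card {l. \<bar>y z - real l\<bar> \<le> 1})"
    by (rule card_UN_le) simp
  also have "\<dots> \<le> (\<Sum>z\<in>{-3..2::int}. 3)" by (intro sum_mono card_nats_near)
  finally show "card {l. (j, l) \<in> active \<eta>} \<le> 18" by simp
qed

text \<open>Three scales \<open>j \<ge> 2\<close> with at most \<open>18\<close> wedges each, and the two isotropic scales.\<close>

lemma finite_active: "finite (active \<eta>)" and card_active: "card (active \<eta>) \<le> 56"
proof -
  define J where "J = {j::nat. (2 * pi / 3) * 2 ^ j \<le> norm \<eta> \<and> norm \<eta> \<le> 4 * (2 * pi / 3) * 2 ^ j} \<inter> {2..}"
  have J: "finite J" "card J \<le> 3"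
  proof -
    have f: "finite {j::nat. (2 * pi / 3) * 2 ^ j \<le> norm \<eta> \<and> norm \<eta> \<le> 4 * (2 * pi / 3) * 2 ^ j}"
      by (rule finite_dyadic_scales) simp
    then show "finite J" unfolding J_def by blast
    have "card J \<le> card {j::nat. (2 * pi / 3) * 2 ^ j \<le> norm \<eta> \<and> norm \<eta> \<le> 4 * (2 * pi / 3) * 2 ^ j}"
      unfolding J_def using f by (intro card_mono) auto
    also have "\<dots> \<le> 3" by (rule card_dyadic_scales) simp
    finally show "card J \<le> 3" .
  qed
  let ?L = "\<lambda>j. {l. (j, l) \<in> active \<eta>}"
  have sub: "active \<eta> \<subseteq> {(0,0), (1,0)} \<union> (SIGMA j:J. ?L j)"
  proof
    fix q assume q: "q \<in> active \<eta>"
    obtain j l where jl: "q = (j, l)" by (cases q)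
    have l: "l < 2 ^ (j div 2)" and nz: "chi j (rot j l \<eta>) \<noteq> 0" using q by (auto simp: active_def jl)
    show "q \<in> {(0,0), (1,0)} \<union> (SIGMA j:J. ?L j)"
    proof (cases "j \<ge> 2")
      case True
      have "j \<in> J" using norm_rot[of j l \<eta>] chi_support(1,2)[OF True nz] True by (simp add: J_def)
      then show ?thesis using q by (simp add: jl)
    next
      case False
      then have "j = 0 \<or> j = 1" by linarith
      then show ?thesis using l by (auto simp: jl)
    qed
  qed
  have fin: "finite (SIGMA j:J. ?L j)"
    using J(1) by (intro finite_SigmaI) (auto simp: J_def intro!: active_angles(1))
  then show "finite (active \<eta>)" using sub by (auto intro: finite_subset)
  have "card (active \<eta>) \<le> card ({(0,0), (1,0)} \<union> (SIGMA j:J. ?L j))"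
    using sub fin by (intro card_mono) auto
  also have "\<dots> \<le> card {(0::nat,0::nat), (1,0)} + card (SIGMA j:J. ?L j)" by (rule card_Un_le)
  also have "card (SIGMA j:J. ?L j) = (\<Sum>j\<in>J. card (?L j))"
    using J(1) by (intro card_SigmaI) (auto simp: J_def intro!: active_angles(1))
  also have "\<dots> \<le> (\<Sum>j\<in>J. 18)"
    by (intro sum_mono active_angles(2)) (auto simp: J_def)
  also have "\<dots> \<le> 54" using J(2) by simp
  finally show "card (active \<eta>) \<le> 56" by simp
qed

lemma integrable_indicator_box2:
  assumes "a > 0" "b > 0"
  shows "integrable lborel (indicat_real (box2 a b))"
proof -
  have e: "lattice_exp a b (0,0) \<xi> = 1" for \<xi>
    by (simp add: lattice_exp_def inner_real2)
  have "integrable lborel (\<lambda>\<xi>. indicator (box2 a b) \<xi> *\<^sub>R (lattice_exp a b (0,0) \<xi> * cnj (lattice_exp a b (0,0) \<xi>)))"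
    using assms by (intro integrable_lattice_exp)
  then have "integrable lborel (\<lambda>\<xi>. complex_of_real (indicat_real (box2 a b) \<xi>))"
    by (simp add: e scaleR_conv_of_real)
  then show ?thesis by (simp only: complex_of_real_integrable_eq)
qed

definition curvelet_hat :: "nat \<times> nat \<Rightarrow> int \<times> int \<Rightarrow> real^2 \<Rightarrow> complex" where
  "curvelet_hat q m \<eta> = complex_of_real (1 / sqrt (big_lambda (fst q) * small_lambda (fst q))) *
     (complex_of_real (chi (fst q) (rot (fst q) (snd q) \<eta>)) *
      lattice_exp (big_lambda (fst q)) (small_lambda (fst q)) m (rot (fst q) (snd q) \<eta>))"

text \<open>Curvelets indexed by integers: \<open>q = (j, l)\<close> is the wedge and \<open>m\<close> the position in the grid.\<close>

definition curvelet_at :: "nat \<times> nat \<Rightarrow> int \<times> int \<Rightarrow> real^2 \<Rightarrow> complex" where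
  "curvelet_at q m = curvelet w0 w \<nu> (fst q) (snd q)
     (vector [2 * pi * of_int (fst m) / big_lambda (fst q), 2 * pi * of_int (snd m) / small_lambda (fst q)])"

lemma integrable_rot_iff:
  fixes f :: "real^2 \<Rightarrow> 'b::{banach, second_countable_topology}"
  assumes "f \<in> borel_measurable borel"
  shows "integrable lborel (\<lambda>\<eta>. f (rot j l \<eta>)) \<longleftrightarrow> integrable lborel f"
  using integrable_affine_iff[OF invertible_transpose_rotation assms, of _ 0]
  by (simp only: rot_def add_0_right)

lemma integral_rot:
  fixes f :: "real^2 \<Rightarrow> 'b::{banach, second_countable_topology}"
  assumes "f \<in> borel_measurable borel"
  shows "(\<integral>\<eta>. f (rot j l \<eta>) \<partial>lborel) = (\<integral>\<xi>. f \<xi> \<partial>lborel)"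
  using integral_affine[OF invertible_transpose_rotation assms, of _ 0]
  by (simp only: rot_def add_0_right det_transpose_rotation abs_one scaleR_one)

lemma curvelet_eq_inverse_fourier: "curvelet_at q m x = inverse_fourier (curvelet_hat q m) x"
proof -
  obtain j l where q: "q = (j, l)" by (cases q)
  define k :: "real^2" where "k = vector [2 * pi * of_int (fst m) / big_lambda j, 2 * pi * of_int (snd m) / small_lambda j]"
  define c where "c = complex_of_real (1 / sqrt (big_lambda j * small_lambda j))"
  let ?g = "\<lambda>\<xi>. complex_of_real (chi j \<xi>) * exp (\<i> * complex_of_real ((rot j l x - k) \<bullet> \<xi>))"
  have hat_borel: "curvelet_hat q m \<in> borel_measurable borel"
    unfolding curvelet_hat_def[abs_def] by measurable
  have cm: "(\<lambda>\<xi>. complex_of_real (chi j \<xi>)) \<in> borel_measurable borel" by measurable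
  have gm: "?g \<in> borel_measurable borel" by measurable
  have "curvelet_at q m x = c * inverse_fourier (\<lambda>\<xi>. complex_of_real (chi j \<xi>)) (rot j l x - k)"
    by (simp only: curvelet_at_def curvelet_def q fst_conv snd_conv rot_def c_def k_def)
  also have "\<dots> = c * ((1 / (2 * pi)) *\<^sub>R (\<integral>\<xi>. ?g \<xi> \<partial>lborel))"
    by (simp only: inverse_fourier_eq_lborel[OF cm])
  also have "(\<integral>\<xi>. ?g \<xi> \<partial>lborel) = (\<integral>\<eta>. ?g (rot j l \<eta>) \<partial>lborel)"
    by (rule integral_rot[OF gm, symmetric])
  also have "(\<lambda>\<eta>. ?g (rot j l \<eta>)) = (\<lambda>\<eta>. (complex_of_real (chi j (rot j l \<eta>)) *
      lattice_exp (big_lambda j) (small_lambda j) m (rot j l \<eta>)) * exp (\<i> * complex_of_real (x \<bullet> \<eta>)))"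
  proof
    fix \<eta>
    have "rot j l x \<bullet> rot j l \<eta> = x \<bullet> \<eta>"
      by (simp only: rot_def transpose_rotation_inner)
    then have "\<i> * complex_of_real ((rot j l x - k) \<bullet> rot j l \<eta>)
        = - (\<i> * complex_of_real (k \<bullet> rot j l \<eta>)) + \<i> * complex_of_real (x \<bullet> \<eta>)"
      by (simp add: inner_diff_left algebra_simps)
    moreover have "lattice_exp (big_lambda j) (small_lambda j) m (rot j l \<eta>) = exp (- (\<i> * complex_of_real (k \<bullet> rot j l \<eta>)))"
      by (simp only: lattice_exp_def k_def)
    ultimately show "?g (rot j l \<eta>) = (complex_of_real (chi j (rot j l \<eta>)) *
      lattice_exp (big_lambda j) (small_lambda j) m (rot j l \<eta>)) * exp (\<i> * complex_of_real (x \<bullet> \<eta>))"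
      by (simp only: exp_add mult.assoc)
  qed
  also have "c * ((1 / (2 * pi)) *\<^sub>R (\<integral>\<eta>. (complex_of_real (chi j (rot j l \<eta>)) *
      lattice_exp (big_lambda j) (small_lambda j) m (rot j l \<eta>)) * exp (\<i> * complex_of_real (x \<bullet> \<eta>)) \<partial>lborel))
      = (1 / (2 * pi)) *\<^sub>R (\<integral>\<eta>. curvelet_hat q m \<eta> * exp (\<i> * complex_of_real (x \<bullet> \<eta>)) \<partial>lborel)"
    by (simp only: curvelet_hat_def q fst_conv snd_conv c_def[symmetric] mult.assoc
        Bochner_Integration.integral_mult_right_zero mult_scaleR_right)
  also have "\<dots> = inverse_fourier (curvelet_hat q m) x"
    by (rule inverse_fourier_eq_lborel[OF hat_borel, symmetric])
  finally show ?thesis .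
qed

lemma chi_integrable: "integrable lborel (chi j)"
proof (rule Bochner_Integration.integrable_bound)
  show "integrable lborel (\<lambda>\<xi>. 2 * indicat_real (box2 (big_lambda j) (small_lambda j)) \<xi>)"
    by (intro integrable_mult_right integrable_indicator_box2 big_lambda_pos small_lambda_pos)
  show "AE \<xi> in lborel. norm (chi j \<xi>) \<le> norm (2 * indicat_real (box2 (big_lambda j) (small_lambda j)) \<xi>)"
  proof (rule AE_I2)
    fix \<xi>
    show "norm (chi j \<xi>) \<le> norm (2 * indicat_real (box2 (big_lambda j) (small_lambda j)) \<xi>)"
      using abs_chi_le_2[of j \<xi>] chi_support_box[of j \<xi>] by (cases "chi j \<xi> = 0") auto
  qed
qed simp

lemma curvelet_hat_integrable: "integrable lborel (curvelet_hat q m)"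
proof -
  have i: "integrable lborel (\<lambda>\<eta>. chi (fst q) (rot (fst q) (snd q) \<eta>))"
    by (subst integrable_rot_iff) (auto intro: chi_integrable)
  have "integrable lborel (\<lambda>\<eta>. complex_of_real (chi (fst q) (rot (fst q) (snd q) \<eta>)) *
      lattice_exp (big_lambda (fst q)) (small_lambda (fst q)) m (rot (fst q) (snd q) \<eta>))"
    by (rule Bochner_Integration.integrable_bound[OF i]) (auto simp: norm_mult)
  then show ?thesis
    unfolding curvelet_hat_def[abs_def] by (rule integrable_mult_right)
qed

text \<open>Within one wedge the Fourier transforms are lattice exponentials cut off by \<open>chi\<close>, so Parseval's
identity on the rectangle bounds the energy. The factor \<open>16\<close> is the product of \<open>chi\<^sup>2 \<le> 4\<close> and the
four periods in the rectangle.\<close>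

lemma curvelet_packet_energy:
  fixes c :: "int \<times> int \<Rightarrow> complex" and q :: "nat \<times> nat"
  assumes "finite M"
  defines "T \<equiv> \<lambda>\<xi>. \<Sum>m\<in>M. c m * lattice_exp (big_lambda (fst q)) (small_lambda (fst q)) m \<xi>"
  shows "integrable lborel (\<lambda>\<eta>. (cmod (\<Sum>m\<in>M. c m * curvelet_hat q m \<eta>))\<^sup>2)"
    and "(\<integral>\<eta>. (cmod (\<Sum>m\<in>M. c m * curvelet_hat q m \<eta>))\<^sup>2 \<partial>lborel) \<le> 16 * (\<Sum>m\<in>M. (cmod (c m))\<^sup>2)"
proof -
  obtain j l where q: "q = (j, l)" by (cases q)
  let ?a = "big_lambda j" and ?b = "small_lambda j"
  note pos = big_lambda_pos[of j] small_lambda_pos[of j]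
  define g where "g \<xi> = (1 / (?a * ?b)) * ((chi j \<xi>)\<^sup>2 * (cmod (T \<xi>))\<^sup>2)" for \<xi>
  define h where "h \<xi> = (4 / (?a * ?b)) * (indicat_real (box2 ?a ?b) \<xi> * (cmod (T \<xi>))\<^sup>2)" for \<xi>
  have [measurable]: "T \<in> borel_measurable borel" unfolding T_def by measurable
  have gm [measurable]: "g \<in> borel_measurable borel" unfolding g_def[abs_def] by measurable
  have eq: "(cmod (\<Sum>m\<in>M. c m * curvelet_hat q m \<eta>))\<^sup>2 = g (rot j l \<eta>)" for \<eta>
  proof -
    have "(\<Sum>m\<in>M. c m * curvelet_hat q m \<eta>)
        = complex_of_real (1 / sqrt (?a * ?b)) * (complex_of_real (chi j (rot j l \<eta>)) * T (rot j l \<eta>))"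
      unfolding T_def curvelet_hat_def q sum_distrib_left by (intro sum.cong refl) simp
    then have "(cmod (\<Sum>m\<in>M. c m * curvelet_hat q m \<eta>))\<^sup>2
        = (1 / sqrt (?a * ?b))\<^sup>2 * ((chi j (rot j l \<eta>))\<^sup>2 * (cmod (T (rot j l \<eta>)))\<^sup>2)"
      by (simp only: norm_mult norm_of_real power_mult_distrib power2_abs)
    then show ?thesis using pos by (simp add: g_def power_divide)
  qed
  have le: "g \<xi> \<le> h \<xi>" "0 \<le> g \<xi>" for \<xi>
  proof -
    show "0 \<le> g \<xi>" unfolding g_def using pos by auto
    show "g \<xi> \<le> h \<xi>"
    proof (cases "chi j \<xi> = 0")
      case True
      then show ?thesis using pos by (simp add: g_def h_def)
    next
      case False
      have "(chi j \<xi>)\<^sup>2 \<le> 2\<^sup>2" using abs_chi_le_2[of j \<xi>] by (metis abs_le_square_iff abs_numeral)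
      then have "(chi j \<xi>)\<^sup>2 * (cmod (T \<xi>))\<^sup>2 \<le> 4 * (cmod (T \<xi>))\<^sup>2" by (intro mult_right_mono) auto
      then have "g \<xi> \<le> (1 / (?a * ?b)) * (4 * (cmod (T \<xi>))\<^sup>2)"
        unfolding g_def using pos by (intro mult_left_mono) auto
      also have "\<dots> = h \<xi>" using chi_support_box[OF False] by (simp add: h_def)
      finally show ?thesis .
    qed
  qed
  have hi: "integrable lborel h"
    unfolding h_def[abs_def] T_def using pos assms(1) by (intro integrable_mult_right) (simp add: q integrable_trig_sum_sq)
  have gi: "integrable lborel g"
  proof (rule Bochner_Integration.integrable_bound[OF hi])
    show "AE \<xi> in lborel. norm (g \<xi>) \<le> norm (h \<xi>)"
      using le(1) le(2) order_trans[OF le(2) le(1)] by (intro AE_I2) simp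
  qed simp
  show "integrable lborel (\<lambda>\<eta>. (cmod (\<Sum>m\<in>M. c m * curvelet_hat q m \<eta>))\<^sup>2)"
    unfolding eq integrable_rot_iff[OF gm] by (rule gi)
  have "(\<integral>\<eta>. (cmod (\<Sum>m\<in>M. c m * curvelet_hat q m \<eta>))\<^sup>2 \<partial>lborel) = (\<integral>\<xi>. g \<xi> \<partial>lborel)"
    unfolding eq by (rule integral_rot[OF gm])
  also have "\<dots> \<le> (\<integral>\<xi>. h \<xi> \<partial>lborel)" by (intro integral_mono gi hi le)
  also have "\<dots> = (4 / (?a * ?b)) * (4 * ?a * ?b * (\<Sum>m\<in>M. (cmod (c m))\<^sup>2))"
    unfolding h_def T_def q fst_conv Bochner_Integration.integral_mult_right_zero
    by (subst parseval_trig_sum) (use pos assms(1) in auto)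
  also have "\<dots> = 16 * (\<Sum>m\<in>M. (cmod (c m))\<^sup>2)" using pos by (simp add: field_simps)
  finally show "(\<integral>\<eta>. (cmod (\<Sum>m\<in>M. c m * curvelet_hat q m \<eta>))\<^sup>2 \<partial>lborel) \<le> 16 * (\<Sum>m\<in>M. (cmod (c m))\<^sup>2)" .
qed

text \<open>At each frequency at most \<open>56\<close> wedges contribute, so by Cauchy-Schwarz the energies of the wedges
add up to within this factor; \<open>896 = 56 * 16\<close>. By Plancherel the bound passes to the curvelets
themselves.\<close>

lemma curvelet_synthesis_bound:
  fixes c :: "(nat \<times> nat) \<times> (int \<times> int) \<Rightarrow> complex"
  assumes "finite I" and valid: "\<And>j l m. ((j, l), m) \<in> I \<Longrightarrow> l < 2 ^ (j div 2)"
  shows "(\<lambda>x. \<Sum>(q, m)\<in>I. c (q, m) * curvelet_at q m x) \<in> L2"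
    and "norm_sq (\<lambda>x. \<Sum>(q, m)\<in>I. c (q, m) * curvelet_at q m x) \<le> 896 * (\<Sum>i\<in>I. (cmod (c i))\<^sup>2)"
proof -
  define Q where "Q = fst ` I"
  define M where "M q = {m. (q, m) \<in> I}" for q
  have I: "I = Sigma Q M" by (force simp: Q_def M_def)
  have finQ: "finite Q" using assms(1) by (simp add: Q_def)
  have finM: "finite (M q)" for q
  proof (rule finite_subset)
    show "M q \<subseteq> snd ` I" by (force simp: M_def)
  qed (use assms(1) in simp)
  define P where "P q \<eta> = (\<Sum>m\<in>M q. c (q, m) * curvelet_hat q m \<eta>)" for q \<eta>
  define \<Phi> where "\<Phi> \<eta> = (\<Sum>q\<in>Q. P q \<eta>)" for \<eta>
  have hat_borel [measurable]: "curvelet_hat q m \<in> borel_measurable borel" for q m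
    using curvelet_hat_integrable[of q m] by auto
  have i1: "integrable lborel \<Phi>"
    unfolding \<Phi>_def[abs_def] P_def
    by (intro Bochner_Integration.integrable_sum integrable_mult_right curvelet_hat_integrable)
  then have \<Phi>m [measurable]: "\<Phi> \<in> borel_measurable borel" by auto
  have Pi: "integrable lborel (\<lambda>\<eta>. (cmod (P q \<eta>))\<^sup>2)" for q
    unfolding P_def by (rule curvelet_packet_energy[OF finM])
  have zero: "P q \<eta> = 0" if "q \<in> Q" "q \<notin> active \<eta>" for q \<eta>
  proof -
    obtain j l where q: "q = (j, l)" by (cases q)
    have "l < 2 ^ (j div 2)" using that(1) valid by (auto simp: Q_def q)
    then have "chi j (rot j l \<eta>) = 0" using that(2) by (simp add: active_def q)
    then show ?thesis by (simp add: P_def curvelet_hat_def q)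
  qed
  have pointwise: "(cmod (\<Phi> \<eta>))\<^sup>2 \<le> 56 * (\<Sum>q\<in>Q. (cmod (P q \<eta>))\<^sup>2)" for \<eta>
  proof -
    let ?A = "Q \<inter> active \<eta>"
    have "\<Phi> \<eta> = (\<Sum>q\<in>?A. P q \<eta>)"
      unfolding \<Phi>_def using finQ zero by (intro sum.mono_neutral_right) auto
    then have "(cmod (\<Phi> \<eta>))\<^sup>2 \<le> real (card ?A) * (\<Sum>q\<in>?A. (cmod (P q \<eta>))\<^sup>2)"
      using finQ by (simp add: cmod_sum_sq_le)
    also have "\<dots> \<le> 56 * (\<Sum>q\<in>Q. (cmod (P q \<eta>))\<^sup>2)"
    proof (intro mult_mono sum_mono2 sum_nonneg)
      have "card ?A \<le> card (active \<eta>)" by (intro card_mono finite_active) auto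
      then show "real (card ?A) \<le> 56" using card_active[of \<eta>] by linarith
    qed (use finQ in auto)
    finally show ?thesis .
  qed
  have Si: "integrable lborel (\<lambda>\<eta>. 56 * (\<Sum>q\<in>Q. (cmod (P q \<eta>))\<^sup>2))"
    by (intro integrable_mult_right Bochner_Integration.integrable_sum Pi)
  have i2: "integrable lborel (\<lambda>\<eta>. (cmod (\<Phi> \<eta>))\<^sup>2)"
    by (rule Bochner_Integration.integrable_bound[OF Si])
      (auto intro!: AE_I2 order_trans[OF pointwise])
  have synth: "(\<Sum>(q, m)\<in>I. c (q, m) * curvelet_at q m x) = inverse_fourier \<Phi> x" for x
  proof -
    let ?e = "\<lambda>\<eta>. exp (\<i> * complex_of_real (x \<bullet> \<eta>))"
    have ie: "integrable lborel (\<lambda>\<eta>. c (q, m) * (curvelet_hat q m \<eta> * ?e \<eta>))" for q m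
      by (intro integrable_mult_right integrable_mult_iexp curvelet_hat_integrable)
    have "inverse_fourier \<Phi> x = (1 / (2 * pi)) *\<^sub>R (\<integral>\<eta>. (\<Sum>q\<in>Q. \<Sum>m\<in>M q. c (q, m) * (curvelet_hat q m \<eta> * ?e \<eta>)) \<partial>lborel)"
      unfolding inverse_fourier_eq_lborel[OF \<Phi>m] \<Phi>_def P_def by (simp only: sum_distrib_right mult.assoc)
    also have "\<dots> = (1 / (2 * pi)) *\<^sub>R (\<Sum>q\<in>Q. \<Sum>m\<in>M q. (\<integral>\<eta>. c (q, m) * (curvelet_hat q m \<eta> * ?e \<eta>) \<partial>lborel))"
      by (subst Bochner_Integration.integral_sum, intro Bochner_Integration.integrable_sum ie)
        (subst Bochner_Integration.integral_sum, rule ie, rule refl)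
    also have "\<dots> = (\<Sum>q\<in>Q. \<Sum>m\<in>M q. c (q, m) * curvelet_at q m x)"
      unfolding curvelet_eq_inverse_fourier inverse_fourier_eq_lborel[OF hat_borel]
      by (simp only: scaleR_sum_right Bochner_Integration.integral_mult_right_zero mult_scaleR_right)
    also have "\<dots> = (\<Sum>(q, m)\<in>I. c (q, m) * curvelet_at q m x)"
      unfolding I using finQ finM by (subst sum.Sigma) auto
    finally show ?thesis by (rule sym)
  qed
  show "(\<lambda>x. \<Sum>(q, m)\<in>I. c (q, m) * curvelet_at q m x) \<in> L2"
    unfolding synth by (rule inverse_fourier_L2[OF i1 i2])
  have "norm_sq (\<lambda>x. \<Sum>(q, m)\<in>I. c (q, m) * curvelet_at q m x) \<le> (\<integral>\<eta>. (cmod (\<Phi> \<eta>))\<^sup>2 \<partial>lborel)"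
    unfolding synth by (rule plancherel_inequality[OF i1 i2])
  also have "\<dots> \<le> (\<integral>\<eta>. 56 * (\<Sum>q\<in>Q. (cmod (P q \<eta>))\<^sup>2) \<partial>lborel)"
    by (intro integral_mono i2 Si pointwise)
  also have "\<dots> = 56 * (\<Sum>q\<in>Q. (\<integral>\<eta>. (cmod (P q \<eta>))\<^sup>2 \<partial>lborel))"
    using Pi by (simp add: Bochner_Integration.integral_sum)
  also have "\<dots> \<le> 56 * (\<Sum>q\<in>Q. 16 * (\<Sum>m\<in>M q. (cmod (c (q, m)))\<^sup>2))"
    unfolding P_def by (intro mult_left_mono sum_mono curvelet_packet_energy finM) auto
  also have "\<dots> = 896 * (\<Sum>q\<in>Q. \<Sum>m\<in>M q. (cmod (c (q, m)))\<^sup>2)"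
    by (simp add: sum_distrib_left)
  also have "(\<Sum>q\<in>Q. \<Sum>m\<in>M q. (cmod (c (q, m)))\<^sup>2) = (\<Sum>i\<in>I. (cmod (c i))\<^sup>2)"
    unfolding I using finQ finM by (subst sum.Sigma) (auto simp: case_prod_unfold)
  finally show "norm_sq (\<lambda>x. \<Sum>(q, m)\<in>I. c (q, m) * curvelet_at q m x) \<le> 896 * (\<Sum>i\<in>I. (cmod (c i))\<^sup>2)" .
qed

end

section \<open>Approximation by Jackson kernels\<close>

text \<open>The \<open>M\<close>-th difference is the first difference applied to the \<open>(M-1)\<close>-st, and each first
difference costs one derivative and one factor \<open>t\<close> by the mean value theorem.\<close>

lemma finite_difference_bound:
  fixes g :: "nat \<Rightarrow> real \<Rightarrow> real"
  assumes "\<And>n x. n < M \<Longrightarrow> (g n has_real_derivative g (Suc n) x) (at x)"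
    and "\<And>x. \<bar>g M x\<bar> \<le> D"
  shows "\<bar>\<Sum>i\<le>M. (-1) ^ i * real (M choose i) * g 0 (x + real i * t)\<bar> \<le> D * \<bar>t\<bar> ^ M"
  using assms
proof (induction M arbitrary: g D x)
  case 0
  then show ?case by simp
next
  case (Suc M)
  define h where "h n y = g n y - g n (y + t)" for n y
  let ?u = "\<lambda>i. g 0 (x + real i * t)"
  have pascal: "(\<Sum>i\<le>Suc M. (-1) ^ i * real (Suc M choose i) * ?u i)
      = (\<Sum>i\<le>M. (-1) ^ i * real (M choose i) * (?u i - ?u (Suc i)))"
  proof -
    have "(\<Sum>i\<le>Suc M. (-1) ^ i * real (Suc M choose i) * ?u i)
        = ?u 0 + (\<Sum>i\<le>M. (-1) ^ Suc i * real (Suc M choose Suc i) * ?u (Suc i))"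
      by (subst sum.atMost_Suc_shift) simp
    also have "\<dots> = (?u 0 + (\<Sum>i\<le>M. (-1) ^ Suc i * real (M choose Suc i) * ?u (Suc i)))
        - (\<Sum>i\<le>M. (-1) ^ i * real (M choose i) * ?u (Suc i))"
      by (simp add: sum_subtractf[symmetric] sum.distrib[symmetric] sum_negf[symmetric] algebra_simps)
    also have "?u 0 + (\<Sum>i\<le>M. (-1) ^ Suc i * real (M choose Suc i) * ?u (Suc i))
        = (\<Sum>i\<le>Suc M. (-1) ^ i * real (M choose i) * ?u i)"
      by (subst sum.atMost_Suc_shift) simp
    also have "\<dots> = (\<Sum>i\<le>M. (-1) ^ i * real (M choose i) * ?u i)" by simp
    finally show ?thesis by (simp add: sum_subtractf[symmetric] algebra_simps)
  qed
  have "\<bar>\<Sum>i\<le>M. (-1) ^ i * real (M choose i) * h 0 (x + real i * t)\<bar> \<le> (D * \<bar>t\<bar>) * \<bar>t\<bar> ^ M"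
  proof (rule Suc.IH)
    fix n y assume "n < M"
    then have d: "(g n has_real_derivative g (Suc n) z) (at z)" for z using Suc.prems(1) by simp
    have "((\<lambda>y. g n (y + t)) has_real_derivative g (Suc n) (y + t)) (at y)"
      using d[of "y + t"] by (simp add: DERIV_shift)
    then show "(h n has_real_derivative h (Suc n) y) (at y)"
      unfolding h_def[abs_def] by (intro DERIV_diff d)
  next
    fix y
    have d: "(g M has_real_derivative g (Suc M) z) (at z)" for z using Suc.prems(1) by simp
    have "norm (g M y - g M (y + t)) \<le> D * norm (y - (y + t))"
      using Suc.prems(2) d
      by (intro field_differentiable_bound[of UNIV "g M" "g (Suc M)"]) (auto intro: has_field_derivative_at_within)
    then show "\<bar>h M y\<bar> \<le> D * \<bar>t\<bar>" by (simp add: h_def)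
  qed
  moreover have "h 0 (x + real i * t) = ?u i - ?u (Suc i)" for i
    by (simp add: h_def algebra_simps)
  ultimately show ?case unfolding pascal by (simp add: mult.assoc)
qed

lemma cos_le_exp: "\<bar>\<theta>\<bar> \<le> pi / 2 \<Longrightarrow> cos \<theta> \<le> exp (- (\<theta>\<^sup>2 / 8))"
proof -
  assume "\<bar>\<theta>\<bar> \<le> pi / 2"
  then have "\<bar>\<theta>\<bar> / 2 / 2 \<le> sin (\<bar>\<theta>\<bar> / 2)" by (intro half_le_sin) auto
  then have "(\<bar>\<theta>\<bar> / 4)\<^sup>2 \<le> (sin (\<bar>\<theta>\<bar> / 2))\<^sup>2" by (intro power_mono) auto
  moreover have "cos \<bar>\<theta>\<bar> = 1 - 2 * (sin (\<bar>\<theta>\<bar> / 2))\<^sup>2"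
    using cos_double_sin[of "\<bar>\<theta>\<bar> / 2"] by simp
  ultimately have "cos \<bar>\<theta>\<bar> \<le> 1 - \<theta>\<^sup>2 / 8" by (simp add: power_divide)
  also have "\<dots> \<le> exp (- (\<theta>\<^sup>2 / 8))"
    using exp_ge_add_one_self[of "- (\<theta>\<^sup>2 / 8)"] by simp
  finally show ?thesis by simp
qed

lemma cos_ge_quadratic: "1 - \<theta>\<^sup>2 / 2 \<le> cos \<theta>" for \<theta> :: real
proof -
  have "\<bar>sin (\<theta> / 2)\<bar> \<le> \<bar>\<theta> / 2\<bar>" by (rule abs_sin_x_le_abs_x)
  then have "(sin (\<theta> / 2))\<^sup>2 \<le> (\<theta> / 2)\<^sup>2" by (simp only: abs_le_square_iff)
  then show ?thesis
    using cos_double_sin[of "\<theta> / 2"] by (simp add: power_divide)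
qed

text \<open>A non-negative trigonometric polynomial of degree \<open>2 * k ^ 4\<close> in \<open>t / k\<close>. On its central period
it is dominated by a Gaussian of width \<open>1 / k\<close>, while the period \<open>pi * k\<close> grows with \<open>k\<close>. The
exponent \<open>4\<close> balances the two: \<open>(t / k)\<^sup>2 * k ^ 4 = (k * t)\<^sup>2\<close>.\<close>

definition cos_kernel :: "nat \<Rightarrow> real \<Rightarrow> real" where
  "cos_kernel k t = cos (t / real k) ^ (2 * k ^ 4)"

definition kernel_mass :: "nat \<Rightarrow> real" where
  "kernel_mass k = (\<integral>t. indicator {- (pi * real k / 2)..pi * real k / 2} t * cos_kernel k t \<partial>lborel)"

definition abs_moment :: "nat \<Rightarrow> real" where
  "abs_moment M = (\<integral>s. \<bar>s\<bar> ^ M * exp (- (s\<^sup>2 / 4)) \<partial>lborel)"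

lemma cos_kernel_nonneg: "0 \<le> cos_kernel k t"
  unfolding cos_kernel_def power_mult by (rule zero_le_power) simp

lemma cos_kernel_le_1: "cos_kernel k t \<le> 1"
  unfolding cos_kernel_def power_mult
  by (rule power_le_one) (auto simp: abs_square_le_1)

lemma cos_kernel_borel [measurable]: "cos_kernel k \<in> borel_measurable borel"
  unfolding cos_kernel_def[abs_def] by measurable

lemma cos_kernel_gaussian_bound:
  assumes "k \<ge> 1" "\<bar>t\<bar> \<le> pi * real k / 2"
  shows "cos_kernel k t \<le> exp (- ((real k * t)\<^sup>2 / 4))"
proof -
  have th: "\<bar>t / real k\<bar> \<le> pi / 2" using assms by (simp add: field_simps)
  then have "0 \<le> cos (t / real k)" by (intro cos_ge_zero) linarith+
  with cos_le_exp[OF th] have "cos_kernel k t \<le> exp (- ((t / real k)\<^sup>2 / 8)) ^ (2 * k ^ 4)"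
    unfolding cos_kernel_def by (intro power_mono)
  also have "\<dots> = exp (real (2 * k ^ 4) * (- ((t / real k)\<^sup>2 / 8)))"
    by (rule exp_of_nat_mult[symmetric])
  also have "real (2 * k ^ 4) * (- ((t / real k)\<^sup>2 / 8)) = - ((real k * t)\<^sup>2 / 4)"
    using assms(1) by (simp add: power_divide power_mult_distrib power2_eq_square power4_eq_xxxx)
  finally show ?thesis .
qed

lemma integrable_indicator_Icc: "integrable lborel (indicat_real {a..b})" for a b :: real
  by (rule integrable_real_indicator) (auto simp: emeasure_lborel_Icc_eq)

lemma kernel_integrable: "integrable lborel (\<lambda>t. indicator {a..b} t * cos_kernel k t)"
  by (rule Bochner_Integration.integrable_bound[OF integrable_indicator_Icc[of a b]])
    (auto simp: abs_mult cos_kernel_nonneg cos_kernel_le_1 indicator_def)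

text \<open>By Bernoulli's inequality the kernel is at least \<open>3 / 4\<close> on an interval of length \<open>1 / k\<close>.\<close>

lemma kernel_mass_ge:
  assumes k: "k \<ge> 1"
  shows "3 / (4 * real k) \<le> kernel_mass k"
proof -
  define a where "a = 1 / (2 * real k)"
  have a: "0 < a" "a \<le> pi * real k / 2"
  proof -
    show "0 < a" using k by (simp add: a_def)
    have "a \<le> 1 / 2" using k by (simp add: a_def)
    also have "\<dots> \<le> pi * real k / 2" using k pi_ge_two mult_mono[of 1 pi 1 "real k"] by simp
    finally show "a \<le> pi * real k / 2" .
  qed
  have low: "3 / 4 \<le> cos_kernel k t" if "t \<in> {-a..a}" for t
  proof -
    have "\<bar>t\<bar> \<le> a" using that by auto
    then have "\<bar>t / real k\<bar> \<le> a / real k" using k by (simp add: divide_right_mono)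
    then have "(t / real k)\<^sup>2 \<le> (a / real k)\<^sup>2" by (rule power2_le_iff_abs_le[THEN iffD2, rotated]) (use a k in auto)
    also have "\<dots> = 1 / (4 * real k ^ 4)" by (simp add: a_def power_divide power_mult_distrib power2_eq_square power4_eq_xxxx)
    finally have s: "(t / real k)\<^sup>2 / 2 \<le> 1 / (8 * real k ^ 4)" by simp
    have k4: "1 \<le> real k ^ 4" using k by simp
    have "1 - 1 / (8 * real k ^ 4) \<le> cos (t / real k)"
      using cos_ge_quadratic[of "t / real k"] s by linarith
    moreover have p: "0 \<le> 1 - 1 / (8 * real k ^ 4)" 
    proof -
      have "1 \<le> 8 * real k ^ 4" using k4 by linarith
      then show ?thesis using k by (simp add: divide_le_eq_1)
    qed
    ultimately have "(1 - 1 / (8 * real k ^ 4)) ^ (2 * k ^ 4) \<le> cos_kernel k t"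
      unfolding cos_kernel_def by (intro power_mono)
    moreover have "1 + real (2 * k ^ 4) * (- (1 / (8 * real k ^ 4))) \<le> (1 + (- (1 / (8 * real k ^ 4)))) ^ (2 * k ^ 4)"
      using p by (intro Bernoulli_inequality) auto
    moreover have "real (2 * k ^ 4) * (1 / (8 * real k ^ 4)) = 1 / 4" using k by simp
    ultimately show ?thesis by simp
  qed
  have "3 / (4 * real k) = (\<integral>t. indicator {-a..a} t * (3 / 4) \<partial>lborel)"
    using a k by (simp add: a_def)
  also have "\<dots> \<le> kernel_mass k"
    unfolding kernel_mass_def
  proof (rule integral_mono[OF _ kernel_integrable])
    show "integrable lborel (\<lambda>t. indicat_real {-a..a} t * (3 / 4))"
      by (intro integrable_mult_left integrable_indicator_Icc)
    fix t
    show "indicat_real {-a..a} t * (3 / 4) \<le> indicator {- (pi * real k / 2)..pi * real k / 2} t * cos_kernel k t"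
      using low[of t] a cos_kernel_nonneg[of k t] by (auto simp: indicator_def)
  qed
  finally show ?thesis .
qed

lemma kernel_mass_pos: "k \<ge> 1 \<Longrightarrow> kernel_mass k > 0"
proof -
  assume "k \<ge> 1"
  moreover from this have "0 < 3 / (4 * real k)" by simp
  ultimately show ?thesis using kernel_mass_ge[of k] by linarith
qed

lemma integrable_abs_moment: "integrable lborel (\<lambda>s::real. \<bar>s\<bar> ^ M * exp (- (s\<^sup>2 / 4)))"
proof -
  have "integrable lborel (\<lambda>x. normal_density 0 (sqrt 2) x * \<bar>x - 0\<bar> ^ M)"
    by (intro integrable_normal_moment_abs) simp
  then have "integrable lborel (\<lambda>x. sqrt (2 * pi * (sqrt 2)\<^sup>2) * (normal_density 0 (sqrt 2) x * \<bar>x - 0\<bar> ^ M))"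
    by (rule integrable_mult_right)
  then show ?thesis by (simp add: normal_density_def mult.commute)
qed

lemma kernel_moment:
  assumes k: "k \<ge> 1"
  shows "(\<integral>t. indicator {- (pi * real k / 2)..pi * real k / 2} t * (\<bar>t\<bar> ^ M * cos_kernel k t) \<partial>lborel)
    \<le> abs_moment M / real k ^ (M + 1)"
    and "integrable lborel (\<lambda>t. indicator {- (pi * real k / 2)..pi * real k / 2} t * (\<bar>t\<bar> ^ M * cos_kernel k t))"
proof -
  let ?g = "\<lambda>t. \<bar>real k * t\<bar> ^ M * exp (- ((real k * t)\<^sup>2 / 4)) / real k ^ M"
  let ?f = "\<lambda>t. indicator {- (pi * real k / 2)..pi * real k / 2} t * (\<bar>t\<bar> ^ M * cos_kernel k t)"
  have gi: "integrable lborel ?g"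
    using lborel_integrable_real_affine[OF integrable_abs_moment[of M], where c = "real k" and t = 0] k
    by (intro Bochner_Integration.integrable_divide) simp
  have le: "?f t \<le> ?g t" "0 \<le> ?f t" for t
  proof -
    show "0 \<le> ?f t" by (simp add: cos_kernel_nonneg)
    have g: "?g t = \<bar>t\<bar> ^ M * exp (- ((real k * t)\<^sup>2 / 4))" using k by (simp add: abs_mult power_mult_distrib)
    show "?f t \<le> ?g t"
      unfolding g using cos_kernel_gaussian_bound[OF k, of t]
      by (auto simp: indicator_def intro!: mult_left_mono)
  qed
  show fi: "integrable lborel ?f"
    by (rule Bochner_Integration.integrable_bound[OF gi]) (use le order_trans[OF le(2) le(1)] in auto)
  have "(\<integral>t. ?f t \<partial>lborel) \<le> (\<integral>t. ?g t \<partial>lborel)" by (intro integral_mono fi gi le)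
  also have "\<dots> = (\<integral>t. \<bar>real k * t\<bar> ^ M * exp (- ((real k * t)\<^sup>2 / 4)) \<partial>lborel) / real k ^ M"
    by simp
  also have "(\<integral>t. \<bar>real k * t\<bar> ^ M * exp (- ((real k * t)\<^sup>2 / 4)) \<partial>lborel) = abs_moment M / real k"
    using lborel_integral_real_affine[of "real k" "\<lambda>s. \<bar>s\<bar> ^ M * exp (- (s\<^sup>2 / 4))" 0] k
    by (simp add: abs_moment_def)
  finally show "(\<integral>t. ?f t \<partial>lborel) \<le> abs_moment M / real k ^ (M + 1)" by (simp add: mult.commute)
qed

text \<open>The combination for which convolution reproduces \<open>h x\<close> up to an average of \<open>M\<close>-th differences
of \<open>h\<close>: the differences contain \<open>h x\<close> once, and the kernel collects the remaining terms
\<open>h (x + i * t)\<close>.\<close>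

definition jackson_kernel :: "nat \<Rightarrow> nat \<Rightarrow> real \<Rightarrow> real" where
  "jackson_kernel M k t = (\<Sum>i\<in>{1..M}. (-1) ^ (i + 1) * real (M choose i) * (cos_kernel k (t / real i) / (real i * kernel_mass k)))"

lemma jackson_kernel_borel [measurable]: "jackson_kernel M k \<in> borel_measurable borel"
  unfolding jackson_kernel_def[abs_def] by measurable

lemma sum_choose_le: "(\<Sum>i\<in>{1..M}. real (M choose i)) \<le> 2 ^ M"
proof -
  have "(\<Sum>i\<in>{1..M}. real (M choose i)) \<le> (\<Sum>i\<le>M. real (M choose i))"
    by (intro sum_mono2) auto
  also have "\<dots> = 2 ^ M"
    using choose_row_sum[of M] by (metis of_nat_numeral of_nat_power of_nat_sum)
  finally show ?thesis .
qed

lemma abs_jackson_kernel_le: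
  assumes k: "k \<ge> 1"
  shows "\<bar>jackson_kernel M k t\<bar> \<le> 2 ^ M * (4 * real k / 3)"
proof -
  have Z: "1 / kernel_mass k \<le> 4 * real k / 3"
    using kernel_mass_ge[OF k] kernel_mass_pos[OF k] k by (simp add: field_simps)
  have "\<bar>jackson_kernel M k t\<bar> \<le> (\<Sum>i\<in>{1..M}. \<bar>(-1) ^ (i + 1) * real (M choose i) * (cos_kernel k (t / real i) / (real i * kernel_mass k))\<bar>)"
    unfolding jackson_kernel_def by (rule sum_abs)
  also have "\<dots> \<le> (\<Sum>i\<in>{1..M}. real (M choose i) * (4 * real k / 3))"
  proof (intro sum_mono)
    fix i assume i: "i \<in> {1..M}"
    have "cos_kernel k (t / real i) / (real i * kernel_mass k) \<le> 1 / (1 * kernel_mass k)"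
      using i cos_kernel_le_1 kernel_mass_pos[OF k] cos_kernel_nonneg by (intro frac_le mult_right_mono) auto
    also have "\<dots> \<le> 4 * real k / 3" using Z by simp
    finally have "real (M choose i) * (cos_kernel k (t / real i) / (real i * kernel_mass k)) \<le> real (M choose i) * (4 * real k / 3)"
      by (intro mult_left_mono) auto
    then show "\<bar>(-1) ^ (i + 1) * real (M choose i) * (cos_kernel k (t / real i) / (real i * kernel_mass k))\<bar> \<le> real (M choose i) * (4 * real k / 3)"
      using kernel_mass_pos[OF k] cos_kernel_nonneg[of k "t / real i"]
      by (simp add: abs_mult power_abs)
  qed
  also have "\<dots> = (\<Sum>i\<in>{1..M}. real (M choose i)) * (4 * real k / 3)" by (simp only: sum_distrib_right)
  also have "\<dots> \<le> 2 ^ M * (4 * real k / 3)" by (intro mult_right_mono sum_choose_le) auto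
  finally show ?thesis .
qed

lemma half_le_period: "k \<ge> 1 \<Longrightarrow> real k / 2 + 1 \<le> pi * real k / 2"
proof -
  assume "k \<ge> 1"
  then have "3 * real k \<le> pi * real k" using pi_gt3 by (intro mult_right_mono) auto
  moreover have "1 \<le> real k" using \<open>k \<ge> 1\<close> by simp
  ultimately show ?thesis by linarith
qed

text \<open>The kernel is periodic, so it peaks also at multiples of \<open>pi * k\<close>. For \<open>\<bar>x\<bar> \<le> k / 2\<close> and \<open>F\<close>
supported in the unit interval these further peaks are not met.\<close>

lemma dilated_kernel_integral:
  fixes F :: "real \<Rightarrow> real"
  assumes k: "k \<ge> 1" and i: "i \<ge> 1" and x: "\<bar>x\<bar> \<le> real k / 2"
    and supp: "\<And>y. \<bar>y\<bar> > 1 \<Longrightarrow> F y = 0"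
  shows "(\<integral>y. F y * cos_kernel k ((y - x) / real i) \<partial>lborel) / real i
    = (\<integral>t. indicator {- (pi * real k / 2)..pi * real k / 2} t * (F (x + real i * t) * cos_kernel k t) \<partial>lborel)"
proof -
  have "(\<integral>y. F y * cos_kernel k ((y - x) / real i) \<partial>lborel)
      = real i * (\<integral>t. F (x + real i * t) * cos_kernel k t \<partial>lborel)"
    using lborel_integral_real_affine[of "real i" "\<lambda>y. F y * cos_kernel k ((y - x) / real i)" x] i by simp
  also have "(\<lambda>t. F (x + real i * t) * cos_kernel k t)
      = (\<lambda>t. indicator {- (pi * real k / 2)..pi * real k / 2} t * (F (x + real i * t) * cos_kernel k t))"
  proof
    fix t
    show "F (x + real i * t) * cos_kernel k t
        = indicator {- (pi * real k / 2)..pi * real k / 2} t * (F (x + real i * t) * cos_kernel k t)"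
    proof (cases "\<bar>t\<bar> \<le> pi * real k / 2")
      case True
      then have "t \<in> {- (pi * real k / 2)..pi * real k / 2}" by auto
      then show ?thesis by simp
    next
      case False
      have "1 * \<bar>t\<bar> \<le> real i * \<bar>t\<bar>" using i by (intro mult_right_mono) auto
      then have "\<bar>t\<bar> \<le> \<bar>real i * t\<bar>" by (simp add: abs_mult)
      then have "\<bar>x + real i * t\<bar> > 1"
        using False x half_le_period[OF k] by linarith
      then show ?thesis using supp by simp
    qed
  qed
  finally show ?thesis using i by simp
qed

lemma bounded_support_integrable:
  fixes F :: "real \<Rightarrow> real"
  assumes "F \<in> borel_measurable borel" "\<And>y. \<bar>y\<bar> > 1 \<Longrightarrow> F y = 0" "\<And>y. \<bar>F y\<bar> \<le> B"
  shows "integrable lborel F" "\<bar>\<integral>y. F y \<partial>lborel\<bar> \<le> 2 * B"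
proof -
  have i: "integrable lborel (\<lambda>y::real. indicat_real {-1..1} y * B)"
    by (intro integrable_mult_left integrable_indicator_Icc)
  have le: "\<bar>F y\<bar> \<le> indicat_real {-1..1} y * B" for y
  proof (cases "\<bar>y\<bar> > 1")
    case True
    then show ?thesis using assms(2) by (auto simp: indicator_def)
  next
    case False
    then have "y \<in> {-1..1}" by auto
    then show ?thesis using assms(3) by simp
  qed
  show F: "integrable lborel F"
  proof (rule Bochner_Integration.integrable_bound[OF i])
    show "AE y in lborel. norm (F y) \<le> norm (indicat_real {-1..1} y * B)"
      using le by (intro AE_I2) (metis abs_ge_self order_trans real_norm_def)
  qed (use assms(1) in simp)
  have "\<bar>\<integral>y. F y \<partial>lborel\<bar> \<le> (\<integral>y. \<bar>F y\<bar> \<partial>lborel)"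
    using integral_norm_bound[of lborel F] by simp
  also have "\<dots> \<le> (\<integral>y. indicat_real {-1..1::real} y * B \<partial>lborel)"
    by (intro integral_mono i le integrable_abs F)
  also have "\<dots> = 2 * B" by simp
  finally show "\<bar>\<integral>y. F y \<partial>lborel\<bar> \<le> 2 * B" .
qed

text \<open>The error is an average of \<open>M\<close>-th differences of \<open>g 0\<close> against the normalised kernel. They are at
most \<open>D * |t| ^ M\<close>, and the \<open>M\<close>-th absolute moment of the kernel is of order \<open>k ^ (- M)\<close>.\<close>

lemma jackson_error_line:
  fixes g :: "nat \<Rightarrow> real \<Rightarrow> real"
  assumes k: "k \<ge> 1" and x: "\<bar>x\<bar> \<le> real k / 2"
    and deriv: "\<And>n y. n < M \<Longrightarrow> (g n has_real_derivative g (Suc n) y) (at y)"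
    and D: "\<And>y. \<bar>g M y\<bar> \<le> D" and B: "\<And>y. \<bar>g 0 y\<bar> \<le> B"
    and supp: "\<And>y. \<bar>y\<bar> > 1 \<Longrightarrow> g 0 y = 0"
    and meas: "g 0 \<in> borel_measurable borel"
  shows "\<bar>g 0 x - (\<integral>y. g 0 y * jackson_kernel M k (y - x) \<partial>lborel)\<bar> \<le> D * (4 / 3 * abs_moment M) / real k ^ M"
proof -
  note [measurable] = meas
  let ?I = "{- (pi * real k / 2)..pi * real k / 2}"
  let ?Z = "kernel_mass k"
  let ?c = "\<lambda>i. (-1) ^ i * real (M choose i)"
  note Z = kernel_mass_pos[OF k]
  have int: "integrable lborel (\<lambda>y. g 0 y * cos_kernel k ((y - x) / real i))" for i
    by (rule bounded_support_integrable(1)[where B = B])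
      (use B supp cos_kernel_le_1[of k] cos_kernel_nonneg[of k] in \<open>auto simp: abs_mult intro: order_trans[OF mult_left_le]\<close>)
  have int2: "integrable lborel (\<lambda>t. indicator ?I t * (g 0 (x + real i * t) * cos_kernel k t))" for i
  proof (rule Bochner_Integration.integrable_bound[where f = "\<lambda>t. B * indicat_real ?I t"])
    show "integrable lborel (\<lambda>t. B * indicat_real ?I t)"
      by (intro integrable_mult_right integrable_indicator_Icc)
    show "AE t in lborel. norm (indicator ?I t * (g 0 (x + real i * t) * cos_kernel k t)) \<le> norm (B * indicat_real ?I t)"
    proof (rule AE_I2)
      fix t
      have "\<bar>g 0 (x + real i * t)\<bar> * cos_kernel k t \<le> B * 1"
        using B[of 0] by (intro mult_mono B cos_kernel_le_1 cos_kernel_nonneg) linarith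
      then show "norm (indicator ?I t * (g 0 (x + real i * t) * cos_kernel k t)) \<le> norm (B * indicat_real ?I t)"
        using B[of 0] cos_kernel_nonneg[of k t] by (auto simp: indicator_def abs_mult)
    qed
  qed measurable
  have "(\<integral>y. g 0 y * jackson_kernel M k (y - x) \<partial>lborel)
      = (\<integral>y. (\<Sum>i\<in>{1..M}. (- ?c i / (real i * ?Z)) * (g 0 y * cos_kernel k ((y - x) / real i))) \<partial>lborel)"
    unfolding jackson_kernel_def sum_distrib_left by (intro Bochner_Integration.integral_cong refl sum.cong) simp
  also have "\<dots> = (\<Sum>i\<in>{1..M}. (- ?c i / (real i * ?Z)) * (\<integral>y. g 0 y * cos_kernel k ((y - x) / real i) \<partial>lborel))"
    by (subst Bochner_Integration.integral_sum) (intro integrable_mult_right int, simp)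
  also have "\<dots> = (\<Sum>i\<in>{1..M}. (- ?c i / ?Z) * (\<integral>t. indicator ?I t * (g 0 (x + real i * t) * cos_kernel k t) \<partial>lborel))"
  proof (intro sum.cong refl)
    fix i assume "i \<in> {1..M}"
    then show "(- ?c i / (real i * ?Z)) * (\<integral>y. g 0 y * cos_kernel k ((y - x) / real i) \<partial>lborel)
        = (- ?c i / ?Z) * (\<integral>t. indicator ?I t * (g 0 (x + real i * t) * cos_kernel k t) \<partial>lborel)"
      using dilated_kernel_integral[where F = "g 0" and i = i, OF k _ x supp, symmetric] by (simp add: mult.commute)
  qed
  finally have J: "(\<integral>y. g 0 y * jackson_kernel M k (y - x) \<partial>lborel)
      = (\<Sum>i\<in>{1..M}. (- ?c i / ?Z) * (\<integral>t. indicator ?I t * (g 0 (x + real i * t) * cos_kernel k t) \<partial>lborel))" .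
  have g0: "g 0 x = (?c 0 / ?Z) * (\<integral>t. indicator ?I t * (g 0 (x + real 0 * t) * cos_kernel k t) \<partial>lborel)"
  proof -
    have "(\<integral>t. indicator ?I t * (g 0 (x + real 0 * t) * cos_kernel k t) \<partial>lborel)
        = (\<integral>t. g 0 x * (indicator ?I t * cos_kernel k t) \<partial>lborel)"
      by (simp add: mult.left_commute)
    also have "\<dots> = g 0 x * ?Z" by (simp add: kernel_mass_def)
    finally show ?thesis using Z by simp
  qed
  have split: "{..M} = insert 0 {1..M}" by auto
  have "g 0 x - (\<integral>y. g 0 y * jackson_kernel M k (y - x) \<partial>lborel)
      = (\<Sum>i\<le>M. (?c i / ?Z) * (\<integral>t. indicator ?I t * (g 0 (x + real i * t) * cos_kernel k t) \<partial>lborel))"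
    unfolding J split by (subst g0) (simp add: sum_negf)
  also have "\<dots> = (\<integral>t. (\<Sum>i\<le>M. (?c i / ?Z) * (indicator ?I t * (g 0 (x + real i * t) * cos_kernel k t))) \<partial>lborel)"
    by (subst Bochner_Integration.integral_sum) (intro integrable_mult_right int2, simp)
  finally have eq: "g 0 x - (\<integral>y. g 0 y * jackson_kernel M k (y - x) \<partial>lborel)
      = (\<integral>t. (\<Sum>i\<le>M. (?c i / ?Z) * (indicator ?I t * (g 0 (x + real i * t) * cos_kernel k t))) \<partial>lborel)" .
  have "\<bar>g 0 x - (\<integral>y. g 0 y * jackson_kernel M k (y - x) \<partial>lborel)\<bar>
      \<le> (\<integral>t. \<bar>\<Sum>i\<le>M. (?c i / ?Z) * (indicator ?I t * (g 0 (x + real i * t) * cos_kernel k t))\<bar> \<partial>lborel)"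
    unfolding eq using integral_norm_bound[of lborel "\<lambda>t. \<Sum>i\<le>M. (?c i / ?Z) * (indicator ?I t * (g 0 (x + real i * t) * cos_kernel k t))"] by simp
  also have "\<dots> \<le> (\<integral>t. (D / ?Z) * (indicator ?I t * (\<bar>t\<bar> ^ M * cos_kernel k t)) \<partial>lborel)"
  proof (intro integral_mono)
    show "integrable lborel (\<lambda>t. \<bar>\<Sum>i\<le>M. (?c i / ?Z) * (indicator ?I t * (g 0 (x + real i * t) * cos_kernel k t))\<bar>)"
      by (intro integrable_abs Bochner_Integration.integrable_sum integrable_mult_right int2)
    show "integrable lborel (\<lambda>t. (D / ?Z) * (indicator ?I t * (\<bar>t\<bar> ^ M * cos_kernel k t)))"
      by (intro integrable_mult_right kernel_moment(2) k)
    fix t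
    have "(\<Sum>i\<le>M. (?c i / ?Z) * (indicator ?I t * (g 0 (x + real i * t) * cos_kernel k t)))
        = (indicator ?I t * cos_kernel k t / ?Z) * (\<Sum>i\<le>M. ?c i * g 0 (x + real i * t))"
      unfolding sum_distrib_left by (intro sum.cong refl) simp
    then have "\<bar>\<Sum>i\<le>M. (?c i / ?Z) * (indicator ?I t * (g 0 (x + real i * t) * cos_kernel k t))\<bar>
        = (indicator ?I t * cos_kernel k t / ?Z) * \<bar>\<Sum>i\<le>M. ?c i * g 0 (x + real i * t)\<bar>"
      using Z cos_kernel_nonneg[of k t] by (simp add: abs_mult)
    also have "\<dots> \<le> (indicator ?I t * cos_kernel k t / ?Z) * (D * \<bar>t\<bar> ^ M)"
      using Z cos_kernel_nonneg[of k t]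
      by (intro mult_left_mono finite_difference_bound deriv D) auto
    finally show "\<bar>\<Sum>i\<le>M. (?c i / ?Z) * (indicator ?I t * (g 0 (x + real i * t) * cos_kernel k t))\<bar>
        \<le> (D / ?Z) * (indicator ?I t * (\<bar>t\<bar> ^ M * cos_kernel k t))"
      by (simp add: mult_ac)
  qed
  also have "\<dots> = (D / ?Z) * (\<integral>t. indicator ?I t * (\<bar>t\<bar> ^ M * cos_kernel k t) \<partial>lborel)"
    by simp
  also have "\<dots> \<le> (D * (4 * real k / 3)) * (abs_moment M / real k ^ (M + 1))"
  proof (intro mult_mono kernel_moment(1) k)
    have "0 \<le> D" using D[of 0] by linarith
    moreover have "1 / ?Z \<le> 4 * real k / 3"
      using kernel_mass_ge[OF k] Z k by (simp add: field_simps)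
    ultimately have "D * (1 / ?Z) \<le> D * (4 * real k / 3)" by (intro mult_left_mono)
    then show "D / ?Z \<le> D * (4 * real k / 3)" by simp
    show "0 \<le> D * (4 * real k / 3)" using \<open>0 \<le> D\<close> by simp
    show "0 \<le> (\<integral>t. indicator ?I t * (\<bar>t\<bar> ^ M * cos_kernel k t) \<partial>lborel)"
      by (intro integral_nonneg_AE AE_I2 mult_nonneg_nonneg cos_kernel_nonneg) auto
  qed
  also have "\<dots> = D * (4 / 3 * abs_moment M) / real k ^ M" using k by (simp add: field_simps)
  finally show ?thesis .
qed

lemma jackson_kernel_mass:
  assumes k: "k \<ge> 1" and x: "\<bar>x\<bar> \<le> real k / 2"
  shows "integrable lborel (\<lambda>y. indicator {-1..1} y * \<bar>jackson_kernel M k (y - x)\<bar>)"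
    and "(\<integral>y. indicator {-1..1} y * \<bar>jackson_kernel M k (y - x)\<bar> \<partial>lborel) \<le> 2 ^ M"
proof -
  let ?I = "{- (pi * real k / 2)..pi * real k / 2}"
  let ?Z = "kernel_mass k"
  let ?F = "\<lambda>i y. (real (M choose i) / (real i * ?Z)) * (indicat_real {-1..1} y * cos_kernel k ((y - x) / real i))"
  note Z = kernel_mass_pos[OF k]
  have int: "integrable lborel (\<lambda>y. indicat_real {-1..1} y * cos_kernel k ((y - x) / real i))" for i
    by (rule Bochner_Integration.integrable_bound[OF integrable_indicator_Icc[of "-1" 1]])
      (auto simp: abs_mult cos_kernel_nonneg cos_kernel_le_1 indicator_def)
  have Si: "integrable lborel (\<lambda>y. \<Sum>i\<in>{1..M}. ?F i y)"
    by (intro Bochner_Integration.integrable_sum integrable_mult_right int)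
  have le: "indicator {-1..1} y * \<bar>jackson_kernel M k (y - x)\<bar> \<le> (\<Sum>i\<in>{1..M}. ?F i y)" for y :: real
  proof -
    have "\<bar>jackson_kernel M k (y - x)\<bar> \<le> (\<Sum>i\<in>{1..M}. \<bar>(-1) ^ (i + 1) * real (M choose i) * (cos_kernel k ((y - x) / real i) / (real i * ?Z))\<bar>)"
      unfolding jackson_kernel_def by (rule sum_abs)
    also have "\<dots> = (\<Sum>i\<in>{1..M}. (real (M choose i) / (real i * ?Z)) * cos_kernel k ((y - x) / real i))"
      using Z by (intro sum.cong refl) (simp add: abs_mult power_abs cos_kernel_nonneg)
    finally have "indicator {-1..1} y * \<bar>jackson_kernel M k (y - x)\<bar>
        \<le> indicator {-1..1} y * (\<Sum>i\<in>{1..M}. (real (M choose i) / (real i * ?Z)) * cos_kernel k ((y - x) / real i))"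
      by (intro mult_left_mono) auto
    also have "\<dots> = (\<Sum>i\<in>{1..M}. ?F i y)" unfolding sum_distrib_left by (intro sum.cong refl) simp
    finally show ?thesis .
  qed
  show i1: "integrable lborel (\<lambda>y. indicator {-1..1} y * \<bar>jackson_kernel M k (y - x)\<bar>)"
  proof (rule Bochner_Integration.integrable_bound[OF Si])
    show "AE y in lborel. norm (indicator {-1..1} y * \<bar>jackson_kernel M k (y - x)\<bar>) \<le> norm (\<Sum>i\<in>{1..M}. ?F i y)"
    proof (rule AE_I2)
      fix y
      have "norm (indicator {-1..1} y * \<bar>jackson_kernel M k (y - x)\<bar>) = indicator {-1..1} y * \<bar>jackson_kernel M k (y - x)\<bar>"
        by (simp add: abs_mult)
      also have "\<dots> \<le> norm (\<Sum>i\<in>{1..M}. ?F i y)"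
        unfolding real_norm_def by (rule order_trans[OF le abs_ge_self])
      finally show "norm (indicator {-1..1} y * \<bar>jackson_kernel M k (y - x)\<bar>) \<le> norm (\<Sum>i\<in>{1..M}. ?F i y)" .
    qed
  qed measurable
  have "(\<integral>y. indicator {-1..1} y * \<bar>jackson_kernel M k (y - x)\<bar> \<partial>lborel) \<le> (\<integral>y. (\<Sum>i\<in>{1..M}. ?F i y) \<partial>lborel)"
    by (intro integral_mono i1 Si le)
  also have "\<dots> = (\<Sum>i\<in>{1..M}. (real (M choose i) / ?Z) * ((\<integral>y. indicat_real {-1..1} y * cos_kernel k ((y - x) / real i) \<partial>lborel) / real i))"
    by (subst Bochner_Integration.integral_sum) (intro integrable_mult_right int, simp add: mult.commute)
  also have "\<dots> \<le> (\<Sum>i\<in>{1..M}. (real (M choose i) / ?Z) * ?Z)"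
  proof (intro sum_mono mult_left_mono)
    fix i assume i: "i \<in> {1..M}"
    have "(\<integral>y. indicat_real {-1..1} y * cos_kernel k ((y - x) / real i) \<partial>lborel) / real i
        = (\<integral>t. indicator ?I t * (indicat_real {-1..1} (x + real i * t) * cos_kernel k t) \<partial>lborel)"
      using i by (intro dilated_kernel_integral k x) (auto simp: indicator_def)
    also have "\<dots> \<le> (\<integral>t. indicator ?I t * cos_kernel k t \<partial>lborel)"
    proof (intro integral_mono kernel_integrable)
      show "integrable lborel (\<lambda>t. indicator ?I t * (indicat_real {-1..1} (x + real i * t) * cos_kernel k t))"
        by (rule Bochner_Integration.integrable_bound[OF integrable_indicator_Icc[of "- (pi * real k / 2)" "pi * real k / 2"]])
          (auto simp: abs_mult cos_kernel_nonneg cos_kernel_le_1 indicator_def)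
    qed (auto simp: indicator_def cos_kernel_nonneg)
    finally show "(\<integral>y. indicat_real {-1..1} y * cos_kernel k ((y - x) / real i) \<partial>lborel) / real i \<le> ?Z"
      by (simp add: kernel_mass_def)
  qed (use Z in auto)
  also have "\<dots> \<le> 2 ^ M" using Z sum_choose_le[of M] by simp
  finally show "(\<integral>y. indicator {-1..1} y * \<bar>jackson_kernel M k (y - x)\<bar> \<partial>lborel) \<le> 2 ^ M" .
qed

text \<open>\<open>M\<close> derivatives bounded by \<open>D\<close>. The witness \<open>g\<close> lists the derivatives, which keeps families of
functions with common bounds free of iterated \<open>deriv\<close>.\<close>

definition diff_bounded :: "nat \<Rightarrow> real \<Rightarrow> (real \<Rightarrow> real) \<Rightarrow> bool" where
  "diff_bounded M D h \<longleftrightarrow> (\<exists>g. g 0 = h \<and>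
     (\<forall>n<M. \<forall>y. (g n has_real_derivative g (Suc n) y) (at y)) \<and> (\<forall>n\<le>M. \<forall>y. \<bar>g n y\<bar> \<le> D))"

lemma jackson_error_diff_bounded:
  assumes k: "k \<ge> 1" and x: "\<bar>x\<bar> \<le> real k / 2"
    and h: "diff_bounded M D h" and supp: "\<And>y. \<bar>y\<bar> > 1 \<Longrightarrow> h y = 0" and meas: "h \<in> borel_measurable borel"
  shows "\<bar>h x - (\<integral>y. h y * jackson_kernel M k (y - x) \<partial>lborel)\<bar> \<le> D * (4 / 3 * abs_moment M) / real k ^ M"
proof -
  obtain g where g: "g 0 = h" "\<And>n y. n < M \<Longrightarrow> (g n has_real_derivative g (Suc n) y) (at y)"
    "\<And>n y. n \<le> M \<Longrightarrow> \<bar>g n y\<bar> \<le> D"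
    using h unfolding diff_bounded_def by blast
  show ?thesis
    using jackson_error_line[where g = g and M = M, OF k x g(2) g(3)[OF order_refl] g(3)[OF le0]] supp meas
    by (simp add: g(1))
qed

text \<open>Bounds on the pure partial derivatives: the planar kernel is a product, and its error is
estimated one variable at a time.\<close>

definition line_smooth :: "nat \<Rightarrow> real \<Rightarrow> (real \<Rightarrow> real \<Rightarrow> real) \<Rightarrow> bool" where
  "line_smooth M D f \<longleftrightarrow>
     (\<lambda>z. f (fst z) (snd z)) \<in> borel_measurable borel \<and>
     (\<forall>x y. \<bar>x\<bar> > 1 \<or> \<bar>y\<bar> > 1 \<longrightarrow> f x y = 0) \<and>
     (\<forall>y. diff_bounded M D (\<lambda>x. f x y)) \<and> (\<forall>x. diff_bounded M D (\<lambda>y. f x y))"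

definition jackson2 :: "nat \<Rightarrow> nat \<Rightarrow> (real \<Rightarrow> real \<Rightarrow> real) \<Rightarrow> real \<Rightarrow> real \<Rightarrow> real" where
  "jackson2 M k f x1 x2 =
     (\<integral>y1. (\<integral>y2. f y1 y2 * jackson_kernel M k (y2 - x2) \<partial>lborel) * jackson_kernel M k (y1 - x1) \<partial>lborel)"

context
  fixes M k :: nat and D :: real and f :: "real \<Rightarrow> real \<Rightarrow> real"
  assumes k: "k \<ge> 1" and f: "line_smooth M D f"
begin

lemma line_smooth_bound: "\<bar>f x y\<bar> \<le> D"
  using f unfolding line_smooth_def diff_bounded_def by (metis le0)

lemma line_smooth_pair_measurable: "(\<lambda>z. f (fst z) (snd z)) \<in> borel_measurable (borel \<Otimes>\<^sub>M borel)"
  using f by (simp add: line_smooth_def borel_prod)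

lemma line_smooth_measurable: "(\<lambda>x. f x y) \<in> borel_measurable borel" "(\<lambda>y. f x y) \<in> borel_measurable borel"
proof -
  have "(\<lambda>x. (\<lambda>z. f (fst z) (snd z)) (x, y)) \<in> borel_measurable borel"
    by (rule measurable_compose[OF _ line_smooth_pair_measurable]) simp
  then show "(\<lambda>x. f x y) \<in> borel_measurable borel" by simp
  have "(\<lambda>y. (\<lambda>z. f (fst z) (snd z)) (x, y)) \<in> borel_measurable borel"
    by (rule measurable_compose[OF _ line_smooth_pair_measurable]) simp
  then show "(\<lambda>y. f x y) \<in> borel_measurable borel" by simp
qed

lemma line_smooth_support: "\<bar>x\<bar> > 1 \<or> \<bar>y\<bar> > 1 \<Longrightarrow> f x y = 0"
  using f by (auto simp: line_smooth_def)

lemma inner_average_measurable: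
  assumes [measurable]: "K \<in> borel_measurable borel"
  shows "(\<lambda>y1. \<integral>y2. f y1 y2 * K y2 \<partial>lborel) \<in> borel_measurable (borel :: real measure)"
proof (rule lborel.borel_measurable_lebesgue_integral)
  note [measurable] = line_smooth_pair_measurable
  have "(\<lambda>z. f (fst z) (snd z) * K (snd z)) \<in> borel_measurable (borel \<Otimes>\<^sub>M borel)" by measurable
  then show "(\<lambda>(y1, y2). f y1 y2 * K y2) \<in> borel_measurable (borel \<Otimes>\<^sub>M lborel)"
    by (simp add: case_prod_unfold)
qed

text \<open>Far from the origin the approximation is wrong, by periodicity, but it stays polynomially
bounded in \<open>k\<close>.\<close>

lemma jackson2_bound: "\<bar>jackson2 M k f x1 x2\<bar> \<le> 8 * D * 4 ^ M * real k ^ 2"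
  and jackson2_outer_integrable:
    "integrable lborel (\<lambda>y1. (\<integral>y2. f y1 y2 * jackson_kernel M k (y2 - x2) \<partial>lborel) * jackson_kernel M k (y1 - x1))"
proof -
  let ?b = "2 ^ M * (4 * real k / 3)"
  let ?h = "\<lambda>y1. \<integral>y2. f y1 y2 * jackson_kernel M k (y2 - x2) \<partial>lborel"
  have D0: "0 \<le> D" using line_smooth_bound[of 0 0] by linarith
  note [measurable] = line_smooth_measurable
  have hm [measurable]: "?h \<in> borel_measurable borel"
    by (rule inner_average_measurable) measurable
  have h: "\<bar>?h y1\<bar> \<le> 2 * (D * ?b)" for y1
  proof (rule bounded_support_integrable(2))
    show "\<bar>f y1 y2 * jackson_kernel M k (y2 - x2)\<bar> \<le> D * ?b" for y2
      unfolding abs_mult by (intro mult_mono line_smooth_bound abs_jackson_kernel_le k D0) auto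
  qed (auto simp: line_smooth_support)
  have h0: "?h y1 = 0" if "\<bar>y1\<bar> > 1" for y1
    using that by (simp add: line_smooth_support)
  have b: "\<bar>?h y1 * jackson_kernel M k (y1 - x1)\<bar> \<le> 2 * (D * ?b) * ?b" for y1
    unfolding abs_mult using D0 by (intro mult_mono h abs_jackson_kernel_le k) auto
  have m: "(\<lambda>y1. ?h y1 * jackson_kernel M k (y1 - x1)) \<in> borel_measurable borel" by measurable
  have z: "?h y1 * jackson_kernel M k (y1 - x1) = 0" if "\<bar>y1\<bar> > 1" for y1 using h0[OF that] by simp
  show "integrable lborel (\<lambda>y1. ?h y1 * jackson_kernel M k (y1 - x1))"
    by (rule bounded_support_integrable(1)[OF m z b])
  have "\<bar>jackson2 M k f x1 x2\<bar> \<le> 2 * (2 * (D * ?b) * ?b)"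
    unfolding jackson2_def by (rule bounded_support_integrable(2)[OF m z b])
  also have "\<dots> = (64 / 9) * (D * (2 ^ M * 2 ^ M) * real k ^ 2)" by (simp add: power2_eq_square)
  also have "(2::real) ^ M * 2 ^ M = 4 ^ M" by (simp only: power_mult_distrib[symmetric]) simp
  also have "(64 / 9) * (D * 4 ^ M * real k ^ 2) \<le> 8 * (D * 4 ^ M * real k ^ 2)"
    using D0 by (intro mult_right_mono) auto
  finally show "\<bar>jackson2 M k f x1 x2\<bar> \<le> 8 * D * 4 ^ M * real k ^ 2" by simp
qed

text \<open>Replace the first variable by its average, then the second; averaging the second error over the
first variable costs the mass \<open>2 ^ M\<close> of the kernel.\<close>

lemma jackson2_error_near:
  assumes x1: "\<bar>x1\<bar> \<le> real k / 2" and x2: "\<bar>x2\<bar> \<le> real k / 2"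
  shows "\<bar>f x1 x2 - jackson2 M k f x1 x2\<bar> \<le> (1 + 2 ^ M) * (D * (4 / 3 * abs_moment M) / real k ^ M)"
proof -
  let ?h = "\<lambda>y1. \<integral>y2. f y1 y2 * jackson_kernel M k (y2 - x2) \<partial>lborel"
  define e where "e = D * (4 / 3 * abs_moment M) / real k ^ M"
  note [measurable] = line_smooth_measurable
  have hm [measurable]: "?h \<in> borel_measurable borel"
    by (rule inner_average_measurable) measurable
  have e1: "\<bar>f x1 x2 - (\<integral>y1. f y1 x2 * jackson_kernel M k (y1 - x1) \<partial>lborel)\<bar> \<le> e"
    unfolding e_def
    by (rule jackson_error_diff_bounded[OF k x1, where h = "\<lambda>x. f x x2"])
      (use f in \<open>auto simp: line_smooth_def line_smooth_measurable\<close>)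
  have e2: "\<bar>f y1 x2 - ?h y1\<bar> \<le> e" for y1
    unfolding e_def
    by (rule jackson_error_diff_bounded[OF k x2, where h = "\<lambda>y. f y1 y"])
      (use f in \<open>auto simp: line_smooth_def line_smooth_measurable\<close>)
  have i1: "integrable lborel (\<lambda>y1. f y1 x2 * jackson_kernel M k (y1 - x1))"
  proof (rule bounded_support_integrable(1))
    have D0: "0 \<le> D" using line_smooth_bound[of 0 0] by linarith
    show "\<bar>f y1 x2 * jackson_kernel M k (y1 - x1)\<bar> \<le> D * (2 ^ M * (4 * real k / 3))" for y1
      unfolding abs_mult by (intro mult_mono line_smooth_bound abs_jackson_kernel_le k D0) auto
  qed (auto simp: line_smooth_support)
  have "(\<integral>y1. f y1 x2 * jackson_kernel M k (y1 - x1) \<partial>lborel) - jackson2 M k f x1 x2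
      = (\<integral>y1. (f y1 x2 - ?h y1) * jackson_kernel M k (y1 - x1) \<partial>lborel)"
    unfolding jackson2_def left_diff_distrib
    by (rule Bochner_Integration.integral_diff[OF i1 jackson2_outer_integrable, symmetric])
  also have "\<bar>\<dots>\<bar> \<le> (\<integral>y1. \<bar>(f y1 x2 - ?h y1) * jackson_kernel M k (y1 - x1)\<bar> \<partial>lborel)"
    using integral_norm_bound[of lborel "\<lambda>y1. (f y1 x2 - ?h y1) * jackson_kernel M k (y1 - x1)"] by simp
  also have "\<dots> \<le> (\<integral>y1. e * (indicator {-1..1} y1 * \<bar>jackson_kernel M k (y1 - x1)\<bar>) \<partial>lborel)"
  proof (intro integral_mono integrable_mult_right jackson_kernel_mass(1) k x1)
    show "integrable lborel (\<lambda>y1. \<bar>(f y1 x2 - ?h y1) * jackson_kernel M k (y1 - x1)\<bar>)"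
      unfolding left_diff_distrib
      by (intro integrable_abs Bochner_Integration.integrable_diff i1 jackson2_outer_integrable)
    fix y1
    show "\<bar>(f y1 x2 - ?h y1) * jackson_kernel M k (y1 - x1)\<bar> \<le> e * (indicator {-1..1} y1 * \<bar>jackson_kernel M k (y1 - x1)\<bar>)"
    proof (cases "\<bar>y1\<bar> > 1")
      case True
      then have "y1 \<notin> {-1..1}" by auto
      then show ?thesis using True by (simp add: line_smooth_support)
    next
      case False
      then have "y1 \<in> {-1..1}" by auto
      then show ?thesis using e2[of y1] by (simp add: abs_mult mult_right_mono)
    qed
  qed
  also have "\<dots> = e * (\<integral>y1. indicator {-1..1} y1 * \<bar>jackson_kernel M k (y1 - x1)\<bar> \<partial>lborel)" by simp
  also have "\<dots> \<le> e * 2 ^ M"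
    using e2[of 0] by (intro mult_left_mono jackson_kernel_mass(2) k x1) linarith
  finally have "\<bar>(\<integral>y1. f y1 x2 * jackson_kernel M k (y1 - x1) \<partial>lborel) - jackson2 M k f x1 x2\<bar> \<le> e * 2 ^ M" .
  with e1 have "\<bar>f x1 x2 - jackson2 M k f x1 x2\<bar> \<le> e + e * 2 ^ M" by linarith
  then show ?thesis unfolding e_def[symmetric] by (simp add: algebra_simps)
qed

text \<open>Outside the central square \<open>k\<close> is at most twice \<open>1 + |x1| + |x2|\<close>, so the crude bound \<open>k\<^sup>2\<close> is traded
for \<open>k ^ (- M)\<close> times a polynomial in \<open>x\<close>. A Gaussian weight will absorb this polynomial.\<close>

lemma jackson2_error:
  "\<bar>f x1 x2 - jackson2 M k f x1 x2\<bar>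
    \<le> ((1 + 2 ^ M) * (4 / 3 * abs_moment M) + 9 * 4 ^ M * 2 ^ (M + 2)) * D / real k ^ M
      * (1 + \<bar>x1\<bar> + \<bar>x2\<bar>) ^ (M + 2)"
proof -
  define r where "r = 1 + \<bar>x1\<bar> + \<bar>x2\<bar>"
  have D0: "0 \<le> D" using line_smooth_bound[of 0 0] by linarith
  have m0: "0 \<le> abs_moment M" unfolding abs_moment_def by (intro integral_nonneg_AE) auto
  have r1: "1 \<le> r ^ (M + 2)" unfolding r_def by (rule one_le_power) simp
  let ?a = "(1 + 2 ^ M) * (4 / 3 * abs_moment M) * D / real k ^ M"
  let ?b = "9 * 4 ^ M * 2 ^ (M + 2) * D / real k ^ M"
  have ab: "0 \<le> ?a" "0 \<le> ?b" using D0 m0 by auto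
  have eq: "((1 + 2 ^ M) * (4 / 3 * abs_moment M) + 9 * 4 ^ M * 2 ^ (M + 2)) * D / real k ^ M = ?a + ?b"
    by (simp add: distrib_right add_divide_distrib)
  show ?thesis
  proof (cases "\<bar>x1\<bar> \<le> real k / 2 \<and> \<bar>x2\<bar> \<le> real k / 2")
    case True
    then have "\<bar>f x1 x2 - jackson2 M k f x1 x2\<bar> \<le> ?a * 1"
      using jackson2_error_near[of x1 x2] by (simp add: mult_ac)
    also have "\<dots> \<le> (?a + ?b) * r ^ (M + 2)" using ab r1 by (intro mult_mono) auto
    finally show ?thesis unfolding eq r_def .
  next
    case False
    then have "real k \<le> 2 * r" by (auto simp: r_def)
    then have "real k ^ (M + 2) \<le> (2 * r) ^ (M + 2)" by (intro power_mono) auto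
    then have "real k ^ 2 * real k ^ M \<le> (2 * r) ^ (M + 2)"
      by (simp only: power_add[of "real k"] mult.commute)
    then have k2: "real k ^ 2 \<le> (2 * r) ^ (M + 2) / real k ^ M"
      using k by (simp only: pos_le_divide_eq zero_less_power of_nat_0_less_iff)
    have "\<bar>f x1 x2 - jackson2 M k f x1 x2\<bar> \<le> D + 8 * D * 4 ^ M * real k ^ 2"
      using line_smooth_bound[of x1 x2] jackson2_bound[of x1 x2] by linarith
    also have "\<dots> \<le> 9 * D * 4 ^ M * real k ^ 2"
    proof -
      have "1 * 1 \<le> (4::real) ^ M * real k ^ 2" using k by (intro mult_mono) (auto simp: one_le_power)
      then have "D * 1 \<le> D * (4 ^ M * real k ^ 2)" using D0 by (intro mult_left_mono) auto
      then show ?thesis by (simp add: mult.commute)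
    qed
    also have "\<dots> \<le> 9 * D * 4 ^ M * ((2 * r) ^ (M + 2) / real k ^ M)"
      using D0 by (intro mult_left_mono k2) auto
    also have "\<dots> = ?b * r ^ (M + 2)" by (simp add: power_mult_distrib)
    also have "\<dots> \<le> (?a + ?b) * r ^ (M + 2)" using ab r1 by (intro mult_right_mono) auto
    finally show ?thesis unfolding eq r_def .
  qed
qed

end

section \<open>From exponential sums to Gaussian mixtures\<close>

lemma cos_power_exponential_sum:
  "complex_of_real (cos \<theta> ^ n) = (\<Sum>r\<le>n. complex_of_real (real (n choose r) / 2 ^ n) * exp (\<i> * complex_of_real ((2 * real r - real n) * \<theta>)))"
proof -
  let ?z = "\<i> * complex_of_real \<theta>"
  have "complex_of_real (cos \<theta>) = (exp ?z + exp (- ?z)) / 2"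
    by (simp add: cos_of_real[symmetric] cos_exp_eq)
  then have "complex_of_real (cos \<theta> ^ n) = (exp ?z + exp (- ?z)) ^ n / 2 ^ n"
    by (simp only: of_real_power power_divide)
  also have "(exp ?z + exp (- ?z)) ^ n = (\<Sum>r\<le>n. of_nat (n choose r) * exp ?z ^ r * exp (- ?z) ^ (n - r))"
    by (rule binomial_ring)
  also have "\<dots> / 2 ^ n = (\<Sum>r\<le>n. complex_of_real (real (n choose r) / 2 ^ n) * exp (\<i> * complex_of_real ((2 * real r - real n) * \<theta>)))"
    unfolding sum_divide_distrib
  proof (intro sum.cong refl)
    fix r assume "r \<in> {..n}"
    then have nr: "of_nat (n - r) = (of_nat n - of_nat r :: complex)" by (simp add: of_nat_diff)
    have "exp ?z ^ r * exp (- ?z) ^ (n - r) = exp (of_nat r * ?z + of_nat (n - r) * (- ?z))"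
      by (simp only: exp_of_nat_mult exp_add)
    also have "of_nat r * ?z + of_nat (n - r) * (- ?z) = \<i> * complex_of_real ((2 * real r - real n) * \<theta>)"
      unfolding nr by (simp add: algebra_simps)
    finally have e: "exp ?z ^ r * exp (- ?z) ^ (n - r) = exp (\<i> * complex_of_real ((2 * real r - real n) * \<theta>))" .
    show "of_nat (n choose r) * exp ?z ^ r * exp (- ?z) ^ (n - r) / 2 ^ n
        = complex_of_real (real (n choose r) / 2 ^ n) * exp (\<i> * complex_of_real ((2 * real r - real n) * \<theta>))"
      unfolding mult.assoc e by simp
  qed
  finally show ?thesis .
qed

lemma jackson_kernel_exponential_sum:
  "\<exists>(S :: (nat \<times> nat) set) a \<beta>. finite S \<and> card S = M * (2 * k ^ 4 + 1) \<and>
     (\<forall>t. complex_of_real (jackson_kernel M k t) = (\<Sum>s\<in>S. a s * exp (\<i> * complex_of_real (\<beta> s * t))))"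
proof -
  let ?n = "2 * k ^ 4"
  define S where "S = {1..M} \<times> {..?n}"
  define a where "a s = complex_of_real ((-1) ^ (fst s + 1) * real (M choose fst s) / (real (fst s) * kernel_mass k) * (real (?n choose snd s) / 2 ^ ?n))" for s :: "nat \<times> nat"
  define \<beta> where "\<beta> s = (2 * real (snd s) - real ?n) / (real (fst s) * real k)" for s :: "nat \<times> nat"
  have "complex_of_real (jackson_kernel M k t) = (\<Sum>s\<in>S. a s * exp (\<i> * complex_of_real (\<beta> s * t)))" for t
  proof -
    have "complex_of_real (jackson_kernel M k t)
        = (\<Sum>i\<in>{1..M}. complex_of_real ((-1) ^ (i + 1) * real (M choose i) / (real i * kernel_mass k)) * complex_of_real (cos (t / real i / real k) ^ ?n))"
      unfolding jackson_kernel_def cos_kernel_def of_real_sum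
      by (intro sum.cong refl) simp
    also have "\<dots> = (\<Sum>i\<in>{1..M}. \<Sum>r\<le>?n. a (i, r) * exp (\<i> * complex_of_real (\<beta> (i, r) * t)))"
      unfolding cos_power_exponential_sum sum_distrib_left
    proof (intro sum.cong refl)
      fix i r
      have "(2 * real r - real ?n) * (t / real i / real k) = \<beta> (i, r) * t"
        by (simp add: \<beta>_def)
      then show "complex_of_real ((-1) ^ (i + 1) * real (M choose i) / (real i * kernel_mass k)) *
          (complex_of_real (real (?n choose r) / 2 ^ ?n) * exp (\<i> * complex_of_real ((2 * real r - real ?n) * (t / real i / real k))))
          = a (i, r) * exp (\<i> * complex_of_real (\<beta> (i, r) * t))"
        by (simp only: a_def fst_conv snd_conv of_real_mult mult.assoc)
    qed
    also have "\<dots> = (\<Sum>s\<in>S. a s * exp (\<i> * complex_of_real (\<beta> s * t)))"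
      unfolding S_def by (simp add: sum.cartesian_product case_prod_unfold)
    finally show ?thesis .
  qed
  then show ?thesis
    by (intro exI[of _ S] exI[of _ a] exI[of _ \<beta>]) (simp add: S_def)
qed

lemma integrable_bounded_on_unit:
  fixes F :: "real \<Rightarrow> complex"
  assumes "F \<in> borel_measurable borel" "\<And>y. \<bar>y\<bar> > 1 \<Longrightarrow> F y = 0" "\<And>y. cmod (F y) \<le> B"
  shows "integrable lborel F" "cmod (\<integral>y. F y \<partial>lborel) \<le> 2 * B"
proof -
  note [measurable] = assms(1)
  have m: "(\<lambda>y. cmod (F y)) \<in> borel_measurable borel" by measurable
  have *: "integrable lborel (\<lambda>y. cmod (F y))" "\<bar>\<integral>y. cmod (F y) \<partial>lborel\<bar> \<le> 2 * B"
    using bounded_support_integrable[OF m, of B] assms by auto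
  show "integrable lborel F"
    using *(1) assms(1) by (simp add: integrable_norm_iff)
  show "cmod (\<integral>y. F y \<partial>lborel) \<le> 2 * B"
    using integral_norm_bound[of lborel F] *(2) by linarith
qed

text \<open>The kernel is a sum of exponentials in \<open>y - x\<close>, which separate into a factor in \<open>y\<close>, integrated
against \<open>f\<close>, and a factor in \<open>x\<close>.\<close>

lemma jackson2_exponential_sum:
  assumes k: "k \<ge> 1" and f: "line_smooth M D f"
  shows "\<exists>(S :: ((nat \<times> nat) \<times> (nat \<times> nat)) set) c b. finite S \<and> card S = (M * (2 * k ^ 4 + 1))\<^sup>2 \<and>
    (\<forall>\<xi> :: real^2. complex_of_real (jackson2 M k f (\<xi> $ 1) (\<xi> $ 2)) = (\<Sum>s\<in>S. c s * exp (- (\<i> * complex_of_real (b s \<bullet> \<xi>)))))"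
proof -
  obtain S :: "(nat \<times> nat) set" and a \<beta> where S: "finite S" "card S = M * (2 * k ^ 4 + 1)"
    and K: "\<And>t. complex_of_real (jackson_kernel M k t) = (\<Sum>s\<in>S. a s * exp (\<i> * complex_of_real (\<beta> s * t)))"
    using jackson_kernel_exponential_sum[of M k] by blast
  let ?e = "\<lambda>s y. exp (\<i> * complex_of_real (\<beta> s * y))"
  have esplit: "?e s (y - x) = ?e s y * exp (- (\<i> * complex_of_real (\<beta> s * x)))" for s x y
    by (simp only: exp_add[symmetric]) (simp add: algebra_simps)
  note [measurable] = line_smooth_measurable[OF k f] line_smooth_pair_measurable[OF k f]
  have bd: "\<bar>f x y\<bar> \<le> D" for x y by (rule line_smooth_bound[OF k f])
  have D0: "0 \<le> D" using bd[of 0 0] by linarith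
  define I where "I s y1 = (\<integral>y2. complex_of_real (f y1 y2) * ?e s y2 \<partial>lborel)" for s y1
  have fi: "integrable lborel (\<lambda>y2. complex_of_real (f y1 y2) * ?e s y2)" "cmod (I s y1) \<le> 2 * D" for s y1
    unfolding I_def
    by (rule integrable_bounded_on_unit[where B = D]; use bd line_smooth_support[OF k f] in \<open>simp add: norm_mult\<close>)+
  have Im [measurable]: "I s \<in> borel_measurable borel" for s
    unfolding I_def[abs_def]
  proof (rule lborel.borel_measurable_lebesgue_integral)
    have "(\<lambda>z. complex_of_real (f (fst z) (snd z)) * ?e s (snd z)) \<in> borel_measurable (borel \<Otimes>\<^sub>M borel)" by measurable
    then show "(\<lambda>(y1, y2). complex_of_real (f y1 y2) * ?e s y2) \<in> borel_measurable (borel \<Otimes>\<^sub>M lborel)"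
      by (simp add: case_prod_unfold)
  qed
  have I0: "I s y1 = 0" if "\<bar>y1\<bar> > 1" for s y1
    using that by (simp add: I_def line_smooth_support[OF k f])
  have Ii: "integrable lborel (\<lambda>y1. I s' y1 * ?e s y1)" for s s'
    by (rule integrable_bounded_on_unit(1)[where B = "2 * D"]) (use fi(2) I0 in \<open>simp_all add: norm_mult\<close>)
  define c where "c s = a (fst s) * a (snd s) * (\<integral>y1. I (snd s) y1 * ?e (fst s) y1 \<partial>lborel)" for s
  define b :: "(nat \<times> nat) \<times> (nat \<times> nat) \<Rightarrow> real^2" where "b s = vector [\<beta> (fst s), \<beta> (snd s)]" for s
  have inner: "complex_of_real (\<integral>y2. f y1 y2 * jackson_kernel M k (y2 - x2) \<partial>lborel)
      = (\<Sum>s'\<in>S. (a s' * exp (- (\<i> * complex_of_real (\<beta> s' * x2)))) * I s' y1)" for y1 x2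
  proof -
    have "complex_of_real (\<integral>y2. f y1 y2 * jackson_kernel M k (y2 - x2) \<partial>lborel)
        = (\<integral>y2. complex_of_real (f y1 y2 * jackson_kernel M k (y2 - x2)) \<partial>lborel)"
      by (rule integral_complex_of_real[symmetric])
    also have "\<dots> = (\<integral>y2. (\<Sum>s'\<in>S. (a s' * exp (- (\<i> * complex_of_real (\<beta> s' * x2)))) * (complex_of_real (f y1 y2) * ?e s' y2)) \<partial>lborel)"
    proof (intro Bochner_Integration.integral_cong refl)
      fix y2
      have "complex_of_real (f y1 y2 * jackson_kernel M k (y2 - x2))
          = complex_of_real (f y1 y2) * (\<Sum>s'\<in>S. a s' * ?e s' (y2 - x2))"
        by (simp only: of_real_mult[of "f y1 y2"] K)
      then show "complex_of_real (f y1 y2 * jackson_kernel M k (y2 - x2))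
          = (\<Sum>s'\<in>S. (a s' * exp (- (\<i> * complex_of_real (\<beta> s' * x2)))) * (complex_of_real (f y1 y2) * ?e s' y2))"
        unfolding esplit sum_distrib_left by (simp only: mult_ac)
    qed
    also have "\<dots> = (\<Sum>s'\<in>S. (a s' * exp (- (\<i> * complex_of_real (\<beta> s' * x2)))) * I s' y1)"
      unfolding I_def
      by (subst Bochner_Integration.integral_sum, intro integrable_mult_right fi(1))
        (simp only: Bochner_Integration.integral_mult_right_zero)
    finally show ?thesis .
  qed
  have "complex_of_real (jackson2 M k f (\<xi> $ 1) (\<xi> $ 2)) = (\<Sum>s\<in>S \<times> S. c s * exp (- (\<i> * complex_of_real (b s \<bullet> \<xi>))))" for \<xi> :: "real^2"
  proof -
    let ?x1 = "\<xi> $ 1" and ?x2 = "\<xi> $ 2"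
    let ?g = "\<lambda>s s'. a s * a s' * (exp (- (\<i> * complex_of_real (\<beta> s * ?x1))) * exp (- (\<i> * complex_of_real (\<beta> s' * ?x2))))"
    have "complex_of_real (jackson2 M k f ?x1 ?x2)
        = (\<integral>y1. complex_of_real ((\<integral>y2. f y1 y2 * jackson_kernel M k (y2 - ?x2) \<partial>lborel) * jackson_kernel M k (y1 - ?x1)) \<partial>lborel)"
      unfolding jackson2_def by (rule integral_complex_of_real[symmetric])
    also have "\<dots> = (\<integral>y1. (\<Sum>s\<in>S. \<Sum>s'\<in>S. ?g s s' * (I s' y1 * ?e s y1)) \<partial>lborel)"
    proof (intro Bochner_Integration.integral_cong refl)
      fix y1
      have "complex_of_real ((\<integral>y2. f y1 y2 * jackson_kernel M k (y2 - ?x2) \<partial>lborel) * jackson_kernel M k (y1 - ?x1))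
          = (\<Sum>s\<in>S. a s * ?e s (y1 - ?x1)) * (\<Sum>s'\<in>S. (a s' * exp (- (\<i> * complex_of_real (\<beta> s' * ?x2)))) * I s' y1)"
        by (rule trans[OF of_real_mult], subst mult.commute) (simp only: inner K)
      also have "\<dots> = (\<Sum>s\<in>S. \<Sum>s'\<in>S. ?g s s' * (I s' y1 * ?e s y1))"
        unfolding sum_product esplit by (simp only: mult_ac)
      finally show "complex_of_real ((\<integral>y2. f y1 y2 * jackson_kernel M k (y2 - ?x2) \<partial>lborel) * jackson_kernel M k (y1 - ?x1))
          = (\<Sum>s\<in>S. \<Sum>s'\<in>S. ?g s s' * (I s' y1 * ?e s y1))" .
    qed
    also have "\<dots> = (\<Sum>s\<in>S. \<Sum>s'\<in>S. ?g s s' * (\<integral>y1. I s' y1 * ?e s y1 \<partial>lborel))"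
      by (subst Bochner_Integration.integral_sum, intro Bochner_Integration.integrable_sum integrable_mult_right Ii,
          subst Bochner_Integration.integral_sum, intro integrable_mult_right Ii)
        (simp only: Bochner_Integration.integral_mult_right_zero)
    also have "\<dots> = (\<Sum>s\<in>S. \<Sum>s'\<in>S. c (s, s') * exp (- (\<i> * complex_of_real (b (s, s') \<bullet> \<xi>))))"
    proof (intro sum.cong refl)
      fix s s'
      have "exp (- (\<i> * complex_of_real (b (s, s') \<bullet> \<xi>))) = exp (- (\<i> * complex_of_real (\<beta> s * ?x1))) * exp (- (\<i> * complex_of_real (\<beta> s' * ?x2)))"
        unfolding exp_add[symmetric] by (rule arg_cong[where f = exp]) (simp add: b_def inner_real2 algebra_simps)
      then show "?g s s' * (\<integral>y1. I s' y1 * ?e s y1 \<partial>lborel) = c (s, s') * exp (- (\<i> * complex_of_real (b (s, s') \<bullet> \<xi>)))"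
        by (simp only: c_def fst_conv snd_conv mult_ac)
    qed
    also have "\<dots> = (\<Sum>s\<in>S \<times> S. c s * exp (- (\<i> * complex_of_real (b s \<bullet> \<xi>))))"
      by (simp add: sum.cartesian_product case_prod_unfold)
    finally show ?thesis .
  qed
  then show ?thesis
    using S by (intro exI[of _ "S \<times> S"] exI[of _ c] exI[of _ b]) (simp add: power2_eq_square)
qed

text \<open>Modulation becomes translation: each exponential in the sum above turns into one Gaussian.\<close>

lemma inverse_fourier_modulated_gaussian:
  fixes b :: "real^2"
  shows "integrable lborel (\<lambda>\<xi>. complex_of_real (exp (- (norm \<xi>)\<^sup>2 / 2)) * exp (- (\<i> * complex_of_real (b \<bullet> \<xi>))))"
    and "inverse_fourier (\<lambda>\<xi>. complex_of_real (exp (- (norm \<xi>)\<^sup>2 / 2)) * exp (- (\<i> * complex_of_real (b \<bullet> \<xi>)))) x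
      = complex_of_real (exp (- (norm (x - b))\<^sup>2 / 2))"
proof -
  let ?g = "\<lambda>\<xi>. complex_of_real (exp (- (norm \<xi>)\<^sup>2 / 2)) * exp (- (\<i> * complex_of_real (b \<bullet> \<xi>)))"
  have "?g = (\<lambda>\<xi>. complex_of_real (exp (- (norm \<xi>)\<^sup>2 / 2)) * exp (\<i> * complex_of_real (\<xi> \<bullet> (- b))))"
    by (simp add: inner_commute)
  then show i: "integrable lborel ?g"
    using integrable_gaussian_exp2[of "- b"] by simp
  then have m: "?g \<in> borel_measurable borel" by auto
  have "?g \<xi> * exp (\<i> * complex_of_real (x \<bullet> \<xi>)) = complex_of_real (exp (- (norm \<xi>)\<^sup>2 / 2)) * exp (\<i> * complex_of_real (\<xi> \<bullet> (x - b)))" for \<xi>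
  proof -
    have "exp (- (\<i> * complex_of_real (b \<bullet> \<xi>))) * exp (\<i> * complex_of_real (x \<bullet> \<xi>)) = exp (\<i> * complex_of_real (\<xi> \<bullet> (x - b)))"
      unfolding exp_add[symmetric] by (rule arg_cong[where f = exp]) (simp add: inner_diff_right inner_commute algebra_simps)
    then show ?thesis by (simp only: mult.assoc)
  qed
  then show "inverse_fourier ?g x = complex_of_real (exp (- (norm (x - b))\<^sup>2 / 2))"
    unfolding inverse_fourier_eq_lborel[OF m] by (simp only: fourier_gaussian) (simp add: scaleR_conv_of_real)
qed

lemma shifted_gaussian_in_dict:
  fixes b :: "real^2"
  shows "(\<lambda>x. complex_of_real (exp (- (norm (x - b))\<^sup>2 / 2))) \<in> gaussian_dict"
proof -
  let ?A = "mat (1 / sqrt 2) :: real^2^2"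
  have A: "?A *v x = (1 / sqrt 2) *\<^sub>R x" for x
    by (simp add: vector2_eq_iff matrix_vector_mult_def mat_def sum_2)
  have "det ?A = 1 / 2" by (simp add: det_2 mat_def)
  then have "invertible ?A" by (simp add: invertible_det_nz)
  moreover have "(\<lambda>x. complex_of_real (exp (- (norm (x - b))\<^sup>2 / 2))) = (\<lambda>x. complex_of_real (exp (- (norm (?A *v (x - b)))\<^sup>2)))"
    unfolding A by (simp add: power_divide)
  ultimately show ?thesis unfolding gaussian_dict_def by blast
qed

lemma gauss_mix_single: "G \<in> gaussian_dict \<Longrightarrow> gauss_mix 1 (\<lambda>x. c * G x)"
  unfolding gauss_mix_def by (intro exI[of _ "\<lambda>_. c"] exI[of _ "\<lambda>_. G"]) auto

lemma integrable_polynomial_gaussian: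
  assumes "c \<ge> 1 / 4"
  shows "integrable lborel (\<lambda>s::real. (1 + \<bar>s\<bar>) ^ n * exp (- (c * s\<^sup>2)))"
proof (rule Bochner_Integration.integrable_bound)
  show "integrable lborel (\<lambda>s::real. 2 ^ n * (\<bar>s\<bar> ^ 0 * exp (- (s\<^sup>2 / 4)) + \<bar>s\<bar> ^ n * exp (- (s\<^sup>2 / 4))))"
    by (intro integrable_mult_right Bochner_Integration.integrable_add integrable_abs_moment)
  show "AE s::real in lborel. norm ((1 + \<bar>s\<bar>) ^ n * exp (- (c * s\<^sup>2)))
      \<le> norm (2 ^ n * (\<bar>s\<bar> ^ 0 * exp (- (s\<^sup>2 / 4)) + \<bar>s\<bar> ^ n * exp (- (s\<^sup>2 / 4))))"
  proof (rule AE_I2)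
    fix s :: real
    have "(1 + \<bar>s\<bar>) ^ n \<le> (2 * max 1 \<bar>s\<bar>) ^ n" by (intro power_mono) auto
    also have "\<dots> \<le> 2 ^ n * (1 + \<bar>s\<bar> ^ n)"
      unfolding power_mult_distrib by (intro mult_left_mono) (auto simp: max_def)
    finally have 1: "(1 + \<bar>s\<bar>) ^ n \<le> 2 ^ n * (1 + \<bar>s\<bar> ^ n)" .
    have "(1 / 4) * s\<^sup>2 \<le> c * s\<^sup>2" using assms by (intro mult_right_mono) auto
    then have 2: "exp (- (c * s\<^sup>2)) \<le> exp (- (s\<^sup>2 / 4))" by simp
    have "(1 + \<bar>s\<bar>) ^ n * exp (- (c * s\<^sup>2)) \<le> 2 ^ n * (1 + \<bar>s\<bar> ^ n) * exp (- (s\<^sup>2 / 4))"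
      using 1 2 by (intro mult_mono) auto
    then show "norm ((1 + \<bar>s\<bar>) ^ n * exp (- (c * s\<^sup>2)))
      \<le> norm (2 ^ n * (\<bar>s\<bar> ^ 0 * exp (- (s\<^sup>2 / 4)) + \<bar>s\<bar> ^ n * exp (- (s\<^sup>2 / 4))))"
      by (simp add: abs_mult distrib_right mult.assoc)
  qed
qed measurable

lemma integrable_polynomial_gaussian2:
  assumes c: "c \<ge> 1 / 4"
  shows "integrable lborel (\<lambda>\<xi>::real^2. (1 + \<bar>\<xi> $ 1\<bar> + \<bar>\<xi> $ 2\<bar>) ^ n * exp (- (c * (norm \<xi>)\<^sup>2)))"
proof (rule Bochner_Integration.integrable_bound)
  let ?h = "\<lambda>s::real. (1 + \<bar>s\<bar>) ^ n * exp (- (c * s\<^sup>2))"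
  show "integrable lborel (\<lambda>\<xi>::real^2. ?h (\<xi> $ 1) * ?h (\<xi> $ 2))"
    by (intro integrable_real2_product integrable_polynomial_gaussian c)
  show "AE \<xi>::real^2 in lborel. norm ((1 + \<bar>\<xi> $ 1\<bar> + \<bar>\<xi> $ 2\<bar>) ^ n * exp (- (c * (norm \<xi>)\<^sup>2))) \<le> norm (?h (\<xi> $ 1) * ?h (\<xi> $ 2))"
  proof (rule AE_I2)
    fix \<xi> :: "real^2"
    have "exp (- (c * (norm \<xi>)\<^sup>2)) = exp (- (c * (\<xi> $ 1)\<^sup>2)) * exp (- (c * (\<xi> $ 2)\<^sup>2))"
      unfolding exp_add[symmetric] norm_real2_sq by (simp add: algebra_simps)
    moreover have "1 + \<bar>\<xi> $ 1\<bar> + \<bar>\<xi> $ 2\<bar> \<le> (1 + \<bar>\<xi> $ 1\<bar>) * (1 + \<bar>\<xi> $ 2\<bar>)" by (simp add: algebra_simps)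
    then have "(1 + \<bar>\<xi> $ 1\<bar> + \<bar>\<xi> $ 2\<bar>) ^ n \<le> (1 + \<bar>\<xi> $ 1\<bar>) ^ n * (1 + \<bar>\<xi> $ 2\<bar>) ^ n"
      unfolding power_mult_distrib[symmetric] by (intro power_mono) auto
    then have "(1 + \<bar>\<xi> $ 1\<bar> + \<bar>\<xi> $ 2\<bar>) ^ n * (exp (- (c * (\<xi> $ 1)\<^sup>2)) * exp (- (c * (\<xi> $ 2)\<^sup>2)))
        \<le> ((1 + \<bar>\<xi> $ 1\<bar>) ^ n * (1 + \<bar>\<xi> $ 2\<bar>) ^ n) * (exp (- (c * (\<xi> $ 1)\<^sup>2)) * exp (- (c * (\<xi> $ 2)\<^sup>2)))"
      by (intro mult_right_mono) auto
    ultimately show "norm ((1 + \<bar>\<xi> $ 1\<bar> + \<bar>\<xi> $ 2\<bar>) ^ n * exp (- (c * (norm \<xi>)\<^sup>2))) \<le> norm (?h (\<xi> $ 1) * ?h (\<xi> $ 2))"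
      by (simp add: abs_mult mult_ac)
  qed
qed measurable

definition gaussian_moment2 :: "nat \<Rightarrow> real" where
  "gaussian_moment2 n = (\<integral>\<xi>. (1 + \<bar>(\<xi>::real^2) $ 1\<bar> + \<bar>\<xi> $ 2\<bar>) ^ n * exp (- (1 * (norm \<xi>)\<^sup>2)) \<partial>lborel)"

text \<open>Write the frequency profile as a Gaussian times \<open>f\<close> and replace \<open>f\<close> by its Jackson approximation.
The inverse transform of the result is a mixture of translated Gaussians, and by Plancherel the
error is that of the approximation in a Gaussian-weighted norm, where polynomial growth is
harmless.\<close>

lemma gaussian_mixture_fourier_approximation:
  assumes k: "k \<ge> 1" and f: "line_smooth M D f"
  defines "C \<equiv> (1 + 2 ^ M) * (4 / 3 * abs_moment M) + 9 * 4 ^ M * 2 ^ (M + 2)"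
  defines "\<Psi> \<equiv> \<lambda>\<xi>::real^2. complex_of_real (exp (- (norm \<xi>)\<^sup>2 / 2) * f (\<xi> $ 1) (\<xi> $ 2))"
  shows "\<exists>S. gauss_mix ((M * (2 * k ^ 4 + 1))\<^sup>2) S \<and>
      norm_sq (\<lambda>x. inverse_fourier \<Psi> x - S x) \<le> (C * D / real k ^ M)\<^sup>2 * gaussian_moment2 (2 * (M + 2))"
    and "integrable lborel \<Psi>"
proof -
  obtain S :: "((nat \<times> nat) \<times> (nat \<times> nat)) set" and c b where S: "finite S" "card S = (M * (2 * k ^ 4 + 1))\<^sup>2"
    and J: "\<And>\<xi> :: real^2. complex_of_real (jackson2 M k f (\<xi> $ 1) (\<xi> $ 2)) = (\<Sum>s\<in>S. c s * exp (- (\<i> * complex_of_real (b s \<bullet> \<xi>))))"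
    using jackson2_exponential_sum[OF k f] by blast
  let ?G = "\<lambda>s \<xi>. complex_of_real (exp (- (norm \<xi>)\<^sup>2 / 2)) * exp (- (\<i> * complex_of_real (b s \<bullet> \<xi>)))"
  define T where "T x = (\<Sum>s\<in>S. c s * complex_of_real (exp (- (norm (x - b s))\<^sup>2 / 2)))" for x
  define E where "E \<xi> = \<Psi> \<xi> - (\<Sum>s\<in>S. c s * ?G s \<xi>)" for \<xi>
  note [measurable] = line_smooth_pair_measurable[OF k f]
  have "(\<lambda>\<xi>::real^2. (\<lambda>z. f (fst z) (snd z)) (\<xi> $ 1, \<xi> $ 2)) \<in> borel_measurable borel"
    by (rule measurable_compose[OF _ line_smooth_pair_measurable[OF k f]]) measurable
  then have [measurable]: "(\<lambda>\<xi>::real^2. f (\<xi> $ 1) (\<xi> $ 2)) \<in> borel_measurable borel" by simp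
  have [measurable]: "\<Psi> \<in> borel_measurable borel" unfolding \<Psi>_def by measurable
  have Gi: "integrable lborel (\<lambda>\<xi>. c s * ?G s \<xi>)" for s
    by (intro integrable_mult_right inverse_fourier_modulated_gaussian(1))
  have Gm [measurable]: "(\<lambda>\<xi>. c s * ?G s \<xi>) \<in> borel_measurable borel" for s
    using Gi[of s] by auto
  have Em [measurable]: "E \<in> borel_measurable borel" unfolding E_def[abs_def] by measurable
  let ?w = "\<lambda>\<xi>::real^2. 1 + \<bar>\<xi> $ 1\<bar> + \<bar>\<xi> $ 2\<bar>"
  have C0: "0 \<le> C" unfolding C_def abs_moment_def
    by (intro add_nonneg_nonneg mult_nonneg_nonneg integral_nonneg_AE) auto
  have D0: "0 \<le> D" using line_smooth_bound[OF k f, of 0 0] by linarith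
  have E_le: "cmod (E \<xi>) \<le> (C * D / real k ^ M) * (?w \<xi> ^ (M + 2) * exp (- (1 / 2 * (norm \<xi>)\<^sup>2)))" for \<xi>
  proof -
    have "(\<Sum>s\<in>S. c s * ?G s \<xi>) = complex_of_real (exp (- (norm \<xi>)\<^sup>2 / 2)) * complex_of_real (jackson2 M k f (\<xi> $ 1) (\<xi> $ 2))"
      unfolding J sum_distrib_left by (simp only: mult_ac)
    then have "E \<xi> = complex_of_real (exp (- (norm \<xi>)\<^sup>2 / 2) * (f (\<xi> $ 1) (\<xi> $ 2) - jackson2 M k f (\<xi> $ 1) (\<xi> $ 2)))"
      unfolding E_def \<Psi>_def by (simp add: right_diff_distrib)
    then have "cmod (E \<xi>) = exp (- (norm \<xi>)\<^sup>2 / 2) * \<bar>f (\<xi> $ 1) (\<xi> $ 2) - jackson2 M k f (\<xi> $ 1) (\<xi> $ 2)\<bar>"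
      by (simp only: norm_of_real abs_mult abs_exp_cancel)
    also have "\<dots> \<le> exp (- (norm \<xi>)\<^sup>2 / 2) * (C * D / real k ^ M * ?w \<xi> ^ (M + 2))"
      unfolding C_def by (intro mult_left_mono jackson2_error k f) auto
    finally show ?thesis by (simp add: mult_ac)
  qed
  have Ei: "integrable lborel E"
  proof (rule Bochner_Integration.integrable_bound)
    show "integrable lborel (\<lambda>\<xi>. (C * D / real k ^ M) * (?w \<xi> ^ (M + 2) * exp (- (1 / 2 * (norm \<xi>)\<^sup>2))))"
      by (intro integrable_mult_right integrable_polynomial_gaussian2) simp
    show "AE \<xi> in lborel. norm (E \<xi>) \<le> norm ((C * D / real k ^ M) * (?w \<xi> ^ (M + 2) * exp (- (1 / 2 * (norm \<xi>)\<^sup>2))))"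
      by (intro AE_I2) (simp only: real_norm_def, rule order_trans[OF E_le abs_ge_self])
  qed simp
  have E2_le: "(cmod (E \<xi>))\<^sup>2 \<le> (C * D / real k ^ M)\<^sup>2 * (?w \<xi> ^ (2 * (M + 2)) * exp (- (1 * (norm \<xi>)\<^sup>2)))" for \<xi>
  proof -
    have "(cmod (E \<xi>))\<^sup>2 \<le> ((C * D / real k ^ M) * (?w \<xi> ^ (M + 2) * exp (- (1 / 2 * (norm \<xi>)\<^sup>2))))\<^sup>2"
      by (intro power_mono E_le) auto
    also have "\<dots> = (C * D / real k ^ M)\<^sup>2 * ((?w \<xi> ^ (M + 2))\<^sup>2 * (exp (- (1 / 2 * (norm \<xi>)\<^sup>2)))\<^sup>2)"
      by (simp only: power_mult_distrib)
    also have "(?w \<xi> ^ (M + 2))\<^sup>2 = ?w \<xi> ^ (2 * (M + 2))" by (simp only: power_mult[symmetric] mult.commute)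
    also have "(exp (- (1 / 2 * (norm \<xi>)\<^sup>2)))\<^sup>2 = exp (- (1 * (norm \<xi>)\<^sup>2))"
      by (simp add: power2_eq_square flip: exp_add)
    finally show ?thesis .
  qed
  have Wi: "integrable lborel (\<lambda>\<xi>. (C * D / real k ^ M)\<^sup>2 * (?w \<xi> ^ (2 * (M + 2)) * exp (- (1 * (norm \<xi>)\<^sup>2))))"
    by (intro integrable_mult_right integrable_polynomial_gaussian2) simp
  have E2i: "integrable lborel (\<lambda>\<xi>. (cmod (E \<xi>))\<^sup>2)"
  proof (rule Bochner_Integration.integrable_bound[OF Wi])
    show "AE \<xi> in lborel. norm ((cmod (E \<xi>))\<^sup>2) \<le> norm ((C * D / real k ^ M)\<^sup>2 * (?w \<xi> ^ (2 * (M + 2)) * exp (- (1 * (norm \<xi>)\<^sup>2))))"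
      by (intro AE_I2) (simp only: real_norm_def abs_power2, rule order_trans[OF E2_le abs_ge_self])
  qed simp
  have "integrable lborel (\<lambda>\<xi>. E \<xi> + (\<Sum>s\<in>S. c s * ?G s \<xi>))"
    by (intro Bochner_Integration.integrable_add Bochner_Integration.integrable_sum Ei Gi)
  then show \<Psi>i: "integrable lborel \<Psi>" by (simp add: E_def)
  have "inverse_fourier \<Psi> x - T x = inverse_fourier E x" for x
  proof -
    let ?e = "\<lambda>\<xi>. exp (\<i> * complex_of_real (x \<bullet> \<xi>))"
    have Gm': "?G s \<in> borel_measurable borel" for s
      using inverse_fourier_modulated_gaussian(1)[of "b s"] by auto
    have "inverse_fourier E x = (1 / (2 * pi)) *\<^sub>R (\<integral>\<xi>. \<Psi> \<xi> * ?e \<xi> - (\<Sum>s\<in>S. c s * (?G s \<xi> * ?e \<xi>)) \<partial>lborel)"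
      unfolding inverse_fourier_eq_lborel[OF Em] E_def left_diff_distrib sum_distrib_right by (simp only: mult.assoc)
    also have "(\<integral>\<xi>. \<Psi> \<xi> * ?e \<xi> - (\<Sum>s\<in>S. c s * (?G s \<xi> * ?e \<xi>)) \<partial>lborel)
        = (\<integral>\<xi>. \<Psi> \<xi> * ?e \<xi> \<partial>lborel) - (\<Sum>s\<in>S. c s * (\<integral>\<xi>. ?G s \<xi> * ?e \<xi> \<partial>lborel))"
      using integrable_mult_iexp[OF \<Psi>i, of x] integrable_mult_iexp[OF inverse_fourier_modulated_gaussian(1), of _ x]
      by (subst Bochner_Integration.integral_diff; (subst Bochner_Integration.integral_sum)?)
        (auto intro!: Bochner_Integration.integrable_sum integrable_mult_right)
    also have "(1 / (2 * pi)) *\<^sub>R \<dots> = inverse_fourier \<Psi> x - (\<Sum>s\<in>S. c s * inverse_fourier (?G s) x)"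
      unfolding inverse_fourier_eq_lborel[OF Gm'] by (simp add: inverse_fourier_eq_lborel scaleR_diff_right scaleR_sum_right)
    also have "\<dots> = inverse_fourier \<Psi> x - T x"
      unfolding inverse_fourier_modulated_gaussian(2) T_def ..
    finally show ?thesis by (rule sym)
  qed
  then have "norm_sq (\<lambda>x. inverse_fourier \<Psi> x - T x) \<le> (\<integral>\<xi>. (cmod (E \<xi>))\<^sup>2 \<partial>lborel)"
    using plancherel_inequality[OF Ei E2i] by simp
  also have "\<dots> \<le> (\<integral>\<xi>. (C * D / real k ^ M)\<^sup>2 * (?w \<xi> ^ (2 * (M + 2)) * exp (- (1 * (norm \<xi>)\<^sup>2))) \<partial>lborel)"
    by (intro integral_mono E2i Wi E2_le)
  also have "\<dots> = (C * D / real k ^ M)\<^sup>2 * gaussian_moment2 (2 * (M + 2))"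
    unfolding gaussian_moment2_def by (rule Bochner_Integration.integral_mult_right_zero)
  finally have "norm_sq (\<lambda>x. inverse_fourier \<Psi> x - T x) \<le> (C * D / real k ^ M)\<^sup>2 * gaussian_moment2 (2 * (M + 2))" .
  moreover have "gauss_mix (\<Sum>s\<in>S. 1) T"
    unfolding T_def[abs_def] by (intro gauss_mix_sum S(1) gauss_mix_single shifted_gaussian_in_dict)
  then have "gauss_mix ((M * (2 * k ^ 4 + 1))\<^sup>2) T" using S(2) by simp
  ultimately show "\<exists>S. gauss_mix ((M * (2 * k ^ 4 + 1))\<^sup>2) S \<and>
      norm_sq (\<lambda>x. inverse_fourier \<Psi> x - S x) \<le> (C * D / real k ^ M)\<^sup>2 * gaussian_moment2 (2 * (M + 2))"
    by blast
qed

section \<open>Families of functions with common derivative bounds\<close>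

text \<open>\<open>n\<close> derivatives in the last argument, on the open sets \<open>U i\<close> and with bounds that do not depend on
the parameter \<open>i\<close>. The recursion on \<open>n\<close> suits closure properties: a derivative of a product or an
inverse is again built from functions with fewer derivatives.\<close>

fun smooth_family :: "nat \<Rightarrow> ('i \<Rightarrow> real set) \<Rightarrow> ('i \<Rightarrow> real \<Rightarrow> real) \<Rightarrow> bool" where
  "smooth_family 0 U f \<longleftrightarrow> (\<exists>B. \<forall>i. \<forall>x\<in>U i. \<bar>f i x\<bar> \<le> B)"
| "smooth_family (Suc n) U f \<longleftrightarrow> (\<exists>B. \<forall>i. \<forall>x\<in>U i. \<bar>f i x\<bar> \<le> B) \<and>
     (\<exists>f'. (\<forall>i. \<forall>x\<in>U i. (f i has_real_derivative f' i x) (at x)) \<and> smooth_family n U f')"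

declare smooth_family.simps(2) [simp del]

lemma smooth_family_SucE:
  assumes "smooth_family (Suc n) U f"
  obtains B f' where "\<forall>i. \<forall>x\<in>U i. \<bar>f i x\<bar> \<le> B" "\<forall>i. \<forall>x\<in>U i. (f i has_real_derivative f' i x) (at x)"
    "smooth_family n U f'"
proof -
  from assms[unfolded smooth_family.simps]
  have "\<exists>B. \<forall>i. \<forall>x\<in>U i. \<bar>f i x\<bar> \<le> B"
    and "\<exists>f'. (\<forall>i. \<forall>x\<in>U i. (f i has_real_derivative f' i x) (at x)) \<and> smooth_family n U f'"
    by (rule conjunct1, rule conjunct2)
  then show ?thesis using that by (elim exE conjE)
qed

lemma smooth_family_bounded: "smooth_family n U f \<Longrightarrow> \<exists>B. \<forall>i. \<forall>x\<in>U i. \<bar>f i x\<bar> \<le> B"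
proof (cases n)
  case (Suc m)
  assume "smooth_family n U f"
  then show ?thesis unfolding Suc by (rule smooth_family_SucE) (rule exI)
qed simp

lemma smooth_family_SucI:
  assumes "\<forall>i. \<forall>x\<in>U i. \<bar>f i x\<bar> \<le> B" "\<forall>i. \<forall>x\<in>U i. (f i has_real_derivative f' i x) (at x)"
    and "smooth_family n U f'"
  shows "smooth_family (Suc n) U f"
  by (simp only: smooth_family.simps) (intro conjI exI[of _ B] exI[of _ f'] assms)

lemma smooth_family_cong:
  assumes "\<And>i. open (U i)" and eq: "\<And>i x. x \<in> U i \<Longrightarrow> f i x = g i x" and "smooth_family n U f"
  shows "smooth_family n U g"
proof (cases n)
  case 0
  then show ?thesis using assms(3) eq by simp
next
  case (Suc m)
  obtain B f' where B: "\<forall>i. \<forall>x\<in>U i. \<bar>f i x\<bar> \<le> B" and d: "\<forall>i. \<forall>x\<in>U i. (f i has_real_derivative f' i x) (at x)" and s: "smooth_family m U f'"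
    using assms(3) unfolding Suc by (rule smooth_family_SucE)
  have b: "\<forall>i. \<forall>x\<in>U i. \<bar>g i x\<bar> \<le> B" using B eq by simp
  have "\<forall>i. \<forall>x\<in>U i. (g i has_real_derivative f' i x) (at x)"
  proof (intro allI ballI)
    fix i x assume "x \<in> U i"
    then show "(g i has_real_derivative f' i x) (at x)"
      by (intro has_field_derivative_transform_within_open[OF d[rule_format] assms(1)[of i]] eq)
  qed
  then show ?thesis unfolding Suc by (rule smooth_family_SucI[OF b _ s])
qed

lemma smooth_family_Suc_D: "smooth_family (Suc n) U f \<Longrightarrow> smooth_family n U f"
proof (induction n arbitrary: f)
  case (Suc n)
  obtain B f' where b: "\<forall>i. \<forall>x\<in>U i. \<bar>f i x\<bar> \<le> B" and d: "\<forall>i. \<forall>x\<in>U i. (f i has_real_derivative f' i x) (at x)"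
    and s: "smooth_family (Suc n) U f'"
    using Suc.prems by (rule smooth_family_SucE)
  show ?case by (rule smooth_family_SucI[OF b d Suc.IH[OF s]])
qed (simp add: smooth_family_bounded)

lemma smooth_family_const: "(\<And>i x. x \<in> U i \<Longrightarrow> \<bar>c i\<bar> \<le> B) \<Longrightarrow> smooth_family n U (\<lambda>i x. c i)"
proof (induction n arbitrary: c B)
  case 0
  then show ?case by auto
next
  case (Suc n)
  have "smooth_family n U (\<lambda>i x. 0)" by (rule Suc.IH[of _ 0]) simp
  then show ?case
    using Suc.prems by (intro smooth_family_SucI[of U "\<lambda>i x. c i" B "\<lambda>i x. 0"]) auto
qed

lemma smooth_family_ident: "(\<And>i x. x \<in> U i \<Longrightarrow> \<bar>x\<bar> \<le> B) \<Longrightarrow> smooth_family n U (\<lambda>i x. x)"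
proof (cases n)
  case (Suc m)
  assume "\<And>i x. x \<in> U i \<Longrightarrow> \<bar>x\<bar> \<le> B"
  moreover have "smooth_family m U (\<lambda>i x. 1)" by (rule smooth_family_const[of _ _ 1]) simp
  ultimately show ?thesis
    unfolding Suc by (intro smooth_family_SucI[of U "\<lambda>i x. x" B "\<lambda>i x. 1"]) auto
qed auto

lemma smooth_family_add:
  "smooth_family n U f \<Longrightarrow> smooth_family n U g \<Longrightarrow> smooth_family n U (\<lambda>i x. f i x + g i x)"
proof (induction n arbitrary: f g)
  case 0
  then obtain A B where "\<forall>i. \<forall>x\<in>U i. \<bar>f i x\<bar> \<le> A" "\<forall>i. \<forall>x\<in>U i. \<bar>g i x\<bar> \<le> B" by auto
  then have "\<forall>i. \<forall>x\<in>U i. \<bar>f i x + g i x\<bar> \<le> A + B" 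
    by (intro allI ballI order_trans[OF abs_triangle_ineq] add_mono) auto
  then show ?case by auto
next
  case (Suc n)
  obtain A f' where A: "\<forall>i. \<forall>x\<in>U i. \<bar>f i x\<bar> \<le> A" and f': "\<forall>i. \<forall>x\<in>U i. (f i has_real_derivative f' i x) (at x)" "smooth_family n U f'"
    using Suc.prems(1) by (rule smooth_family_SucE)
  obtain B g' where B: "\<forall>i. \<forall>x\<in>U i. \<bar>g i x\<bar> \<le> B" and g': "\<forall>i. \<forall>x\<in>U i. (g i has_real_derivative g' i x) (at x)" "smooth_family n U g'"
    using Suc.prems(2) by (rule smooth_family_SucE)
  note d = f'(1) g'(1) and s = f'(2) g'(2)
  have b: "\<forall>i. \<forall>x\<in>U i. \<bar>f i x + g i x\<bar> \<le> A + B"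
    using A B by (intro allI ballI order_trans[OF abs_triangle_ineq] add_mono) auto
  have "\<forall>i. \<forall>x\<in>U i. ((\<lambda>x. f i x + g i x) has_real_derivative f' i x + g' i x) (at x)"
    by (intro allI ballI DERIV_add d[rule_format])
  then show ?case by (rule smooth_family_SucI[OF b _ Suc.IH[OF s]])
qed

lemma smooth_family_mult:
  "smooth_family n U f \<Longrightarrow> smooth_family n U g \<Longrightarrow> smooth_family n U (\<lambda>i x. f i x * g i x)"
proof (induction n arbitrary: f g)
  case 0
  then obtain A B where "\<forall>i. \<forall>x\<in>U i. \<bar>f i x\<bar> \<le> A" "\<forall>i. \<forall>x\<in>U i. \<bar>g i x\<bar> \<le> B" by auto
  then have "\<forall>i. \<forall>x\<in>U i. \<bar>f i x * g i x\<bar> \<le> A * B" unfolding abs_mult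
    by (intro allI ballI mult_mono') auto
  then show ?case by auto
next
  case (Suc n)
  obtain A f' where A: "\<forall>i. \<forall>x\<in>U i. \<bar>f i x\<bar> \<le> A" and f': "\<forall>i. \<forall>x\<in>U i. (f i has_real_derivative f' i x) (at x)" "smooth_family n U f'"
    using Suc.prems(1) by (rule smooth_family_SucE)
  obtain B g' where B: "\<forall>i. \<forall>x\<in>U i. \<bar>g i x\<bar> \<le> B" and g': "\<forall>i. \<forall>x\<in>U i. (g i has_real_derivative g' i x) (at x)" "smooth_family n U g'"
    using Suc.prems(2) by (rule smooth_family_SucE)
  note d = f'(1) g'(1) and s = f'(2) g'(2)
  have b: "\<forall>i. \<forall>x\<in>U i. \<bar>f i x * g i x\<bar> \<le> A * B"
    unfolding abs_mult using A B by (intro allI ballI mult_mono') auto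
  have "\<forall>i. \<forall>x\<in>U i. ((\<lambda>x. f i x * g i x) has_real_derivative f' i x * g i x + g' i x * f i x) (at x)"
    by (intro allI ballI DERIV_mult d[rule_format])
  moreover have "smooth_family n U (\<lambda>i x. f' i x * g i x + g' i x * f i x)"
    by (intro smooth_family_add Suc.IH s smooth_family_Suc_D[OF Suc.prems(1)] smooth_family_Suc_D[OF Suc.prems(2)])
  ultimately show ?case by (rule smooth_family_SucI[OF b])
qed

lemma smooth_family_inverse:
  assumes "0 < c" "\<And>i x. x \<in> U i \<Longrightarrow> c \<le> f i x"
  shows "smooth_family n U f \<Longrightarrow> smooth_family n U (\<lambda>i x. inverse (f i x))"
proof (induction n)
  have b: "\<forall>i. \<forall>x\<in>U i. \<bar>inverse (f i x)\<bar> \<le> inverse c"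
  proof (intro allI ballI)
    fix i x assume "x \<in> U i"
    then have "c \<le> f i x" by (rule assms(2))
    then show "\<bar>inverse (f i x)\<bar> \<le> inverse c" using assms(1) by (simp add: le_imp_inverse_le)
  qed
  {
    case 0
    then show ?case using b by auto
  next
    case (Suc n)
    obtain B f' where "\<forall>i. \<forall>x\<in>U i. \<bar>f i x\<bar> \<le> B" and d: "\<forall>i. \<forall>x\<in>U i. (f i has_real_derivative f' i x) (at x)"
      and s: "smooth_family n U f'" using Suc.prems by (rule smooth_family_SucE)
    have IH: "smooth_family n U (\<lambda>i x. inverse (f i x))" using Suc.IH smooth_family_Suc_D[OF Suc.prems] by blast
    have m: "smooth_family n U (\<lambda>i x. (-1))" by (rule smooth_family_const[of _ _ 1]) simp
    have "smooth_family n U (\<lambda>i x. (-1) * (inverse (f i x) * f' i x * inverse (f i x)))"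
      by (intro smooth_family_mult m IH s)
    moreover have "\<forall>i. \<forall>x\<in>U i. ((\<lambda>x. inverse (f i x)) has_real_derivative (-1) * (inverse (f i x) * f' i x * inverse (f i x))) (at x)"
    proof (intro allI ballI)
      fix i x assume x: "x \<in> U i"
      then have "f i x \<noteq> 0" using assms by force
      then show "((\<lambda>x. inverse (f i x)) has_real_derivative (-1) * (inverse (f i x) * f' i x * inverse (f i x))) (at x)"
        using DERIV_inverse'[OF d[rule_format, OF x]] by simp
    qed
    ultimately show ?case by (intro smooth_family_SucI[OF b])
  }
qed

text \<open>A sequence of functions closed under differentiation up to a common smooth factor is smooth as
soon as each member is bounded. The typical sequence consists of the derivatives of a window
composed with a function \<open>r\<close>, with \<open>\<rho> = r'\<close>; this replaces the formula for higher derivatives of a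
composition.\<close>

lemma smooth_family_chain:
  fixes \<Phi> :: "nat \<Rightarrow> 'i \<Rightarrow> real \<Rightarrow> real"
  assumes b: "\<And>m. \<exists>B. \<forall>i. \<forall>x\<in>U i. \<bar>\<Phi> m i x\<bar> \<le> B"
    and d: "\<And>m i x. x \<in> U i \<Longrightarrow> (\<Phi> m i has_real_derivative \<Phi> (Suc m) i x * \<rho> i x) (at x)"
    and r: "\<And>n. smooth_family n U \<rho>"
  shows "smooth_family n U (\<Phi> m)"
proof (induction n arbitrary: m)
  case 0
  then show ?case using b by simp
next
  case (Suc n)
  have "smooth_family n U (\<lambda>i x. \<Phi> (Suc m) i x * \<rho> i x)"
    by (rule smooth_family_mult[OF Suc.IH r])
  note s = this
  obtain B where B: "\<forall>i. \<forall>x\<in>U i. \<bar>\<Phi> m i x\<bar> \<le> B" using b by blast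
  show ?case by (rule smooth_family_SucI[OF B _ s]) (simp add: d)
qed

text \<open>A square root \<open>r\<close> satisfies \<open>r' = \<kappa> / r\<close> with \<open>\<kappa>\<close> half the derivative of \<open>r\<^sup>2\<close>; the equation itself
propagates smoothness.\<close>

lemma smooth_family_root:
  assumes b: "\<exists>B. \<forall>i. \<forall>x\<in>U i. \<bar>r i x\<bar> \<le> B" and low: "\<And>i x. x \<in> U i \<Longrightarrow> 1 \<le> r i x"
    and d: "\<And>i x. x \<in> U i \<Longrightarrow> (r i has_real_derivative \<kappa> i x * inverse (r i x)) (at x)"
    and k: "\<And>n. smooth_family n U \<kappa>"
  shows "smooth_family n U r"
proof (induction n)
  case 0
  then show ?case using b by simp
next
  case (Suc n)
  have "smooth_family n U (\<lambda>i x. \<kappa> i x * inverse (r i x))"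
    by (intro smooth_family_mult[OF k] smooth_family_inverse[OF zero_less_one low Suc.IH])
  note s = this
  obtain B where B: "\<forall>i. \<forall>x\<in>U i. \<bar>r i x\<bar> \<le> B" using b by blast
  show ?case by (rule smooth_family_SucI[OF B _ s]) (simp add: d)
qed

text \<open>Where a function is locally constant all its derivatives vanish. Singularities of polar
coordinates and the edge of the domain are covered by such sets.\<close>

lemma smooth_family_extend:
  assumes U: "\<And>i. open (U i)" and V: "\<And>i. open (V i)" and WUV: "\<And>i. W i \<subseteq> U i \<union> V i"
  shows "smooth_family n U f \<Longrightarrow> (\<And>i x. x \<in> V i \<Longrightarrow> \<bar>f i x\<bar> \<le> B) \<Longrightarrow>
    (\<And>i x. x \<in> V i \<Longrightarrow> (f i has_real_derivative 0) (at x)) \<Longrightarrow> smooth_family n W f"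
proof (induction n arbitrary: f B)
  case 0
  then obtain A where A: "\<forall>i. \<forall>x\<in>U i. \<bar>f i x\<bar> \<le> A" by auto
  have "\<bar>f i x\<bar> \<le> max A B" if "x \<in> W i" for i x
    using WUV[of i] that A 0(2)[of x i] by (auto simp: le_max_iff_disj)
  then show ?case by auto
next
  case (Suc n)
  obtain A f' where A: "\<forall>i. \<forall>x\<in>U i. \<bar>f i x\<bar> \<le> A" and d: "\<forall>i. \<forall>x\<in>U i. (f i has_real_derivative f' i x) (at x)"
    and s: "smooth_family n U f'" using Suc.prems(1) by (rule smooth_family_SucE)
  have b: "\<forall>i. \<forall>x\<in>W i. \<bar>f i x\<bar> \<le> max A B"
  proof (intro allI ballI)
    fix i x assume "x \<in> W i"
    then show "\<bar>f i x\<bar> \<le> max A B"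
      using WUV[of i] A Suc.prems(2)[of x i] by (auto simp: le_max_iff_disj)
  qed
  define g where "g i x = (if x \<in> V i then 0 else f' i x)" for i x
  have gU: "g i x = f' i x" if "x \<in> U i" for i x
    using d[rule_format, OF that] Suc.prems(3)[of x i] by (auto simp: g_def dest: DERIV_unique)
  have gd: "(g i has_real_derivative 0) (at x)" if "x \<in> V i" for i x
  proof (rule has_field_derivative_transform_within_open[OF _ V that])
    show "((\<lambda>x. 0) has_real_derivative 0) (at x)" by simp
  qed (simp add: g_def)
  have sg: "smooth_family n U g"
    by (rule smooth_family_cong[OF U _ s]) (simp add: gU)
  have "smooth_family n W g"
    by (rule Suc.IH[OF sg _ gd, of 0]) (auto simp: g_def)
  moreover have "\<forall>i. \<forall>x\<in>W i. (f i has_real_derivative g i x) (at x)"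
  proof (intro allI ballI)
    fix i x assume "x \<in> W i"
    then consider "x \<in> V i" | "x \<notin> V i" "x \<in> U i" using WUV by blast
    then show "(f i has_real_derivative g i x) (at x)"
      using Suc.prems(3) d by cases (auto simp: g_def)
  qed
  ultimately show ?case by (intro smooth_family_SucI[OF b])
qed

lemma smooth_family_diff_bounded:
  "smooth_family n (\<lambda>_. UNIV) f \<Longrightarrow> \<exists>D. \<forall>i. diff_bounded n D (f i)"
proof (induction n arbitrary: f)
  case 0
  then obtain B where "\<forall>i x. \<bar>f i x\<bar> \<le> B" by auto
  then show ?case unfolding diff_bounded_def by (intro exI[of _ B] allI exI[of _ "\<lambda>_. f _"]) auto
next
  case (Suc n)
  obtain B f' where B': "\<forall>i. \<forall>x\<in>UNIV. \<bar>f i x\<bar> \<le> B" and d': "\<forall>i. \<forall>x\<in>UNIV. (f i has_real_derivative f' i x) (at x)"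
    and s: "smooth_family n (\<lambda>_. UNIV) f'"
    using Suc.prems by (rule smooth_family_SucE)
  have B: "\<bar>f i x\<bar> \<le> B" and d: "(f i has_real_derivative f' i x) (at x)" for i x
    using B' d' by blast+
  obtain D where D: "\<And>i. diff_bounded n D (f' i)" using Suc.IH[OF s] by blast
  have "diff_bounded (Suc n) (max B D) (f i)" for i
  proof -
    obtain g where g: "g 0 = f' i" "\<forall>m<n. \<forall>y. (g m has_real_derivative g (Suc m) y) (at y)" "\<forall>m\<le>n. \<forall>y. \<bar>g m y\<bar> \<le> D"
      using D[of i] unfolding diff_bounded_def by blast
    define h where "h m = (case m of 0 \<Rightarrow> f i | Suc k \<Rightarrow> g k)" for m
    have "h 0 = f i" by (simp add: h_def)
    moreover have "(h m has_real_derivative h (Suc m) y) (at y)" if "m < Suc n" for m y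
      using that d[of i y] g by (cases m) (auto simp: h_def)
    moreover have "\<bar>h m y\<bar> \<le> max B D" if "m \<le> Suc n" for m y
      using that B[of i y] g(3) by (cases m) (auto simp: h_def le_max_iff_disj)
    ultimately show ?thesis unfolding diff_bounded_def by blast
  qed
  then show ?case by blast
qed

lemma diff_bounded_dilate:
  assumes "diff_bounded M D h" "c \<ge> 1"
  shows "diff_bounded M (c ^ M * D) (\<lambda>x. h (c * x))"
proof -
  obtain g where g: "g 0 = h" "\<forall>m<M. \<forall>y. (g m has_real_derivative g (Suc m) y) (at y)" "\<forall>m\<le>M. \<forall>y. \<bar>g m y\<bar> \<le> D"
    using assms(1) unfolding diff_bounded_def by blast
  define k where "k m x = c ^ m * g m (c * x)" for m x
  have "k 0 = (\<lambda>x. h (c * x))" by (simp add: k_def fun_eq_iff g(1))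
  moreover have "(k m has_real_derivative k (Suc m) y) (at y)" if "m < M" for m y
  proof -
    have "((\<lambda>x. g m (c * x)) has_real_derivative g (Suc m) (c * y) * c) (at y)"
      using g(2) that by (intro DERIV_chain2[where f = "g m"]) (auto intro!: derivative_eq_intros)
    from DERIV_cmult[OF this, of "c ^ m"] show ?thesis
      unfolding k_def by (simp add: mult_ac)
  qed
  moreover have "\<bar>k m y\<bar> \<le> c ^ M * D" if "m \<le> M" for m y
  proof -
    have "c ^ m \<le> c ^ M" using that assms(2) by (intro power_increasing) auto
    then have "c ^ m * \<bar>g m (c * y)\<bar> \<le> c ^ M * D"
      using g(3) that assms(2) by (intro mult_mono) auto
    then show ?thesis using assms(2) by (simp add: k_def abs_mult)
  qed
  ultimately show ?thesis unfolding diff_bounded_def by blast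
qed

section \<open>Anisotropic polar coordinates\<close>

text \<open>The cut \<open>v = 0 \<and> u \<le> 0\<close> of the logarithm has to be avoided.\<close>

lemma
  assumes off: "\<not> (v = 0 \<and> u \<le> 0)"
  shows polar_angle_deriv_1: "((\<lambda>u. polar_angle (vector [u, v])) has_real_derivative - v / (u\<^sup>2 + v\<^sup>2)) (at u)"
    and polar_angle_deriv_2: "((\<lambda>v. polar_angle (vector [u, v])) has_real_derivative u / (u\<^sup>2 + v\<^sup>2)) (at v)"
proof -
  have p: "polar_angle (vector [a, b]) = Im (Ln (Complex a b))" if "\<not> (b = 0 \<and> a \<le> 0)" for a b
  proof -
    have "Complex a b \<noteq> 0" using that by (auto simp: complex_eq_iff)
    then show ?thesis by (simp add: polar_angle_def Arg_eq_Im_Ln)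
  qed
  have notin: "Complex u v \<notin> \<real>\<^sub>\<le>\<^sub>0" using off by (auto simp: complex_nonpos_Reals_iff)
  have ln: "(Ln has_field_derivative inverse (Complex u v)) (at (Complex u v))"
    using notin by (rule has_field_derivative_Ln)
  have sq: "(cmod (Complex u v))\<^sup>2 = u\<^sup>2 + v\<^sup>2" by (simp add: cmod_power2)
  have 1: "((\<lambda>u. Complex u v) has_vector_derivative 1) (at u)"
  proof -
    have "((\<lambda>u. complex_of_real u + \<i> * complex_of_real v) has_vector_derivative 1) (at u)"
      unfolding has_vector_derivative_def
      by (auto intro!: derivative_eq_intros simp: scaleR_conv_of_real)
    then show ?thesis by (simp add: Complex_eq)
  qed
  have 2: "((\<lambda>v. Complex u v) has_vector_derivative \<i>) (at v)"
  proof -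
    have "((\<lambda>v. complex_of_real u + \<i> * complex_of_real v) has_vector_derivative \<i>) (at v)"
      unfolding has_vector_derivative_def
      by (auto intro!: derivative_eq_intros simp: scaleR_conv_of_real)
    then show ?thesis by (simp add: Complex_eq)
  qed
  have "((\<lambda>u. Im (Ln (Complex u v))) has_vector_derivative Im (1 * inverse (Complex u v))) (at u)"
    using bounded_linear.has_vector_derivative[OF bounded_linear_Im field_vector_diff_chain_at[OF 1 ln]] by (simp add: o_def)
  then have d1: "((\<lambda>u. Im (Ln (Complex u v))) has_real_derivative - v / (u\<^sup>2 + v\<^sup>2)) (at u)"
    by (simp add: has_real_derivative_iff_has_vector_derivative)
  have "((\<lambda>v. Im (Ln (Complex u v))) has_vector_derivative Im (\<i> * inverse (Complex u v))) (at v)"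
    using bounded_linear.has_vector_derivative[OF bounded_linear_Im field_vector_diff_chain_at[OF 2 ln]] by (simp add: o_def)
  then have d2: "((\<lambda>v. Im (Ln (Complex u v))) has_real_derivative u / (u\<^sup>2 + v\<^sup>2)) (at v)"
    by (simp add: has_real_derivative_iff_has_vector_derivative)
  have o1: "open {a::real. \<not> (v = 0 \<and> a \<le> 0)}"
  proof (cases "v = 0")
    case True
    have "{a::real. \<not> (v = 0 \<and> a \<le> 0)} = {0<..}" using True by auto
    then show ?thesis by simp
  qed simp
  show "((\<lambda>u. polar_angle (vector [u, v])) has_real_derivative - v / (u\<^sup>2 + v\<^sup>2)) (at u)"
    by (rule has_field_derivative_transform_within_open[OF d1 o1]) (use off p in auto)
  have o2: "open {b::real. \<not> (b = 0 \<and> u \<le> 0)}"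
  proof (cases "u \<le> 0")
    case True
    have "{b::real. \<not> (b = 0 \<and> u \<le> 0)} = - {0}" using True by auto
    then show ?thesis by (simp only: open_Compl closed_singleton)
  qed simp
  show "((\<lambda>v. polar_angle (vector [u, v])) has_real_derivative u / (u\<^sup>2 + v\<^sup>2)) (at v)"
    by (rule has_field_derivative_transform_within_open[OF d2 o2]) (use off p in auto)
qed

lemma wrap_angle_idem: "- pi \<le> \<theta> \<Longrightarrow> \<theta> < pi \<Longrightarrow> wrap_angle \<theta> = \<theta>"
  by (simp add: wrap_angle_def rmod_idem)

lemma wrap_angle_bounds: "- pi \<le> wrap_angle \<theta>" "wrap_angle \<theta> < pi"
  using rmod_nonneg[of "2 * pi" "\<theta> + pi"] rmod_less[of "2 * pi" "\<theta> + pi"] by (auto simp: wrap_angle_def)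

lemma cos_wrap_angle: "cos (wrap_angle \<theta>) = cos \<theta>"
proof -
  obtain n :: int where "wrap_angle \<theta> = \<theta> + 2 * pi * of_int n" using wrap_angle_conv by blast
  then show ?thesis by (simp add: cos_add sin_int_2pin cos_int_2pin)
qed

lemma wrap_polar_angle_off_cut:
  assumes "\<not> (v = 0 \<and> u \<le> 0)"
  shows "wrap_angle (polar_angle (vector [u, v])) = polar_angle (vector [u, v])"
proof -
  have "polar_angle (vector [u, v]) \<noteq> pi"
    using assms by (auto simp: polar_angle_def Arg_eq_pi)
  then show ?thesis
    using polar_angle_bounds[of "vector [u, v]"] by (intro wrap_angle_idem) auto
qed

lemma wrap_polar_angle_left_half_plane:
  assumes "u < 0"
  shows "pi / 2 < \<bar>wrap_angle (polar_angle (vector [u, v]))\<bar>"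
proof (rule ccontr)
  let ?x = "vector [u, v] :: real^2"
  assume "\<not> ?thesis"
  then have "0 \<le> cos (wrap_angle (polar_angle ?x))" by (intro cos_ge_zero) auto
  then have "0 \<le> norm ?x * cos (polar_angle ?x)" by (simp add: cos_wrap_angle)
  then have "0 \<le> ?x $ 1" by (simp only: polar_1)
  then show False using assms by simp
qed

text \<open>The radius after shrinking the second coordinate by \<open>s\<close>. A wedge of scale \<open>j\<close> has \<open>s\<close> equal to
\<open>1 / 2 ^ (j div 2)\<close>; in the coordinates \<open>u, v\<close> its size is independent of \<open>s\<close>, and all bounds have to
be uniform in \<open>s\<close>.\<close>

definition arad :: "real \<Rightarrow> real \<Rightarrow> real \<Rightarrow> real" where
  "arad s u v = sqrt (u\<^sup>2 + (s * v)\<^sup>2)"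

text \<open>Index pairs \<open>i = (s, c)\<close>: the parameter \<open>s\<close> and the coordinate that stays fixed along the line. For
parameters out of range the set is empty, which makes statements about them void.\<close>

definition wide_lines :: "real \<times> real \<Rightarrow> real set" where
  "wide_lines i = {x. \<bar>x\<bar> < 30 \<and> \<bar>snd i\<bar> < 30 \<and> 0 < fst i \<and> fst i \<le> 1}"

text \<open>Away from the origin, where polar coordinates degenerate; \<open>lines1\<close> varies \<open>u\<close> and \<open>lines2\<close> varies \<open>v\<close>.\<close>

definition lines1 :: "real \<times> real \<Rightarrow> real set" where
  "lines1 i = {u. u \<in> wide_lines i \<and> 1 < arad (fst i) u (snd i)}"

definition lines2 :: "real \<times> real \<Rightarrow> real set" where
  "lines2 i = {v. v \<in> wide_lines i \<and> 1 < arad (fst i) (snd i) v}"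

lemma open_wide_lines: "open (wide_lines i)"
  unfolding wide_lines_def by (intro open_Collect_conj open_Collect_less continuous_intros) auto

lemma open_lines1: "open (lines1 i)" and open_lines2: "open (lines2 i)"
proof -
  have "open {u. 1 < arad (fst i) u (snd i)}" "open {v. 1 < arad (fst i) (snd i) v}"
    unfolding arad_def by (intro open_Collect_less continuous_intros)+
  then show "open (lines1 i)" "open (lines2 i)"
    using open_wide_lines[of i] unfolding lines1_def lines2_def by (auto intro: open_Collect_conj simp: Collect_conj_eq[symmetric])
qed

lemma arad_le: "\<bar>u\<bar> \<le> 30 \<Longrightarrow> \<bar>v\<bar> \<le> 30 \<Longrightarrow> 0 \<le> s \<Longrightarrow> s \<le> 1 \<Longrightarrow> arad s u v \<le> 60"
proof -
  assume "\<bar>u\<bar> \<le> 30" "\<bar>v\<bar> \<le> 30" "0 \<le> s" "s \<le> 1"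
  then have "\<bar>s * v\<bar> \<le> 1 * 30" unfolding abs_mult by (intro mult_mono) auto
  moreover have "arad s u v \<le> \<bar>u\<bar> + \<bar>s * v\<bar>" unfolding arad_def by (rule sqrt_sum_squares_le_sum_abs)
  ultimately show ?thesis using \<open>\<bar>u\<bar> \<le> 30\<close> by simp
qed

lemma arad_nonneg [simp]: "0 \<le> arad s u v" by (simp add: arad_def)

lemma arad_deriv_1: "0 < arad s u v \<Longrightarrow> ((\<lambda>u. arad s u v) has_real_derivative u * inverse (arad s u v)) (at u)"
  and arad_deriv_2: "0 < arad s u v \<Longrightarrow> ((\<lambda>v. arad s u v) has_real_derivative s * s * v * inverse (arad s u v)) (at v)"
proof -
  assume pos: "0 < arad s u v"
  then have q: "0 < u\<^sup>2 + (s * v)\<^sup>2" by (simp add: arad_def)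
  have "((\<lambda>u. u\<^sup>2 + (s * v)\<^sup>2) has_real_derivative 2 * u) (at u)"
    by (auto intro!: derivative_eq_intros)
  from DERIV_chain2[OF DERIV_real_sqrt[OF q] this]
  show "((\<lambda>u. arad s u v) has_real_derivative u * inverse (arad s u v)) (at u)"
    unfolding arad_def by (simp add: mult.commute)
  have "((\<lambda>v. u\<^sup>2 + (s * v)\<^sup>2) has_real_derivative 2 * (s * s * v)) (at v)"
    by (auto intro!: derivative_eq_intros simp: power2_eq_square)
  from DERIV_chain2[OF DERIV_real_sqrt[OF q] this]
  show "((\<lambda>v. arad s u v) has_real_derivative s * s * v * inverse (arad s u v)) (at v)"
    unfolding arad_def by (rule DERIV_cong) simp
qed

lemma lines1_D: "u \<in> lines1 i \<Longrightarrow> \<bar>u\<bar> < 30 \<and> \<bar>snd i\<bar> < 30 \<and> 0 < fst i \<and> fst i \<le> 1 \<and> 1 < arad (fst i) u (snd i)"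
  and lines2_D: "v \<in> lines2 i \<Longrightarrow> \<bar>v\<bar> < 30 \<and> \<bar>snd i\<bar> < 30 \<and> 0 < fst i \<and> fst i \<le> 1 \<and> 1 < arad (fst i) (snd i) v"
  by (simp_all add: lines1_def lines2_def wide_lines_def)

lemma smooth_ident1: "smooth_family n lines1 (\<lambda>i x. x)" and smooth_ident2: "smooth_family n lines2 (\<lambda>i x. x)"
  by (rule smooth_family_ident[of _ 30], use lines1_D in force, rule smooth_family_ident[of _ 30], use lines2_D in force)

lemma smooth_snd1: "smooth_family n lines1 (\<lambda>i x. snd i)" and smooth_snd2: "smooth_family n lines2 (\<lambda>i x. snd i)"
  by (rule smooth_family_const[of _ _ 30], use lines1_D in force, rule smooth_family_const[of _ _ 30], use lines2_D in force)

lemma smooth_fst2: "smooth_family n lines2 (\<lambda>i x. fst i)"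
  by (rule smooth_family_const[of _ _ 1], use lines2_D in force)

lemma smooth_arad1: "smooth_family n lines1 (\<lambda>i u. arad (fst i) u (snd i))"
proof (rule smooth_family_root[where \<kappa> = "\<lambda>i x. x"])
  show "\<exists>B. \<forall>i. \<forall>x\<in>lines1 i. \<bar>arad (fst i) x (snd i)\<bar> \<le> B"
    by (intro exI[of _ 60] allI ballI) (use lines1_D in \<open>force intro: arad_le\<close>)
  show "\<And>i x. x \<in> lines1 i \<Longrightarrow> 1 \<le> arad (fst i) x (snd i)" using lines1_D by force
  show "((\<lambda>u. arad (fst i) u (snd i)) has_real_derivative x * inverse (arad (fst i) x (snd i))) (at x)" if "x \<in> lines1 i" for i x
    by (intro arad_deriv_1) (use lines1_D[OF that] in auto)
qed (rule smooth_ident1)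

lemma smooth_arad2: "smooth_family n lines2 (\<lambda>i v. arad (fst i) (snd i) v)"
proof (rule smooth_family_root[where \<kappa> = "\<lambda>i x. fst i * fst i * x"])
  show "\<exists>B. \<forall>i. \<forall>x\<in>lines2 i. \<bar>arad (fst i) (snd i) x\<bar> \<le> B"
    by (intro exI[of _ 60] allI ballI) (use lines2_D in \<open>force intro: arad_le\<close>)
  show "\<And>i x. x \<in> lines2 i \<Longrightarrow> 1 \<le> arad (fst i) (snd i) x" using lines2_D by force
  show "((\<lambda>v. arad (fst i) (snd i) v) has_real_derivative fst i * fst i * x * inverse (arad (fst i) (snd i) x)) (at x)" if "x \<in> lines2 i" for i x
    by (intro arad_deriv_2) (use lines2_D[OF that] in auto)
qed (intro smooth_family_mult smooth_fst2 smooth_ident2)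

lemma smooth_inverse_arad1: "smooth_family n lines1 (\<lambda>i u. inverse (arad (fst i) u (snd i)))"
  and smooth_inverse_arad2: "smooth_family n lines2 (\<lambda>i v. inverse (arad (fst i) (snd i) v))"
  by (rule smooth_family_inverse[OF zero_less_one _ smooth_arad1], use lines1_D in force)
    (rule smooth_family_inverse[OF zero_less_one _ smooth_arad2], use lines2_D in force)

text \<open>\<open>W m\<close> is the \<open>m\<close>-th derivative of a radial window, composed with a smooth radius.\<close>

lemma
  fixes W :: "nat \<Rightarrow> real \<Rightarrow> real"
  assumes d: "\<And>m r. 0 < r \<Longrightarrow> (W m has_real_derivative W (Suc m) r) (at r)"
    and b: "\<And>m. \<exists>B. \<forall>r. 0 < r \<and> r \<le> 60 \<longrightarrow> \<bar>W m r\<bar> \<le> B"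
  shows smooth_radial1: "smooth_family n lines1 (\<lambda>i u. W 0 (arad (fst i) u (snd i)))"
    and smooth_radial2: "smooth_family n lines2 (\<lambda>i v. W 0 (arad (fst i) (snd i) v))"
proof -
  have r1: "0 < arad (fst i) u (snd i)" "arad (fst i) u (snd i) \<le> 60" if "u \<in> lines1 i" for u i
    using lines1_D[OF that] arad_le[of u "snd i" "fst i"] by auto
  have r2: "0 < arad (fst i) (snd i) v" "arad (fst i) (snd i) v \<le> 60" if "v \<in> lines2 i" for v i
    using lines2_D[OF that] arad_le[of "snd i" v "fst i"] by auto
  show "smooth_family n lines1 (\<lambda>i u. W 0 (arad (fst i) u (snd i)))"
  proof (rule smooth_family_chain[where \<Phi> = "\<lambda>m i u. W m (arad (fst i) u (snd i))" and m = 0])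
    show "\<exists>B. \<forall>i. \<forall>x\<in>lines1 i. \<bar>W m (arad (fst i) x (snd i))\<bar> \<le> B" for m
      using b[of m] r1 by meson
    show "((\<lambda>u. W m (arad (fst i) u (snd i))) has_real_derivative W (Suc m) (arad (fst i) x (snd i)) * (x * inverse (arad (fst i) x (snd i)))) (at x)"
      if "x \<in> lines1 i" for m i x
      using r1[OF that] by (intro DERIV_chain2[where f = "W m"] d arad_deriv_1)
    show "smooth_family n lines1 (\<lambda>i x. x * inverse (arad (fst i) x (snd i)))" for n
      by (intro smooth_family_mult smooth_ident1 smooth_inverse_arad1)
  qed
  show "smooth_family n lines2 (\<lambda>i v. W 0 (arad (fst i) (snd i) v))"
  proof (rule smooth_family_chain[where \<Phi> = "\<lambda>m i v. W m (arad (fst i) (snd i) v)" and m = 0])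
    show "\<exists>B. \<forall>i. \<forall>x\<in>lines2 i. \<bar>W m (arad (fst i) (snd i) x)\<bar> \<le> B" for m
      using b[of m] r2 by meson
    show "((\<lambda>v. W m (arad (fst i) (snd i) v)) has_real_derivative W (Suc m) (arad (fst i) (snd i) x) * (fst i * fst i * x * inverse (arad (fst i) (snd i) x))) (at x)"
      if "x \<in> lines2 i" for m i x
      using r2[OF that] by (intro DERIV_chain2[where f = "W m"] d arad_deriv_2)
    show "smooth_family n lines2 (\<lambda>i x. fst i * fst i * x * inverse (arad (fst i) (snd i) x))" for n
      by (intro smooth_family_mult smooth_fst2 smooth_ident2 smooth_inverse_arad2)
  qed
qed

text \<open>Angles within a wedge are of order \<open>s\<close>, whence the division by \<open>s\<close>. For \<open>s > 1 / 2\<close>, which does not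
occur in the curvelet system, the value \<open>0\<close> keeps families indexed by all \<open>s\<close> smooth.\<close>

definition angular :: "(real \<Rightarrow> real) \<Rightarrow> real \<Rightarrow> real \<Rightarrow> real \<Rightarrow> real" where
  "angular N s u v = (if 0 < s \<and> s \<le> 1 / 2 then N (wrap_angle (polar_angle (vector [u, s * v])) / s) else 0)"

text \<open>For \<open>u < 0\<close> the angle exceeds \<open>pi / 2 \<ge> pi * s\<close>, hence lies outside the angular window. In this way
the discontinuity of the angle at the negative axis is never met.\<close>

lemma angular_left_half_plane:
  assumes "\<And>x. \<bar>x\<bar> > pi \<Longrightarrow> N x = 0" "u < 0"
  shows "angular N s u v = 0"
proof (cases "0 < s \<and> s \<le> 1 / 2")
  case True
  let ?a = "wrap_angle (polar_angle (vector [u, s * v]))"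
  have "pi / 2 < \<bar>?a\<bar>" by (rule wrap_polar_angle_left_half_plane[OF assms(2)])
  moreover have "\<bar>?a\<bar> * 2 \<le> \<bar>?a\<bar> * (1 / s)" using True by (intro mult_left_mono) (auto simp: field_simps)
  ultimately have "pi < \<bar>?a\<bar> * (1 / s)" by linarith
  then have "pi < \<bar>?a / s\<bar>" using True by simp
  then have "N (?a / s) = 0" by (rule assms(1))
  then show ?thesis by (simp add: angular_def)
qed (auto simp: angular_def)

text \<open>Differentiating the angle gives \<open>- (s * v) / r\<^sup>2\<close> and \<open>s * u / r\<^sup>2\<close> with \<open>r = arad s u v\<close>. The factor \<open>s\<close>
cancels the division by \<open>s\<close> in the definition, and this is why the bounds are uniform in \<open>s\<close>.\<close>

lemma
  fixes N :: "nat \<Rightarrow> real \<Rightarrow> real"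
  assumes d: "\<And>m x. (N m has_real_derivative N (Suc m) x) (at x)"
    and z: "\<And>m x. \<bar>x\<bar> > pi \<Longrightarrow> N m x = 0" and pos: "0 < arad s u v"
  shows angular_deriv_1: "((\<lambda>u. angular (N m) s u v) has_real_derivative
      angular (N (Suc m)) s u v * ((-1) * v * (inverse (arad s u v) * inverse (arad s u v)))) (at u)"
    and angular_deriv_2: "((\<lambda>v. angular (N m) s u v) has_real_derivative
      angular (N (Suc m)) s u v * (u * (inverse (arad s u v) * inverse (arad s u v)))) (at v)"
proof -
  have "((\<lambda>u. angular (N m) s u v) has_real_derivative
      angular (N (Suc m)) s u v * ((-1) * v * (inverse (arad s u v) * inverse (arad s u v)))) (at u)
    \<and> ((\<lambda>v. angular (N m) s u v) has_real_derivative
      angular (N (Suc m)) s u v * (u * (inverse (arad s u v) * inverse (arad s u v)))) (at v)"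
  proof (cases "0 < s \<and> s \<le> 1 / 2")
    case False
    then show ?thesis by (auto simp: angular_def)
  next
    case s: True
    show ?thesis
    proof (cases "u < 0")
      case True
      have 0: "angular (N k) s u' v' = 0" if "u' < 0" for k u' v'
        by (rule angular_left_half_plane[OF z that])
      have "((\<lambda>u. angular (N m) s u v) has_real_derivative 0) (at u)"
        by (rule has_field_derivative_transform_within_open[of "\<lambda>_. 0" _ _ "{..<0}"]) (use True 0 in auto)
      moreover have "((\<lambda>v. angular (N m) s u v) has_real_derivative 0) (at v)"
        using 0[OF True] by simp
      ultimately show ?thesis using 0[OF True] by simp
    next
      case False
      have q: "0 < u\<^sup>2 + (s * v)\<^sup>2" using pos by (simp add: arad_def)
      (* Off the cut wrapping changes nothing, and the angle can be differentiated. *)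
      have off: "\<not> (s * v = 0 \<and> u \<le> 0)" using False q by auto
      have ir: "inverse (arad s u v) * inverse (arad s u v) = 1 / (u\<^sup>2 + (s * v)\<^sup>2)"
      proof -
        have "arad s u v * arad s u v = u\<^sup>2 + (s * v)\<^sup>2" using q by (simp add: arad_def)
        then have "inverse (arad s u v * arad s u v) = 1 / (u\<^sup>2 + (s * v)\<^sup>2)" by (simp only: inverse_eq_divide)
        then show ?thesis by (simp only: inverse_mult_distrib)
      qed
      have eq: "angular (N k) s u' v' = N k (polar_angle (vector [u', s * v']) / s)"
        if "\<not> (s * v' = 0 \<and> u' \<le> 0)" for k u' v'
        using s wrap_polar_angle_off_cut[OF that] by (simp add: angular_def)
      have o1: "open {a::real. \<not> (s * v = 0 \<and> a \<le> 0)}"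
      proof (cases "s * v = 0")
        case True
        have "{a::real. \<not> (s * v = 0 \<and> a \<le> 0)} = {0<..}" using True by auto
        then show ?thesis by simp
      qed simp
      have o2: "open {b::real. \<not> (s * b = 0 \<and> u \<le> 0)}"
      proof (cases "u \<le> 0")
        case True
        have "{b::real. \<not> (s * b = 0 \<and> u \<le> 0)} = - {0}" using True s by auto
        then show ?thesis by (simp only: open_Compl closed_singleton)
      qed simp
      have "((\<lambda>u. N m (polar_angle (vector [u, s * v]) / s)) has_real_derivative
          N (Suc m) (polar_angle (vector [u, s * v]) / s) * (- (s * v) / (u\<^sup>2 + (s * v)\<^sup>2) / s)) (at u)"
        by (intro DERIV_chain2[where f = "N m"] d DERIV_cdivide polar_angle_deriv_1 off)
      then have "((\<lambda>u. angular (N m) s u v) has_real_derivative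
          N (Suc m) (polar_angle (vector [u, s * v]) / s) * (- (s * v) / (u\<^sup>2 + (s * v)\<^sup>2) / s)) (at u)"
        by (rule has_field_derivative_transform_within_open[OF _ o1]) (use off eq in auto)
      moreover have "- (s * v) / (u\<^sup>2 + (s * v)\<^sup>2) / s = (-1) * v * (1 / (u\<^sup>2 + (s * v)\<^sup>2))"
        using s by simp
      moreover have "((\<lambda>v. s * v) has_real_derivative s) (at v)" by (auto intro!: derivative_eq_intros)
      then have "((\<lambda>v. N m (polar_angle (vector [u, s * v]) / s)) has_real_derivative
          N (Suc m) (polar_angle (vector [u, s * v]) / s) * (u / (u\<^sup>2 + (s * v)\<^sup>2) * s / s)) (at v)"
        by (intro DERIV_chain2[where f = "N m"] d DERIV_cdivide DERIV_chain2[where f = "\<lambda>v. polar_angle (vector [u, v])"]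
            polar_angle_deriv_2 off)
      then have "((\<lambda>v. angular (N m) s u v) has_real_derivative
          N (Suc m) (polar_angle (vector [u, s * v]) / s) * (u / (u\<^sup>2 + (s * v)\<^sup>2) * s / s)) (at v)"
        by (rule has_field_derivative_transform_within_open[OF _ o2]) (use off eq in auto)
      moreover have "u / (u\<^sup>2 + (s * v)\<^sup>2) * s / s = u * (1 / (u\<^sup>2 + (s * v)\<^sup>2))"
        using s by simp
      ultimately show ?thesis unfolding ir eq[OF off] by simp
    qed
  qed
  then show "((\<lambda>u. angular (N m) s u v) has_real_derivative
      angular (N (Suc m)) s u v * ((-1) * v * (inverse (arad s u v) * inverse (arad s u v)))) (at u)"
    "((\<lambda>v. angular (N m) s u v) has_real_derivative
      angular (N (Suc m)) s u v * (u * (inverse (arad s u v) * inverse (arad s u v)))) (at v)"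
    by blast+
qed

lemma
  fixes N :: "nat \<Rightarrow> real \<Rightarrow> real"
  assumes d: "\<And>m x. (N m has_real_derivative N (Suc m) x) (at x)"
    and z: "\<And>m x. \<bar>x\<bar> > pi \<Longrightarrow> N m x = 0" and b: "\<And>m. \<exists>B. \<forall>x. \<bar>N m x\<bar> \<le> B"
  shows smooth_angular1: "smooth_family n lines1 (\<lambda>i u. angular (N 0) (fst i) u (snd i))"
    and smooth_angular2: "smooth_family n lines2 (\<lambda>i v. angular (N 0) (fst i) (snd i) v)"
proof -
  have ab: "\<exists>B. \<forall>s u v. \<bar>angular (N m) s u v\<bar> \<le> B" for m
  proof -
    obtain B where B: "\<And>x. \<bar>N m x\<bar> \<le> B" using b by blast
    have "0 \<le> B" using B[of 0] by linarith
    then have "\<bar>angular (N m) s u v\<bar> \<le> B" for s u v using B by (simp add: angular_def)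
    then show ?thesis by blast
  qed
  have m1: "smooth_family n U (\<lambda>i x. (-1))" for n and U :: "real \<times> real \<Rightarrow> real set"
    by (rule smooth_family_const[of _ _ 1]) simp
  show "smooth_family n lines1 (\<lambda>i u. angular (N 0) (fst i) u (snd i))"
  proof (rule smooth_family_chain[where \<Phi> = "\<lambda>m i u. angular (N m) (fst i) u (snd i)" and m = 0])
    show "\<exists>B. \<forall>i. \<forall>x\<in>lines1 i. \<bar>angular (N m) (fst i) x (snd i)\<bar> \<le> B" for m using ab[of m] by blast
    show "((\<lambda>u. angular (N m) (fst i) u (snd i)) has_real_derivative angular (N (Suc m)) (fst i) x (snd i) *
        ((-1) * snd i * (inverse (arad (fst i) x (snd i)) * inverse (arad (fst i) x (snd i))))) (at x)" if "x \<in> lines1 i" for m i x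
      by (intro angular_deriv_1 d z) (use lines1_D[OF that] in auto)
    show "smooth_family n lines1 (\<lambda>i x. (-1) * snd i * (inverse (arad (fst i) x (snd i)) * inverse (arad (fst i) x (snd i))))" for n
      by (intro smooth_family_mult m1 smooth_snd1 smooth_inverse_arad1)
  qed
  show "smooth_family n lines2 (\<lambda>i v. angular (N 0) (fst i) (snd i) v)"
  proof (rule smooth_family_chain[where \<Phi> = "\<lambda>m i v. angular (N m) (fst i) (snd i) v" and m = 0])
    show "\<exists>B. \<forall>i. \<forall>x\<in>lines2 i. \<bar>angular (N m) (fst i) (snd i) x\<bar> \<le> B" for m using ab[of m] by blast
    show "((\<lambda>v. angular (N m) (fst i) (snd i) v) has_real_derivative angular (N (Suc m)) (fst i) (snd i) x *
        (snd i * (inverse (arad (fst i) (snd i) x) * inverse (arad (fst i) (snd i) x)))) (at x)" if "x \<in> lines2 i" for m i x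
      by (intro angular_deriv_2 d z) (use lines2_D[OF that] in auto)
    show "smooth_family n lines2 (\<lambda>i x. snd i * (inverse (arad (fst i) (snd i) x) * inverse (arad (fst i) (snd i) x)))" for n
      by (intro smooth_family_mult smooth_snd2 smooth_inverse_arad2)
  qed
qed

section \<open>Uniform approximation of frequency profiles\<close>

text \<open>The factor \<open>1 / 1800\<close> is \<open>1 / 2\<close> in coordinates scaled by \<open>30\<close>.\<close>

lemma smooth_gaussian_factor:
  "smooth_family n wide_lines (\<lambda>i x. exp ((x\<^sup>2 + (snd i)\<^sup>2) / 1800))"
proof (rule smooth_family_chain[where \<Phi> = "\<lambda>m i x. exp ((x\<^sup>2 + (snd i)\<^sup>2) / 1800)" and m = 0])
  have "\<bar>exp ((x\<^sup>2 + (snd i)\<^sup>2) / 1800)\<bar> \<le> exp 1" if "x \<in> wide_lines i" for x i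
  proof -
    have "\<bar>x\<bar> \<le> 30" "\<bar>snd i\<bar> \<le> 30" using that by (auto simp: wide_lines_def)
    then have "x\<^sup>2 \<le> 30\<^sup>2" "(snd i)\<^sup>2 \<le> 30\<^sup>2"
      by (metis abs_le_square_iff abs_numeral)+
    then show ?thesis by simp
  qed
  then show "\<exists>B. \<forall>i. \<forall>x\<in>wide_lines i. \<bar>exp ((x\<^sup>2 + (snd i)\<^sup>2) / 1800)\<bar> \<le> B" by blast
  show "((\<lambda>x. exp ((x\<^sup>2 + (snd i)\<^sup>2) / 1800)) has_real_derivative exp ((x\<^sup>2 + (snd i)\<^sup>2) / 1800) * (1 / 900 * x)) (at x)" for i :: "real \<times> real" and x
    by (auto intro!: derivative_eq_intros)
  show "smooth_family n wide_lines (\<lambda>i x. 1 / 900 * x)" for n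
  proof (rule smooth_family_mult)
    show "smooth_family n wide_lines (\<lambda>i x. 1 / 900)" by (rule smooth_family_const[of _ _ 1]) simp
    show "smooth_family n wide_lines (\<lambda>i x. x)" by (rule smooth_family_ident[of _ 30]) (simp add: wide_lines_def)
  qed
qed

text \<open>Three regions: near the origin the profile is the constant \<open>c\<close>, outside the box of half-width \<open>28\<close>
it vanishes, and in between it is smooth. The smooth family is glued across both borders.\<close>

lemma localised_profile_diff_bounded:
  fixes \<phi> :: "real \<times> real \<Rightarrow> real \<Rightarrow> real"
  assumes sm: "smooth_family n U \<phi>" and U: "\<And>i. open (U i)" and Z: "\<And>i. open (Z i)"
    and cover: "\<And>i. wide_lines i \<subseteq> U i \<union> Z i"
    and near: "\<And>i x. x \<in> Z i \<Longrightarrow> \<phi> i x = c"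
    and S: "S \<subseteq> {0<..1}"
    and supp: "\<And>i x. fst i \<in> S \<Longrightarrow> \<bar>x\<bar> > 28 \<or> \<bar>snd i\<bar> > 28 \<Longrightarrow> \<phi> i x = 0"
  shows "\<exists>D. \<forall>i. fst i \<in> S \<longrightarrow> diff_bounded n D (\<lambda>x. exp ((x\<^sup>2 + (snd i)\<^sup>2) / 1800) * \<phi> i x)"
proof -
  have w: "smooth_family n wide_lines \<phi>"
  proof (rule smooth_family_extend[OF U Z cover sm])
    show "\<bar>\<phi> i x\<bar> \<le> \<bar>c\<bar>" if "x \<in> Z i" for i x using near[OF that] by simp
    show "(\<phi> i has_real_derivative 0) (at x)" if "x \<in> Z i" for i x
      by (rule has_field_derivative_transform_within_open[OF _ Z that, of "\<lambda>_. c"]) (auto simp: near)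
  qed
  define g where "g i x = indicator S (fst i) * (exp ((x\<^sup>2 + (snd i)\<^sup>2) / 1800) * \<phi> i x)" for i x
  have "smooth_family n wide_lines (\<lambda>i x. indicat_real S (fst i))"
    by (rule smooth_family_const[of _ _ 1]) (simp add: indicator_def)
  then have sg: "smooth_family n wide_lines g"
    unfolding g_def[abs_def] by (intro smooth_family_mult smooth_gaussian_factor w)
  define V where "V i = {x::real. \<bar>x\<bar> > 28} \<union> {x. \<bar>snd i\<bar> > 28 \<or> fst i \<notin> S}" for i :: "real \<times> real"
  have V: "open (V i)" for i
  proof -
    have "open {x::real. \<bar>x\<bar> > 28}" by (intro open_Collect_less continuous_intros)
    moreover have "open {x::real. \<bar>snd i\<bar> > 28 \<or> fst i \<notin> S}" by simp
    ultimately show ?thesis unfolding V_def by (rule open_Un)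
  qed
  have g0: "g i x = 0" if "x \<in> V i" for i x
  proof (cases "fst i \<in> S")
    case True
    then have "\<bar>x\<bar> > 28 \<or> \<bar>snd i\<bar> > 28" using that unfolding V_def by auto
    then show ?thesis using supp[OF True] by (simp add: g_def)
  qed (simp add: g_def)
  have "smooth_family n (\<lambda>_. UNIV) g"
  proof (rule smooth_family_extend[OF open_wide_lines V _ sg])
    show "UNIV \<subseteq> wide_lines i \<union> V i" for i
      using S by (auto simp: wide_lines_def V_def subset_eq)
    show "\<bar>g i x\<bar> \<le> 0" if "x \<in> V i" for i x using g0[OF that] by simp
    show "(g i has_real_derivative 0) (at x)" if "x \<in> V i" for i x
      by (rule has_field_derivative_transform_within_open[OF _ V that, of "\<lambda>_. 0"]) (auto simp: g0)
  qed
  then obtain D where D: "\<And>i. diff_bounded n D (g i)" using smooth_family_diff_bounded by blast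
  have "diff_bounded n D (\<lambda>x. exp ((x\<^sup>2 + (snd i)\<^sup>2) / 1800) * \<phi> i x)" if "fst i \<in> S" for i
    using D[of i] that by (simp add: g_def[abs_def])
  then show ?thesis by blast
qed

lemma diff_bounded_mono:
  assumes "diff_bounded M D h" "D \<le> D'"
  shows "diff_bounded M D' h"
proof -
  obtain g where g: "g 0 = h" "\<forall>n<M. \<forall>y. (g n has_real_derivative g (Suc n) y) (at y)" "\<forall>n\<le>M. \<forall>y. \<bar>g n y\<bar> \<le> D"
    using assms(1) unfolding diff_bounded_def by auto
  have "\<forall>n\<le>M. \<forall>y. \<bar>g n y\<bar> \<le> D'" using g(3) assms(2) order_trans by blast
  then show ?thesis unfolding diff_bounded_def using g(1,2) by (intro exI[of _ g]) simp
qed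

lemma line_smooth_mono: "line_smooth M D f \<Longrightarrow> D \<le> D' \<Longrightarrow> line_smooth M D' f"
  unfolding line_smooth_def using diff_bounded_mono by blast

text \<open>The rescaling by \<open>30\<close> moves the support into the unit square, as the Jackson approximation
demands, and the factor \<open>exp\<close> is the reciprocal of the Gaussian that will be split off.\<close>

lemma profile_line_smooth:
  fixes \<psi> :: "real \<Rightarrow> real \<Rightarrow> real \<Rightarrow> real"
  assumes s1: "smooth_family M lines1 (\<lambda>i u. \<psi> (fst i) u (snd i))"
    and s2: "smooth_family M lines2 (\<lambda>i v. \<psi> (fst i) (snd i) v)"
    and near: "\<And>s u v. arad s u v < 2 \<Longrightarrow> \<psi> s u v = c"
    and S: "S \<subseteq> {0<..1}"
    and supp: "\<And>s u v. s \<in> S \<Longrightarrow> \<bar>u\<bar> > 28 \<or> \<bar>v\<bar> > 28 \<Longrightarrow> \<psi> s u v = 0"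
    and meas: "\<And>s. (\<lambda>z. \<psi> s (fst z) (snd z)) \<in> borel_measurable borel"
  shows "\<exists>D. \<forall>s\<in>S. line_smooth M D (\<lambda>x y. exp ((x\<^sup>2 + y\<^sup>2) / 2) * \<psi> s (30 * x) (30 * y))"
proof -
  obtain D1 where D1: "\<And>i. fst i \<in> S \<Longrightarrow> diff_bounded M D1 (\<lambda>x. exp ((x\<^sup>2 + (snd i)\<^sup>2) / 1800) * \<psi> (fst i) x (snd i))"
  proof -
    have "\<exists>D. \<forall>i. fst i \<in> S \<longrightarrow> diff_bounded M D (\<lambda>x. exp ((x\<^sup>2 + (snd i)\<^sup>2) / 1800) * \<psi> (fst i) x (snd i))"
    proof (rule localised_profile_diff_bounded[OF s1 open_lines1, where Z = "\<lambda>i. {x. arad (fst i) x (snd i) < 2}" and c = c])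
      show "open {x. arad (fst i) x (snd i) < 2}" for i
        unfolding arad_def by (intro open_Collect_less continuous_intros)
      show "wide_lines i \<subseteq> lines1 i \<union> {x. arad (fst i) x (snd i) < 2}" for i
        by (auto simp: lines1_def)
    qed (use near S supp in auto)
    then show ?thesis using that by blast
  qed
  obtain D2 where D2: "\<And>i. fst i \<in> S \<Longrightarrow> diff_bounded M D2 (\<lambda>x. exp ((x\<^sup>2 + (snd i)\<^sup>2) / 1800) * \<psi> (fst i) (snd i) x)"
  proof -
    have "\<exists>D. \<forall>i. fst i \<in> S \<longrightarrow> diff_bounded M D (\<lambda>x. exp ((x\<^sup>2 + (snd i)\<^sup>2) / 1800) * \<psi> (fst i) (snd i) x)"
    proof (rule localised_profile_diff_bounded[OF s2 open_lines2, where Z = "\<lambda>i. {x. arad (fst i) (snd i) x < 2}" and c = c])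
      show "open {x. arad (fst i) (snd i) x < 2}" for i
        unfolding arad_def by (intro open_Collect_less continuous_intros)
      show "wide_lines i \<subseteq> lines2 i \<union> {x. arad (fst i) (snd i) x < 2}" for i
        by (auto simp: lines2_def)
    qed (use near S supp in auto)
    then show ?thesis using that by blast
  qed
  have sc: "exp ((x\<^sup>2 + y\<^sup>2) / 2) = exp (((30 * x)\<^sup>2 + (30 * y)\<^sup>2) / 1800)" for x y :: real
    by (simp add: power_mult_distrib add_divide_distrib)
  define D where "D = max (30 ^ M * D1) (30 ^ M * D2)"
  have "line_smooth M D (\<lambda>x y. exp ((x\<^sup>2 + y\<^sup>2) / 2) * \<psi> s (30 * x) (30 * y))" if s: "s \<in> S" for s
    unfolding line_smooth_def
  proof (intro conjI allI impI)
    have "(\<lambda>z. (\<lambda>z. \<psi> s (fst z) (snd z)) (30 * fst z, 30 * snd z)) \<in> borel_measurable borel"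
      by (rule measurable_compose[OF _ meas]) (simp add: borel_prod[symmetric])
    then have [measurable]: "(\<lambda>z. \<psi> s (30 * fst z) (30 * snd z)) \<in> borel_measurable borel" by simp
    have [measurable]: "(\<lambda>z::real\<times>real. exp (((fst z)\<^sup>2 + (snd z)\<^sup>2) / 2)) \<in> borel_measurable borel"
      by (intro borel_measurable_continuous_onI continuous_intros) simp
    show "(\<lambda>z. exp (((fst z)\<^sup>2 + (snd z)\<^sup>2) / 2) * \<psi> s (30 * fst z) (30 * snd z)) \<in> borel_measurable borel"
      by measurable
  next
    fix x y :: real assume "\<bar>x\<bar> > 1 \<or> \<bar>y\<bar> > 1"
    then have "\<bar>30 * x\<bar> > 28 \<or> \<bar>30 * y\<bar> > 28" by auto
    then show "exp ((x\<^sup>2 + y\<^sup>2) / 2) * \<psi> s (30 * x) (30 * y) = 0" using supp[OF s] by simp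
  next
    fix y
    have "diff_bounded M (30 ^ M * D1) (\<lambda>x. exp (((30 * x)\<^sup>2 + (30 * y)\<^sup>2) / 1800) * \<psi> s (30 * x) (30 * y))"
      using diff_bounded_dilate[OF D1[of "(s, 30 * y)"], of 30] s by simp
    then show "diff_bounded M D (\<lambda>x. exp ((x\<^sup>2 + y\<^sup>2) / 2) * \<psi> s (30 * x) (30 * y))"
      unfolding sc by (rule diff_bounded_mono) (simp add: D_def)
  next
    fix x
    have "diff_bounded M (30 ^ M * D2) (\<lambda>y. exp (((30 * x)\<^sup>2 + (30 * y)\<^sup>2) / 1800) * \<psi> s (30 * x) (30 * y))"
      using diff_bounded_dilate[OF D2[of "(s, 30 * x)"], of 30] s by (simp add: add.commute)
    then show "diff_bounded M D (\<lambda>y. exp ((x\<^sup>2 + y\<^sup>2) / 2) * \<psi> s (30 * x) (30 * y))"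
      unfolding sc by (rule diff_bounded_mono) (simp add: D_def)
  qed
  then show ?thesis by blast
qed

definition profile_hat :: "(real \<Rightarrow> real \<Rightarrow> real) \<Rightarrow> real^2 \<Rightarrow> complex" where
  "profile_hat f \<xi> = complex_of_real (f (30 * \<xi> $ 1) (30 * \<xi> $ 2))"

text \<open>For a budget of \<open>2 ^ L\<close> Gaussians take Jackson kernels with \<open>k = 2 ^ e\<close>, which use about \<open>k ^ 8\<close>
Gaussians, and smoothness \<open>M = 8 * P\<close>, so that the squared error \<open>k ^ (- 2 * M)\<close> is of order
\<open>4 ^ (- L * P)\<close>. If \<open>2 ^ L\<close> is too small for one kernel, the zero mixture is good enough.\<close>

lemma uniform_profile_approximation:
  fixes F :: "(real \<Rightarrow> real \<Rightarrow> real) set"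
  assumes F: "\<And>M. \<exists>D. \<forall>f\<in>F. line_smooth M D (\<lambda>x y. exp ((x\<^sup>2 + y\<^sup>2) / 2) * f (30 * x) (30 * y))"
  shows "\<exists>C\<ge>0. \<forall>f\<in>F. \<forall>L. \<exists>T. gauss_mix (2 ^ L) T \<and>
      norm_sq (\<lambda>x. inverse_fourier (profile_hat f) x - T x) \<le> C * ((1/4) ^ L) ^ P"
    and "f \<in> F \<Longrightarrow> integrable lborel (profile_hat f)"
proof -
  have hat: "profile_hat f = (\<lambda>\<xi>. complex_of_real (exp (- (norm \<xi>)\<^sup>2 / 2) *
      (exp (((\<xi> $ 1)\<^sup>2 + (\<xi> $ 2)\<^sup>2) / 2) * f (30 * \<xi> $ 1) (30 * \<xi> $ 2))))" for f
  proof
    fix \<xi> :: "real^2"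
    have "exp (- (norm \<xi>)\<^sup>2 / 2) * exp (((\<xi> $ 1)\<^sup>2 + (\<xi> $ 2)\<^sup>2) / 2) = 1"
      unfolding norm_real2_sq exp_add[symmetric] by (simp add: add_divide_distrib diff_divide_distrib)
    then show "profile_hat f \<xi> = complex_of_real (exp (- (norm \<xi>)\<^sup>2 / 2) *
      (exp (((\<xi> $ 1)\<^sup>2 + (\<xi> $ 2)\<^sup>2) / 2) * f (30 * \<xi> $ 1) (30 * \<xi> $ 2)))"
      by (simp only: profile_hat_def mult.assoc[symmetric] mult_1_left)
  qed
  show int: "integrable lborel (profile_hat f)" if "f \<in> F" for f
    using F[of 0] that gaussian_mixture_fourier_approximation(2)[of 1 0] unfolding hat by fastforce
  define M where "M = 8 * P"
  obtain D where D: "\<And>f. f \<in> F \<Longrightarrow> line_smooth M D (\<lambda>x y. exp ((x\<^sup>2 + y\<^sup>2) / 2) * f (30 * x) (30 * y))"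
    using F by blast
  define A where "A = (((1 + 2 ^ M) * (4 / 3 * abs_moment M) + 9 * 4 ^ M * 2 ^ (M + 2)) * D)\<^sup>2 * gaussian_moment2 (2 * (M + 2))"
  define A0 where "A0 = D\<^sup>2 * gaussian_moment2 0"
  have gm: "0 \<le> gaussian_moment2 n" for n unfolding gaussian_moment2_def by (intro integral_nonneg_AE) auto
  have A: "0 \<le> A" "0 \<le> A0" unfolding A_def A0_def by (intro mult_nonneg_nonneg gm; simp)+
  obtain c0 where c0: "9 * M\<^sup>2 \<le> 2 ^ c0"
    using less_exp[of "9 * M\<^sup>2"] less_imp_le by blast
  define C where "C = A * (4 ^ (c0 + 7)) ^ P + A0 * (4 ^ c0) ^ P"
  have C: "0 \<le> C" unfolding C_def using A by (intro add_nonneg_nonneg mult_nonneg_nonneg) auto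
  have "\<exists>T. gauss_mix (2 ^ L) T \<and> norm_sq (\<lambda>x. inverse_fourier (profile_hat f) x - T x) \<le> C * ((1/4) ^ L) ^ P"
    if f: "f \<in> F" for f L
  proof (cases "c0 \<le> L")
    case True
  (* 2 ^ c0 covers the constant in the number of Gaussians, and 8 binary levels of budget double k. *)
    define e where "e = (L - c0) div 8"
    have e: "c0 + 8 * e \<le> L" "L \<le> c0 + 7 + 8 * e" using True unfolding e_def by presburger+
    define k :: nat where "k = 2 ^ e"
    have k: "k \<ge> 1" by (simp add: k_def)
    obtain T where T: "gauss_mix ((M * (2 * k ^ 4 + 1))\<^sup>2) T"
      and err: "norm_sq (\<lambda>x. inverse_fourier (profile_hat f) x - T x)
        \<le> (((1 + 2 ^ M) * (4 / 3 * abs_moment M) + 9 * 4 ^ M * 2 ^ (M + 2)) * D / real k ^ M)\<^sup>2 * gaussian_moment2 (2 * (M + 2))"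
      using gaussian_mixture_fourier_approximation(1)[OF k D[OF f]] unfolding hat by blast
    have "(M * (2 * k ^ 4 + 1))\<^sup>2 \<le> (M * (3 * k ^ 4))\<^sup>2"
      using k by (intro power_mono mult_le_mono2) (auto simp: Suc_le_eq)
    also have "\<dots> = 9 * M\<^sup>2 * k ^ 8" by (simp add: power_mult_distrib power_mult[symmetric])
    also have "\<dots> \<le> 2 ^ c0 * k ^ 8" using c0 by (intro mult_le_mono1)
    also have "\<dots> = 2 ^ (c0 + 8 * e)" unfolding k_def by (simp only: power_add power_mult[symmetric] mult.commute)
    also have "\<dots> \<le> 2 ^ L" using e(1) by (intro power_increasing) auto
    finally have "gauss_mix (2 ^ L) T" using T gauss_mix_mono by blast
    moreover have "norm_sq (\<lambda>x. inverse_fourier (profile_hat f) x - T x) \<le> A / (real k ^ M)\<^sup>2"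
      using err by (simp add: A_def power_divide)
    moreover have "A / (real k ^ M)\<^sup>2 \<le> A * (4 ^ (c0 + 7)) ^ P * ((1/4) ^ L) ^ P"
    proof -
      have "(real k ^ M)\<^sup>2 = (4 ^ (8 * e)) ^ P"
      proof -
        have "(real k ^ M)\<^sup>2 = 2 ^ (e * M * 2)" by (simp only: k_def of_nat_power of_nat_numeral power_mult)
        also have "e * M * 2 = 2 * (8 * e) * P" by (simp add: M_def)
        also have "(2::real) ^ (2 * (8 * e) * P) = ((2 ^ 2) ^ (8 * e)) ^ P" by (simp only: power_mult)
        finally show ?thesis by simp
      qed
      moreover have "(4::real) ^ L \<le> 4 ^ (c0 + 7) * 4 ^ (8 * e)"
        unfolding power_add[symmetric] using e(2) by (intro power_increasing) auto
      then have "((4::real) ^ L) ^ P \<le> (4 ^ (c0 + 7)) ^ P * (4 ^ (8 * e)) ^ P"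
        unfolding power_mult_distrib[symmetric] by (intro power_mono) auto
      then have "1 / (4 ^ (8 * e)) ^ P \<le> (4 ^ (c0 + 7)) ^ P * (1 / ((4::real) ^ L) ^ P)"
        by (simp add: field_simps)
      ultimately have "A * (1 / (real k ^ M)\<^sup>2) \<le> A * ((4 ^ (c0 + 7)) ^ P * ((1/4) ^ L) ^ P)"
        using A by (intro mult_left_mono) (auto simp: power_one_over)
      then show ?thesis by simp
    qed
    moreover have "A * (4 ^ (c0 + 7)) ^ P * ((1/4) ^ L) ^ P \<le> C * ((1/4) ^ L) ^ P"
      unfolding C_def using A by (intro mult_right_mono) auto
    ultimately show ?thesis by (meson order_trans)
  next
    case False
    have i1: "integrable lborel (profile_hat f)" by (rule int[OF f])
    then have [measurable]: "profile_hat f \<in> borel_measurable borel" by auto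
    have le: "(cmod (profile_hat f \<xi>))\<^sup>2 \<le> D\<^sup>2 * ((1 + \<bar>\<xi> $ 1\<bar> + \<bar>\<xi> $ 2\<bar>) ^ 0 * exp (- (1 * (norm \<xi>)\<^sup>2)))" for \<xi>
    proof -
      have "\<bar>exp (((\<xi> $ 1)\<^sup>2 + (\<xi> $ 2)\<^sup>2) / 2) * f (30 * \<xi> $ 1) (30 * \<xi> $ 2)\<bar> \<le> D"
        using line_smooth_bound[OF order_refl D[OF f], of "\<xi> $ 1" "\<xi> $ 2"] by simp
      then have "cmod (profile_hat f \<xi>) \<le> exp (- (norm \<xi>)\<^sup>2 / 2) * D"
        unfolding hat norm_of_real abs_mult[of "exp (- (norm \<xi>)\<^sup>2 / 2)"] by (intro mult_mono) auto
      then have "(cmod (profile_hat f \<xi>))\<^sup>2 \<le> (exp (- (norm \<xi>)\<^sup>2 / 2) * D)\<^sup>2" by (intro power_mono) auto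
      moreover have "(exp (- (norm \<xi>)\<^sup>2 / 2) * D)\<^sup>2 = D\<^sup>2 * exp (- (norm \<xi>)\<^sup>2)"
        by (simp add: power_mult_distrib power2_eq_square[of "exp _"] exp_add[symmetric] del: exp_add)
      ultimately show ?thesis by simp
    qed
    have iG: "integrable lborel (\<lambda>\<xi>::real^2. D\<^sup>2 * ((1 + \<bar>\<xi> $ 1\<bar> + \<bar>\<xi> $ 2\<bar>) ^ 0 * exp (- (1 * (norm \<xi>)\<^sup>2))))"
      by (intro integrable_mult_right integrable_polynomial_gaussian2) simp
    have i2: "integrable lborel (\<lambda>\<xi>. (cmod (profile_hat f \<xi>))\<^sup>2)"
    proof (rule Bochner_Integration.integrable_bound[OF iG])
      show "AE \<xi> in lborel. norm ((cmod (profile_hat f \<xi>))\<^sup>2) \<le> norm (D\<^sup>2 * ((1 + \<bar>\<xi> $ 1\<bar> + \<bar>\<xi> $ 2\<bar>) ^ 0 * exp (- (1 * (norm \<xi>)\<^sup>2))))"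
        by (intro AE_I2) (simp only: real_norm_def abs_power2, rule order_trans[OF le abs_ge_self])
    qed simp
    have "norm_sq (inverse_fourier (profile_hat f)) \<le> (\<integral>\<xi>. (cmod (profile_hat f \<xi>))\<^sup>2 \<partial>lborel)"
      by (rule plancherel_inequality[OF i1 i2])
    also have "\<dots> \<le> (\<integral>\<xi>. D\<^sup>2 * ((1 + \<bar>\<xi> $ 1\<bar> + \<bar>\<xi> $ 2\<bar>) ^ 0 * exp (- (1 * (norm \<xi>)\<^sup>2))) \<partial>(lborel :: (real^2) measure))"
      by (rule Bochner_Integration.integral_mono[OF i2 iG le])
    also have "\<dots> = A0"
      unfolding A0_def gaussian_moment2_def by (rule Bochner_Integration.integral_mult_right_zero)
    also have "A0 * 1 \<le> A0 * ((4 ^ c0) ^ P * ((1/4) ^ L) ^ P)"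
    proof (intro mult_left_mono A)
      have "(4::real) ^ L \<le> 4 ^ c0" using False by (intro power_increasing) auto
      then have "((4::real) ^ L) ^ P \<le> (4 ^ c0) ^ P" by (intro power_mono) auto
      then show "(1::real) \<le> (4 ^ c0) ^ P * ((1/4) ^ L) ^ P"
        by (simp add: power_one_over field_simps)
    qed
    then have "A0 \<le> A0 * (4 ^ c0) ^ P * ((1/4) ^ L) ^ P" by (simp add: mult.assoc)
    also have "\<dots> \<le> C * ((1/4) ^ L) ^ P"
      unfolding C_def using A by (intro mult_right_mono) auto
    finally have "norm_sq (\<lambda>x. inverse_fourier (profile_hat f) x - 0) \<le> C * ((1/4) ^ L) ^ P" by simp
    then show ?thesis using gauss_mix_zero[of "2 ^ L"] by blast
  qed
  then show "\<exists>C\<ge>0. \<forall>f\<in>F. \<forall>L. \<exists>T. gauss_mix (2 ^ L) T \<and>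
      norm_sq (\<lambda>x. inverse_fourier (profile_hat f) x - T x) \<le> C * ((1/4) ^ L) ^ P"
    using C by blast
qed

section \<open>The profiles of the curvelet windows\<close>

text \<open>The bound \<open>60\<close> exceeds the radius of every point in the box under consideration.\<close>

lemma radial_derivative_sequence:
  assumes "smooth_real_on S f" "{0..} \<subseteq> S"
  obtains W :: "nat \<Rightarrow> real \<Rightarrow> real"
  where "\<And>r. 0 \<le> r \<Longrightarrow> W 0 r = f r"
    and "\<And>m r. 0 < r \<Longrightarrow> (W m has_real_derivative W (Suc m) r) (at r)"
    and "\<And>m. \<exists>B. \<forall>r. 0 < r \<and> r \<le> 60 \<longrightarrow> \<bar>W m r\<bar> \<le> B"
proof -
  obtain W where W: "\<forall>x\<in>S. W 0 x = f x"
    "\<forall>n. \<forall>x\<in>S. (W n has_real_derivative W (Suc n) x) (at x within S)"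
    using assms(1) unfolding smooth_real_on_def by blast
  show ?thesis
  proof (rule that[of W])
    show "W 0 r = f r" if "0 \<le> r" for r using W(1) assms(2) that by auto
    show "(W m has_real_derivative W (Suc m) r) (at r)" if "0 < r" for m r
    proof -
      have "r \<in> S" using that assms(2) by auto
      then have "(W m has_real_derivative W (Suc m) r) (at r within S)" using W(2) by blast
      then have "(W m has_real_derivative W (Suc m) r) (at r within {0<..})"
        by (rule has_field_derivative_subset) (use assms(2) in auto)
      then show ?thesis using at_within_open[of r "{0<..}"] that by simp
    qed
    show "\<exists>B. \<forall>r. 0 < r \<and> r \<le> 60 \<longrightarrow> \<bar>W m r\<bar> \<le> B" for m
    proof -
      have "continuous_on S (W m)" using W(2) by (meson DERIV_continuous_on)
      then have "continuous_on {0..60} (W m)" by (rule continuous_on_subset) (use assms(2) in auto)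
      then have "bounded (W m ` {0..60})" by (intro compact_imp_bounded compact_continuous_image) auto
      then obtain B where "\<forall>y \<in> W m ` {0..60}. \<bar>y\<bar> \<le> B" unfolding bounded_iff by auto
      then show ?thesis by (intro exI[of _ B]) auto
    qed
  qed
qed

lemma compact_derivative_sequence:
  assumes "smooth_real_on UNIV f" "\<And>x. \<bar>x\<bar> > c \<Longrightarrow> f x = 0"
  obtains N :: "nat \<Rightarrow> real \<Rightarrow> real"
  where "N 0 = f"
    and "\<And>m x. (N m has_real_derivative N (Suc m) x) (at x)"
    and "\<And>m x. \<bar>x\<bar> > c \<Longrightarrow> N m x = 0"
    and "\<And>m. \<exists>B. \<forall>x. \<bar>N m x\<bar> \<le> B"
proof -
  obtain N where N: "N 0 = f" "\<And>m x. (N m has_real_derivative N (Suc m) x) (at x)"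
    using assms(1) unfolding smooth_real_on_def by (auto simp: fun_eq_iff)
  have z: "\<bar>x\<bar> > c \<Longrightarrow> N m x = 0" for m x
  proof (induction m arbitrary: x)
    case 0
    then show ?case using assms(2) N(1) by simp
  next
    case (Suc m)
    have "open {x::real. \<bar>x\<bar> > c}" by (intro open_Collect_less continuous_intros)
    then have "(N m has_real_derivative 0) (at x)"
      by (rule has_field_derivative_transform_within_open[of "\<lambda>_. 0", rotated]) (use Suc in auto)
    then show ?case using N(2) DERIV_unique by blast
  qed
  have "\<exists>B. \<forall>x. \<bar>N m x\<bar> \<le> B" for m
  proof -
    have "continuous_on UNIV (N m)" using N(2) by (meson DERIV_continuous_on DERIV_subset top_greatest)
    then have "continuous_on {-c..c} (N m)" by (rule continuous_on_subset) auto
    then have "bounded (N m ` {-c..c})" by (intro compact_imp_bounded compact_continuous_image) auto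
    then obtain B where B: "\<forall>y \<in> N m ` {-c..c}. \<bar>y\<bar> \<le> B" unfolding bounded_iff by auto
    have "\<bar>N m x\<bar> \<le> max B 0" for x
    proof (cases "\<bar>x\<bar> > c")
      case True then show ?thesis using z by simp
    next
      case False
      then have "x \<in> {-c..c}" by auto
      then have "\<bar>N m x\<bar> \<le> B" using B by blast
      then show ?thesis by simp
    qed
    then show ?thesis by blast
  qed
  then show ?thesis using that N z by blast
qed

lemma vector2_borel [measurable]:
  assumes [measurable]: "f \<in> borel_measurable M" "g \<in> borel_measurable M"
  shows "(\<lambda>x. vector [f x, g x] :: real^2) \<in> borel_measurable M"
proof -
  have "vector [f x, g x] = f x *\<^sub>R axis 1 1 + g x *\<^sub>R (axis 2 1 :: real^2)" for x
    by (simp add: vector2_eq_iff axis_def)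
  then show ?thesis by simp
qed

context curvelet_system begin

definition radial_profile :: "(real \<Rightarrow> real) \<Rightarrow> real \<Rightarrow> real \<Rightarrow> real \<Rightarrow> real" where
  "radial_profile W s u v = W (arad s u v)"

definition wedge_profile :: "real \<Rightarrow> real \<Rightarrow> real \<Rightarrow> real" where
  "wedge_profile s u v = w (arad s u v) * angular \<nu> s u v"

text \<open>Up to dilations the curvelet windows are these functions: the two isotropic ones, and one wedge
for each eccentricity. In the isotropic case \<open>s = 1\<close>.\<close>

definition profiles :: "(real \<Rightarrow> real \<Rightarrow> real) set" where
  "profiles = {radial_profile w0 1, radial_profile w 1} \<union> wedge_profile ` {0<..1/2}"

lemma arad_ge: "\<bar>u\<bar> \<le> arad s u v" "\<bar>s * v\<bar> \<le> arad s u v"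
  unfolding arad_def by (simp_all add: real_le_rsqrt)

lemma arad_continuous: "continuous_on UNIV (\<lambda>z. arad s (fst z) (snd z))"
  unfolding arad_def by (intro continuous_intros)

lemma radial_profile_line_smooth:
  assumes W: "smooth_real_on S W" "{0..} \<subseteq> S" and near: "\<And>r. 0 \<le> r \<Longrightarrow> r < 2 \<Longrightarrow> W r = c"
    and supp: "\<And>r. r > 8 * pi / 3 \<Longrightarrow> W r = 0"
  shows "\<exists>D. line_smooth M D (\<lambda>x y. exp ((x\<^sup>2 + y\<^sup>2) / 2) * radial_profile W 1 (30 * x) (30 * y))"
proof -
  obtain V where V: "\<And>r. 0 \<le> r \<Longrightarrow> V 0 r = W r"
    "\<And>m r. 0 < r \<Longrightarrow> (V m has_real_derivative V (Suc m) r) (at r)"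
    "\<And>m. \<exists>B. \<forall>r. 0 < r \<and> r \<le> 60 \<longrightarrow> \<bar>V m r\<bar> \<le> B"
    using radial_derivative_sequence[OF W] by blast
  have "\<exists>D. \<forall>s\<in>{1}. line_smooth M D (\<lambda>x y. exp ((x\<^sup>2 + y\<^sup>2) / 2) * radial_profile W s (30 * x) (30 * y))"
  proof (rule profile_line_smooth)
    show "smooth_family M lines1 (\<lambda>i u. radial_profile W (fst i) u (snd i))"
      using smooth_radial1[of V M, OF V(2,3)] by (simp add: radial_profile_def V(1))
    show "smooth_family M lines2 (\<lambda>i v. radial_profile W (fst i) (snd i) v)"
      using smooth_radial2[of V M, OF V(2,3)] by (simp add: radial_profile_def V(1))
    show "radial_profile W s u v = c" if "arad s u v < 2" for s u v
      using near that by (simp add: radial_profile_def)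
    show "{1} \<subseteq> {0<..1::real}" by simp
    show "radial_profile W s u v = 0" if "s \<in> {1}" "\<bar>u\<bar> > 28 \<or> \<bar>v\<bar> > 28" for s u v
      unfolding radial_profile_def
    proof (rule supp)
      have "28 < arad s u v" using that arad_ge[where s = s and u = u and v = v] by auto
      then show "8 * pi / 3 < arad s u v" using pi_less_4 by linarith
    qed
    show "(\<lambda>z. radial_profile W s (fst z) (snd z)) \<in> borel_measurable borel" for s
      unfolding radial_profile_def
      by (intro borel_measurable_continuous_onI continuous_on_compose2[OF smooth_real_on_continuous[OF W(1)] arad_continuous])
        (use W(2) in \<open>auto simp: subset_eq\<close>)
  qed
  then show ?thesis by simp
qed

lemma abs_sin_le: "\<bar>a\<bar> \<le> b \<Longrightarrow> \<bar>sin a\<bar> \<le> (b::real)"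
  using abs_sin_x_le_abs_x order_trans by blast

text \<open>The angle is at most \<open>pi * s\<close> in absolute value, so \<open>s * |v| \<le> 8 * pi / 3 * (pi * s)\<close>, and
\<open>8 * pi\<^sup>2 / 3 < 28\<close>.\<close>

lemma wedge_profile_support:
  assumes s: "s \<in> {0<..1/2}" and nz: "wedge_profile s u v \<noteq> 0"
  shows "\<bar>u\<bar> \<le> 28 \<and> \<bar>v\<bar> \<le> 28"
proof -
  let ?x = "vector [u, s * v] :: real^2"
  let ?a = "wrap_angle (polar_angle ?x)"
  have n: "norm ?x = arad s u v" by (simp add: arad_def norm_eq_sqrt_inner inner_real2 power2_eq_square)
  have r: "arad s u v \<le> 8 * pi / 3" and "angular \<nu> s u v \<noteq> 0"
    using nz w_support[of "arad s u v"] by (auto simp: wedge_profile_def)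
  then have "\<nu> (?a / s) \<noteq> 0" using s by (auto simp: angular_def)
  then have "\<bar>?a / s\<bar> \<le> pi" by (rule \<nu>_support)
  then have "\<bar>?a\<bar> \<le> pi * s" using s by (simp add: field_simps)
  then have "\<bar>sin ?a\<bar> \<le> pi * s" by (rule abs_sin_le)
  then have sn: "\<bar>sin (polar_angle ?x)\<bar> \<le> pi * s" by (simp add: sin_wrap_angle)
  have "\<bar>s * v\<bar> = arad s u v * \<bar>sin (polar_angle ?x)\<bar>"
    using arg_cong[OF polar_2[of ?x], of abs] unfolding n abs_mult by (simp add: abs_mult arad_def)
  also have "\<dots> \<le> (8 * pi / 3) * (pi * s)" by (intro mult_mono r sn) auto
  finally have "s * \<bar>v\<bar> \<le> s * (8 / 3 * pi\<^sup>2)" using s by (simp add: abs_mult power2_eq_square algebra_simps)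
  then have "\<bar>v\<bar> \<le> 8 / 3 * pi\<^sup>2" using s by simp
  moreover have "pi\<^sup>2 \<le> 3.2\<^sup>2" using pi_approx by (intro power_mono) auto
  ultimately have "\<bar>v\<bar> \<le> 28" by (simp add: power2_eq_square)
  moreover have "\<bar>u\<bar> \<le> 28" using arad_ge(1)[where s = s and u = u and v = v] r pi_less_4 by linarith
  ultimately show ?thesis by blast
qed

lemma wedge_profile_line_smooth:
  "\<exists>D. \<forall>s\<in>{0<..1/2}. line_smooth M D (\<lambda>x y. exp ((x\<^sup>2 + y\<^sup>2) / 2) * wedge_profile s (30 * x) (30 * y))"
proof -
  obtain V where V: "\<And>r. 0 \<le> r \<Longrightarrow> V 0 r = w r"
    "\<And>m r. 0 < r \<Longrightarrow> (V m has_real_derivative V (Suc m) r) (at r)"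
    "\<And>m. \<exists>B. \<forall>r. 0 < r \<and> r \<le> 60 \<longrightarrow> \<bar>V m r\<bar> \<le> B"
    using radial_derivative_sequence[OF smooth_w] by blast
  have "\<bar>x\<bar> > pi \<Longrightarrow> \<nu> x = 0" for x using \<nu>_support[of x] by linarith
  then obtain N where N: "N 0 = \<nu>" "\<And>m x. (N m has_real_derivative N (Suc m) x) (at x)"
    "\<And>m x. \<bar>x\<bar> > pi \<Longrightarrow> N m x = 0" "\<And>m. \<exists>B. \<forall>x. \<bar>N m x\<bar> \<le> B"
    using compact_derivative_sequence[OF smooth_\<nu>, of pi] by blast
  have eq: "wedge_profile = (\<lambda>s u v. V 0 (arad s u v) * angular (N 0) s u v)"
    by (simp add: wedge_profile_def fun_eq_iff V(1) N(1))
  show ?thesis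
  proof (rule profile_line_smooth)
    show "smooth_family M lines1 (\<lambda>i u. wedge_profile (fst i) u (snd i))"
      unfolding eq by (intro smooth_family_mult smooth_radial1[of V, OF V(2,3)] smooth_angular1[of N, OF N(2-4)])
    show "smooth_family M lines2 (\<lambda>i v. wedge_profile (fst i) (snd i) v)"
      unfolding eq by (intro smooth_family_mult smooth_radial2[of V, OF V(2,3)] smooth_angular2[of N, OF N(2-4)])
    show "wedge_profile s u v = 0" if "arad s u v < 2" for s u v
    proof -
      have "w (arad s u v) = 0" using w_support[of "arad s u v"] that pi_gt3 by fastforce
      then show ?thesis by (simp add: wedge_profile_def)
    qed
    show "{0<..1/2} \<subseteq> {0<..1::real}" by auto
    show "wedge_profile s u v = 0" if "s \<in> {0<..1/2}" "\<bar>u\<bar> > 28 \<or> \<bar>v\<bar> > 28" for s u v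
      using wedge_profile_support[OF that(1), of u v] that(2) by linarith
    show "(\<lambda>z. wedge_profile s (fst z) (snd z)) \<in> borel_measurable borel" for s
    proof -
      have [measurable]: "(\<lambda>z. arad s (fst z) (snd z)) \<in> borel_measurable borel"
        by (intro borel_measurable_continuous_onI arad_continuous)
      have [measurable]: "(fst :: real \<times> real \<Rightarrow> real) \<in> borel_measurable borel" "(snd :: real \<times> real \<Rightarrow> real) \<in> borel_measurable borel"
        by (intro borel_measurable_continuous_onI continuous_intros)+
      show ?thesis unfolding wedge_profile_def angular_def by measurable
    qed
  qed
qed

text \<open>One bound for infinitely many profiles: this uniformity is where the parabolic scaling of the
curvelets enters.\<close>

lemma profiles_line_smooth:
  "\<exists>D. \<forall>f\<in>profiles. line_smooth M D (\<lambda>x y. exp ((x\<^sup>2 + y\<^sup>2) / 2) * f (30 * x) (30 * y))"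
proof -
  let ?g = "\<lambda>f x y. exp ((x\<^sup>2 + y\<^sup>2) / 2) * f (30 * x) (30 * y)"
  have "\<exists>D. line_smooth M D (?g (radial_profile w0 1))"
  proof (rule radial_profile_line_smooth[OF smooth_w0])
    show "w0 r = 1" if "0 \<le> r" "r < 2" for r
      using w0_near_0[OF that(1)] that(2) pi_gt3 by linarith
    show "w0 r = 0" if "8 * pi / 3 < r" for r using w0_support[of r] that by linarith
  qed simp
  moreover have "\<exists>D. line_smooth M D (?g (radial_profile w 1))"
  proof (rule radial_profile_line_smooth[OF smooth_w])
    show "w r = 0" if "0 \<le> r" "r < 2" for r
      using w_support[of r] that(2) pi_gt3 by linarith
    show "w r = 0" if "8 * pi / 3 < r" for r using w_support[of r] that by linarith
  qed simp
  moreover obtain D3 where "\<And>s. s \<in> {0<..1/2} \<Longrightarrow> line_smooth M D3 (?g (wedge_profile s))"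
    using wedge_profile_line_smooth[of M] by blast
  ultimately obtain D1 D2 where D: "line_smooth M D1 (?g (radial_profile w0 1))" "line_smooth M D2 (?g (radial_profile w 1))"
    "\<And>s. s \<in> {0<..1/2} \<Longrightarrow> line_smooth M D3 (?g (wedge_profile s))"
    by blast
  define D where "D = max D1 (max D2 D3)"
  have "D1 \<le> D" "D2 \<le> D" "D3 \<le> D" by (auto simp: D_def)
  then have "line_smooth M D (?g f)" if "f \<in> profiles" for f
    using that D line_smooth_mono unfolding profiles_def by blast
  then show ?thesis by blast
qed

end

section \<open>Uniform approximation of curvelets\<close>

definition diag2 :: "real \<Rightarrow> real \<Rightarrow> real^2^2" where
  "diag2 a b = vector [vector [a, 0], vector [0, b]]"

lemma diag2_mult: "diag2 a b *v x = vector [a * x $ 1, b * x $ 2]"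
  by (simp add: vector2_eq_iff diag2_def matrix_vector_mult_def sum_2)

lemma det_diag2: "det (diag2 a b) = a * b"
  by (simp add: det_2 diag2_def)

lemma invertible_diag2: "a \<noteq> 0 \<Longrightarrow> b \<noteq> 0 \<Longrightarrow> invertible (diag2 a b)"
  by (simp add: invertible_det_nz det_diag2)

lemma matrix_vector_borel [measurable]: "(\<lambda>x::real^2. A *v x) \<in> borel_measurable borel" for A :: "real^2^2"
  by (intro borel_measurable_continuous_onI continuous_intros)

text \<open>Allowing negative factors covers the reflection \<open>\<xi> \<mapsto> - \<xi>\<close> as well.\<close>

lemma inverse_fourier_dilate:
  fixes \<Psi> :: "real^2 \<Rightarrow> complex"
  assumes pq: "p \<noteq> 0" "q \<noteq> 0" and [measurable]: "\<Psi> \<in> borel_measurable borel"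
  shows "inverse_fourier (\<lambda>\<xi>. \<Psi> (diag2 (1 / p) (1 / q) *v \<xi>)) x =
    complex_of_real \<bar>p * q\<bar> * inverse_fourier \<Psi> (diag2 p q *v x)"
proof -
  let ?f = "\<lambda>\<xi>. \<Psi> (diag2 (1 / p) (1 / q) *v \<xi>) * exp (\<i> * complex_of_real (x \<bullet> \<xi>))"
  have f: "?f \<in> borel_measurable borel" by measurable
  have inv: "diag2 (1 / p) (1 / q) *v (diag2 p q *v \<xi>) = \<xi>" for \<xi>
    using pq by (simp add: diag2_mult vector2_eq_iff)
  have ip: "x \<bullet> (diag2 p q *v \<xi>) = (diag2 p q *v x) \<bullet> \<xi>" for \<xi>
    by (simp add: diag2_mult inner_real2)
  have "(\<integral>\<xi>. ?f \<xi> \<partial>lborel) = \<bar>p * q\<bar> *\<^sub>R (\<integral>\<xi>. \<Psi> \<xi> * exp (\<i> * complex_of_real ((diag2 p q *v x) \<bullet> \<xi>)) \<partial>lborel)"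
    using integral_affine[OF invertible_diag2[OF pq] f, of 0] by (simp only: add_0_right det_diag2 inv ip)
  moreover have m: "(\<lambda>\<xi>. \<Psi> (diag2 (1 / p) (1 / q) *v \<xi>)) \<in> borel_measurable borel" by measurable
  ultimately show ?thesis
    unfolding inverse_fourier_eq_lborel[OF m] inverse_fourier_eq_lborel[OF assms(3)]
    by (simp add: scaleR_conv_of_real)
qed

lemma wrap_angle_cong:
  assumes "cos a = cos b" "sin a = sin b"
  shows "wrap_angle a = wrap_angle b"
proof -
  have "cos (wrap_angle a) = cos (wrap_angle b)" "sin (wrap_angle a) = sin (wrap_angle b)"
    using assms by (simp_all add: cos_wrap_angle sin_wrap_angle)
  then obtain n :: int where n: "wrap_angle a = wrap_angle b + 2 * pi * of_int n"
    using sin_cos_eq_iff by blast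
  have "\<bar>2 * pi * of_int n\<bar> < 2 * pi"
    using n wrap_angle_bounds[of a] wrap_angle_bounds[of b] by linarith
  then have "\<bar>real_of_int n\<bar> < 1" by (simp add: abs_mult)
  then have "n = 0" by linarith
  then show ?thesis using n by simp
qed

lemma polar_angle_scale_wrap:
  assumes "\<xi> \<noteq> 0" "c > 0"
  shows "wrap_angle (polar_angle (c *\<^sub>R \<xi>)) = wrap_angle (polar_angle \<xi>)"
    and "wrap_angle (polar_angle (- c *\<^sub>R \<xi>)) = wrap_angle (polar_angle \<xi> - pi)"
proof -
  have n: "c * norm \<xi> \<noteq> 0" "norm (c *\<^sub>R \<xi>) = c * norm \<xi>" "norm (- c *\<^sub>R \<xi>) = c * norm \<xi>" using assms by simp_all
  have "c * norm \<xi> * cos (polar_angle (c *\<^sub>R \<xi>)) = c * norm \<xi> * cos (polar_angle \<xi>)"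
    "c * norm \<xi> * sin (polar_angle (c *\<^sub>R \<xi>)) = c * norm \<xi> * sin (polar_angle \<xi>)"
    "c * norm \<xi> * cos (polar_angle (- c *\<^sub>R \<xi>)) = c * norm \<xi> * - cos (polar_angle \<xi>)"
    "c * norm \<xi> * sin (polar_angle (- c *\<^sub>R \<xi>)) = c * norm \<xi> * - sin (polar_angle \<xi>)"
    using polar_1[of \<xi>] polar_2[of \<xi>] polar_1[of "c *\<^sub>R \<xi>"] polar_2[of "c *\<^sub>R \<xi>"]
      polar_1[of "- c *\<^sub>R \<xi>"] polar_2[of "- c *\<^sub>R \<xi>"]
    unfolding n(2,3) by (simp_all only: vector_scaleR_component real_scaleR_def mult_minus_left mult_minus_right mult.assoc)
  then have "cos (polar_angle (c *\<^sub>R \<xi>)) = cos (polar_angle \<xi>)"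
    "sin (polar_angle (c *\<^sub>R \<xi>)) = sin (polar_angle \<xi>)"
    "cos (polar_angle (- c *\<^sub>R \<xi>)) = cos (polar_angle \<xi> - pi)"
    "sin (polar_angle (- c *\<^sub>R \<xi>)) = sin (polar_angle \<xi> - pi)"
    using n(1) by (simp_all only: mult_cancel_left cos_minus_pi sin_minus_pi) simp_all
  then show "wrap_angle (polar_angle (c *\<^sub>R \<xi>)) = wrap_angle (polar_angle \<xi>)"
    and "wrap_angle (polar_angle (- c *\<^sub>R \<xi>)) = wrap_angle (polar_angle \<xi> - pi)"
    by (blast intro: wrap_angle_cong)+
qed

context curvelet_system begin

lemma profile_hat_integrable:
  assumes f: "f \<in> profiles"
  shows "integrable lborel (profile_hat f)" "integrable lborel (\<lambda>\<xi>. (cmod (profile_hat f \<xi>))\<^sup>2)"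
proof -
  show i: "integrable lborel (profile_hat f)"
    by (rule uniform_profile_approximation(2)[OF profiles_line_smooth f])
  then have [measurable]: "profile_hat f \<in> borel_measurable borel" by auto
  obtain D where D: "line_smooth 0 D (\<lambda>x y. exp ((x\<^sup>2 + y\<^sup>2) / 2) * f (30 * x) (30 * y))"
    using profiles_line_smooth f by blast
  have b: "cmod (profile_hat f \<xi>) \<le> D" for \<xi>
  proof -
    have "1 * \<bar>f (30 * \<xi> $ 1) (30 * \<xi> $ 2)\<bar> \<le> exp (((\<xi> $ 1)\<^sup>2 + (\<xi> $ 2)\<^sup>2) / 2) * \<bar>f (30 * \<xi> $ 1) (30 * \<xi> $ 2)\<bar>"
      by (intro mult_right_mono) auto
    also have "\<dots> \<le> D" using line_smooth_bound[OF order_refl D, of "\<xi> $ 1" "\<xi> $ 2"] by (simp add: abs_mult)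
    finally show ?thesis by (simp add: profile_hat_def)
  qed
  show "integrable lborel (\<lambda>\<xi>. (cmod (profile_hat f \<xi>))\<^sup>2)"
  proof (rule Bochner_Integration.integrable_bound)
    show "integrable lborel (\<lambda>\<xi>. D * cmod (profile_hat f \<xi>))"
      by (intro integrable_mult_right integrable_norm i)
    show "AE \<xi> in lborel. norm ((cmod (profile_hat f \<xi>))\<^sup>2) \<le> norm (D * cmod (profile_hat f \<xi>))"
    proof (rule AE_I2)
      fix \<xi>
      have "0 \<le> D" using b[of \<xi>] norm_ge_zero order_trans by blast
      then show "norm ((cmod (profile_hat f \<xi>))\<^sup>2) \<le> norm (D * cmod (profile_hat f \<xi>))"
        using b[of \<xi>] by (simp add: power2_eq_square abs_mult mult_right_mono)
    qed
  qed simp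
qed

text \<open>A curvelet window of scale \<open>j \<ge> 2\<close> is a wedge and its mirror image, \<open>t = 1\<close>; the isotropic windows
are a single profile, \<open>t = 0\<close>. The bound on \<open>p * q\<close> says that the normalisation of the curvelets
does not magnify errors.\<close>

lemma chi_eq_profiles:
  "\<exists>f\<in>profiles. \<exists>p q t. 0 < p \<and> 0 < q \<and> \<bar>t\<bar> \<le> 1 \<and> p * q \<le> 4 * (big_lambda j * small_lambda j) \<and>
    (\<forall>\<xi>. complex_of_real (chi j \<xi>) = profile_hat f (diag2 (1 / p) (1 / q) *v \<xi>) +
       complex_of_real t * profile_hat f (diag2 (1 / - p) (1 / - q) *v \<xi>))"
proof -
  have nrm: "arad 1 (\<xi> $ 1 / c) (\<xi> $ 2 / c) = norm \<xi> / c" if "c > 0" for \<xi> :: "real^2" and c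
  proof -
    have "arad 1 (\<xi> $ 1 / c) (\<xi> $ 2 / c) = norm ((1 / c) *\<^sub>R \<xi>)"
      by (simp add: arad_def norm_eq_sqrt_inner inner_real2 power2_eq_square)
    then show ?thesis using that by simp
  qed
  (* profile_hat rescales by 30, so the dilations carry the factor 30 as well. *)
  have hat: "profile_hat f (diag2 (1 / (30 * p)) (1 / (30 * q)) *v \<xi>) = complex_of_real (f (\<xi> $ 1 / p) (\<xi> $ 2 / q))"
    "profile_hat f (diag2 (1 / - (30 * p)) (1 / - (30 * q)) *v \<xi>) = complex_of_real (f (- \<xi> $ 1 / p) (- \<xi> $ 2 / q))"
    for f p q \<xi> by (simp_all add: profile_hat_def diag2_mult)
  have pi2: "9 \<le> pi * pi" using pi_gt3 mult_mono[of 3 pi 3 pi] by simp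
  consider "j = 0" | "j = 1" | "j \<ge> 2" by linarith
  then show ?thesis
  proof cases
    case 1
    have "(30 * 1) * (30 * 1) \<le> 4 * (big_lambda j * small_lambda j)"
      using pi2 1 by (simp add: big_lambda_def small_lambda_def)
    moreover have "complex_of_real (chi j \<xi>) = profile_hat (radial_profile w0 1) (diag2 (1 / (30 * 1)) (1 / (30 * 1)) *v \<xi>) +
       complex_of_real 0 * profile_hat (radial_profile w0 1) (diag2 (1 / - (30 * 1)) (1 / - (30 * 1)) *v \<xi>)" for \<xi>
      unfolding hat using 1 nrm[of 1 \<xi>] by (simp add: curvelet_chi_def radial_profile_def)
    ultimately show ?thesis
      by (intro bexI[of _ "radial_profile w0 1"] exI[of _ "30 * 1"] exI[of _ 0]) (auto simp: profiles_def)
  next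
    case 2
    have "(30 * 2) * (30 * 2) \<le> 4 * (big_lambda j * small_lambda j)"
      using pi2 2 by (simp add: big_lambda_def small_lambda_def)
    moreover have "complex_of_real (chi j \<xi>) = profile_hat (radial_profile w 1) (diag2 (1 / (30 * 2)) (1 / (30 * 2)) *v \<xi>) +
       complex_of_real 0 * profile_hat (radial_profile w 1) (diag2 (1 / - (30 * 2)) (1 / - (30 * 2)) *v \<xi>)" for \<xi>
      unfolding hat radial_profile_def nrm[OF zero_less_numeral] using 2 by (simp add: curvelet_chi_def)
    ultimately show ?thesis
      by (intro bexI[of _ "radial_profile w 1"] exI[of _ "30 * 2"] exI[of _ 0]) (auto simp: profiles_def)
  next
    case 3
    define K where "K = (2::real) ^ (j div 2)"
    define s where "s = 1 / K"
    define c where "c = (2::real) ^ j"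
    have "(2::real) ^ 1 \<le> 2 ^ (j div 2)" using 3 by (intro power_increasing) auto
    then have K: "K \<ge> 2" by (simp add: K_def)
    then have s: "s \<in> {0<..1/2}" by (simp add: s_def field_simps)
    have c: "c > 0" by (simp add: c_def)
    have prod: "(30 * c) * (30 * (c * s)) \<le> 4 * (big_lambda j * small_lambda j)"
    proof -
      have "(4 * pi * c) * (8 * pi / 3 * pi * (c * s)) \<le> big_lambda j * small_lambda j"
        using big_lambda_ge[OF 3] small_lambda_ge[OF 3] s c big_lambda_pos[of j]
        by (intro mult_mono) (auto simp: c_def s_def K_def)
      moreover have "9 * 3 * (c * (c * s)) \<le> (pi * pi * pi) * (c * (c * s))"
        using pi2 pi_gt3 c s by (intro mult_right_mono mult_mono) auto
      moreover have "0 \<le> c * (c * s)" using c s by simp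
      ultimately show ?thesis by (simp add: algebra_simps)
    qed
    (* The second wedge, at the angle of the frequency minus pi, is the first one at its negative: a = -1. *)
    have wp: "wedge_profile s (a * \<xi> $ 1 / c) (a * \<xi> $ 2 / (c * s)) =
        w (norm \<xi> / c) * \<nu> (K * wrap_angle (polar_angle ((a / c) *\<^sub>R \<xi>)))" if "a = 1 \<or> a = -1" for a \<xi>
    proof -
      have sv: "s * (a * \<xi> $ 2 / (c * s)) = a * \<xi> $ 2 / c" using s by simp
      have "(vector [a * \<xi> $ 1 / c, a * \<xi> $ 2 / c] :: real^2) = (a / c) *\<^sub>R \<xi>"
        by (simp add: vector2_eq_iff)
      moreover have "arad s (a * \<xi> $ 1 / c) (a * \<xi> $ 2 / (c * s)) = norm \<xi> / c"
        using nrm[OF c, of \<xi>] that unfolding arad_def sv by (auto simp: power_divide)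
      moreover have "x / s = K * x" for x by (simp add: s_def)
      ultimately show ?thesis using s unfolding wedge_profile_def angular_def sv by simp
    qed
    have "chi j \<xi> = wedge_profile s (\<xi> $ 1 / c) (\<xi> $ 2 / (c * s)) + wedge_profile s (- \<xi> $ 1 / c) (- \<xi> $ 2 / (c * s))" for \<xi>
    proof (cases "\<xi> = 0")
      case True
      have "w 0 = 0" using w_support[of 0] pi_gt_zero by auto
      then show ?thesis using True 3 wp[of 1 0] wp[of "-1" 0] by (simp add: curvelet_chi_def)
    next
      case False
      have "wedge_profile s (\<xi> $ 1 / c) (\<xi> $ 2 / (c * s)) = w (norm \<xi> / c) * \<nu> (K * wrap_angle (polar_angle \<xi>))"
        using wp[of 1 \<xi>] polar_angle_scale_wrap(1)[OF False, of "1 / c"] c by simp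
      moreover have "wedge_profile s (- \<xi> $ 1 / c) (- \<xi> $ 2 / (c * s)) = w (norm \<xi> / c) * \<nu> (K * wrap_angle (polar_angle \<xi> - pi))"
        using wp[of "-1" \<xi>] polar_angle_scale_wrap(2)[OF False, of "1 / c"] c by simp
      ultimately show ?thesis using 3 by (simp add: curvelet_chi_def K_def c_def distrib_left)
    qed
    then have "complex_of_real (chi j \<xi>) = profile_hat (wedge_profile s) (diag2 (1 / (30 * c)) (1 / (30 * (c * s))) *v \<xi>) +
       complex_of_real 1 * profile_hat (wedge_profile s) (diag2 (1 / - (30 * c)) (1 / - (30 * (c * s))) *v \<xi>)" for \<xi>
      unfolding hat by simp
    then show ?thesis using s c prod
      by (intro bexI[of _ "wedge_profile s"] exI[of _ "30 * c"] exI[of _ "30 * (c * s)"] exI[of _ 1]) (auto simp: profiles_def)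
  qed
qed

text \<open>Transport a mixture for the profile through the dilation, the reflection, the rotation and the
translation that produce the curvelet. Two copies of the mixture are needed, and the squared
error grows at most by \<open>4 * (p * q) / (big_lambda j * small_lambda j) \<le> 16\<close>.\<close>

lemma curvelet_from_profile:
  "\<exists>f\<in>profiles. \<forall>m T. gauss_mix m T \<longrightarrow> (\<exists>S. gauss_mix (m + m) S \<and>
     norm_sq (\<lambda>x. curvelet w0 w \<nu> j l k x - S x) \<le> 16 * norm_sq (\<lambda>x. inverse_fourier (profile_hat f) x - T x))"
proof -
  obtain f p q t where f: "f \<in> profiles" and pq: "0 < p" "0 < q" and t: "\<bar>t\<bar> \<le> 1"
    and prod: "p * q \<le> 4 * (big_lambda j * small_lambda j)"
    and chi: "\<And>\<xi>. complex_of_real (chi j \<xi>) = profile_hat f (diag2 (1 / p) (1 / q) *v \<xi>) +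
       complex_of_real t * profile_hat f (diag2 (1 / - p) (1 / - q) *v \<xi>)"
    using chi_eq_profiles by blast
  note i = profile_hat_integrable[OF f]
  have [measurable]: "profile_hat f \<in> borel_measurable borel" using i(1) by auto
  define h where "h = inverse_fourier (profile_hat f)"
  have hL: "h \<in> L2" unfolding h_def by (rule inverse_fourier_L2[OF i])
  have hb: "h \<in> borel_measurable borel" unfolding h_def using inverse_fourier_borel[of "profile_hat f"] by simp
  define c where "c = 1 / sqrt (big_lambda j * small_lambda j)"
  define R where "R = transpose (rotation2 (pi * real l / 2 ^ (j div 2)))"
  have R: "invertible R" "det R = 1" unfolding R_def by (rule invertible_transpose_rotation, rule det_transpose_rotation)
  have ft: "inverse_fourier (\<lambda>\<xi>. complex_of_real (chi j \<xi>)) y =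
      complex_of_real (p * q) * (h (diag2 p q *v y) + complex_of_real t * h (diag2 (- p) (- q) *v y))" for y
  proof -
    have i1: "integrable lborel (\<lambda>\<xi>. profile_hat f (diag2 (1 / a) (1 / b) *v \<xi>))" if "a \<noteq> 0" "b \<noteq> 0" for a b
      using integrable_affine_iff[of "diag2 (1 / a) (1 / b)" "profile_hat f" 0] invertible_diag2[of "1 / a" "1 / b"] that i(1) by simp
    have i2: "integrable lborel (\<lambda>\<xi>. profile_hat f (diag2 (1 / a) (1 / b) *v \<xi>) * exp (\<i> * complex_of_real (y \<bullet> \<xi>)))"
      if "a \<noteq> 0" "b \<noteq> 0" for a b
      by (rule integrable_mult_iexp[OF i1[OF that]])
    have "inverse_fourier (\<lambda>\<xi>. complex_of_real (chi j \<xi>)) y =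
       inverse_fourier (\<lambda>\<xi>. profile_hat f (diag2 (1 / p) (1 / q) *v \<xi>)) y +
       complex_of_real t * inverse_fourier (\<lambda>\<xi>. profile_hat f (diag2 (1 / - p) (1 / - q) *v \<xi>)) y"
    proof -
      have m1: "(\<lambda>\<xi>. profile_hat f (diag2 a b *v \<xi>)) \<in> borel_measurable borel" for a b by measurable
      have m2: "(\<lambda>\<xi>. profile_hat f (diag2 (1 / p) (1 / q) *v \<xi>) + complex_of_real t * profile_hat f (diag2 (1 / - p) (1 / - q) *v \<xi>)) \<in> borel_measurable borel"
        by measurable
      show ?thesis
        unfolding chi inverse_fourier_eq_lborel[OF m1] inverse_fourier_eq_lborel[OF m2]
        using pq i2[of p q] i2[of "- p" "- q"]
        by (simp add: distrib_right mult.assoc scaleR_add_right del: divide_minus_right)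
    qed
    also have "\<dots> = complex_of_real (p * q) * h (diag2 p q *v y) + complex_of_real t * (complex_of_real (p * q) * h (diag2 (- p) (- q) *v y))"
      using inverse_fourier_dilate[of p q "profile_hat f" y] inverse_fourier_dilate[of "- p" "- q" "profile_hat f" y] pq
      by (simp add: h_def)
    finally show ?thesis by (simp add: algebra_simps)
  qed
  have "\<exists>S. gauss_mix (m + m) S \<and>
      norm_sq (\<lambda>x. curvelet w0 w \<nu> j l k x - S x) \<le> 16 * norm_sq (\<lambda>x. inverse_fourier (profile_hat f) x - T x)"
    if T: "gauss_mix m T" for m T
  proof -
    define B where "B T y = complex_of_real (c * (p * q)) * (T (diag2 p q *v y) + complex_of_real t * T (diag2 (- p) (- q) *v y))"
      for T :: "real^2 \<Rightarrow> complex" and y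
    define e where "e x = h x - T x" for x
    have eL: "e \<in> L2" unfolding e_def[abs_def] by (rule L2_diff[OF hL gauss_mix_L2[OF T]])
    have eb: "e \<in> borel_measurable borel" unfolding e_def[abs_def] by (intro borel_measurable_diff hb gauss_mix_borel[OF T])
    have Bg: "gauss_mix (m + m) (B T)"
      unfolding B_def[abs_def]
      using pq gauss_mix_affine[OF T invertible_diag2[of p q], of 0] gauss_mix_affine[OF T invertible_diag2[of "- p" "- q"], of 0]
      by (intro gauss_mix_cmult gauss_mix_add) simp_all
    have curv: "curvelet w0 w \<nu> j l k x = B h (R *v x + - k)" for x
      by (simp add: curvelet_def ft B_def c_def R_def del: transpose_matrix_vector)
    have diff: "curvelet w0 w \<nu> j l k x - B T (R *v x + - k) = B e (R *v x + - k)" for x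
      unfolding curv B_def e_def by (simp add: algebra_simps)
    have d1: "(\<lambda>y. e (diag2 a b *v y)) \<in> L2" "norm_sq e = \<bar>a * b\<bar> * norm_sq (\<lambda>y. e (diag2 a b *v y))"
      if "a \<noteq> 0" "b \<noteq> 0" for a b
      using L2_affine[OF invertible_diag2[OF that] eb eL, of 0] norm_sq_affine[OF invertible_diag2[OF that] eb, of 0]
      by (simp_all add: det_diag2)
    have Bb: "B e \<in> borel_measurable borel"
    proof -
      note [measurable] = eb
      show ?thesis unfolding B_def[abs_def] by measurable
    qed
    have "norm_sq (\<lambda>x. curvelet w0 w \<nu> j l k x - B T (R *v x + - k)) = norm_sq (B e)"
      using norm_sq_affine[OF R(1) Bb, of "- k"] R(2) unfolding diff by simp
    also have "norm_sq (B e) = (c * (p * q))\<^sup>2 * norm_sq (\<lambda>y. e (diag2 p q *v y) + complex_of_real t * e (diag2 (- p) (- q) *v y))"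
      unfolding B_def[abs_def] norm_sq_cmult norm_of_real power2_abs ..
    also have "\<dots> \<le> (c * (p * q))\<^sup>2 * (4 * (norm_sq e / (p * q)))"
    proof (intro mult_left_mono)
      let ?u = "\<lambda>y. e (diag2 p q *v y)" and ?v = "\<lambda>y. e (diag2 (- p) (- q) *v y)"
      have n: "norm_sq ?u = norm_sq e / (p * q)" "norm_sq ?v = norm_sq e / (p * q)"
        using d1(2)[of p q] d1(2)[of "- p" "- q"] pq by simp_all
      have "norm_sq (\<lambda>y. ?u y + complex_of_real t * ?v y) \<le> 2 * norm_sq ?u + 2 * norm_sq (\<lambda>y. complex_of_real t * ?v y)"
        by (intro norm_sq_add_le L2_cmult d1) (use pq in auto)
      also have "norm_sq (\<lambda>y. complex_of_real t * ?v y) \<le> 1 * norm_sq ?v"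
        unfolding norm_sq_cmult using t by (intro mult_right_mono norm_sq_nonneg) (simp add: abs_square_le_1)
      finally show "norm_sq (\<lambda>y. ?u y + complex_of_real t * ?v y) \<le> 4 * (norm_sq e / (p * q))" unfolding n by simp
    qed simp
    also have "\<dots> = 4 * (c\<^sup>2 * (p * q)) * norm_sq e"
      using pq by (simp add: power2_eq_square)
    also have "\<dots> \<le> 4 * 4 * norm_sq e"
    proof (intro mult_right_mono mult_left_mono norm_sq_nonneg)
      have P: "0 < big_lambda j * small_lambda j" by (intro mult_pos_pos big_lambda_pos small_lambda_pos)
      then have "c\<^sup>2 = 1 / (big_lambda j * small_lambda j)" by (simp add: c_def power_divide)
      then show "c\<^sup>2 * (p * q) \<le> 4" using prod P by (simp add: field_simps)
    qed simp
    finally have "norm_sq (\<lambda>x. curvelet w0 w \<nu> j l k x - B T (R *v x + - k)) \<le> 16 * norm_sq e" by simp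
    moreover have "gauss_mix (m + m) (\<lambda>x. B T (R *v x + - k))" by (rule gauss_mix_affine[OF Bg R(1)])
    ultimately show ?thesis unfolding e_def[abs_def] h_def by (intro exI[of _ "\<lambda>x. B T (R *v x + - k)"]) simp
  qed
  then show ?thesis using f by blast
qed

lemma curvelet_dict_index: "g \<in> curvelet_dict w0 w \<nu> \<longleftrightarrow> (\<exists>q m. snd q < 2 ^ (fst q div 2) \<and> g = curvelet_at q m)"
  unfolding curvelet_dict_def curvelet_grid_def curvelet_at_def by fastforce

lemma curvelet_L2_norm:
  assumes "g \<in> curvelet_dict w0 w \<nu>"
  shows "g \<in> L2" "norm_sq g \<le> 896"
proof -
  obtain q m where qm: "snd q < 2 ^ (fst q div 2)" "g = curvelet_at q m" using assms curvelet_dict_index by blast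
  show "g \<in> L2" "norm_sq g \<le> 896"
    using curvelet_synthesis_bound[of "{(q, m)}" "\<lambda>_. 1"] qm by (cases q; force)+
qed

text \<open>The constant serves all curvelets at once. One level is lost to the two mirror images, which the
factor \<open>4 ^ P\<close> pays for; with a single Gaussian nothing is approximated and the norm bound is used.\<close>

lemma curvelet_approximation:
  "\<exists>C. \<forall>g\<in>curvelet_dict w0 w \<nu>. \<forall>L. \<exists>S. gauss_mix (2 ^ L) S \<and>
     norm_sq (\<lambda>x. g x - S x) \<le> C * ((1/4) ^ L) ^ P"
proof -
  obtain C where C: "C \<ge> 0" "\<And>f L. f \<in> profiles \<Longrightarrow> \<exists>T. gauss_mix (2 ^ L) T \<and>
      norm_sq (\<lambda>x. inverse_fourier (profile_hat f) x - T x) \<le> C * ((1/4) ^ L) ^ P"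
    using uniform_profile_approximation(1)[OF profiles_line_smooth, of P] by blast
  have "\<exists>S. gauss_mix (2 ^ L) S \<and> norm_sq (\<lambda>x. g x - S x) \<le> (896 + 16 * C * 4 ^ P) * ((1/4) ^ L) ^ P"
    if g: "g \<in> curvelet_dict w0 w \<nu>" for g L
  proof (cases L)
    case 0
    have "norm_sq (\<lambda>x. g x - 0) \<le> (896 + 16 * C * 4 ^ P) * ((1/4) ^ L) ^ P"
      using curvelet_L2_norm(2)[OF g] C(1) 0 by (simp add: add_increasing2)
    then show ?thesis using gauss_mix_zero[of "2 ^ L"] by blast
  next
    case (Suc L')
    obtain j l k where "g = curvelet w0 w \<nu> j l k" using g by (auto simp: curvelet_dict_def)
    then obtain f where f: "f \<in> profiles" "\<And>m T. gauss_mix m T \<Longrightarrow> \<exists>S. gauss_mix (m + m) S \<and>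
       norm_sq (\<lambda>x. g x - S x) \<le> 16 * norm_sq (\<lambda>x. inverse_fourier (profile_hat f) x - T x)"
      using curvelet_from_profile by blast
    obtain T where T: "gauss_mix (2 ^ L') T"
      "norm_sq (\<lambda>x. inverse_fourier (profile_hat f) x - T x) \<le> C * ((1/4) ^ L') ^ P"
      using C(2)[OF f(1)] by blast
    obtain S where S: "gauss_mix (2 ^ L' + 2 ^ L') S"
      "norm_sq (\<lambda>x. g x - S x) \<le> 16 * norm_sq (\<lambda>x. inverse_fourier (profile_hat f) x - T x)"
      using f(2)[OF T(1)] by blast
    have "norm_sq (\<lambda>x. g x - S x) \<le> 16 * (C * ((1/4) ^ L') ^ P)" using S(2) T(2) by linarith
    also have "((1/4) ^ L') ^ P = (4::real) ^ P * ((1/4) ^ L) ^ P"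
      unfolding power_mult_distrib[symmetric] Suc by simp
    also have "16 * (C * (4 ^ P * ((1/4) ^ L) ^ P)) \<le> (896 + 16 * C * 4 ^ P) * ((1/4) ^ L) ^ P"
      by (simp add: algebra_simps)
    finally show ?thesis using S(1) Suc by (auto simp: mult_2)
  qed
  then show ?thesis by blast
qed

end

section \<open>The rate of approximation\<close>

lemma powr_tail_sum:
  fixes \<beta> :: real
  assumes "\<beta> > 1" "1 \<le> N" "N \<le> M"
  shows "(\<Sum>n\<in>{N<..M}. real n powr (-\<beta>)) \<le> real N powr (1 - \<beta>) / (\<beta> - 1)"
proof -
  have step: "real (Suc n) powr (-\<beta>) \<le> (real n powr (1 - \<beta>) - real (Suc n) powr (1 - \<beta>)) / (\<beta> - 1)"
    if "1 \<le> n" for n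
  proof -
    have "\<exists>z. real n < z \<and> z < real (Suc n) \<and>
        real (Suc n) powr (1 - \<beta>) - real n powr (1 - \<beta>)
          = (real (Suc n) - real n) * ((1 - \<beta>) * z powr (-\<beta>))"
    proof (rule MVT2)
      fix x assume "real n \<le> x" "x \<le> real (Suc n)"
      then have "x > 0" using that by simp
      then show "((\<lambda>x. x powr (1 - \<beta>)) has_real_derivative (1 - \<beta>) * x powr (-\<beta>)) (at x)"
        using has_real_derivative_powr[of x "1 - \<beta>"] by simp
    qed simp
    then obtain z where z: "real n < z" "z < real (Suc n)"
      and eq: "real (Suc n) powr (1 - \<beta>) - real n powr (1 - \<beta>) = (1 - \<beta>) * z powr (-\<beta>)"
      by auto
    have "real (Suc n) powr (-\<beta>) \<le> z powr (-\<beta>)"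
      using z that assms(1) by (intro powr_mono2') auto
    also have "\<dots> = (real n powr (1 - \<beta>) - real (Suc n) powr (1 - \<beta>)) / (\<beta> - 1)"
      using eq assms(1) by (simp add: field_simps)
    finally show ?thesis .
  qed
  have "(\<Sum>n\<in>{N<..M}. real n powr (-\<beta>)) \<le> (real N powr (1 - \<beta>) - real M powr (1 - \<beta>)) / (\<beta> - 1)"
    using assms(3)
  proof (induction M rule: dec_induct)
    case base
    then show ?case by simp
  next
    case (step n)
    have "{N<..Suc n} = insert (Suc n) {N<..n}" using step.hyps by auto
    then show ?case
      using step.IH \<open>N \<le> n\<close> \<open>1 \<le> N\<close>
        \<open>1 \<le> n \<Longrightarrow> real (Suc n) powr (-\<beta>) \<le> (real n powr (1 - \<beta>) - real (Suc n) powr (1 - \<beta>)) / (\<beta> - 1)\<close>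
      by (simp add: diff_divide_distrib)
  qed
  also have "\<dots> \<le> real N powr (1 - \<beta>) / (\<beta> - 1)"
    using assms(1) by (intro divide_right_mono) auto
  finally show ?thesis .
qed

lemma sum_inverse_sqrt_le: "(\<Sum>n=1..N. 1 / sqrt (real n)) \<le> 2 * sqrt (real N)"
proof (induction N)
  case (Suc N)
  have "1 \<le> 2 * (sqrt (real (Suc N)) - sqrt (real N)) * sqrt (real (Suc N))"
  proof -
    have "1 = (sqrt (real (Suc N)) - sqrt (real N)) * (sqrt (real (Suc N)) + sqrt (real N))"
      by (simp add: square_diff_square_factored[symmetric] algebra_simps)
    also have "\<dots> \<le> (sqrt (real (Suc N)) - sqrt (real N)) * (2 * sqrt (real (Suc N)))"
      by (intro mult_left_mono) auto
    finally show ?thesis by (simp add: algebra_simps)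
  qed
  then have "1 / sqrt (real (Suc N)) \<le> 2 * (sqrt (real (Suc N)) - sqrt (real N))"
    by (simp add: pos_divide_le_eq)
  then show ?case using Suc.IH by simp
qed simp

text \<open>\<open>K\<close> is the integer part of the logarithm of \<open>N / n\<close> to base \<open>4\<close>.\<close>

lemma scale_exponent_exists:
  fixes n N :: nat
  assumes "1 \<le> n" "n \<le> N"
  shows "\<exists>K. 4 ^ K * n \<le> N \<and> N < 4 * 4 ^ K * n"
proof -
  have "N < 4 ^ N"
    using less_exp[of N] power_mono[of 2 "4::nat" N] by linarith
  also have "\<dots> \<le> 4 ^ N * n" using assms(1) by simp
  finally have "N < 4 ^ N * n" .
  then have "\<exists>k<N. (\<forall>i\<le>k. \<not> N < 4 ^ i * n) \<and> N < 4 ^ (Suc k) * n"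
    using assms(2) by (intro ex_least_nat_less) auto
  then show ?thesis by (auto simp: not_less)
qed

text \<open>The expected number of Gaussians in a random correction: \<open>3 * 2 ^ (K + k)\<close> of them with
probability \<open>(1/2) * (1/4) ^ k\<close>. The probabilities decay faster than the costs grow.\<close>

lemma dyadic_selection_cost:
  "(\<Sum>k<m. (1/2) * (1/4)^k * (3 * 2 ^ (K + k))) \<le> 3 * (2::real) ^ K"
proof -
  have "(\<Sum>k<m. (1/2) * (1/4)^k * (3 * 2 ^ (K + k))) = (3/2) * 2^K * (\<Sum>k<m. (1/2::real)^k)"
    unfolding sum_distrib_left
  proof (intro sum.cong refl)
    fix k
    have "(1/4::real)^k * 2^k = (1/2)^k" by (simp only: power_mult_distrib[symmetric]) simp
    then show "(1/2) * (1/4)^k * (3 * 2 ^ (K + k)) = (3/2) * 2^K * (1/2::real)^k"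
      by (simp add: power_add mult.commute)
  qed
  also have "\<dots> \<le> (3/2) * 2^K * 2"
    by (intro mult_left_mono) (auto simp: sum_gp_strict)
  finally show ?thesis by simp
qed

text \<open>Term \<open>n \<le> N\<close> starts with a mixture of \<open>2 ^ K n\<close> Gaussians, \<open>K n\<close> being about half the binary
logarithm of \<open>N / n\<close>. These numbers add up to \<open>O(N)\<close>, and each weighted squared error is of order
\<open>N powr (- 2 * \<alpha>)\<close>. The errors of different terms are not orthogonal, so the triangle inequality
would lose a factor \<open>N\<close> in the squared norm.

To recover it, write the missing part as a telescoping sum of corrections \<open>h n k\<close> between
consecutive levels and replace it by one random correction, divided by its probability \<open>q k\<close>. Its
mean is exactly the missing part, so only the variances remain, and these add up over \<open>n\<close>
without cross terms. The law \<open>q k = (1/2) * (1/4) ^ k\<close> keeps both the variance and the expected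
number of Gaussians summable in \<open>k\<close>.

The squared error has four sources: the remainder of the expansion, the terms beyond \<open>N\<close>, the
levels beyond \<open>K n + m\<close>, and the deviation of the random corrections from their means.\<close>

lemma gaussian_block_approximation:
  fixes g :: "nat \<Rightarrow> real^2 \<Rightarrow> complex" and \<omega> :: "nat \<Rightarrow> complex"
  assumes \<alpha>: "\<alpha> > 1/2" and f: "f \<in> L2" and gL: "\<And>n. n \<ge> 1 \<Longrightarrow> g n \<in> L2"
    and coef: "\<And>n. n \<ge> 1 \<Longrightarrow> cmod (\<omega> n) \<le> A * real n powr (-\<alpha>)"
    and expansion: "\<And>\<epsilon> M0. \<epsilon> > 0 \<Longrightarrow>
          \<exists>M\<ge>M0. norm_sq (\<lambda>x. f x - (\<Sum>n=1..M. \<omega> n * g n x)) < \<epsilon>"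
    and bessel: "\<And>I. finite I \<Longrightarrow> I \<subseteq> {1..} \<Longrightarrow>
          norm_sq (\<lambda>x. \<Sum>n\<in>I. \<omega> n * g n x) \<le> B * (\<Sum>n\<in>I. (cmod (\<omega> n))\<^sup>2)"
    and B: "0 \<le> B" and C: "0 \<le> C"
    and P: "2 \<le> P" "2 * \<alpha> \<le> real P"
    and approx: "\<And>n L. n \<ge> 1 \<Longrightarrow> gauss_mix (2 ^ L) (S n L) \<and>
          norm_sq (\<lambda>x. g n x - S n L x) \<le> C * ((1/4)^L)^P"
    and N: "1 \<le> N"
  shows "\<exists>T. gauss_mix (16 * N) T \<and>
      norm_sq (\<lambda>x. f x - T x) \<le>
        4 * (2 + B * A\<^sup>2 / (2 * \<alpha> - 1) + 2 * (16 * C * A\<^sup>2 * 4 ^ P + 1)) * real N powr (1 - 2 * \<alpha>)"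
proof -
  define E where "E = real N powr (1 - 2 * \<alpha>)"
  have E: "E > 0" using N by (simp add: E_def)
  have SL: "S n L \<in> L2" if "n \<ge> 1" for n L
    using approx that gauss_mix_L2 by blast
  have SG: "gauss_mix (2 ^ L) (S n L)" if "n \<ge> 1" for n L
    using approx[OF that] by blast
  have coef2: "(cmod (\<omega> n))\<^sup>2 \<le> A\<^sup>2 * real n powr (-(2*\<alpha>))" if "n \<ge> 1" for n
  proof -
    have "(cmod (\<omega> n))\<^sup>2 \<le> (A * real n powr (-\<alpha>))\<^sup>2"
      using coef[OF that] by (intro power_mono) auto
    also have "\<dots> = A\<^sup>2 * real n powr (-(2*\<alpha>))"
      using that by (simp add: power_mult_distrib power2_eq_square flip: powr_add)
    finally show ?thesis .
  qed

  (* The level K n + m is so fine that even the triangle inequality can be afforded there. *)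
  obtain m where m: "real N * real N * A\<^sup>2 * C * (1/4)^m < E"
  proof -
    define c where "c = real N * real N * A\<^sup>2 * C"
    have "(\<lambda>m. c * (1/4)^m) \<longlonglongrightarrow> c * 0"
      by (intro tendsto_mult tendsto_const LIMSEQ_realpow_zero) auto
    then have "\<forall>\<^sub>F m in sequentially. c * (1/4)^m < E"
      using E by (intro order_tendstoD) auto
    then show ?thesis
      using that unfolding c_def by (auto simp: eventually_sequentially)
  qed
  have "\<forall>n\<in>{1..N}. \<exists>K. 4 ^ K * n \<le> N \<and> N < 4 * 4 ^ K * n"
    using scale_exponent_exists by auto
  then obtain K where K: "\<And>n. n \<in> {1..N} \<Longrightarrow> 4 ^ K n * n \<le> N"
      "\<And>n. n \<in> {1..N} \<Longrightarrow> N < 4 * 4 ^ K n * n"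
    by metis
  define h where "h n k x = S n (K n + Suc k) x - S n (K n + k) x" for n k x
  define q where "q k = (1/2) * (1/4::real)^k" for k :: nat
  have q_pos: "q k > 0" for k by (simp add: q_def)
  have q_sum: "(\<Sum>k<m. q k) \<le> 1"
  proof -
    have "(\<Sum>k<m. q k) = (1/2) * (\<Sum>k<m. (1/4::real)^k)" by (simp add: q_def sum_distrib_left)
    also have "\<dots> \<le> (1/2) * (4/3)" by (intro mult_left_mono) (auto simp: sum_gp_strict)
    finally show ?thesis by simp
  qed
  (* The outcome k = m stands for no correction and takes up the remaining probability. *)
  define p where "p n k = (if k < m then q k else 1 - (\<Sum>k<m. q k))" for n k :: nat
  define X where "X n k x = (if k < m then \<omega> n * h n k x / complex_of_real (q k) else 0)" for n k x
  define cost where "cost n k = (if k < m then 3 * (2::real) ^ (K n + k) else 0)" for n k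

  have hL: "h n k \<in> L2" if "n \<ge> 1" for n k
    unfolding h_def[abs_def] using that by (intro L2_diff SL)
  have XL: "X n k \<in> L2" if "n \<ge> 1" for n k
    using L2_cmult[OF hL[OF that, of k], of "\<omega> n / complex_of_real (q k)"] L2_zero
    unfolding X_def[abs_def] by (cases "k < m") simp_all
  have h_small: "norm_sq (h n k) \<le> 4 * C * ((1/4)^(K n + k))^P" if "n \<ge> 1" for n k
  proof -
    have "norm_sq (h n k) = norm_sq (\<lambda>x. (g n x - S n (K n + k) x) - (g n x - S n (K n + Suc k) x))"
      by (simp add: h_def[abs_def])
    also have "\<dots> \<le> 2 * norm_sq (\<lambda>x. g n x - S n (K n + k) x)
        + 2 * norm_sq (\<lambda>x. g n x - S n (K n + Suc k) x)"
      using that by (intro norm_sq_diff_le L2_diff gL SL)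
    also have "\<dots> \<le> 2 * (C * ((1/4)^(K n + k))^P) + 2 * (C * ((1/4)^(K n + Suc k))^P)"
      using approx[OF that, of "K n + k"] approx[OF that, of "K n + Suc k"] by linarith
    also have "\<dots> \<le> 2 * (C * ((1/4)^(K n + k))^P) + 2 * (C * ((1/4)^(K n + k))^P)"
      using C by (intro add_mono mult_left_mono power_mono power_decreasing) auto
    finally show ?thesis by simp
  qed
  have second_moment: "(\<Sum>k\<le>m. p n k * norm_sq (X n k)) \<le> (cmod (\<omega> n))\<^sup>2 * (16 * C * ((1/4)^K n)^P)"
    if n: "n \<ge> 1" for n
  proof -
    have "(\<Sum>k\<le>m. p n k * norm_sq (X n k)) = (\<Sum>k<m. p n k * norm_sq (X n k))"
      by (simp add: X_def[abs_def] norm_sq_def lessThan_Suc_atMost[symmetric])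
    also have "\<dots> = (\<Sum>k<m. (cmod (\<omega> n))\<^sup>2 * (norm_sq (h n k) / q k))"
    proof (intro sum.cong refl)
      fix k assume "k \<in> {..<m}"
      then have "norm_sq (X n k) = norm_sq (\<lambda>x. (\<omega> n / complex_of_real (q k)) * h n k x)"
        by (simp add: X_def[abs_def])
      also have "\<dots> = (cmod (\<omega> n))\<^sup>2 * norm_sq (h n k) / (q k)\<^sup>2"
        by (simp only: norm_sq_cmult) (simp add: norm_divide power_divide)
      finally show "p n k * norm_sq (X n k) = (cmod (\<omega> n))\<^sup>2 * (norm_sq (h n k) / q k)"
        using \<open>k \<in> {..<m}\<close> q_pos[of k] by (simp add: p_def power2_eq_square)
    qed
    also have "\<dots> \<le> (\<Sum>k<m. (cmod (\<omega> n))\<^sup>2 * (8 * C * ((1/4)^K n)^P * (1/4)^k))"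
    proof (intro sum_mono mult_left_mono)
      fix k
      have "((1/4::real)^k)^P \<le> ((1/4)^k)^2"
        using P(1) by (intro power_decreasing) (auto intro: power_le_one)
      then have "((1/4)^(K n + k))^P \<le> ((1/4::real)^K n)^P * ((1/4)^k)^2"
        by (simp add: power_add power_mult_distrib mult_left_mono)
      then have "4 * C * ((1/4)^(K n + k))^P \<le> 4 * C * (((1/4::real)^K n)^P * ((1/4)^k)^2)"
        using C by (intro mult_left_mono) auto
      with h_small[OF n, of k] have "norm_sq (h n k) \<le> 4 * C * (((1/4::real)^K n)^P * ((1/4)^k)^2)"
        by linarith
      then show "norm_sq (h n k) / q k \<le> 8 * C * ((1/4)^K n)^P * (1/4)^k"
        unfolding pos_divide_le_eq[OF q_pos] by (simp add: q_def power2_eq_square algebra_simps)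
    qed simp
    also have "\<dots> = (cmod (\<omega> n))\<^sup>2 * (8 * C * ((1/4)^K n)^P * (\<Sum>k<m. (1/4)^k))"
      by (simp add: sum_distrib_left)
    also have "\<dots> \<le> (cmod (\<omega> n))\<^sup>2 * (8 * C * ((1/4)^K n)^P * 2)"
    proof -
      have "(\<Sum>k<m. (1/4::real)^k) = (4/3) * (1 - (1/4)^m)" by (simp add: sum_gp_strict)
      also have "\<dots> \<le> (4/3) * 1" by (intro mult_left_mono) auto
      finally show ?thesis using C by (intro mult_left_mono) auto
    qed
    finally show ?thesis by (simp add: algebra_simps)
  qed
  have mean_cost: "(\<Sum>k\<le>m. p n k * cost n k) \<le> 3 * 2 ^ K n" for n
    using dyadic_selection_cost[of "K n" m]
    by (simp add: p_def q_def cost_def lessThan_Suc_atMost[symmetric])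
  have sum_K: "(\<Sum>n=1..N. 2 ^ K n) \<le> 2 * real N"
  proof -
    have "(\<Sum>n=1..N. 2 ^ K n) \<le> (\<Sum>n=1..N. sqrt (real N) * (1 / sqrt (real n)))"
    proof (intro sum_mono)
      fix n assume n: "n \<in> {1..N}"
      have "(2 ^ K n)\<^sup>2 * real n \<le> real N"
      proof -
        have "real (4 ^ K n * n) \<le> real N" using K(1)[OF n] by (simp only: of_nat_le_iff)
        moreover have "((2::real) ^ K n)\<^sup>2 = 4 ^ K n"
          by (simp only: power2_eq_square power_mult_distrib[symmetric]) simp
        ultimately show ?thesis by simp
      qed
      then have "sqrt ((2 ^ K n)\<^sup>2 * real n) \<le> sqrt (real N)" by simp
      then have "2 ^ K n * sqrt (real n) \<le> sqrt (real N)" by (simp add: real_sqrt_mult)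
      then show "2 ^ K n \<le> sqrt (real N) * (1 / sqrt (real n))"
        using n by (simp add: pos_le_divide_eq)
    qed
    also have "\<dots> = sqrt (real N) * (\<Sum>n=1..N. 1 / sqrt (real n))"
      by (simp add: sum_distrib_left)
    also have "\<dots> \<le> sqrt (real N) * (2 * sqrt (real N))"
      by (intro mult_left_mono sum_inverse_sqrt_le) auto
    also have "\<dots> = 2 * (sqrt (real N) * sqrt (real N))" by (simp only: mult_ac)
    finally show ?thesis by simp
  qed
  have K_decay: "(cmod (\<omega> n))\<^sup>2 * ((1/4)^K n)^P \<le> A\<^sup>2 * 4 ^ P * real N powr (-(2*\<alpha>))"
    if n: "n \<in> {1..N}" for n
  proof -
    have pos: "real n > 0" "real N > 0" using n by auto
    have "real N < 4 * 4 ^ K n * real n"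
    proof -
      have "real N < real (4 * 4 ^ K n * n)" using K(2)[OF n] by (simp only: of_nat_less_iff)
      then show ?thesis by simp
    qed
    then have "real N / 4 ^ K n \<le> 4 * real n"
      by (simp add: pos_divide_le_eq mult_ac)
    then have "real N * (1/4) ^ K n \<le> 4 * real n"
      by (simp add: power_divide)
    then have "(1/4) ^ K n \<le> 4 * (real n / real N)"
      using pos by (simp add: pos_le_divide_eq mult.commute)
    then have "((1/4) ^ K n)^P \<le> (4 * (real n / real N))^P"
      by (intro power_mono) auto
    also have "\<dots> = 4 ^ P * (real n / real N) powr (real P)"
      using pos by (simp add: power_mult_distrib powr_realpow power_divide)
    also have "\<dots> \<le> 4 ^ P * (real n / real N) powr (2 * \<alpha>)"
      using P(2) pos n by (intro mult_left_mono powr_mono') auto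
    finally have "(cmod (\<omega> n))\<^sup>2 * ((1/4)^K n)^P
        \<le> (A\<^sup>2 * real n powr (-(2*\<alpha>))) * (4 ^ P * (real n / real N) powr (2 * \<alpha>))"
      using coef2[of n] n by (intro mult_mono) auto
    also have "\<dots> = A\<^sup>2 * 4 ^ P * real N powr (-(2*\<alpha>))"
      using pos by (simp add: powr_divide powr_minus field_simps)
    finally show ?thesis .
  qed
  have N_E: "real N * real N powr (-(2*\<alpha>)) = E"
    using N by (simp add: E_def powr_diff powr_minus field_simps)

  define V where "V = (16 * C * A\<^sup>2 * 4 ^ P + 1) * E"
  have V: "V > 0" unfolding V_def using C E by (intro mult_pos_pos add_nonneg_pos) auto
  have total_variance: "(\<Sum>n=1..N. \<Sum>k\<le>m. p n k * norm_sq (X n k)) \<le> V"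
  proof -
    have "(\<Sum>n=1..N. \<Sum>k\<le>m. p n k * norm_sq (X n k))
        \<le> (\<Sum>n=1..N. 16 * C * (A\<^sup>2 * 4 ^ P * real N powr (-(2*\<alpha>))))"
    proof (intro sum_mono)
      fix n assume n: "n \<in> {1..N}"
      have "(\<Sum>k\<le>m. p n k * norm_sq (X n k)) \<le> 16 * C * ((cmod (\<omega> n))\<^sup>2 * ((1/4)^K n)^P)"
        using second_moment[of n] n by (simp add: algebra_simps)
      also have "\<dots> \<le> 16 * C * (A\<^sup>2 * 4 ^ P * real N powr (-(2*\<alpha>)))"
        using K_decay[OF n] C by (intro mult_left_mono) auto
      finally show "(\<Sum>k\<le>m. p n k * norm_sq (X n k)) \<le> 16 * C * (A\<^sup>2 * 4 ^ P * real N powr (-(2*\<alpha>)))" .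
    qed
    also have "\<dots> = 16 * C * A\<^sup>2 * 4 ^ P * (real N * real N powr (-(2*\<alpha>)))"
      by simp
    also have "\<dots> \<le> V" unfolding N_E V_def using E by (simp add: algebra_simps)
    finally show ?thesis .
  qed
  have total_cost: "(\<Sum>n=1..N. \<Sum>k\<le>m. p n k * cost n k) \<le> 6 * real N"
  proof -
    have "(\<Sum>n=1..N. \<Sum>k\<le>m. p n k * cost n k) \<le> (\<Sum>n=1..N. 3 * 2 ^ K n)"
      by (intro sum_mono mean_cost)
    also have "\<dots> = 3 * (\<Sum>n=1..N. 2 ^ K n)" by (simp add: sum_distrib_left)
    finally show ?thesis using sum_K by simp
  qed

  (* Weights 1/V and 1/(6 N) make both expectations at most 1, so a single choice keeps error and
     cost within twice their means. *)
  obtain \<kappa> where \<kappa>: "\<forall>n\<in>{1..N}. \<kappa> n \<in> {..m}"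
    and sel: "(1/V) * norm_sq (\<lambda>x. \<Sum>n=1..N. X n (\<kappa> n) x - (\<Sum>k\<le>m. p n k *\<^sub>R X n k x))
        + (1 / (6 * real N)) * (\<Sum>n=1..N. cost n (\<kappa> n))
      \<le> (1/V) * (\<Sum>n=1..N. \<Sum>k\<le>m. p n k * norm_sq (X n k))
        + (1 / (6 * real N)) * (\<Sum>n=1..N. \<Sum>k\<le>m. p n k * cost n k)"
  proof -
    have "\<exists>\<kappa>. (\<forall>n\<in>{1..N}. \<kappa> n \<in> {..m}) \<and>
        (1/V) * norm_sq (\<lambda>x. \<Sum>n=1..N. X n (\<kappa> n) x - (\<Sum>k\<le>m. p n k *\<^sub>R X n k x))
        + (1 / (6 * real N)) * (\<Sum>n=1..N. cost n (\<kappa> n))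
      \<le> (1/V) * (\<Sum>n=1..N. \<Sum>k\<le>m. p n k * norm_sq (X n k))
        + (1 / (6 * real N)) * (\<Sum>n=1..N. \<Sum>k\<le>m. p n k * cost n k)"
    proof (rule derandomised_selection)
      show "0 \<le> p n k" for n k using q_pos q_sum by (auto simp: p_def less_imp_le)
      show "sum (p n) {..m} = 1" for n by (simp add: p_def lessThan_Suc_atMost[symmetric])
      show "X n k \<in> L2" if "n \<in> {1..N}" for n k using that by (intro XL) auto
    qed (use V in auto)
    then show ?thesis using that by blast
  qed
  have rhs: "(1/V) * (\<Sum>n=1..N. \<Sum>k\<le>m. p n k * norm_sq (X n k))
        + (1 / (6 * real N)) * (\<Sum>n=1..N. \<Sum>k\<le>m. p n k * cost n k) \<le> 1 + 1"
    using total_variance total_cost V N by (intro add_mono) (auto simp: pos_divide_le_eq)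
  have cost_nonneg: "cost n k \<ge> 0" for n k by (simp add: cost_def)
  have e4: "norm_sq (\<lambda>x. \<Sum>n=1..N. X n (\<kappa> n) x - (\<Sum>k\<le>m. p n k *\<^sub>R X n k x)) \<le> 2 * V"
  proof -
    have "0 \<le> (1 / (6 * real N)) * (\<Sum>n=1..N. cost n (\<kappa> n))"
      by (intro mult_nonneg_nonneg sum_nonneg cost_nonneg) auto
    then have "(1/V) * norm_sq (\<lambda>x. \<Sum>n=1..N. X n (\<kappa> n) x - (\<Sum>k\<le>m. p n k *\<^sub>R X n k x)) \<le> 2"
      using sel rhs by linarith
    then show ?thesis using V by (simp add: pos_divide_le_eq)
  qed
  have chosen_cost: "(\<Sum>n=1..N. cost n (\<kappa> n)) \<le> 12 * real N"
  proof -
    have "0 \<le> (1/V) * norm_sq (\<lambda>x. \<Sum>n=1..N. X n (\<kappa> n) x - (\<Sum>k\<le>m. p n k *\<^sub>R X n k x))"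
      using V by (intro mult_nonneg_nonneg norm_sq_nonneg) auto
    then have "(1 / (6 * real N)) * (\<Sum>n=1..N. cost n (\<kappa> n)) \<le> 2"
      using sel rhs by linarith
    then show ?thesis using N by (simp add: pos_divide_le_eq)
  qed

  define T where "T x = (\<Sum>n=1..N. \<omega> n * S n (K n) x + X n (\<kappa> n) x)" for x
  define c :: "nat \<Rightarrow> nat" where "c n = 2 ^ K n + (if \<kappa> n < m then 3 * 2 ^ (K n + \<kappa> n) else 0)" for n
  have TG: "gauss_mix (\<Sum>n=1..N. c n) T"
    unfolding T_def[abs_def]
  proof (intro gauss_mix_sum)
    fix n assume n: "n \<in> {1..N}"
    show "gauss_mix (c n) (\<lambda>x. \<omega> n * S n (K n) x + X n (\<kappa> n) x)"
    proof (cases "\<kappa> n < m")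
      case True
      have "gauss_mix (2 ^ (K n + Suc (\<kappa> n)) + 2 ^ (K n + \<kappa> n)) (h n (\<kappa> n))"
        unfolding h_def[abs_def] using n by (intro gauss_mix_diff SG) auto
      then have "gauss_mix (3 * 2 ^ (K n + \<kappa> n)) (h n (\<kappa> n))"
        by (rule gauss_mix_mono) simp
      from gauss_mix_cmult[OF this, of "\<omega> n / complex_of_real (q (\<kappa> n))"] True
      have "gauss_mix (3 * 2 ^ (K n + \<kappa> n)) (X n (\<kappa> n))"
        by (simp add: X_def[abs_def])
      then show ?thesis
        using True n unfolding c_def by (auto intro!: gauss_mix_add gauss_mix_cmult SG)
    next
      case False
      then show ?thesis
        using False n unfolding c_def X_def by (auto intro!: gauss_mix_cmult SG)
    qed
  qed simp
  have "real (\<Sum>n=1..N. c n) = (\<Sum>n=1..N. 2 ^ K n) + (\<Sum>n=1..N. cost n (\<kappa> n))"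
    unfolding of_nat_sum sum.distrib[symmetric] by (intro sum.cong) (simp_all add: c_def cost_def)
  also have "\<dots> \<le> real (16 * N)"
    using sum_K chosen_cost N by simp
  finally have "(\<Sum>n=1..N. c n) \<le> 16 * N" by linarith
  then have TG': "gauss_mix (16 * N) T" using TG gauss_mix_mono by blast

  obtain M where M: "M \<ge> N" and e1: "norm_sq (\<lambda>x. f x - (\<Sum>n=1..M. \<omega> n * g n x)) < E"
    using expansion[OF E, of N] by blast
  have e2: "norm_sq (\<lambda>x. \<Sum>n\<in>{N<..M}. \<omega> n * g n x) \<le> B * A\<^sup>2 / (2 * \<alpha> - 1) * E"
  proof -
    have "norm_sq (\<lambda>x. \<Sum>n\<in>{N<..M}. \<omega> n * g n x) \<le> B * (\<Sum>n\<in>{N<..M}. (cmod (\<omega> n))\<^sup>2)"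
      using N by (intro bessel) auto
    also have "\<dots> \<le> B * (\<Sum>n\<in>{N<..M}. A\<^sup>2 * real n powr (-(2*\<alpha>)))"
      using N by (intro mult_left_mono sum_mono coef2 B) auto
    also have "\<dots> = B * A\<^sup>2 * (\<Sum>n\<in>{N<..M}. real n powr (-(2*\<alpha>)))"
      by (simp add: sum_distrib_left mult.assoc)
    also have "\<dots> \<le> B * A\<^sup>2 * (real N powr (1 - 2 * \<alpha>) / (2 * \<alpha> - 1))"
      using B M N \<alpha> by (intro mult_left_mono powr_tail_sum) auto
    finally show ?thesis by (simp add: E_def)
  qed
  have e3: "norm_sq (\<lambda>x. \<Sum>n=1..N. \<omega> n * (g n x - S n (K n + m) x)) \<le> E"
  proof -
    have "norm_sq (\<lambda>x. \<Sum>n=1..N. \<omega> n * (g n x - S n (K n + m) x))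
        \<le> real (card {1..N}) * (\<Sum>n=1..N. norm_sq (\<lambda>x. \<omega> n * (g n x - S n (K n + m) x)))"
      by (intro norm_sq_sum_le L2_cmult L2_diff gL SL) auto
    also have "real (card {1..N}) = real N" by simp
    also have "real N * (\<Sum>n=1..N. norm_sq (\<lambda>x. \<omega> n * (g n x - S n (K n + m) x))) \<le> real N * (\<Sum>n=1..N. A\<^sup>2 * (C * (1/4)^m))"
    proof -
      have "norm_sq (\<lambda>x. \<omega> n * (g n x - S n (K n + m) x)) \<le> A\<^sup>2 * (C * (1/4)^m)"
        if n: "n \<in> {1..N}" for n
      proof -
        have 1: "((1/4::real)^(K n + m))^P \<le> (1/4)^m"
        proof -
          have "((1/4::real)^(K n + m))^P = (1/4)^((K n + m) * P)"
            by (simp add: power_mult)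
          also have "\<dots> \<le> (1/4)^m"
          proof (rule power_decreasing)
            have "m * 1 \<le> (K n + m) * P" using P(1) by (intro mult_le_mono) auto
            then show "m \<le> (K n + m) * P" by simp
          qed auto
          finally show ?thesis .
        qed
        have "real n powr (-(2*\<alpha>)) \<le> 1"
          using n \<alpha> powr_mono[of "-(2*\<alpha>)" 0 "real n"] by simp
        then have "A\<^sup>2 * real n powr (-(2*\<alpha>)) \<le> A\<^sup>2 * 1"
          by (intro mult_left_mono) auto
        then have 2: "(cmod (\<omega> n))\<^sup>2 \<le> A\<^sup>2"
          using coef2[of n] n by simp
        have "norm_sq (\<lambda>x. g n x - S n (K n + m) x) \<le> C * ((1/4)^(K n + m))^P"
          using approx[of n "K n + m"] n by simp
        also have "\<dots> \<le> C * (1/4)^m"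
          using 1 C by (rule mult_left_mono)
        finally show ?thesis
          unfolding norm_sq_cmult using 2 by (intro mult_mono norm_sq_nonneg) auto
      qed
      then show ?thesis by (intro mult_left_mono sum_mono) auto
    qed
    also have "\<dots> = real N * real N * A\<^sup>2 * C * (1/4)^m" by simp
    finally show ?thesis using m by simp
  qed

  let ?F1 = "\<lambda>x. f x - (\<Sum>n=1..M. \<omega> n * g n x)"
  let ?F2 = "\<lambda>x. \<Sum>n\<in>{N<..M}. \<omega> n * g n x"
  let ?F3 = "\<lambda>x. \<Sum>n=1..N. \<omega> n * (g n x - S n (K n + m) x)"
  let ?F4 = "\<lambda>x. \<Sum>n=1..N. X n (\<kappa> n) x - (\<Sum>k\<le>m. p n k *\<^sub>R X n k x)"
  have mean: "(\<Sum>k\<le>m. p n k *\<^sub>R X n k x) = \<omega> n * (S n (K n + m) x - S n (K n) x)" for n x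
  proof -
    have "(\<Sum>k\<le>m. p n k *\<^sub>R X n k x) = (\<Sum>k<m. \<omega> n * h n k x)"
    proof -
      have "q k \<noteq> 0" for k using q_pos[of k] by simp
      then have "p n k *\<^sub>R X n k x = \<omega> n * h n k x" if "k < m" for k
        using that by (simp add: X_def p_def scaleR_conv_of_real)
      then show ?thesis
        by (simp add: lessThan_Suc_atMost[symmetric] X_def[of _ m])
    qed
    also have "\<dots> = \<omega> n * (\<Sum>k<m. h n k x)" by (simp add: sum_distrib_left)
    also have "(\<Sum>k<m. h n k x) = S n (K n + m) x - S n (K n) x"
      unfolding h_def using sum_lessThan_telescope[of "\<lambda>k. S n (K n + k) x" m] by simp
    finally show ?thesis .
  qed
  have split: "f x - T x = (?F1 x + ?F2 x) + (?F3 x - ?F4 x)" for x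
  proof -
    have "(\<Sum>n=1..M. \<omega> n * g n x) = (\<Sum>n=1..N. \<omega> n * g n x) + ?F2 x"
    proof -
      have "{1..M} = {1..N} \<union> {N<..M}" using M by auto
      then show ?thesis by (simp only:) (rule sum.union_disjoint, auto)
    qed
    moreover have "T x = (\<Sum>n=1..N. \<omega> n * g n x) - (?F3 x - ?F4 x)"
      unfolding T_def mean sum_subtractf[symmetric]
      by (intro sum.cong refl) (simp add: algebra_simps)
    ultimately show ?thesis by simp
  qed
  have F1: "?F1 \<in> L2" using f by (intro L2_diff L2_sum L2_cmult gL) auto
  have F2: "?F2 \<in> L2" using N by (intro L2_sum L2_cmult gL) auto
  have F3: "?F3 \<in> L2" by (intro L2_diff L2_sum L2_cmult gL SL) auto
  have F4: "?F4 \<in> L2" unfolding mean by (intro L2_diff L2_sum L2_cmult SL XL) auto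
  have combine: "2 * (2 * a + 2 * b) + 2 * (2 * c + 2 * d) \<le> 4 * (a' + b' + c' + d')"
    if "a \<le> a'" "b \<le> b'" "c \<le> c'" "d \<le> d'" for a b c d a' b' c' d' :: real
    using that by simp
  have "norm_sq (\<lambda>x. f x - T x) \<le> 2 * norm_sq (\<lambda>x. ?F1 x + ?F2 x) + 2 * norm_sq (\<lambda>x. ?F3 x - ?F4 x)"
    unfolding split by (intro norm_sq_add_le L2_add L2_diff F1 F2 F3 F4)
  also have "\<dots> \<le> 2 * (2 * norm_sq ?F1 + 2 * norm_sq ?F2) + 2 * (2 * norm_sq ?F3 + 2 * norm_sq ?F4)"
    by (intro add_mono mult_left_mono norm_sq_add_le norm_sq_diff_le F1 F2 F3 F4) auto
  also have "\<dots> \<le> 4 * (E + B * A\<^sup>2 / (2 * \<alpha> - 1) * E + E + 2 * V)"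
    by (rule combine[OF less_imp_le[OF e1] e2 e3 e4])
  also have "\<dots> = 4 * (2 + B * A\<^sup>2 / (2 * \<alpha> - 1) + 2 * (16 * C * A\<^sup>2 * 4 ^ P + 1)) * E"
    by (simp add: V_def algebra_simps)
  finally show ?thesis
    using TG' unfolding E_def by blast
qed

text \<open>Apply the preceding lemma to \<open>N div 16\<close>, with \<open>P \<ge> 2 * \<alpha>\<close>: the bound for the coefficient of term
\<open>n\<close> is \<open>(N / n) powr \<alpha>\<close> times that of term \<open>N\<close>, and about \<open>(N / n) powr (1/2)\<close> Gaussians reduce
the error by at least this factor, up to a constant. For \<open>N < 16\<close> the zero mixture satisfies the bound.\<close>

lemma gaussian_approximation_rate:
  fixes g :: "nat \<Rightarrow> real^2 \<Rightarrow> complex" and \<omega> :: "nat \<Rightarrow> complex"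
  assumes \<alpha>: "\<alpha> > 1/2" and f: "f \<in> L2" and gL: "\<And>n. n \<ge> 1 \<Longrightarrow> g n \<in> L2"
    and coef: "\<And>n. n \<ge> 1 \<Longrightarrow> cmod (\<omega> n) \<le> A * real n powr (-\<alpha>)"
    and expansion: "\<And>\<epsilon> M0. \<epsilon> > 0 \<Longrightarrow>
          \<exists>M\<ge>M0. norm_sq (\<lambda>x. f x - (\<Sum>n=1..M. \<omega> n * g n x)) < \<epsilon>"
    and bessel: "\<And>I. finite I \<Longrightarrow> I \<subseteq> {1..} \<Longrightarrow>
          norm_sq (\<lambda>x. \<Sum>n\<in>I. \<omega> n * g n x) \<le> B * (\<Sum>n\<in>I. (cmod (\<omega> n))\<^sup>2)"
    and approx: "\<And>P. \<exists>C. \<forall>n\<ge>1. \<forall>L. \<exists>S. gauss_mix (2 ^ L) S \<and>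
          norm_sq (\<lambda>x. g n x - S x) \<le> C * ((1/4)^L)^P"
  shows "\<exists>C. \<forall>N\<ge>1. \<exists>T. gauss_mix N T \<and> norm_L2 (\<lambda>x. T x - f x) \<le> C * real N powr (1/2 - \<alpha>)"
proof -
  define P where "P = max 2 (nat \<lceil>2 * \<alpha>\<rceil>)"
  have P: "2 \<le> P" "2 * \<alpha> \<le> real P" by (auto simp: P_def) linarith
  obtain C0 where C0: "\<forall>n\<ge>1. \<forall>L. \<exists>S. gauss_mix (2 ^ L) S \<and>
      norm_sq (\<lambda>x. g n x - S x) \<le> C0 * ((1/4)^L)^P"
    using approx by blast
  define C where "C = max 0 C0"
  have "\<forall>n L. \<exists>S. n \<ge> 1 \<longrightarrow> gauss_mix (2 ^ L) S \<and> norm_sq (\<lambda>x. g n x - S x) \<le> C * ((1/4)^L)^P"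
  proof (intro allI)
    fix n L
    have "C0 * ((1/4)^L)^P \<le> C * ((1/4)^L)^P" by (intro mult_right_mono) (auto simp: C_def)
    then show "\<exists>S. n \<ge> 1 \<longrightarrow> gauss_mix (2 ^ L) S \<and> norm_sq (\<lambda>x. g n x - S x) \<le> C * ((1/4)^L)^P"
      using C0 by (meson order_trans)
  qed
  then obtain S where S: "\<And>n L. n \<ge> 1 \<Longrightarrow> gauss_mix (2 ^ L) (S n L) \<and>
      norm_sq (\<lambda>x. g n x - S n L x) \<le> C * ((1/4)^L)^P"
    by metis
  define B' where "B' = max 0 B"
  have bessel': "norm_sq (\<lambda>x. \<Sum>n\<in>I. \<omega> n * g n x) \<le> B' * (\<Sum>n\<in>I. (cmod (\<omega> n))\<^sup>2)"
    if "finite I" "I \<subseteq> {1..}" for I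
    using bessel[OF that] by (rule order_trans) (auto intro!: mult_right_mono sum_nonneg simp: B'_def)
  define D where "D = 4 * (2 + B' * A\<^sup>2 / (2 * \<alpha> - 1) + 2 * (16 * C * A\<^sup>2 * 4 ^ P + 1))"
  have block: "\<exists>T. gauss_mix (16 * N) T \<and> norm_sq (\<lambda>x. f x - T x) \<le> D * real N powr (1 - 2 * \<alpha>)"
    if "1 \<le> N" for N
    unfolding D_def
    by (rule gaussian_block_approximation[OF \<alpha> f gL coef expansion bessel' _ _ P S that])
      (auto simp: B'_def C_def)
  have D: "0 \<le> D"
    using \<alpha> unfolding D_def B'_def C_def by (intro mult_nonneg_nonneg add_nonneg_nonneg divide_nonneg_nonneg) auto
  define F where "F = max (norm_L2 f * 16 powr (\<alpha> - 1/2)) (sqrt D * 32 powr (\<alpha> - 1/2))"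
  show ?thesis
  proof (intro exI[of _ F] allI impI)
    fix N :: nat assume N: "1 \<le> N"
    show "\<exists>T. gauss_mix N T \<and> norm_L2 (\<lambda>x. T x - f x) \<le> F * real N powr (1/2 - \<alpha>)"
    proof (cases "N < 16")
      case True
      have "1 = 16 powr (\<alpha> - 1/2) * 16 powr (1/2 - \<alpha>)" by (simp flip: powr_add)
      also have "\<dots> \<le> 16 powr (\<alpha> - 1/2) * real N powr (1/2 - \<alpha>)"
        using True N \<alpha> by (intro mult_left_mono powr_mono2') auto
      finally have "norm_L2 f * 1 \<le> norm_L2 f * (16 powr (\<alpha> - 1/2) * real N powr (1/2 - \<alpha>))"
        by (intro mult_left_mono) (auto simp: norm_L2_eq_sqrt norm_sq_nonneg)
      also have "\<dots> \<le> F * real N powr (1/2 - \<alpha>)"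
        unfolding mult.assoc[symmetric] by (intro mult_right_mono) (auto simp: F_def)
      finally have "norm_L2 (\<lambda>x. 0 - f x) \<le> F * real N powr (1/2 - \<alpha>)"
        by (simp add: norm_L2_def)
      then show ?thesis using gauss_mix_zero by blast
    next
      case False
      define N' where "N' = N div 16"
      have N': "1 \<le> N'" "16 * N' \<le> N" "N \<le> 32 * N'"
        using False unfolding N'_def by presburger+
      obtain T where T: "gauss_mix (16 * N') T"
          "norm_sq (\<lambda>x. f x - T x) \<le> D * real N' powr (1 - 2 * \<alpha>)"
        using block[OF N'(1)] by blast
      have "norm_L2 (\<lambda>x. T x - f x) = sqrt (norm_sq (\<lambda>x. f x - T x))"
        by (simp only: norm_L2_eq_sqrt norm_sq_diff_commute[of T f])
      also have "\<dots> \<le> sqrt (D * real N' powr (1 - 2 * \<alpha>))" using T(2) by simp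
      also have "\<dots> = sqrt D * real N' powr (1/2 - \<alpha>)"
        by (simp add: real_sqrt_mult powr_half_sqrt[symmetric] powr_powr field_simps)
      also have "\<dots> \<le> sqrt D * (32 powr (\<alpha> - 1/2) * real N powr (1/2 - \<alpha>))"
      proof (intro mult_left_mono)
        have "real N' powr (1/2 - \<alpha>) \<le> (real N / 32) powr (1/2 - \<alpha>)"
          using N' N \<alpha> by (intro powr_mono2') auto
        also have "\<dots> = 32 powr (\<alpha> - 1/2) * real N powr (1/2 - \<alpha>)"
          using N powr_minus_divide[of 32 "\<alpha> - 1/2"] by (simp add: powr_divide)
        finally show "real N' powr (1/2 - \<alpha>) \<le> 32 powr (\<alpha> - 1/2) * real N powr (1/2 - \<alpha>)" .
      qed (use D in auto)
      also have "\<dots> \<le> F * real N powr (1/2 - \<alpha>)"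
        unfolding mult.assoc[symmetric] by (intro mult_right_mono) (auto simp: F_def)
      finally show ?thesis using gauss_mix_mono[OF T(1) N'(2)] by blast
    qed
  qed
qed

section \<open>Functions of the smoothness class\<close>

context curvelet_system begin

text \<open>Different indices may give the same function, so one index is chosen for each curvelet; since
\<open>g\<close> is injective, so is the choice.\<close>

lemma curvelet_bessel:
  fixes g :: "nat \<Rightarrow> real^2 \<Rightarrow> complex"
  assumes I: "finite I" and inj: "inj_on g I" and g: "g ` I \<subseteq> curvelet_dict w0 w \<nu>"
  shows "norm_sq (\<lambda>x. \<Sum>n\<in>I. \<omega> n * g n x) \<le> 896 * (\<Sum>n\<in>I. (cmod (\<omega> n))\<^sup>2)"
proof -
  have "\<forall>n\<in>I. \<exists>i. snd (fst i) < 2 ^ (fst (fst i) div 2) \<and> g n = curvelet_at (fst i) (snd i)"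
  proof
    fix n assume "n \<in> I"
    then have "g n \<in> curvelet_dict w0 w \<nu>" using g by blast
    then obtain q m where "snd q < 2 ^ (fst q div 2)" "g n = curvelet_at q m" using curvelet_dict_index by blast
    then show "\<exists>i. snd (fst i) < 2 ^ (fst (fst i) div 2) \<and> g n = curvelet_at (fst i) (snd i)"
      by (intro exI[of _ "(q, m)"]) simp
  qed
  from bchoice[OF this] obtain idx where
    "\<forall>n\<in>I. snd (fst (idx n)) < 2 ^ (fst (fst (idx n)) div 2) \<and> g n = curvelet_at (fst (idx n)) (snd (idx n))"
    by (elim exE)
  then have idx: "\<And>n. n \<in> I \<Longrightarrow> snd (fst (idx n)) < 2 ^ (fst (fst (idx n)) div 2)"
    "\<And>n. n \<in> I \<Longrightarrow> g n = curvelet_at (fst (idx n)) (snd (idx n))"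
    by blast+
  have ij: "inj_on idx I"
    by (rule inj_onI, rule inj_onD[OF inj]) (simp_all add: idx(2))
  define c where "c i = \<omega> (the_inv_into I idx i)" for i
  have c: "c (idx n) = \<omega> n" if "n \<in> I" for n unfolding c_def by (simp add: the_inv_into_f_f ij that)
  have "norm_sq (\<lambda>x. \<Sum>(q, m)\<in>idx ` I. c (q, m) * curvelet_at q m x) \<le> 896 * (\<Sum>i\<in>idx ` I. (cmod (c i))\<^sup>2)"
  proof (rule curvelet_synthesis_bound(2))
    show "l < 2 ^ (j div 2)" if jlm: "((j, l), m) \<in> idx ` I" for j l m
    proof -
      obtain n where "n \<in> I" "idx n = ((j, l), m)" using jlm by auto
      then show ?thesis using idx(1)[of n] by simp
    qed
  qed (use I in simp)
  moreover have "(\<Sum>(q, m)\<in>idx ` I. c (q, m) * curvelet_at q m x) = (\<Sum>n\<in>I. \<omega> n * g n x)" for x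
    unfolding sum.reindex[OF ij] by (rule sum.cong) (auto simp: case_prod_unfold c idx(2))
  moreover have "(\<Sum>i\<in>idx ` I. (cmod (c i))\<^sup>2) = (\<Sum>n\<in>I. (cmod (\<omega> n))\<^sup>2)"
    unfolding sum.reindex[OF ij] by (rule sum.cong) (auto simp: c)
  ultimately show ?thesis by simp
qed

end

text \<open>Once \<open>{1..M}\<close> covers the members of \<open>X\<close> that the enumeration reaches, the remaining members of \<open>X\<close>
have coefficient \<open>0\<close> and may be dropped from the sum.\<close>

lemma expansion_along_rearrangement:
  assumes ex: "L2_expansion D f" and g: "decreasing_rearrangement D f g" and \<epsilon>: "\<epsilon> > 0"
  shows "\<exists>M\<ge>M0. norm_sq (\<lambda>x. f x - (\<Sum>n=1..M. inner_L2 f (g n) * g n x)) < \<epsilon>"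
proof -
  have inj: "inj_on g {1..}" and gD: "g ` {1..} \<subseteq> D"
    and nz: "\<And>\<gamma>. \<gamma> \<in> D \<Longrightarrow> inner_L2 f \<gamma> \<noteq> 0 \<Longrightarrow> \<gamma> \<in> g ` {1..}"
    using g unfolding decreasing_rearrangement_def by blast+
  have "eventually (\<lambda>F. norm_L2 (\<lambda>x. f x - (\<Sum>\<gamma>\<in>F. inner_L2 f \<gamma> * \<gamma> x)) < sqrt \<epsilon>) (finite_subsets_at_top D)"
    using ex[unfolded L2_expansion_def] by (rule order_tendstoD(2)) (simp add: \<epsilon>)
  then obtain X where X: "finite X" "X \<subseteq> D"
    and small: "\<And>Y. finite Y \<Longrightarrow> X \<subseteq> Y \<Longrightarrow> Y \<subseteq> D \<Longrightarrow> norm_L2 (\<lambda>x. f x - (\<Sum>\<gamma>\<in>Y. inner_L2 f \<gamma> * \<gamma> x)) < sqrt \<epsilon>"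
    unfolding eventually_finite_subsets_at_top by (elim exE conjE) simp
  have "finite {n\<in>{1..}. g n \<in> X}"
    using finite_vimage_IntI[OF X(1) inj] by (simp add: vimage_def Int_def conj_commute)
  then obtain M1 where M1: "\<And>n. n \<ge> 1 \<Longrightarrow> g n \<in> X \<Longrightarrow> n \<le> M1"
    unfolding finite_nat_set_iff_bounded_le by auto
  define M where "M = max M0 M1"
  define Y where "Y = X \<union> g ` {1..M}"
  have "norm_L2 (\<lambda>x. f x - (\<Sum>\<gamma>\<in>Y. inner_L2 f \<gamma> * \<gamma> x)) < sqrt \<epsilon>"
    by (rule small) (use X gD in \<open>auto simp: Y_def\<close>)
  moreover have "(\<Sum>\<gamma>\<in>Y. inner_L2 f \<gamma> * \<gamma> x) = (\<Sum>n=1..M. inner_L2 f (g n) * g n x)" for x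
  proof -
    have "(\<Sum>\<gamma>\<in>Y. inner_L2 f \<gamma> * \<gamma> x) = (\<Sum>\<gamma>\<in>g ` {1..M}. inner_L2 f \<gamma> * \<gamma> x)"
    proof (rule sum.mono_neutral_right)
      show "\<forall>\<gamma>\<in>Y - g ` {1..M}. inner_L2 f \<gamma> * \<gamma> x = 0"
      proof
        fix \<gamma> assume \<gamma>: "\<gamma> \<in> Y - g ` {1..M}"
        then have "\<gamma> \<in> X" by (auto simp: Y_def)
        have "\<gamma> \<notin> g ` {1..}"
        proof
          assume "\<gamma> \<in> g ` {1..}"
          then obtain n where "n \<ge> 1" "\<gamma> = g n" by auto
          then have "n \<le> M" using M1[of n] \<open>\<gamma> \<in> X\<close> by (simp add: M_def)
          then show False using \<gamma> \<open>n \<ge> 1\<close> \<open>\<gamma> = g n\<close> by auto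
        qed
        then show "inner_L2 f \<gamma> * \<gamma> x = 0" using nz[of \<gamma>] \<open>\<gamma> \<in> X\<close> X(2) by auto
      qed
    qed (use X in \<open>auto simp: Y_def\<close>)
    also have "\<dots> = (\<Sum>n=1..M. inner_L2 f (g n) * g n x)"
      by (subst sum.reindex) (auto intro: inj_on_subset[OF inj])
    finally show ?thesis .
  qed
  ultimately have "norm_sq (\<lambda>x. f x - (\<Sum>n=1..M. inner_L2 f (g n) * g n x)) < \<epsilon>"
    by (simp add: norm_L2_eq_sqrt)
  then show ?thesis by (intro exI[of _ M]) (simp add: M_def)
qed

lemma bigo_powr_bound_everywhere:
  fixes u :: "nat \<Rightarrow> real"
  assumes "u \<in> O(\<lambda>n. real n powr (- \<alpha>))"
  obtains A where "\<And>n. n \<ge> 1 \<Longrightarrow> \<bar>u n\<bar> \<le> A * real n powr (- \<alpha>)"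
proof -
  obtain c where c: "c > 0" "eventually (\<lambda>n. norm (u n) \<le> c * norm (real n powr (- \<alpha>))) at_top"
    using landau_o.bigE[OF assms] by blast
  then obtain n0 where n0: "\<And>n. n \<ge> n0 \<Longrightarrow> \<bar>u n\<bar> \<le> c * real n powr (- \<alpha>)"
    unfolding eventually_at_top_linorder by auto
  define s where "s = (\<Sum>n\<le>n0. \<bar>u n\<bar> * real n powr \<alpha>)"
  have s: "0 \<le> s" unfolding s_def by (intro sum_nonneg) auto
  have "\<bar>u n\<bar> \<le> (c + s) * real n powr (- \<alpha>)" if n: "n \<ge> 1" for n
  proof (cases "n \<ge> n0")
    case True
    have "\<bar>u n\<bar> \<le> c * real n powr (- \<alpha>)" by (rule n0[OF True])
    also have "\<dots> \<le> (c + s) * real n powr (- \<alpha>)" using s by (intro mult_right_mono) auto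
    finally show ?thesis .
  next
    case False
    have "\<bar>u n\<bar> = (\<bar>u n\<bar> * real n powr \<alpha>) * real n powr (- \<alpha>)"
      using n by (simp add: powr_minus field_simps)
    also have "\<dots> \<le> s * real n powr (- \<alpha>)"
    proof (intro mult_right_mono)
      show "\<bar>u n\<bar> * real n powr \<alpha> \<le> s"
        unfolding s_def using False by (intro member_le_sum) auto
    qed simp
    also have "\<dots> \<le> (c + s) * real n powr (- \<alpha>)" using c by (intro mult_right_mono) auto
    finally show ?thesis .
  qed
  then show ?thesis using that by blast
qed

theorem theorem1:
  fixes w0 w \<nu> :: "real \<Rightarrow> real"
    and \<alpha> :: real
    and f :: "real^2 \<Rightarrow> complex"
  assumes "curvelet_windows w0 w \<nu>"
    and "\<alpha> > 1 / 2"
    and "f \<in> curvelet_class w0 w \<nu> \<alpha>"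
  shows "\<exists>C :: real. \<forall>N :: nat. N \<ge> 1 \<longrightarrow>
           (\<exists>(a :: nat \<Rightarrow> complex) (G :: nat \<Rightarrow> real^2 \<Rightarrow> complex).
              (\<forall>j\<in>{1..N}. G j \<in> gaussian_dict) \<and>
              norm_L2 (\<lambda>x. (\<Sum>j=1..N. a j * G j x) - f x) \<le> C * real N powr (1 / 2 - \<alpha>))"
proof -
  interpret curvelet_system w0 w \<nu> by unfold_locales (rule assms(1))
  let ?D = "curvelet_dict w0 w \<nu>"
  obtain g where f: "f \<in> L2" "L2_expansion ?D f" and g: "decreasing_rearrangement ?D f g"
    and decay: "(\<lambda>n. cmod (inner_L2 f (g n))) \<in> O(\<lambda>n. real n powr (- \<alpha>))"
    using assms(3) unfolding curvelet_class_def by blast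
  have inj: "inj_on g {1..}" and gD: "\<And>n. n \<ge> 1 \<Longrightarrow> g n \<in> ?D"
    using g unfolding decreasing_rearrangement_def by auto
  obtain A where A: "\<And>n. n \<ge> 1 \<Longrightarrow> cmod (inner_L2 f (g n)) \<le> A * real n powr (- \<alpha>)"
    using bigo_powr_bound_everywhere[OF decay] by auto
  have bessel: "norm_sq (\<lambda>x. \<Sum>n\<in>I. inner_L2 f (g n) * g n x) \<le> 896 * (\<Sum>n\<in>I. (cmod (inner_L2 f (g n)))\<^sup>2)"
    if "finite I" "I \<subseteq> {1..}" for I
    by (rule curvelet_bessel[OF that(1) inj_on_subset[OF inj that(2)]]) (use that(2) gD in auto)
  have approx: "\<exists>C. \<forall>n\<ge>1. \<forall>L. \<exists>S. gauss_mix (2 ^ L) S \<and> norm_sq (\<lambda>x. g n x - S x) \<le> C * ((1/4) ^ L) ^ P" for P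
  proof -
    obtain C where "\<forall>h\<in>?D. \<forall>L. \<exists>S. gauss_mix (2 ^ L) S \<and> norm_sq (\<lambda>x. h x - S x) \<le> C * ((1/4) ^ L) ^ P"
      using curvelet_approximation[of P] by (elim exE)
    then show ?thesis by (intro exI[of _ C] allI impI) (simp add: gD)
  qed
  have "\<exists>C. \<forall>N\<ge>1. \<exists>T. gauss_mix N T \<and> norm_L2 (\<lambda>x. T x - f x) \<le> C * real N powr (1/2 - \<alpha>)"
    by (rule gaussian_approximation_rate[OF assms(2) f(1) curvelet_L2_norm(1)[OF gD] A
        expansion_along_rearrangement[OF f(2) g] bessel approx])
  then obtain C where C: "\<forall>N\<ge>1. \<exists>T. gauss_mix N T \<and> norm_L2 (\<lambda>x. T x - f x) \<le> C * real N powr (1/2 - \<alpha>)"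
    by (elim exE)
  show ?thesis
  proof (intro exI[of _ C] allI impI)
    fix N :: nat assume "N \<ge> 1"
    then obtain T where T: "gauss_mix N T" "norm_L2 (\<lambda>x. T x - f x) \<le> C * real N powr (1/2 - \<alpha>)"
      using C by blast
    then obtain a G where G: "\<forall>j<N. G j \<in> gaussian_dict" "T = (\<lambda>x. \<Sum>j<N. a j * G j x)"
      unfolding gauss_mix_def by blast
    have "(\<Sum>j=1..N. a (j - 1) * G (j - 1) x) = T x" for x
      unfolding G(2) by (rule sum.reindex_bij_witness[of _ Suc "\<lambda>j. j - 1"]) auto
    moreover have "G (j - 1) \<in> gaussian_dict" if "j \<in> {1..N}" for j using G(1) that by auto
    ultimately show "\<exists>(a :: nat \<Rightarrow> complex) (G :: nat \<Rightarrow> real^2 \<Rightarrow> complex).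
        (\<forall>j\<in>{1..N}. G j \<in> gaussian_dict) \<and>
        norm_L2 (\<lambda>x. (\<Sum>j=1..N. a j * G j x) - f x) \<le> C * real N powr (1 / 2 - \<alpha>)"
      using T(2) by (intro exI[of _ "\<lambda>j. a (j - 1)"] exI[of _ "\<lambda>j. G (j - 1)"] conjI ballI) simp_all
  qed
qed

end
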